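(* Let $M$ be a graded manifold or supermanifold equipped with a generalized Poisson structure of the form $P=P_1+P_2+\cdots$, let $\mathcal{P}$ be a graded operad concentrated in degrees $\leq0$, and let $\mathcal{P}\to\mathcal{ECBV}_\infty$ be an operad morphism. Equip $\Omega(M)$ with the $\mathcal{P}$-algebra structure obtained by restriction of scalars along $\mathcal{P}\to\mathcal{ECBV}_\infty$ from the $\mathcal{ECBV}_\infty$-algebra structure given by the exterior differential, the exterior product and the interior products $i_n=i_{P_n}$, $n\geq1$. Then this $\mathcal{P}$-algebra is quasi-isomorphic to $\Omega(M)$ with the trivial $\mathcal{P}$-algebra structure.
   Context: The ground field is $k=\mathbb{R}$; complexes are cochain complexes; operads are symmetric DG operads. $[a,b]=ab-(-1)^{|a||b|}ba$. Two algebras over an operad are quasi-isomorphic if connected by a zig-zag of quasi-isomorphisms of such algebras. A generalized Poisson manifold is a graded manifold or supermanifold $M$ with an even polyvector field $P$ satisfying $[P,P]=0$ (Schouten--Nijenhuis bracket). In the decomposition $P=P_1+P_2+\cdots$ the indexing is that of Braun--Lazarev: $P_n$ is the component of polyvector degree $n+1$, and the gradings are such that the interior product $i_{P_n}$ on the de Rham complex $\Omega(M)$ is a differential operator of degree $-2n$ and order $\leq n+1$. These satisfy $[i_{P_n},i_{P_m}]=0$ and $\sum_{j=1}^{n-1}[i_{P_j},[i_{P_{n-j}},d]]=0$, so that $\Omega(M)$ is an $\mathcal{ECBV}_\infty$-algebra. $\mathcal{ECBV}_\infty$ (exact commutative $BV_\infty$ operad) is the DG operad whose algebras are DG commutative algebras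 $A$ equipped with differential operators $i_n\colon A\to A$, $n\geq1$, of degree $-2n$ and order $\leq n+1$ such that $[i_n,i_m]=0$ for $n,m\geq1$ and $\sum_{j=1}^{n-1}[i_j,[i_{n-j},d]]=0$ for $n\geq2$. It is generated as a DG operad by a symmetric associative $\mu$ (arity $2$, degree $0$, $d(\mu)=0$) and the $i_n$ (arity $1$, degree $-2n$), with the corresponding relations. Here $D$ is a differential operator of order $\leq r$ on a graded commutative algebra if $\sum_{p+q=r+1,\,p\geq1}(-1)^p\sum_{\sigma}\pm D(x_{\sigma(1)}\cdots x_{\sigma(p)})x_{\sigma(p+1)}\cdots x_{\sigma(r+1)}=0$ for all $x_1,\dots,x_{r+1}$, where $\sigma$ runs over $(p,q)$-shuffles and signs follow the Koszul rule. A graded operad is a DG operad with trivial differential. For a graded operad $\mathcal{P}$ concentrated in degrees $\leq0$, $\mathcal{P}^0\subset\mathcal{P}$ is its degree $0$ suboperad and there is a unique retraction $\mathcal{P}\to\mathcal{P}^0$. The trivial $\mathcal{P}$-algebra structure is the restriction of scalars along $\mathcal{P}\to\mathcal{P}^0$ of the underlying $\mathcal{P}^0$-algebra structure. *)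

theory Defs
  imports
    "HOL-Analysis.Analysis"
    "HOL-Library.Function_Algebras"
    "HOL-Analysis.Finite_Function_Topology"
    "HOL-Combinatorics.Permutations"
begin

section \<open>Linear preliminaries\<close>

instantiation "fun" :: (type, real_vector) real_vector
begin

definition scaleR_fun :: "real \<Rightarrow> ('a \<Rightarrow> 'b) \<Rightarrow> 'a \<Rightarrow> 'b"
  where "scaleR_fun c f = (\<lambda>x. c *\<^sub>R f x)"

instance
  by standard (simp_all add: scaleR_fun_def fun_eq_iff scaleR_add_right scaleR_add_left)

end

definition sgn_pow :: "int \<Rightarrow> real"
  where "sgn_pow k = (if even k then 1 else - 1)"

definition lin_on :: "'v::real_vector set \<Rightarrow> ('v \<Rightarrow> 'w::real_vector) \<Rightarrow> bool"
  where "lin_on S f \<longleftrightarrow>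
    (\<forall>x\<in>S. \<forall>y\<in>S. f (x + y) = f x + f y) \<and> (\<forall>c. \<forall>x\<in>S. f (c *\<^sub>R x) = c *\<^sub>R f x)"

text \<open>Formal linear combinations are finitely supported functions; \<open>linext h\<close> is the
  linear extension of a map \<open>h\<close> given on basis elements.\<close>

abbreviation basis_elt :: "'t \<Rightarrow> ('t \<Rightarrow>\<^sub>0 real)"
  where "basis_elt t \<equiv> Poly_Mapping.single t 1"

definition linext :: "('t \<Rightarrow> 'w::real_vector) \<Rightarrow> ('t \<Rightarrow>\<^sub>0 real) \<Rightarrow> 'w"
  where "linext h x = (\<Sum>t\<in>Poly_Mapping.keys x. Poly_Mapping.lookup x t *\<^sub>R h t)"


section \<open>Graded vector spaces\<close>

text \<open>A graded vector space is a family of subspaces \<open>V k\<close> of an ambient real vector space,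
  whose sum is direct. The modulus \<open>m\<close> selects the grading group: \<open>m = 0\<close> is a
  grading by the integers, \<open>m = 2\<close> a grading by the integers modulo 2, in which case the
  family is 2-periodic. Only homogeneous elements, i.e. elements of \<open>homog V\<close>, are used.\<close>

definition graded_space :: "int \<Rightarrow> (int \<Rightarrow> 'v::real_vector set) \<Rightarrow> bool"
  where "graded_space m V \<longleftrightarrow>
    (\<forall>k. subspace (V k)) \<and>
    (\<forall>k. V (k + m) = V k) \<and>
    (\<forall>I x. finite I \<and> inj_on (\<lambda>k. k mod m) I \<and> (\<forall>k\<in>I. x k \<in> V k) \<and> (\<Sum>k\<in>I. x k) = 0
       \<longrightarrow> (\<forall>k\<in>I. x k = 0))"

definition homog :: "(int \<Rightarrow> 'v set) \<Rightarrow> 'v set"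
  where "homog V = (\<Union>k. V k)"

text \<open>For a nonzero homogeneous element the degree is well defined modulo \<open>m\<close>, so its
  parity is well defined; for the zero element the value is irrelevant.\<close>

definition gdeg :: "(int \<Rightarrow> 'v set) \<Rightarrow> 'v \<Rightarrow> int"
  where "gdeg V x = (SOME k. x \<in> V k)"

definition cochain_complex ::
    "int \<Rightarrow> (int \<Rightarrow> 'v::real_vector set) \<Rightarrow> ('v \<Rightarrow> 'v) \<Rightarrow> bool"
  where "cochain_complex m V d \<longleftrightarrow>
    graded_space m V \<and>
    (\<forall>k. lin_on (V k) d \<and> d ` V k \<subseteq> V (k + 1)) \<and> (\<forall>x\<in>homog V. d (d x) = 0)"


section \<open>Symmetric DG operads and their algebras\<close>

text \<open>Operads are given by partial compositions, with inputs numbered from \<open>0\<close>.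
  \<open>opc P n k\<close> is the space of operations of arity \<open>n\<close> and degree \<open>k\<close>.
  \<open>opcomp P m k i n l x y\<close> is \<open>x \<circ>\<^sub>i y\<close> for \<open>x\<close> of arity and degree \<open>m\<close>,
  \<open>k\<close> and \<open>y\<close> of arity and degree \<open>n\<close>, \<open>l\<close>. \<open>opact P n k \<sigma> x\<close> is the right
  action \<open>x \<cdot> \<sigma>\<close>.\<close>

record 'p operad =
  opc :: "nat \<Rightarrow> int \<Rightarrow> 'p set"
  opid :: 'p
  opcomp :: "nat \<Rightarrow> int \<Rightarrow> nat \<Rightarrow> nat \<Rightarrow> int \<Rightarrow> 'p \<Rightarrow> 'p \<Rightarrow> 'p"
  opact :: "nat \<Rightarrow> int \<Rightarrow> (nat \<Rightarrow> nat) \<Rightarrow> 'p \<Rightarrow> 'p"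
  opdiff :: "nat \<Rightarrow> int \<Rightarrow> 'p \<Rightarrow> 'p"

text \<open>\<open>x \<cdot> \<sigma>\<close> feeds its input \<open>a\<close> into the input \<open>\<sigma> a\<close> of \<open>x\<close>.
  Accordingly \<open>(x \<cdot> \<sigma>) \<circ>\<^sub>i (y \<cdot> \<tau>) = (x \<circ>\<^bsub>\<sigma> i\<^esub> y) \<cdot> block_perm i n \<sigma> \<tau>\<close> where \<open>n\<close> is
  the arity of \<open>y\<close>.\<close>

definition block_perm :: "nat \<Rightarrow> nat \<Rightarrow> (nat \<Rightarrow> nat) \<Rightarrow> (nat \<Rightarrow> nat) \<Rightarrow> nat \<Rightarrow> nat"
  where "block_perm i n \<sigma> \<tau> a =
    (let shift = (\<lambda>c. if c < \<sigma> i then c else c + n - 1) in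
     if a < i then shift (\<sigma> a)
     else if a < i + n then \<sigma> i + \<tau> (a - i)
     else shift (\<sigma> (a + 1 - n)))"

definition dg_operad :: "'p::real_vector operad \<Rightarrow> bool"
  where "dg_operad P \<longleftrightarrow>
    (\<forall>n k. subspace (opc P n k)) \<and>
    opid P \<in> opc P 1 0 \<and>
    \<comment> \<open>partial compositions\<close>
    (\<forall>m k i n l. i < m \<longrightarrow>
      (\<forall>x\<in>opc P m k. \<forall>y\<in>opc P n l. opcomp P m k i n l x y \<in> opc P (m + n - 1) (k + l)) \<and>
      (\<forall>x\<in>opc P m k. lin_on (opc P n l) (\<lambda>y. opcomp P m k i n l x y)) \<and>
      (\<forall>y\<in>opc P n l. lin_on (opc P m k) (\<lambda>x. opcomp P m k i n l x y))) \<and>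
    (\<forall>n k. \<forall>x\<in>opc P n k. opcomp P 1 0 0 n k (opid P) x = x) \<and>
    (\<forall>n k i. i < n \<longrightarrow> (\<forall>x\<in>opc P n k. opcomp P n k i 1 0 x (opid P) = x)) \<and>
    (\<forall>m k n l r q i j. i < m \<and> j < n \<longrightarrow>
      (\<forall>x\<in>opc P m k. \<forall>y\<in>opc P n l. \<forall>z\<in>opc P r q.
        opcomp P (m + n - 1) (k + l) (i + j) r q (opcomp P m k i n l x y) z =
        opcomp P m k i (n + r - 1) (l + q) x (opcomp P n l j r q y z))) \<and>
    (\<forall>m k n l r q i j. i < j \<and> j < m \<longrightarrow>
      (\<forall>x\<in>opc P m k. \<forall>y\<in>opc P n l. \<forall>z\<in>opc P r q.
        opcomp P (m + n - 1) (k + l) (j + n - 1) r q (opcomp P m k i n l x y) z =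
        sgn_pow (l * q) *\<^sub>R
        opcomp P (m + r - 1) (k + q) i n l (opcomp P m k j r q x z) y)) \<and>
    \<comment> \<open>symmetric group actions\<close>
    (\<forall>n k \<sigma>. \<sigma> permutes {..<n} \<longrightarrow>
      opact P n k \<sigma> ` opc P n k \<subseteq> opc P n k \<and> lin_on (opc P n k) (opact P n k \<sigma>)) \<and>
    (\<forall>n k. \<forall>x\<in>opc P n k. opact P n k id x = x) \<and>
    (\<forall>n k \<sigma> \<tau>. \<sigma> permutes {..<n} \<and> \<tau> permutes {..<n} \<longrightarrow>
      (\<forall>x\<in>opc P n k. opact P n k \<tau> (opact P n k \<sigma> x) = opact P n k (\<sigma> \<circ> \<tau>) x)) \<and>
    (\<forall>m k n l i \<sigma> \<tau>. i < m \<and> \<sigma> permutes {..<m} \<and> \<tau> permutes {..<n} \<longrightarrow>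
      (\<forall>x\<in>opc P m k. \<forall>y\<in>opc P n l.
        opcomp P m k i n l (opact P m k \<sigma> x) (opact P n l \<tau> y) =
        opact P (m + n - 1) (k + l) (block_perm i n \<sigma> \<tau>) (opcomp P m k (\<sigma> i) n l x y))) \<and>
    \<comment> \<open>differential\<close>
    (\<forall>n k. opdiff P n k ` opc P n k \<subseteq> opc P n (k + 1) \<and> lin_on (opc P n k) (opdiff P n k)) \<and>
    (\<forall>n k. \<forall>x\<in>opc P n k. opdiff P n (k + 1) (opdiff P n k x) = 0) \<and>
    (\<forall>n k \<sigma>. \<sigma> permutes {..<n} \<longrightarrow>
      (\<forall>x\<in>opc P n k. opdiff P n k (opact P n k \<sigma> x) = opact P n (k + 1) \<sigma> (opdiff P n k x))) \<and>
    (\<forall>m k n l i. i < m \<longrightarrow>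
      (\<forall>x\<in>opc P m k. \<forall>y\<in>opc P n l.
        opdiff P (m + n - 1) (k + l) (opcomp P m k i n l x y) =
        opcomp P m (k + 1) i n l (opdiff P m k x) y +
        sgn_pow k *\<^sub>R opcomp P m k i n (l + 1) x (opdiff P n l y)))"

definition graded_operad :: "'p::real_vector operad \<Rightarrow> bool"
  where "graded_operad P \<longleftrightarrow> dg_operad P \<and> (\<forall>n k. \<forall>x\<in>opc P n k. opdiff P n k x = 0)"

text \<open>A morphism is a family of linear maps indexed by arity and degree.\<close>

definition operad_morphism ::
    "'p::real_vector operad \<Rightarrow> 'q::real_vector operad \<Rightarrow> (nat \<Rightarrow> int \<Rightarrow> 'p \<Rightarrow> 'q) \<Rightarrow> bool"
  where "operad_morphism P Q \<phi> \<longleftrightarrow>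
    (\<forall>n k. \<phi> n k ` opc P n k \<subseteq> opc Q n k \<and> lin_on (opc P n k) (\<phi> n k)) \<and>
    \<phi> 1 0 (opid P) = opid Q \<and>
    (\<forall>m k n l i. i < m \<longrightarrow>
      (\<forall>x\<in>opc P m k. \<forall>y\<in>opc P n l.
        \<phi> (m + n - 1) (k + l) (opcomp P m k i n l x y) = opcomp Q m k i n l (\<phi> m k x) (\<phi> n l y))) \<and>
    (\<forall>n k \<sigma>. \<sigma> permutes {..<n} \<longrightarrow>
      (\<forall>x\<in>opc P n k. \<phi> n k (opact P n k \<sigma> x) = opact Q n k \<sigma> (\<phi> n k x))) \<and>
    (\<forall>n k. \<forall>x\<in>opc P n k. \<phi> n (k + 1) (opdiff P n k x) = opdiff Q n k (\<phi> n k x))"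

subsection \<open>The endomorphism operad\<close>

text \<open>An operation of arity \<open>n\<close> is a multilinear map on lists of length \<open>n\<close> of
  homogeneous elements, extended by zero to all other lists.\<close>

definition multilinear_maps ::
    "(int \<Rightarrow> 'v::real_vector set) \<Rightarrow> nat \<Rightarrow> int \<Rightarrow> ('v list \<Rightarrow> 'v) set"
  where "multilinear_maps V n k = {f.
    (\<forall>xs. length xs \<noteq> n \<or> \<not> set xs \<subseteq> homog V \<longrightarrow> f xs = 0) \<and>
    (\<forall>xs js. length xs = n \<and> list_all2 (\<lambda>x j. x \<in> V j) xs js \<longrightarrow> f xs \<in> V (sum_list js + k)) \<and>
    (\<forall>us vs j. set us \<subseteq> homog V \<and> set vs \<subseteq> homog V \<longrightarrow> lin_on (V j) (\<lambda>x. f (us @ [x] @ vs)))}"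

definition ext_map ::
    "(int \<Rightarrow> 'v::real_vector set) \<Rightarrow> nat \<Rightarrow> ('v list \<Rightarrow> 'v) \<Rightarrow> 'v list \<Rightarrow> 'v"
  where "ext_map V n f = (\<lambda>xs. if length xs = n \<and> set xs \<subseteq> homog V then f xs else 0)"

abbreviation unary_op ::
    "(int \<Rightarrow> 'v::real_vector set) \<Rightarrow> ('v \<Rightarrow> 'v) \<Rightarrow> 'v list \<Rightarrow> 'v"
  where "unary_op V f \<equiv> ext_map V 1 (\<lambda>xs. f (xs ! 0))"

abbreviation binary_op ::
    "(int \<Rightarrow> 'v::real_vector set) \<Rightarrow> ('v \<Rightarrow> 'v \<Rightarrow> 'v) \<Rightarrow> 'v list \<Rightarrow> 'v"
  where "binary_op V f \<equiv> ext_map V 2 (\<lambda>xs. f (xs ! 0) (xs ! 1))"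

abbreviation deg_sum :: "(int \<Rightarrow> 'v set) \<Rightarrow> 'v list \<Rightarrow> int"
  where "deg_sum V xs \<equiv> sum_list (map (gdeg V) xs)"

definition end_comp :: "(int \<Rightarrow> 'v::real_vector set) \<Rightarrow> nat \<Rightarrow> nat \<Rightarrow> nat \<Rightarrow> int
    \<Rightarrow> ('v list \<Rightarrow> 'v) \<Rightarrow> ('v list \<Rightarrow> 'v) \<Rightarrow> 'v list \<Rightarrow> 'v"
  where "end_comp V m i n l f g = ext_map V (m + n - 1) (\<lambda>xs.
    sgn_pow (l * deg_sum V (take i xs)) *\<^sub>R
    f (take i xs @ [g (take n (drop i xs))] @ drop (i + n) xs))"

definition end_act :: "(int \<Rightarrow> 'v::real_vector set) \<Rightarrow> nat \<Rightarrow> (nat \<Rightarrow> nat)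
    \<Rightarrow> ('v list \<Rightarrow> 'v) \<Rightarrow> 'v list \<Rightarrow> 'v"
  where "end_act V n \<sigma> f = ext_map V n (\<lambda>xs.
    sgn_pow (\<Sum>(a, b) | a < b \<and> b < n \<and> \<sigma> b < \<sigma> a. gdeg V (xs ! a) * gdeg V (xs ! b)) *\<^sub>R
    f (map (\<lambda>j. xs ! inv \<sigma> j) [0..<n]))"

definition end_diff :: "(int \<Rightarrow> 'v::real_vector set) \<Rightarrow> ('v \<Rightarrow> 'v) \<Rightarrow> nat \<Rightarrow> int
    \<Rightarrow> ('v list \<Rightarrow> 'v) \<Rightarrow> 'v list \<Rightarrow> 'v"
  where "end_diff V d n k f = ext_map V n (\<lambda>xs.
    d (f xs) - sgn_pow k *\<^sub>R (\<Sum>j<n. sgn_pow (deg_sum V (take j xs)) *\<^sub>R f (xs[j := d (xs ! j)])))"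

definition End_operad ::
    "(int \<Rightarrow> 'v::real_vector set) \<Rightarrow> ('v \<Rightarrow> 'v) \<Rightarrow> ('v list \<Rightarrow> 'v) operad"
  where "End_operad V d =
    \<lparr> opc = multilinear_maps V,
      opid = unary_op V (\<lambda>x. x),
      opcomp = (\<lambda>m k i n l. end_comp V m i n l),
      opact = (\<lambda>n k. end_act V n),
      opdiff = end_diff V d \<rparr>"

subsection \<open>Algebras over an operad and quasi-isomorphisms\<close>

record ('v, 'p) op_algebra =
  cx :: "int \<Rightarrow> 'v set"
  cdiff :: "'v \<Rightarrow> 'v"
  act :: "nat \<Rightarrow> int \<Rightarrow> 'p \<Rightarrow> 'v list \<Rightarrow> 'v"

definition operad_algebra ::
    "int \<Rightarrow> 'p::real_vector operad \<Rightarrow> ('v::real_vector, 'p) op_algebra \<Rightarrow> bool"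
  where "operad_algebra m P A \<longleftrightarrow>
    cochain_complex m (cx A) (cdiff A) \<and> operad_morphism P (End_operad (cx A) (cdiff A)) (act A)"

definition algebra_morphism :: "'p operad \<Rightarrow> ('v::real_vector, 'p) op_algebra
    \<Rightarrow> ('w::real_vector, 'p) op_algebra \<Rightarrow> ('v \<Rightarrow> 'w) \<Rightarrow> bool"
  where "algebra_morphism P A B f \<longleftrightarrow>
    (\<forall>k. f ` cx A k \<subseteq> cx B k \<and> lin_on (cx A k) f) \<and>
    (\<forall>x\<in>homog (cx A). f (cdiff A x) = cdiff B (f x)) \<and>
    (\<forall>n k xs. length xs = n \<and> set xs \<subseteq> homog (cx A) \<longrightarrow>
      (\<forall>p\<in>opc P n k. f (act A n k p xs) = act B n k p (map f xs)))"

text \<open>The two last clauses say that the induced maps on cohomology are injective and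
  surjective.\<close>

definition quasi_iso :: "int \<Rightarrow> 'p::real_vector operad \<Rightarrow> ('v::real_vector, 'p) op_algebra
    \<Rightarrow> ('w::real_vector, 'p) op_algebra \<Rightarrow> ('v \<Rightarrow> 'w) \<Rightarrow> bool"
  where "quasi_iso m P A B f \<longleftrightarrow>
    operad_algebra m P A \<and> operad_algebra m P B \<and> algebra_morphism P A B f \<and>
    (\<forall>k. \<forall>x\<in>cx A k. cdiff A x = 0 \<and> f x \<in> cdiff B ` cx B (k - 1) \<longrightarrow> x \<in> cdiff A ` cx A (k - 1)) \<and>
    (\<forall>k. \<forall>y\<in>cx B k. cdiff B y = 0 \<longrightarrow>
      (\<exists>x\<in>cx A k. cdiff A x = 0 \<and> y - f x \<in> cdiff B ` cx B (k - 1)))"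

definition qi_link :: "int \<Rightarrow> 'p::real_vector operad \<Rightarrow> ('v::real_vector, 'p) op_algebra
    \<Rightarrow> ('w::real_vector, 'p) op_algebra \<Rightarrow> bool"
  where "qi_link m P A B \<longleftrightarrow> (\<exists>f. quasi_iso m P A B f) \<or> (\<exists>g. quasi_iso m P B A g)"

text \<open>\<open>A\<close> and \<open>B\<close> are connected by a zig-zag of quasi-isomorphisms of algebras over
  \<open>P\<close>. Since one cannot quantify over types, the type \<open>'u\<close> in which the intermediate
  algebras live is a parameter; a zig-zag in a specific type is in particular a zig-zag.\<close>

definition quasi_isomorphic :: "'u::real_vector itself \<Rightarrow> int \<Rightarrow> 'p::real_vector operad
    \<Rightarrow> ('v::real_vector, 'p) op_algebra \<Rightarrow> ('w::real_vector, 'p) op_algebra \<Rightarrow> bool"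
  where "quasi_isomorphic _ m P A B \<longleftrightarrow>
    (\<exists>C C' :: ('u, 'p) op_algebra.
      qi_link m P A C \<and> (qi_link m P)\<^sup>*\<^sup>* C C' \<and> qi_link m P C' B)"

subsection \<open>Restriction of scalars and trivial structures\<close>

definition restrict_scalars ::
    "(nat \<Rightarrow> int \<Rightarrow> 'p \<Rightarrow> 'q) \<Rightarrow> ('v, 'q) op_algebra \<Rightarrow> ('v, 'p) op_algebra"
  where "restrict_scalars \<phi> A =
    \<lparr> cx = cx A, cdiff = cdiff A, act = (\<lambda>n k p. act A n k (\<phi> n k p)) \<rparr>"

definition deg0_suboperad :: "'p::real_vector operad \<Rightarrow> 'p operad"
  where "deg0_suboperad P = P \<lparr> opc := (\<lambda>n k. if k = 0 then opc P n 0 else {0}) \<rparr>"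

definition deg0_inclusion :: "nat \<Rightarrow> int \<Rightarrow> 'p \<Rightarrow> 'p"
  where "deg0_inclusion n k p = p"

text \<open>The retraction of an operad in degrees \<open>\<le> 0\<close> onto its degree 0 suboperad.\<close>

definition deg0_retraction :: "nat \<Rightarrow> int \<Rightarrow> 'p::real_vector \<Rightarrow> 'p"
  where "deg0_retraction n k p = (if k = 0 then p else 0)"

definition trivial_algebra :: "('v, 'p::real_vector) op_algebra \<Rightarrow> ('v, 'p) op_algebra"
  where "trivial_algebra A = restrict_scalars deg0_retraction (restrict_scalars deg0_inclusion A)"


section \<open>The exact commutative homotopy BV operad\<close>

text \<open>The operad is constructed from its presentation: formal linear combinations of well-formed
  expressions in the generators, modulo the smallest family of subspaces that contains the axioms
  of DG operads and the defining relations and is closed under the operad operations.\<close>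

datatype expr =
    EMu
  | EI nat
  | EId
  | EComp expr nat expr
  | EAct expr "nat \<Rightarrow> nat"
  | EDiff expr

primrec earity :: "expr \<Rightarrow> nat" where
  "earity EMu = 2"
| "earity (EI n) = 1"
| "earity EId = 1"
| "earity (EComp s i t) = earity s + earity t - 1"
| "earity (EAct s \<sigma>) = earity s"
| "earity (EDiff s) = earity s"

primrec edeg :: "expr \<Rightarrow> int" where
  "edeg EMu = 0"
| "edeg (EI n) = - 2 * int n"
| "edeg EId = 0"
| "edeg (EComp s i t) = edeg s + edeg t"
| "edeg (EAct s \<sigma>) = edeg s"
| "edeg (EDiff s) = edeg s + 1"

primrec wf_expr :: "expr \<Rightarrow> bool" where
  "wf_expr EMu = True"
| "wf_expr (EI n) = (1 \<le> n)"
| "wf_expr EId = True"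
| "wf_expr (EComp s i t) = (wf_expr s \<and> wf_expr t \<and> i < earity s)"
| "wf_expr (EAct s \<sigma>) = (wf_expr s \<and> \<sigma> permutes {..<earity s})"
| "wf_expr (EDiff s) = wf_expr s"

definition exprs :: "nat \<Rightarrow> int \<Rightarrow> expr set"
  where "exprs n k = {t. wf_expr t \<and> earity t = n \<and> edeg t = k}"

type_synonym fexpr = "expr \<Rightarrow>\<^sub>0 real"

definition fexprs :: "nat \<Rightarrow> int \<Rightarrow> fexpr set"
  where "fexprs n k = {x. Poly_Mapping.keys x \<subseteq> exprs n k}"

definition wf_basis :: "expr \<Rightarrow> fexpr"
  where "wf_basis t = (if wf_expr t then basis_elt t else 0)"

definition expr_comp :: "nat \<Rightarrow> fexpr \<Rightarrow> fexpr \<Rightarrow> fexpr"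
  where "expr_comp i x y = linext (\<lambda>s. linext (\<lambda>t. wf_basis (EComp s i t)) y) x"

definition expr_perm :: "(nat \<Rightarrow> nat) \<Rightarrow> fexpr \<Rightarrow> fexpr"
  where "expr_perm \<sigma> x = linext (\<lambda>s. wf_basis (EAct s \<sigma>)) x"

definition expr_diff :: "fexpr \<Rightarrow> fexpr"
  where "expr_diff x = linext (\<lambda>s. wf_basis (EDiff s)) x"

text \<open>\<open>mu_pow n\<close> is the \<open>n\<close>-fold product, for \<open>n \<ge> 1\<close>.\<close>

fun mu_pow :: "nat \<Rightarrow> expr" where
  "mu_pow 0 = EId"
| "mu_pow (Suc 0) = EId"
| "mu_pow (Suc (Suc n)) = EComp EMu 0 (mu_pow (Suc n))"

definition shuffles_perm :: "nat \<Rightarrow> nat \<Rightarrow> (nat \<Rightarrow> nat) set"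
  where "shuffles_perm p q = {\<sigma>. \<sigma> permutes {..<p + q} \<and>
    strict_mono_on {..<p} \<sigma> \<and> strict_mono_on {p..<p + q} \<sigma>}"

text \<open>The relation that \<open>i\<^sub>n\<close> has order at most \<open>r\<close>. The expression
  \<open>EComp (mu_pow (q + 1)) 0 (EComp (EI n) 0 (mu_pow p))\<close> stands for
  \<open>i\<^sub>n(x\<^sub>1\<cdots>x\<^sub>p)x\<^bsub>p+1\<^esub>\<cdots>x\<^bsub>p+q\<^esub>\<close>; replacing \<open>x\<^sub>j\<close> by \<open>x\<^bsub>\<sigma>(j)\<^esub>\<close> is the right action of the inverse
  of \<open>\<sigma>\<close>, which produces the Koszul sign.\<close>

definition order_rel :: "nat \<Rightarrow> nat \<Rightarrow> fexpr"
  where "order_rel n r = (\<Sum>p = 1..r + 1. \<Sum>\<sigma>\<in>shuffles_perm p (r + 1 - p).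
    (- 1) ^ p *\<^sub>R basis_elt
      (EAct (EComp (mu_pow (r + 1 - p + 1)) 0 (EComp (EI n) 0 (mu_pow p))) (inv \<sigma>)))"

text \<open>In \<open>exact\<close> below, \<open>EDiff (EI n)\<close> is \<open>d i\<^sub>n - i\<^sub>n d = - [i\<^sub>n, d]\<close>.\<close>

inductive ecbv_null :: "nat \<Rightarrow> int \<Rightarrow> fexpr \<Rightarrow> bool" where
  zero: "ecbv_null n k 0"
| add: "ecbv_null n k x \<Longrightarrow> ecbv_null n k y \<Longrightarrow> ecbv_null n k (x + y)"
| scale: "ecbv_null n k x \<Longrightarrow> ecbv_null n k (c *\<^sub>R x)"
| comp_left: "ecbv_null n k x \<Longrightarrow> t \<in> exprs m l \<Longrightarrow> i < n \<Longrightarrow>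
    ecbv_null (n + m - 1) (k + l) (expr_comp i x (basis_elt t))"
| comp_right: "ecbv_null n k x \<Longrightarrow> s \<in> exprs m l \<Longrightarrow> i < m \<Longrightarrow>
    ecbv_null (m + n - 1) (l + k) (expr_comp i (basis_elt s) x)"
| act: "ecbv_null n k x \<Longrightarrow> \<sigma> permutes {..<n} \<Longrightarrow> ecbv_null n k (expr_perm \<sigma> x)"
| diff: "ecbv_null n k x \<Longrightarrow> ecbv_null n (k + 1) (expr_diff x)"
  \<comment> \<open>axioms of DG operads\<close>
| unit_left: "t \<in> exprs n k \<Longrightarrow> ecbv_null n k (basis_elt (EComp EId 0 t) - basis_elt t)"
| unit_right: "t \<in> exprs n k \<Longrightarrow> i < n \<Longrightarrow>
    ecbv_null n k (basis_elt (EComp t i EId) - basis_elt t)"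
| assoc_seq: "s \<in> exprs m k \<Longrightarrow> t \<in> exprs n l \<Longrightarrow> u \<in> exprs r q \<Longrightarrow> i < m \<Longrightarrow> j < n \<Longrightarrow>
    ecbv_null (m + n - 1 + r - 1) (k + l + q)
      (basis_elt (EComp (EComp s i t) (i + j) u) - basis_elt (EComp s i (EComp t j u)))"
| assoc_par: "s \<in> exprs m k \<Longrightarrow> t \<in> exprs n l \<Longrightarrow> u \<in> exprs r q \<Longrightarrow> i < j \<Longrightarrow> j < m \<Longrightarrow>
    ecbv_null (m + n - 1 + r - 1) (k + l + q)
      (basis_elt (EComp (EComp s i t) (j + n - 1) u)
        - sgn_pow (l * q) *\<^sub>R basis_elt (EComp (EComp s j u) i t))"
| act_id: "t \<in> exprs n k \<Longrightarrow> ecbv_null n k (basis_elt (EAct t id) - basis_elt t)"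
| act_act: "t \<in> exprs n k \<Longrightarrow> \<sigma> permutes {..<n} \<Longrightarrow> \<tau> permutes {..<n} \<Longrightarrow>
    ecbv_null n k (basis_elt (EAct (EAct t \<sigma>) \<tau>) - basis_elt (EAct t (\<sigma> \<circ> \<tau>)))"
| equivariance: "s \<in> exprs m k \<Longrightarrow> t \<in> exprs n l \<Longrightarrow> i < m \<Longrightarrow>
    \<sigma> permutes {..<m} \<Longrightarrow> \<tau> permutes {..<n} \<Longrightarrow>
    ecbv_null (m + n - 1) (k + l)
      (basis_elt (EComp (EAct s \<sigma>) i (EAct t \<tau>))
        - basis_elt (EAct (EComp s (\<sigma> i) t) (block_perm i n \<sigma> \<tau>)))"
| diff_diff: "t \<in> exprs n k \<Longrightarrow> ecbv_null n (k + 2) (basis_elt (EDiff (EDiff t)))"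
| diff_act: "t \<in> exprs n k \<Longrightarrow> \<sigma> permutes {..<n} \<Longrightarrow>
    ecbv_null n (k + 1) (basis_elt (EDiff (EAct t \<sigma>)) - basis_elt (EAct (EDiff t) \<sigma>))"
| diff_comp: "s \<in> exprs m k \<Longrightarrow> t \<in> exprs n l \<Longrightarrow> i < m \<Longrightarrow>
    ecbv_null (m + n - 1) (k + l + 1)
      (basis_elt (EDiff (EComp s i t))
        - (basis_elt (EComp (EDiff s) i t) + sgn_pow k *\<^sub>R basis_elt (EComp s i (EDiff t))))"
  \<comment> \<open>defining relations\<close>
| mu_sym: "ecbv_null 2 0 (basis_elt (EAct EMu (Transposition.transpose 0 1)) - basis_elt EMu)"
| mu_assoc: "ecbv_null 3 0 (basis_elt (EComp EMu 0 EMu) - basis_elt (EComp EMu 1 EMu))"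
| mu_closed: "ecbv_null 2 1 (basis_elt (EDiff EMu))"
| order: "1 \<le> n \<Longrightarrow> ecbv_null (n + 2) (- 2 * int n) (order_rel n (n + 1))"
| commute: "1 \<le> n \<Longrightarrow> 1 \<le> m \<Longrightarrow> ecbv_null 1 (- 2 * int n - 2 * int m)
    (basis_elt (EComp (EI n) 0 (EI m)) - basis_elt (EComp (EI m) 0 (EI n)))"
| exact: "2 \<le> n \<Longrightarrow> ecbv_null 1 (1 - 2 * int n)
    (\<Sum>j = 1..n - 1. basis_elt (EComp (EI j) 0 (EDiff (EI (n - j))))
                 - basis_elt (EComp (EDiff (EI (n - j))) 0 (EI j)))"

definition ecbv_ideal :: "fexpr set"
  where "ecbv_ideal = span (\<Union>n k. Collect (ecbv_null n k))"

subsection \<open>The quotient operad\<close>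

lemma lookup_scaleR: "Poly_Mapping.lookup (c *\<^sub>R x) t = c *\<^sub>R Poly_Mapping.lookup x t"
proof -
  have "finite {t. c *\<^sub>R Poly_Mapping.lookup x t \<noteq> 0}"
    by (rule finite_subset[OF _ finite_keys[of x]]) (auto simp: in_keys_iff)
  then show ?thesis
    by (simp add: scaleR_poly_mapping_def Abs_poly_mapping_inverse)
qed

lemma linext_superset:
  assumes "finite S" "Poly_Mapping.keys x \<subseteq> S"
  shows "linext h x = (\<Sum>t\<in>S. Poly_Mapping.lookup x t *\<^sub>R h t)"
  unfolding linext_def by (rule sum.mono_neutral_left) (use assms in \<open>auto simp: in_keys_iff\<close>)

lemma linear_linext: "linear (linext h)"
proof (rule linearI)
  fix x y :: "'a \<Rightarrow>\<^sub>0 real" and c :: real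
  let ?S = "Poly_Mapping.keys x \<union> Poly_Mapping.keys y"
  have "linext h (x + y) = (\<Sum>t\<in>?S. Poly_Mapping.lookup (x + y) t *\<^sub>R h t)"
    by (rule linext_superset) (auto simp: Poly_Mapping.keys_add)
  also have "\<dots> = (\<Sum>t\<in>?S. Poly_Mapping.lookup x t *\<^sub>R h t) + (\<Sum>t\<in>?S. Poly_Mapping.lookup y t *\<^sub>R h t)"
    by (simp add: lookup_add scaleR_add_left sum.distrib)
  also have "\<dots> = linext h x + linext h y"
    by (simp add: linext_superset[of ?S])
  finally show "linext h (x + y) = linext h x + linext h y" .
  have "linext h (c *\<^sub>R x) = (\<Sum>t\<in>Poly_Mapping.keys x. Poly_Mapping.lookup (c *\<^sub>R x) t *\<^sub>R h t)"
    by (rule linext_superset) (auto simp: in_keys_iff lookup_scaleR)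
  also have "\<dots> = c *\<^sub>R linext h x"
    by (simp add: linext_def lookup_scaleR scaleR_sum_right)
  finally show "linext h (c *\<^sub>R x) = c *\<^sub>R linext h x" .
qed

lemma linext_basis [simp]: "linext h (basis_elt t) = h t"
  by (simp add: linext_def)

lemma linext_expand: "x = linext basis_elt x"
proof (rule poly_mapping_eqI)
  fix u
  have "Poly_Mapping.lookup (\<Sum>t\<in>A. f t) u = (\<Sum>t\<in>A. Poly_Mapping.lookup (f t) u)"
    for A :: "'a set" and f :: "'a \<Rightarrow> 'a \<Rightarrow>\<^sub>0 real"
    by (induction A rule: infinite_finite_induct) (auto simp: lookup_add)
  then have "Poly_Mapping.lookup (linext basis_elt x) u =
      (\<Sum>t\<in>Poly_Mapping.keys x. Poly_Mapping.lookup x t * (if t = u then 1 else 0))"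
    by (simp add: linext_def lookup_scaleR lookup_single when_def)
  also have "\<dots> = (\<Sum>t\<in>Poly_Mapping.keys x. if t = u then Poly_Mapping.lookup x t else 0)"
    by (rule sum.cong) auto
  also have "\<dots> = Poly_Mapping.lookup x u"
    by (simp add: sum.delta in_keys_iff)
  finally show "Poly_Mapping.lookup x u = Poly_Mapping.lookup (linext basis_elt x) u" by simp
qed

lemma in_span_basis: "x \<in> span (basis_elt ` Poly_Mapping.keys x)"
  by (subst (1) linext_expand, unfold linext_def, intro span_sum span_scale span_base) auto

lemma linear_add_fun: "linear f \<Longrightarrow> linear g \<Longrightarrow> linear (\<lambda>x. f x + g x)"
  by (simp add: linear_iff algebra_simps)

lemma linext_fun_add: "linext (\<lambda>t. h t + h' t) x = linext h x + linext h' x"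
  by (simp add: linext_def scaleR_add_right sum.distrib)

lemma linext_fun_scale: "linext (\<lambda>t. c *\<^sub>R h t) x = c *\<^sub>R linext h x"
  by (simp add: linext_def scaleR_sum_right mult.commute)

lemma linear_expr_comp_left: "linear (\<lambda>x. expr_comp i x y)"
  unfolding expr_comp_def by (rule linear_linext)

lemma linear_expr_comp_right: "linear (\<lambda>y. expr_comp i x y)"
  unfolding expr_comp_def
  by (rule linearI) (simp_all add: linear_add[OF linear_linext] linear_scale[OF linear_linext]
      linext_fun_add linext_fun_scale)

lemma linear_expr_perm: "linear (expr_perm \<sigma>)"
  unfolding expr_perm_def[abs_def] by (rule linear_linext)

lemma linear_expr_diff: "linear expr_diff"
  unfolding expr_diff_def[abs_def] by (rule linear_linext)

lemma expr_comp_basis: "expr_comp i (basis_elt s) (basis_elt t) = wf_basis (EComp s i t)"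
  by (simp add: expr_comp_def)

lemma expr_perm_basis: "expr_perm \<sigma> (basis_elt s) = wf_basis (EAct s \<sigma>)"
  by (simp add: expr_perm_def)

lemma expr_diff_basis: "expr_diff (basis_elt s) = wf_basis (EDiff s)"
  by (simp add: expr_diff_def)

lemma exprs_mem: "t \<in> exprs n k \<longleftrightarrow> wf_expr t \<and> earity t = n \<and> edeg t = k"
  by (simp add: exprs_def)

lemma subspace_fexprs: "subspace (fexprs n k)"
proof -
  have "Poly_Mapping.keys (c *\<^sub>R x) \<subseteq> Poly_Mapping.keys x" for c and x :: fexpr
    by (auto simp: in_keys_iff lookup_scaleR)
  then show ?thesis
    unfolding subspace_def fexprs_def
    by (simp, meson Poly_Mapping.keys_add Un_least subset_trans)
qed

lemma fexprs_eq_span: "fexprs n k = span (basis_elt ` exprs n k)"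
proof
  show "fexprs n k \<subseteq> span (basis_elt ` exprs n k)"
  proof
    fix x assume "x \<in> fexprs n k"
    then have "basis_elt ` Poly_Mapping.keys x \<subseteq> basis_elt ` exprs n k" by (auto simp: fexprs_def)
    then show "x \<in> span (basis_elt ` exprs n k)" using in_span_basis span_mono by blast
  qed
  show "span (basis_elt ` exprs n k) \<subseteq> fexprs n k"
    by (rule span_minimal[OF _ subspace_fexprs]) (auto simp: fexprs_def)
qed

lemma basis_in_fexprs [simp]: "basis_elt t \<in> fexprs n k \<longleftrightarrow> t \<in> exprs n k"
  by (simp add: fexprs_def)

lemma linear_maps_span:
  assumes "linear f" "x \<in> span S" "\<And>s. s \<in> S \<Longrightarrow> f s \<in> T" "subspace T"
  shows "f x \<in> T"
proof -
  have "f ` span S = span (f ` S)" by (rule linear_span_image[OF assms(1), symmetric])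
  also have "\<dots> \<subseteq> T" by (rule span_minimal) (use assms(3,4) in auto)
  finally show ?thesis using assms(2) by blast
qed

lemma expr_comp_fexprs:
  assumes "x \<in> fexprs m k" "y \<in> fexprs n l" "i < m"
  shows "expr_comp i x y \<in> fexprs (m + n - 1) (k + l)"
proof (rule linear_maps_span[OF linear_expr_comp_left assms(1)[unfolded fexprs_eq_span] _ subspace_fexprs])
  fix s assume "s \<in> basis_elt ` exprs m k"
  then obtain s' where s: "s = basis_elt s'" "s' \<in> exprs m k" by blast
  show "expr_comp i s y \<in> fexprs (m + n - 1) (k + l)"
  proof (rule linear_maps_span[OF linear_expr_comp_right assms(2)[unfolded fexprs_eq_span] _ subspace_fexprs])
    fix t assume "t \<in> basis_elt ` exprs n l"
    then show "expr_comp i s t \<in> fexprs (m + n - 1) (k + l)"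
      using s assms(3) by (auto simp: expr_comp_basis wf_basis_def exprs_def)
  qed
qed

lemma expr_perm_fexprs: "x \<in> fexprs n k \<Longrightarrow> \<sigma> permutes {..<n} \<Longrightarrow> expr_perm \<sigma> x \<in> fexprs n k"
  by (rule linear_maps_span[OF linear_expr_perm, where S = "basis_elt ` exprs n k"])
    (auto simp: expr_perm_basis wf_basis_def subspace_fexprs exprs_mem simp flip: fexprs_eq_span)

lemma expr_diff_fexprs: "x \<in> fexprs n k \<Longrightarrow> expr_diff x \<in> fexprs n (k + 1)"
  by (rule linear_maps_span[OF linear_expr_diff, where S = "basis_elt ` exprs n k"])
    (auto simp: expr_diff_basis wf_basis_def subspace_fexprs exprs_mem simp flip: fexprs_eq_span)

lemma mu_pow_exprs: "1 \<le> p \<Longrightarrow> mu_pow p \<in> exprs p 0"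
  by (induction p rule: mu_pow.induct) (auto simp: exprs_def)

lemma block_perm_permutes:
  assumes "i < m" "\<sigma> permutes {..<m}" "\<tau> permutes {..<n}"
  shows "block_perm i n \<sigma> \<tau> permutes {..<m + n - 1}"
proof -
  let ?b = "block_perm i n \<sigma> \<tau>"
  define sh where "sh = (\<lambda>c. if c < \<sigma> i then c else c + n - 1)"
  have si: "\<sigma> i < m" using assms permutes_in_image[OF assms(2)] by auto
  have sh_range: "sh c < \<sigma> i \<or> \<sigma> i + n \<le> sh c" if "c \<noteq> \<sigma> i" for c
    using that by (auto simp: sh_def)
  have sh_inj: "c = c'" if "sh c = sh c'" "c \<noteq> \<sigma> i" "c' \<noteq> \<sigma> i" for c c'
    using that by (simp add: sh_def split: if_splits)
  have sh_less: "sh c < m + n - 1" if "c < m" "c \<noteq> \<sigma> i" for c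
    using that si by (simp add: sh_def, arith)
  have b: "a < i \<Longrightarrow> ?b a = sh (\<sigma> a)" "i \<le> a \<Longrightarrow> a < i + n \<Longrightarrow> ?b a = \<sigma> i + \<tau> (a - i)"
    "i + n \<le> a \<Longrightarrow> ?b a = sh (\<sigma> (a + 1 - n))" for a
    by (simp_all add: block_perm_def sh_def)
  have \<sigma>_inj: "\<sigma> c = \<sigma> c' \<longleftrightarrow> c = c'" for c c'
    using permutes_inj[OF assms(2)] by (simp add: inj_eq)
  have \<sigma>_less: "c < m \<Longrightarrow> \<sigma> c < m" for c
    using permutes_in_image[OF assms(2), of c] by simp
  have \<tau>_less: "c < n \<Longrightarrow> \<tau> c < n" for c
    using permutes_in_image[OF assms(3), of c] by simp
  have "inj_on ?b {..<m + n - 1}"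
  proof (rule linorder_inj_onI')
    fix a a' assume lt': "a \<in> {..<m + n - 1}" "a' \<in> {..<m + n - 1}" "a < a'"
    note lt = lt'(3)
    consider "a' < i" | "a < i" "i \<le> a'" "a' < i + n" | "a < i" "i + n \<le> a'"
      | "i \<le> a" "a' < i + n" | "i \<le> a" "a < i + n" "i + n \<le> a'" | "i + n \<le> a"
      using lt by linarith
    then show "?b a \<noteq> ?b a'"
    proof cases
      case 1
      then show ?thesis using lt b(1)[of a] b(1)[of a'] sh_inj[of "\<sigma> a" "\<sigma> a'"] \<sigma>_inj by auto
    next
      case 2
      have "sh (\<sigma> a) < \<sigma> i \<or> \<sigma> i + n \<le> sh (\<sigma> a)" using 2 by (intro sh_range) (simp add: \<sigma>_inj)
      moreover have "\<tau> (a' - i) < n" using 2 by (intro \<tau>_less) linarith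
      ultimately show ?thesis using 2 b(1)[of a] b(2)[of a'] by linarith
    next
      case 3
      then have "\<sigma> a \<noteq> \<sigma> (a' + 1 - n)" "\<sigma> a \<noteq> \<sigma> i" "\<sigma> (a' + 1 - n) \<noteq> \<sigma> i"
        unfolding \<sigma>_inj by linarith+
      then have "sh (\<sigma> a) \<noteq> sh (\<sigma> (a' + 1 - n))" using sh_inj by blast
      then show ?thesis using 3 b(1)[of a] b(3)[of a'] by simp
    next
      case 4
      have "\<tau> (a - i) \<noteq> \<tau> (a' - i)"
        using 4 lt permutes_inj[OF assms(3)] by (simp add: inj_eq)
      then show ?thesis using 4 lt b(2)[of a] b(2)[of a'] by simp
    next
      case 5
      have "\<sigma> (a' + 1 - n) \<noteq> \<sigma> i" unfolding \<sigma>_inj using 5 by linarith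
      then have "sh (\<sigma> (a' + 1 - n)) < \<sigma> i \<or> \<sigma> i + n \<le> sh (\<sigma> (a' + 1 - n))" by (rule sh_range)
      moreover have "\<tau> (a - i) < n" using 5 by (intro \<tau>_less) linarith
      ultimately show ?thesis using 5 b(2)[of a] b(3)[of a'] by linarith
    next
      case 6
      then have "\<sigma> (a + 1 - n) \<noteq> \<sigma> (a' + 1 - n)" "\<sigma> (a + 1 - n) \<noteq> \<sigma> i" "\<sigma> (a' + 1 - n) \<noteq> \<sigma> i"
        unfolding \<sigma>_inj using lt by linarith+
      then have "sh (\<sigma> (a + 1 - n)) \<noteq> sh (\<sigma> (a' + 1 - n))" using sh_inj by blast
      then show ?thesis using 6 lt b(3)[of a] b(3)[of a'] by simp
    qed
  qed
  moreover have "?b ` {..<m + n - 1} \<subseteq> {..<m + n - 1}"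
  proof clarify
    fix a assume a: "a < m + n - 1"
    consider "a < i" | "i \<le> a" "a < i + n" | "i + n \<le> a" by linarith
    then show "?b a < m + n - 1"
    proof cases
      case 1
      then have "\<sigma> a < m" "\<sigma> a \<noteq> \<sigma> i" using \<sigma>_less assms(1) by (auto simp: \<sigma>_inj)
      then show ?thesis using 1 b(1)[of a] sh_less by simp
    next
      case 2
      then have "\<tau> (a - i) < n" by (intro \<tau>_less) linarith
      then show ?thesis using 2 si b(2)[of a] by linarith
    next
      case 3
      have "\<sigma> (a + 1 - n) < m" using a 3 by (intro \<sigma>_less) linarith
      moreover have "\<sigma> (a + 1 - n) \<noteq> \<sigma> i" unfolding \<sigma>_inj using 3 by linarith
      ultimately show ?thesis using 3 b(3)[of a] sh_less by simp
    qed
  qed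
  ultimately have "bij_betw ?b {..<m + n - 1} {..<m + n - 1}"
    by (simp add: bij_betw_def endo_inj_surj)
  moreover have "?b a = a" if "a \<notin> {..<m + n - 1}" for a
  proof -
    have a: "i + n \<le> a" "m \<le> a + 1 - n" using that assms(1) by auto
    then have "\<sigma> (a + 1 - n) = a + 1 - n" by (intro permutes_not_in[OF assms(2)]) simp
    then show ?thesis using a b(3)[of a] si by (simp add: sh_def)
  qed
  ultimately show ?thesis by (rule bij_imp_permutes)
qed

lemma order_rel_fexprs: "1 \<le> n \<Longrightarrow> order_rel n r \<in> fexprs (r + 1) (- 2 * int n)"
  unfolding order_rel_def
proof (intro subspace_sum subspace_fexprs subspace_scale)
  fix p \<sigma> assume n: "1 \<le> n" and p: "p \<in> {1..r + 1}" and "\<sigma> \<in> shuffles_perm p (r + 1 - p)"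
  then have "inv \<sigma> permutes {..<r + 1}"
    by (auto simp: shuffles_perm_def intro!: permutes_inv)
  moreover have "mu_pow p \<in> exprs p 0" "mu_pow (r + 1 - p + 1) \<in> exprs (r + 1 - p + 1) 0"
    using p by (auto intro!: mu_pow_exprs)
  ultimately show "basis_elt (EAct (EComp (mu_pow (r + 1 - p + 1)) 0 (EComp (EI n) 0 (mu_pow p)))
      (inv \<sigma>)) \<in> fexprs (r + 1) (- 2 * int n)"
    using n p by (auto simp: exprs_def)
qed

lemma ecbv_null_fexprs: "ecbv_null n k x \<Longrightarrow> x \<in> fexprs n k"
proof (induction rule: ecbv_null.induct)
  case (comp_left n k x t m l i)
  then show ?case using expr_comp_fexprs basis_in_fexprs by blast
next
  case (comp_right n k x s m l i)
  then show ?case using expr_comp_fexprs basis_in_fexprs by blast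
next
  case (equivariance s m k t n l i \<sigma> \<tau>)
  have "\<sigma> i < m" using equivariance(3) permutes_in_image[OF equivariance(4)] by auto
  then show ?case
    using equivariance block_perm_permutes[OF equivariance(3-5)]
    by (intro subspace_diff subspace_fexprs) (auto simp: exprs_def)
next
  case (act_act t n k \<sigma> \<tau>)
  then show ?case
    by (intro subspace_diff subspace_fexprs) (auto simp: exprs_def intro: permutes_compose)
next
  case (order n)
  then show ?case using order_rel_fexprs[of n "n + 1"] by simp
next
  case mu_sym
  have "Transposition.transpose 0 1 permutes {..<2::nat}" by (rule permutes_swap_id) auto
  then show ?case by (intro subspace_diff subspace_fexprs) (auto simp: exprs_def)
next
  case (exact n)
  then show ?case
    by (intro subspace_sum subspace_diff subspace_fexprs) (auto simp: exprs_def of_nat_diff)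
qed (auto intro!: subspace_add subspace_diff subspace_scale subspace_0 subspace_fexprs
      expr_perm_fexprs expr_diff_fexprs simp: exprs_def permutes_id)

lemma subspace_ideal: "subspace ecbv_ideal"
  unfolding ecbv_ideal_def by (rule subspace_span)

lemma null_in_ideal: "ecbv_null n k x \<Longrightarrow> x \<in> ecbv_ideal"
  unfolding ecbv_ideal_def by (rule span_base) auto

text \<open>Operations indexed by positions or permutations that do not fit the arity are zero.\<close>

lemma linear_zero_on_fexprs:
  assumes "linear f" "x \<in> fexprs n k" "\<And>t. t \<in> exprs n k \<Longrightarrow> f (basis_elt t) = 0"
  shows "f x = 0"
  using linear_maps_span[OF assms(1) assms(2)[unfolded fexprs_eq_span], of "{0}"] assms(3) by auto

lemma expr_comp_ideal_left:
  assumes "x \<in> ecbv_ideal" shows "expr_comp i x y \<in> ecbv_ideal"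
proof (rule linear_maps_span[OF linear_expr_comp_left assms[unfolded ecbv_ideal_def] _ subspace_ideal])
  fix z assume "z \<in> (\<Union>n k. Collect (ecbv_null n k))"
  then obtain n k where z: "ecbv_null n k z" by auto
  show "expr_comp i z y \<in> ecbv_ideal"
  proof (rule linear_maps_span[OF linear_expr_comp_right in_span_basis _ subspace_ideal])
    fix t' assume "t' \<in> basis_elt ` Poly_Mapping.keys y"
    then obtain t where t: "t' = basis_elt t" by auto
    show "expr_comp i z t' \<in> ecbv_ideal"
    proof (cases "wf_expr t \<and> i < n")
      case True
      then show ?thesis unfolding t
        by (intro null_in_ideal[OF ecbv_null.comp_left[OF z]]) (auto simp: exprs_def)
    next
      case False
      have "expr_comp i z t' = 0"
        by (rule linear_zero_on_fexprs[OF linear_expr_comp_left ecbv_null_fexprs[OF z]])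
          (use False in \<open>auto simp: t expr_comp_basis wf_basis_def exprs_def\<close>)
      then show ?thesis by (simp add: subspace_0 subspace_ideal)
    qed
  qed
qed

lemma expr_comp_ideal_right:
  assumes "y \<in> ecbv_ideal" shows "expr_comp i x y \<in> ecbv_ideal"
proof (rule linear_maps_span[OF linear_expr_comp_right assms[unfolded ecbv_ideal_def] _ subspace_ideal])
  fix z assume "z \<in> (\<Union>n k. Collect (ecbv_null n k))"
  then obtain n k where z: "ecbv_null n k z" by auto
  show "expr_comp i x z \<in> ecbv_ideal"
  proof (rule linear_maps_span[OF linear_expr_comp_left in_span_basis _ subspace_ideal])
    fix s' assume "s' \<in> basis_elt ` Poly_Mapping.keys x"
    then obtain s where s: "s' = basis_elt s" by auto
    show "expr_comp i s' z \<in> ecbv_ideal"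
    proof (cases "wf_expr s \<and> i < earity s")
      case True
      then show ?thesis unfolding s
        by (intro null_in_ideal[OF ecbv_null.comp_right[OF z]]) (auto simp: exprs_def)
    next
      case False
      have "expr_comp i s' z = 0"
        by (rule linear_zero_on_fexprs[OF linear_expr_comp_right ecbv_null_fexprs[OF z]])
          (use False in \<open>auto simp: s expr_comp_basis wf_basis_def exprs_def\<close>)
      then show ?thesis by (simp add: subspace_0 subspace_ideal)
    qed
  qed
qed

lemma expr_perm_ideal:
  assumes "x \<in> ecbv_ideal" shows "expr_perm \<sigma> x \<in> ecbv_ideal"
proof (rule linear_maps_span[OF linear_expr_perm assms[unfolded ecbv_ideal_def] _ subspace_ideal])
  fix z assume "z \<in> (\<Union>n k. Collect (ecbv_null n k))"
  then obtain n k where z: "ecbv_null n k z" by auto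
  show "expr_perm \<sigma> z \<in> ecbv_ideal"
  proof (cases "\<sigma> permutes {..<n}")
    case True
    then show ?thesis by (rule null_in_ideal[OF ecbv_null.act[OF z]])
  next
    case False
    have "expr_perm \<sigma> z = 0"
      by (rule linear_zero_on_fexprs[OF linear_expr_perm ecbv_null_fexprs[OF z]])
        (use False in \<open>auto simp: expr_perm_basis wf_basis_def exprs_def\<close>)
    then show ?thesis by (simp add: subspace_0 subspace_ideal)
  qed
qed

lemma expr_diff_ideal:
  assumes "x \<in> ecbv_ideal" shows "expr_diff x \<in> ecbv_ideal"
  by (rule linear_maps_span[OF linear_expr_diff assms[unfolded ecbv_ideal_def] _ subspace_ideal])
    (auto intro: null_in_ideal ecbv_null.diff)

quotient_type ecbv = fexpr / "\<lambda>x y. x - y \<in> ecbv_ideal"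
proof (rule equivpI)
  show "reflp (\<lambda>x y. x - y \<in> ecbv_ideal)"
    by (rule reflpI) (simp add: subspace_0 subspace_ideal)
  show "symp (\<lambda>x y. x - y \<in> ecbv_ideal)"
    by (rule sympI) (drule subspace_neg[OF subspace_ideal], simp)
  show "transp (\<lambda>x y. x - y \<in> ecbv_ideal)"
    by (rule transpI) (drule (1) subspace_add[OF subspace_ideal], simp)
qed

instantiation ecbv :: real_vector
begin

lift_definition zero_ecbv :: ecbv is 0 .

lift_definition plus_ecbv :: "ecbv \<Rightarrow> ecbv \<Rightarrow> ecbv" is "(+)"
proof -
  fix x x' y y' :: fexpr
  assume "x - x' \<in> ecbv_ideal" "y - y' \<in> ecbv_ideal"
  then have "(x - x') + (y - y') \<in> ecbv_ideal" by (rule subspace_add[OF subspace_ideal])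
  then show "x + y - (x' + y') \<in> ecbv_ideal" by (simp add: algebra_simps)
qed

lift_definition uminus_ecbv :: "ecbv \<Rightarrow> ecbv" is uminus
proof -
  fix x x' :: fexpr
  assume "x - x' \<in> ecbv_ideal"
  then have "- (x - x') \<in> ecbv_ideal" by (rule subspace_neg[OF subspace_ideal])
  then show "- x - - x' \<in> ecbv_ideal" by (simp add: algebra_simps)
qed

lift_definition minus_ecbv :: "ecbv \<Rightarrow> ecbv \<Rightarrow> ecbv" is "(-)"
proof -
  fix x x' y y' :: fexpr
  assume "x - x' \<in> ecbv_ideal" "y - y' \<in> ecbv_ideal"
  then have "(x - x') - (y - y') \<in> ecbv_ideal" by (rule subspace_diff[OF subspace_ideal])
  then show "x - y - (x' - y') \<in> ecbv_ideal" by (simp add: algebra_simps)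
qed

lift_definition scaleR_ecbv :: "real \<Rightarrow> ecbv \<Rightarrow> ecbv" is "(*\<^sub>R)"
proof -
  fix c :: real and x x' :: fexpr
  assume "x - x' \<in> ecbv_ideal"
  then have "c *\<^sub>R (x - x') \<in> ecbv_ideal" by (rule subspace_scale[OF subspace_ideal])
  then show "c *\<^sub>R x - c *\<^sub>R x' \<in> ecbv_ideal" by (simp add: scaleR_diff_right)
qed

instance
  by standard (transfer; simp add: algebra_simps subspace_0 subspace_ideal)+

end

lift_definition ecbv_comp :: "nat \<Rightarrow> ecbv \<Rightarrow> ecbv \<Rightarrow> ecbv" is expr_comp
proof -
  fix i :: nat and x x' y y' :: fexpr
  assume "x - x' \<in> ecbv_ideal" "y - y' \<in> ecbv_ideal"
  then have "expr_comp i (x - x') y + expr_comp i x' (y - y') \<in> ecbv_ideal"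
    by (intro subspace_add subspace_ideal expr_comp_ideal_left expr_comp_ideal_right)
  then show "expr_comp i x y - expr_comp i x' y' \<in> ecbv_ideal"
    by (simp add: linear_diff[OF linear_expr_comp_left] linear_diff[OF linear_expr_comp_right])
qed

lift_definition ecbv_perm :: "(nat \<Rightarrow> nat) \<Rightarrow> ecbv \<Rightarrow> ecbv" is expr_perm
  by (simp add: expr_perm_ideal linear_diff[OF linear_expr_perm, symmetric])

lift_definition ecbv_diff :: "ecbv \<Rightarrow> ecbv" is expr_diff
  by (simp add: expr_diff_ideal linear_diff[OF linear_expr_diff, symmetric])

lift_definition ecbv_class :: "expr \<Rightarrow> ecbv" is basis_elt .

definition ECBV :: "ecbv operad"
  where "ECBV =
    \<lparr> opc = (\<lambda>n k. abs_ecbv ` fexprs n k),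
      opid = ecbv_class EId,
      opcomp = (\<lambda>m k i n l. ecbv_comp i),
      opact = (\<lambda>n k. ecbv_perm),
      opdiff = (\<lambda>n k. ecbv_diff) \<rparr>"

subsection \<open>\<open>ECBV\<close> is a DG operad\<close>

lemma abs_ecbv_eq_iff: "abs_ecbv x = abs_ecbv y \<longleftrightarrow> x - y \<in> ecbv_ideal"
  using ecbv.abs_eq_iff by blast

lemma ideal_linear1:
  assumes "x \<in> fexprs n k" "linear f" "\<And>t. t \<in> exprs n k \<Longrightarrow> f (basis_elt t) \<in> ecbv_ideal"
  shows "f x \<in> ecbv_ideal"
  by (rule linear_maps_span[OF assms(2) assms(1)[unfolded fexprs_eq_span] _ subspace_ideal])
    (use assms(3) in auto)

lemma ideal_linear2:
  assumes "x \<in> fexprs m k" "y \<in> fexprs n l"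
    and "\<And>y. linear (\<lambda>x. f x y)" "\<And>x. linear (f x)"
    and "\<And>s t. s \<in> exprs m k \<Longrightarrow> t \<in> exprs n l \<Longrightarrow> f (basis_elt s) (basis_elt t) \<in> ecbv_ideal"
  shows "f x y \<in> ecbv_ideal"
  by (intro ideal_linear1[OF assms(1) assms(3)] ideal_linear1[OF assms(2) assms(4)] assms(5))

lemma ideal_linear3:
  assumes "x \<in> fexprs m k" "y \<in> fexprs n l" "z \<in> fexprs r q"
    and "\<And>y z. linear (\<lambda>x. f x y z)" "\<And>x z. linear (\<lambda>y. f x y z)" "\<And>x y. linear (f x y)"
    and "\<And>s t u. s \<in> exprs m k \<Longrightarrow> t \<in> exprs n l \<Longrightarrow> u \<in> exprs r q \<Longrightarrow>
      f (basis_elt s) (basis_elt t) (basis_elt u) \<in> ecbv_ideal"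
  shows "f x y z \<in> ecbv_ideal"
  by (intro ideal_linear2[OF assms(1,2) assms(4,5)] ideal_linear1[OF assms(3) assms(6)] assms(7))

lemmas linear_expr_intros =
  linear_compose_sub linear_compose_add linear_compose_scale_right linear_ident
  linear_compose[OF _ linear_expr_comp_left, unfolded o_def]
  linear_compose[OF _ linear_expr_comp_right, unfolded o_def]
  linear_compose[OF _ linear_expr_perm, unfolded o_def]
  linear_compose[OF _ linear_expr_diff, unfolded o_def]

lemmas expr_basis_simps = expr_comp_basis expr_perm_basis expr_diff_basis wf_basis_def

lemma lin_on_quotient:
  assumes "linear f" "\<And>x. g (abs_ecbv x) = abs_ecbv (f x)"
  shows "lin_on S g"
proof -
  have "g (X + Y) = g X + g Y" "g (c *\<^sub>R X) = c *\<^sub>R g X" for X Y c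
    by (induction X, induction Y; simp add: plus_ecbv.abs_eq scaleR_ecbv.abs_eq assms(2)
        linear_add[OF assms(1)] linear_scale[OF assms(1)])+
  then show ?thesis by (simp add: lin_on_def)
qed

lemma ecbv_axiom_unit_left: "x \<in> fexprs n k \<Longrightarrow> expr_comp 0 (basis_elt EId) x - x \<in> ecbv_ideal"
  by (erule ideal_linear1, intro linear_expr_intros)
    (auto simp: expr_basis_simps exprs_mem intro!: null_in_ideal[OF ecbv_null.unit_left])

lemma ecbv_axiom_unit_right:
  "x \<in> fexprs n k \<Longrightarrow> i < n \<Longrightarrow> expr_comp i x (basis_elt EId) - x \<in> ecbv_ideal"
  by (erule ideal_linear1, intro linear_expr_intros)
    (auto simp: expr_basis_simps exprs_mem intro!: null_in_ideal[OF ecbv_null.unit_right])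

lemma ecbv_axiom_seq:
  assumes "x \<in> fexprs m k" "y \<in> fexprs n l" "z \<in> fexprs r q" "i < m" "j < n"
  shows "expr_comp (i + j) (expr_comp i x y) z - expr_comp i x (expr_comp j y z) \<in> ecbv_ideal"
proof (rule ideal_linear3[OF assms(1-3)])
  fix s t u assume "s \<in> exprs m k" "t \<in> exprs n l" "u \<in> exprs r q"
  moreover have "i + j < m + n - 1" using assms(4,5) by linarith
  ultimately show "expr_comp (i + j) (expr_comp i (basis_elt s) (basis_elt t)) (basis_elt u)
      - expr_comp i (basis_elt s) (expr_comp j (basis_elt t) (basis_elt u)) \<in> ecbv_ideal"
    using null_in_ideal[OF ecbv_null.assoc_seq[of s m k t n l u r q i j]] assms(4,5)
    by (simp add: expr_basis_simps exprs_mem)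
qed (intro linear_expr_intros)+

lemma ecbv_axiom_par:
  assumes "x \<in> fexprs m k" "y \<in> fexprs n l" "z \<in> fexprs r q" "i < j" "j < m"
  shows "expr_comp (j + n - 1) (expr_comp i x y) z
    - sgn_pow (l * q) *\<^sub>R expr_comp i (expr_comp j x z) y \<in> ecbv_ideal"
proof (rule ideal_linear3[OF assms(1-3)])
  fix s t u assume "s \<in> exprs m k" "t \<in> exprs n l" "u \<in> exprs r q"
  moreover have "j + n - 1 < m + n - 1" "i < m + r - 1" "i < m" using assms(4,5) by linarith+
  ultimately show "expr_comp (j + n - 1) (expr_comp i (basis_elt s) (basis_elt t)) (basis_elt u)
      - sgn_pow (l * q) *\<^sub>R expr_comp i (expr_comp j (basis_elt s) (basis_elt u)) (basis_elt t)
      \<in> ecbv_ideal"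
    using null_in_ideal[OF ecbv_null.assoc_par[of s m k t n l u r q i j]] assms(4,5)
    by (simp add: expr_basis_simps exprs_mem)
qed (intro linear_expr_intros)+

lemma ecbv_axiom_perm_id: "x \<in> fexprs n k \<Longrightarrow> expr_perm id x - x \<in> ecbv_ideal"
  by (erule ideal_linear1, intro linear_expr_intros)
    (use null_in_ideal[OF ecbv_null.act_id] in \<open>simp only: expr_basis_simps exprs_mem wf_expr.simps permutes_id simp_thms if_True\<close>)

lemma ecbv_axiom_perm_perm:
  assumes "x \<in> fexprs n k" "\<sigma> permutes {..<n}" "\<tau> permutes {..<n}"
  shows "expr_perm \<tau> (expr_perm \<sigma> x) - expr_perm (\<sigma> \<circ> \<tau>) x \<in> ecbv_ideal"
proof (rule ideal_linear1[OF assms(1)])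
  fix t assume "t \<in> exprs n k"
  then show "expr_perm \<tau> (expr_perm \<sigma> (basis_elt t)) - expr_perm (\<sigma> \<circ> \<tau>) (basis_elt t) \<in> ecbv_ideal"
    using null_in_ideal[OF ecbv_null.act_act[of t n k \<sigma> \<tau>]] assms(2,3)
      permutes_compose[OF assms(3,2)]
    by (simp add: expr_basis_simps exprs_mem)
qed (intro linear_expr_intros)

lemma ecbv_axiom_equivariance:
  assumes "x \<in> fexprs m k" "y \<in> fexprs n l" "i < m" "\<sigma> permutes {..<m}" "\<tau> permutes {..<n}"
  shows "expr_comp i (expr_perm \<sigma> x) (expr_perm \<tau> y)
    - expr_perm (block_perm i n \<sigma> \<tau>) (expr_comp (\<sigma> i) x y) \<in> ecbv_ideal"
proof (rule ideal_linear2[OF assms(1-2)])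
  fix s t assume "s \<in> exprs m k" "t \<in> exprs n l"
  moreover have "\<sigma> i < m" using assms(3) permutes_in_image[OF assms(4)] by auto
  ultimately show "expr_comp i (expr_perm \<sigma> (basis_elt s)) (expr_perm \<tau> (basis_elt t))
      - expr_perm (block_perm i n \<sigma> \<tau>) (expr_comp (\<sigma> i) (basis_elt s) (basis_elt t)) \<in> ecbv_ideal"
    using null_in_ideal[OF ecbv_null.equivariance[of s m k t n l i \<sigma> \<tau>]] assms(3-5)
      block_perm_permutes[OF assms(3-5)]
    by (simp add: expr_basis_simps exprs_mem)
qed (intro linear_expr_intros)+

lemma ecbv_axiom_diff_diff: "x \<in> fexprs n k \<Longrightarrow> expr_diff (expr_diff x) \<in> ecbv_ideal"
  by (erule ideal_linear1, intro linear_expr_intros)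
    (auto simp: expr_basis_simps exprs_mem intro!: null_in_ideal[OF ecbv_null.diff_diff])

lemma ecbv_axiom_diff_perm:
  "x \<in> fexprs n k \<Longrightarrow> \<sigma> permutes {..<n} \<Longrightarrow>
    expr_diff (expr_perm \<sigma> x) - expr_perm \<sigma> (expr_diff x) \<in> ecbv_ideal"
  by (erule ideal_linear1, intro linear_expr_intros)
    (auto simp: expr_basis_simps exprs_mem intro!: null_in_ideal[OF ecbv_null.diff_act])

lemma ecbv_axiom_diff_comp:
  assumes "x \<in> fexprs m k" "y \<in> fexprs n l" "i < m"
  shows "expr_diff (expr_comp i x y)
    - (expr_comp i (expr_diff x) y + sgn_pow k *\<^sub>R expr_comp i x (expr_diff y)) \<in> ecbv_ideal"
proof (rule ideal_linear2[OF assms(1-2)])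
  fix s t assume "s \<in> exprs m k" "t \<in> exprs n l"
  then show "expr_diff (expr_comp i (basis_elt s) (basis_elt t))
      - (expr_comp i (expr_diff (basis_elt s)) (basis_elt t)
        + sgn_pow k *\<^sub>R expr_comp i (basis_elt s) (expr_diff (basis_elt t))) \<in> ecbv_ideal"
    using null_in_ideal[OF ecbv_null.diff_comp[of s m k t n l i]] assms(3)
    by (simp add: expr_basis_simps exprs_mem)
qed (intro linear_expr_intros)+

lemma dg_operad_ECBV: "dg_operad ECBV"
proof -
  note abs = ecbv_comp.abs_eq ecbv_perm.abs_eq ecbv_diff.abs_eq ecbv_class.abs_eq
    plus_ecbv.abs_eq scaleR_ecbv.abs_eq
  have sub: "subspace (abs_ecbv ` fexprs n k)" for n k
    using subspace_fexprs[of n k]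
    unfolding subspace_def zero_ecbv_def
    by (auto simp: plus_ecbv.abs_eq scaleR_ecbv.abs_eq)
  have lin: "lin_on S (\<lambda>y. ecbv_comp i x y)" "lin_on S (\<lambda>x. ecbv_comp i x y)"
    "lin_on S (ecbv_perm \<sigma>)" "lin_on S ecbv_diff" for S i x y \<sigma>
    subgoal by (induction x) (rule lin_on_quotient[OF linear_expr_comp_right ecbv_comp.abs_eq])
    subgoal by (induction y) (rule lin_on_quotient[OF linear_expr_comp_left ecbv_comp.abs_eq])
    subgoal by (rule lin_on_quotient[OF linear_expr_perm ecbv_perm.abs_eq])
    subgoal by (rule lin_on_quotient[OF linear_expr_diff ecbv_diff.abs_eq])
    done
  show ?thesis
    unfolding dg_operad_def ECBV_def operad.simps
    apply (intro conjI allI impI ballI; (elim imageE conjE)?; (hypsubst)?; (simp only: abs abs_ecbv_eq_iff)?)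
    apply (simp_all only: sub lin)
    subgoal by (intro imageI) (simp add: exprs_mem)
    subgoal by (intro imageI expr_comp_fexprs)
    subgoal by (rule ecbv_axiom_unit_left)
    subgoal by (rule ecbv_axiom_unit_right)
    subgoal by (rule ecbv_axiom_seq)
    subgoal by (rule ecbv_axiom_par)
    subgoal by (auto simp: ecbv_perm.abs_eq intro: expr_perm_fexprs)
    subgoal by (rule ecbv_axiom_perm_id)
    subgoal by (rule ecbv_axiom_perm_perm)
    subgoal by (rule ecbv_axiom_equivariance)
    subgoal by (auto simp: ecbv_diff.abs_eq intro: expr_diff_fexprs)
    subgoal by (simp only: zero_ecbv_def abs_ecbv_eq_iff) (simp add: ecbv_axiom_diff_diff)
    subgoal by (rule ecbv_axiom_diff_perm)
    subgoal by (rule ecbv_axiom_diff_comp)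
    done
qed

subsection \<open>Algebras over \<open>ECBV\<close>\<close>

text \<open>An \<open>ECBV\<close>-algebra structure on the complex \<open>(V, d)\<close> whose product is \<open>mul\<close>
  and whose \<open>n\<close>-th operator is \<open>i n\<close>.\<close>

definition ecbv_algebra :: "int \<Rightarrow> (int \<Rightarrow> 'v::real_vector set) \<Rightarrow> ('v \<Rightarrow> 'v)
    \<Rightarrow> ('v \<Rightarrow> 'v \<Rightarrow> 'v) \<Rightarrow> (nat \<Rightarrow> 'v \<Rightarrow> 'v) \<Rightarrow> ('v, ecbv) op_algebra \<Rightarrow> bool"
  where "ecbv_algebra m V d mul i A \<longleftrightarrow>
    operad_algebra m ECBV A \<and> cx A = V \<and> cdiff A = d \<and>
    act A 2 0 (ecbv_class EMu) = binary_op V mul \<and>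
    (\<forall>n\<ge>1. act A 1 (- 2 * int n) (ecbv_class (EI n)) = unary_op V (i n))"


section \<open>Graded manifolds and supermanifolds\<close>

record 'a graded_alg =
  gcar :: "int \<Rightarrow> 'a set"
  gmul :: "'a \<Rightarrow> 'a \<Rightarrow> 'a"
  gone :: 'a

definition graded_comm_alg :: "int \<Rightarrow> 'a::real_vector graded_alg \<Rightarrow> bool"
  where "graded_comm_alg m A \<longleftrightarrow>
    graded_space m (gcar A) \<and> gone A \<in> gcar A 0 \<and>
    (\<forall>j k. \<forall>x\<in>gcar A j. \<forall>y\<in>gcar A k.
      gmul A x y \<in> gcar A (j + k) \<and> gmul A x y = sgn_pow (j * k) *\<^sub>R gmul A y x) \<and>
    (\<forall>k. \<forall>x\<in>homog (gcar A). lin_on (gcar A k) (gmul A x)) \<and>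
    (\<forall>x\<in>homog (gcar A). \<forall>y\<in>homog (gcar A). \<forall>z\<in>homog (gcar A).
      gmul A (gmul A x y) z = gmul A x (gmul A y z)) \<and>
    (\<forall>x\<in>homog (gcar A). gmul A (gone A) x = x)"

definition graded_alg_hom ::
    "'a::real_vector graded_alg \<Rightarrow> 'b::real_vector graded_alg \<Rightarrow> ('a \<Rightarrow> 'b) \<Rightarrow> bool"
  where "graded_alg_hom A B f \<longleftrightarrow>
    (\<forall>k. f ` gcar A k \<subseteq> gcar B k \<and> lin_on (gcar A k) f) \<and> f (gone A) = gone B \<and>
    (\<forall>x\<in>homog (gcar A). \<forall>y\<in>homog (gcar A). f (gmul A x y) = gmul B (f x) (f y))"

definition graded_alg_iso ::
    "'a::real_vector graded_alg \<Rightarrow> 'b::real_vector graded_alg \<Rightarrow> ('a \<Rightarrow> 'b) \<Rightarrow> bool"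
  where "graded_alg_iso A B f \<longleftrightarrow>
    graded_alg_hom A B f \<and> (\<forall>k. bij_betw f (gcar A k) (gcar B k))"

subsection \<open>Local models\<close>

text \<open>\<open>R\<^sup>p\<close> is realised inside the space of all real sequences in order to allow any
  dimension \<open>p \<ge> 0\<close>; the subspace topology is the Euclidean one.\<close>

definition Rspace :: "nat \<Rightarrow> (nat \<Rightarrow> real) set"
  where "Rspace p = {x. \<forall>i\<ge>p. x i = 0}"

text \<open>Infinitely differentiable: all iterated partial derivatives exist and are continuous.\<close>

coinductive smooth_fun :: "nat \<Rightarrow> (nat \<Rightarrow> real) set \<Rightarrow> ((nat \<Rightarrow> real) \<Rightarrow> real) \<Rightarrow> bool"
  for p U where
  "continuous_on U f \<Longrightarrow>
   (\<forall>i<p. \<exists>g. (\<forall>x\<in>U. ((\<lambda>t. f (x(i := t))) has_real_derivative g x) (at (x i))) \<and> smooth_fun p U g) \<Longrightarrow>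
   smooth_fun p U f"

text \<open>The model algebra over an open set \<open>U\<close> of \<open>R\<^sup>p\<close> with graded coordinates
  \<open>\<xi>\<^sub>0, \<dots>, \<xi>\<^bsub>q-1\<^esub>\<close> of degrees \<open>w 0, \<dots>, w (q - 1)\<close>: formal power series
  \<open>\<Sum>\<^sub>\<nu> F \<nu> \<xi>\<^sup>\<nu>\<close> whose coefficients are smooth functions on \<open>U\<close> (extended by zero), where
  \<open>\<xi>\<^sup>\<nu> = \<xi>\<^sub>0\<^bsup>\<nu>(0)\<^esup> \<cdots> \<xi>\<^bsub>q-1\<^esub>\<^bsup>\<nu>(q-1)\<^esup>\<close> and coordinates of odd degree square to zero.\<close>

definition model_exponents :: "nat \<Rightarrow> (nat \<Rightarrow> int) \<Rightarrow> (nat \<Rightarrow> nat) set"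
  where "model_exponents q w = {\<nu>. (\<forall>j\<ge>q. \<nu> j = 0) \<and> (\<forall>j<q. odd (w j) \<longrightarrow> \<nu> j \<le> 1)}"

definition model_alg :: "int \<Rightarrow> nat \<Rightarrow> nat \<Rightarrow> (nat \<Rightarrow> int) \<Rightarrow> (nat \<Rightarrow> real) set
    \<Rightarrow> ((nat \<Rightarrow> nat) \<Rightarrow> (nat \<Rightarrow> real) \<Rightarrow> real) graded_alg"
  where "model_alg m p q w U =
    \<lparr> gcar = (\<lambda>k. {F. \<forall>\<nu>. smooth_fun p U (F \<nu>) \<and> (\<forall>x. x \<notin> U \<longrightarrow> F \<nu> x = 0) \<and>
        (F \<nu> \<noteq> 0 \<longrightarrow> \<nu> \<in> model_exponents q w \<and> (\<Sum>j<q. int (\<nu> j) * w j) mod m = k mod m)}),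
      gmul = (\<lambda>F G \<nu> x. if \<nu> \<in> model_exponents q w
        then \<Sum>\<alpha> | \<forall>j. \<alpha> j \<le> \<nu> j.
          sgn_pow (\<Sum>i<q. \<Sum>j<i. int (\<alpha> i) * w i * (int (\<nu> j - \<alpha> j) * w j)) *
          F \<alpha> x * G (\<lambda>j. \<nu> j - \<alpha> j) x
        else 0),
      gone = (\<lambda>\<nu> x. if \<nu> = (\<lambda>_. 0) \<and> x \<in> U then 1 else 0) \<rparr>"

definition model_restrict :: "(nat \<Rightarrow> real) set
    \<Rightarrow> ((nat \<Rightarrow> nat) \<Rightarrow> (nat \<Rightarrow> real) \<Rightarrow> real) \<Rightarrow> (nat \<Rightarrow> nat) \<Rightarrow> (nat \<Rightarrow> real) \<Rightarrow> real"
  where "model_restrict V F = (\<lambda>\<nu> x. if x \<in> V then F \<nu> x else 0)"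

subsection \<open>Ringed spaces\<close>

record ('x, 'a) graded_ringed_space =
  body :: "'x topology"
  sections :: "'x set \<Rightarrow> 'a graded_alg"
  restr :: "'x set \<Rightarrow> 'x set \<Rightarrow> 'a \<Rightarrow> 'a"  \<comment> \<open>\<open>restr U V\<close> restricts from \<open>U\<close> to \<open>V \<subseteq> U\<close>\<close>

definition sheaf_of_algebras ::
    "int \<Rightarrow> ('x, 'a::real_vector) graded_ringed_space \<Rightarrow> bool"
  where "sheaf_of_algebras m M \<longleftrightarrow>
    (\<forall>U. openin (body M) U \<longrightarrow> graded_comm_alg m (sections M U)) \<and>
    (\<forall>U V. openin (body M) U \<and> openin (body M) V \<and> V \<subseteq> U \<longrightarrow>
      graded_alg_hom (sections M U) (sections M V) (restr M U V)) \<and>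
    (\<forall>U. openin (body M) U \<longrightarrow> (\<forall>s\<in>homog (gcar (sections M U)). restr M U U s = s)) \<and>
    (\<forall>U V W. openin (body M) U \<and> openin (body M) V \<and> openin (body M) W \<and> W \<subseteq> V \<and> V \<subseteq> U \<longrightarrow>
      (\<forall>s\<in>homog (gcar (sections M U)). restr M V W (restr M U V s) = restr M U W s)) \<and>
    (\<forall>\<U> k s. (\<forall>U\<in>\<U>. openin (body M) U \<and> s U \<in> gcar (sections M U) k) \<and>
        (\<forall>U\<in>\<U>. \<forall>V\<in>\<U>. restr M U (U \<inter> V) (s U) = restr M V (U \<inter> V) (s V)) \<longrightarrow>
      (\<exists>!t. t \<in> gcar (sections M (\<Union>\<U>)) k \<and> (\<forall>U\<in>\<U>. restr M (\<Union>\<U>) U t = s U)))"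

definition locally_modelled :: "int \<Rightarrow> nat \<Rightarrow> nat \<Rightarrow> (nat \<Rightarrow> int)
    \<Rightarrow> ('x, 'a::real_vector) graded_ringed_space \<Rightarrow> bool"
  where "locally_modelled m p q w M \<longleftrightarrow>
    (\<forall>x\<in>topspace (body M). \<exists>U W h \<psi>.
      openin (body M) U \<and> x \<in> U \<and> openin (top_of_set (Rspace p)) W \<and>
      homeomorphic_map (subtopology (body M) U) (top_of_set W) h \<and>
      (\<forall>V. openin (body M) V \<and> V \<subseteq> U \<longrightarrow>
        graded_alg_iso (sections M V) (model_alg m p q w (h ` V)) (\<psi> V)) \<and>
      (\<forall>V V'. openin (body M) V \<and> openin (body M) V' \<and> V' \<subseteq> V \<and> V \<subseteq> U \<longrightarrow>
        (\<forall>s\<in>homog (gcar (sections M V)).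
          \<psi> V' (restr M V V' s) = model_restrict (h ` V') (\<psi> V s))))"

definition graded_manifold :: "('x, 'a::real_vector) graded_ringed_space \<Rightarrow> bool"
  where "graded_manifold M \<longleftrightarrow>
    Hausdorff_space (body M) \<and> second_countable (body M) \<and> sheaf_of_algebras 0 M \<and>
    (\<exists>p q w. (\<forall>j<q. w j \<noteq> 0) \<and> locally_modelled 0 p q w M)"

definition supermanifold :: "('x, 'a::real_vector) graded_ringed_space \<Rightarrow> bool"
  where "supermanifold M \<longleftrightarrow>
    Hausdorff_space (body M) \<and> second_countable (body M) \<and> sheaf_of_algebras 2 M \<and>
    (\<exists>p q. locally_modelled 2 p q (\<lambda>_. 1) M)"

definition global_functions :: "('x, 'a) graded_ringed_space \<Rightarrow> 'a graded_alg"
  where "global_functions M = sections M (topspace (body M))"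


section \<open>Cartan calculus\<close>

text \<open>By the existence of partitions of unity, vector fields, differential forms and
  polyvector fields on a manifold \<open>M\<close> are determined by the algebra \<open>A\<close> of global
  functions. Vector fields are the derivations of \<open>A\<close>.\<close>

definition vector_fields :: "'a::real_vector graded_alg \<Rightarrow> int \<Rightarrow> ('a \<Rightarrow> 'a) set"
  where "vector_fields A k = {X.
    (\<forall>j. X ` gcar A j \<subseteq> gcar A (j + k) \<and> lin_on (gcar A j) X) \<and>
    (\<forall>j. \<forall>a\<in>gcar A j. \<forall>b\<in>homog (gcar A).
      X (gmul A a b) = gmul A (X a) b + sgn_pow (k * j) *\<^sub>R gmul A a (X b)) \<and>
    (\<forall>a. a \<notin> homog (gcar A) \<longrightarrow> X a = 0)}"

abbreviation vdeg :: "'a::real_vector graded_alg \<Rightarrow> ('a \<Rightarrow> 'a) \<Rightarrow> int"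
  where "vdeg A \<equiv> gdeg (vector_fields A)"

definition vf_scale :: "'a graded_alg \<Rightarrow> 'a \<Rightarrow> ('a \<Rightarrow> 'a) \<Rightarrow> 'a \<Rightarrow> 'a"
  where "vf_scale A f X = (\<lambda>a. gmul A f (X a))"

definition vf_bracket :: "'a::real_vector graded_alg \<Rightarrow> ('a \<Rightarrow> 'a) \<Rightarrow> ('a \<Rightarrow> 'a) \<Rightarrow> 'a \<Rightarrow> 'a"
  where "vf_bracket A X Y = (\<lambda>a. X (Y a) - sgn_pow (vdeg A X * vdeg A Y) *\<^sub>R Y (X a))"

subsection \<open>Differential forms\<close>

text \<open>A form \<open>\<omega>\<close> is given by its values on lists of homogeneous vector fields; its
  component of form degree \<open>r\<close> is its restriction to lists of length \<open>r\<close>, and only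
  finitely many components are nonzero. The contraction \<open>\<iota> X\<close> inserts \<open>X\<close> in front,
  so \<open>\<omega> [X\<^sub>1, \<dots>, X\<^sub>r] = \<iota> X\<^sub>r (\<cdots> (\<iota> X\<^sub>1 \<omega>))\<close>. Forms are graded by total degree and
  \<open>\<iota> X\<close> has degree \<open>|X| - 1\<close>, which determines all signs: the \<open>\<iota> X\<close> commute in the
  graded sense, and \<open>\<omega>\<close> is linear over functions, without sign, in the last argument.\<close>

type_synonym 'a form = "('a \<Rightarrow> 'a) list \<Rightarrow> 'a"

definition contract :: "('a \<Rightarrow> 'a) \<Rightarrow> 'a form \<Rightarrow> 'a form"
  where "contract X \<omega> = (\<lambda>Xs. \<omega> (X # Xs))"

definition forms :: "'a::real_vector graded_alg \<Rightarrow> int \<Rightarrow> 'a form set"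
  where "forms A k = {\<omega>.
    (\<exists>N. \<forall>Xs. N < length Xs \<longrightarrow> \<omega> Xs = 0) \<and>
    (\<forall>Xs. \<not> set Xs \<subseteq> homog (vector_fields A) \<longrightarrow> \<omega> Xs = 0) \<and>
    (\<forall>Xs js. list_all2 (\<lambda>X j. X \<in> vector_fields A j) Xs js \<longrightarrow>
      \<omega> Xs \<in> gcar A (k + (\<Sum>j\<leftarrow>js. j - 1))) \<and>
    (\<forall>Us Vs j. set Us \<subseteq> homog (vector_fields A) \<and> set Vs \<subseteq> homog (vector_fields A) \<longrightarrow>
      lin_on (vector_fields A j) (\<lambda>X. \<omega> (Us @ [X] @ Vs))) \<and>
    (\<forall>Us Vs i j. set Us \<subseteq> homog (vector_fields A) \<and> set Vs \<subseteq> homog (vector_fields A) \<longrightarrow>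
      (\<forall>X\<in>vector_fields A i. \<forall>Y\<in>vector_fields A j.
        \<omega> (Us @ [X, Y] @ Vs) = sgn_pow ((i - 1) * (j - 1)) *\<^sub>R \<omega> (Us @ [Y, X] @ Vs))) \<and>
    (\<forall>Us. set Us \<subseteq> homog (vector_fields A) \<longrightarrow>
      (\<forall>f\<in>homog (gcar A). \<forall>X\<in>homog (vector_fields A).
        \<omega> (Us @ [vf_scale A f X]) = gmul A f (\<omega> (Us @ [X]))))}"

definition on_fields :: "'a::real_vector graded_alg \<Rightarrow> 'a form \<Rightarrow> 'a form"
  where "on_fields A \<omega> = (\<lambda>Xs. if set Xs \<subseteq> homog (vector_fields A) then \<omega> Xs else 0)"

text \<open>The exterior product is the one for which contractions are derivations:
  \<open>\<iota> X (\<alpha> \<and> \<beta>) = \<iota> X \<alpha> \<and> \<beta> + (- 1)\<^bsup>(|X| - 1) |\<alpha>|\<^esup> \<alpha> \<and> \<iota> X \<beta>\<close>. Unfolding the recursion gives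
  the usual sum over shuffles. In \<open>wedge_rec\<close>, the number \<open>a\<close> is the degree of
  \<open>\<alpha>\<close>.\<close>

primrec wedge_rec ::
    "'a::real_vector graded_alg \<Rightarrow> ('a \<Rightarrow> 'a) list \<Rightarrow> int \<Rightarrow> 'a form \<Rightarrow> 'a form \<Rightarrow> 'a" where
  "wedge_rec A [] a \<alpha> \<beta> = gmul A (\<alpha> []) (\<beta> [])"
| "wedge_rec A (X # Xs) a \<alpha> \<beta> =
    wedge_rec A Xs (a + vdeg A X - 1) (contract X \<alpha>) \<beta> +
    sgn_pow ((vdeg A X - 1) * a) *\<^sub>R wedge_rec A Xs a \<alpha> (contract X \<beta>)"

definition wedge :: "'a::real_vector graded_alg \<Rightarrow> 'a form \<Rightarrow> 'a form \<Rightarrow> 'a form"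
  where "wedge A \<alpha> \<beta> = on_fields A (\<lambda>Xs. wedge_rec A Xs (gdeg (forms A) \<alpha>) \<alpha> \<beta>)"

text \<open>The Lie derivative is determined by \<open>L X f = X f\<close> on functions and
  \<open>[L X, \<iota> Y] = \<iota> [X, Y]\<close>, the exterior derivative by Cartan's formula \<open>[\<iota> X, d] = L X\<close>,
  where the brackets are graded commutators. Unfolding the recursion gives the usual global formula
  for the exterior derivative.\<close>

primrec lie_rec :: "'a::real_vector graded_alg \<Rightarrow> ('a \<Rightarrow> 'a) \<Rightarrow> ('a \<Rightarrow> 'a) list \<Rightarrow> 'a form \<Rightarrow> 'a" where
  "lie_rec A X [] \<omega> = X (\<omega> [])"
| "lie_rec A X (Y # Ys) \<omega> = sgn_pow (vdeg A X * (vdeg A Y - 1)) *\<^sub>R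
    (lie_rec A X Ys (contract Y \<omega>) - \<omega> (vf_bracket A X Y # Ys))"

primrec ext_deriv_rec :: "'a::real_vector graded_alg \<Rightarrow> ('a \<Rightarrow> 'a) list \<Rightarrow> 'a form \<Rightarrow> 'a" where
  "ext_deriv_rec A [] \<omega> = 0"
| "ext_deriv_rec A (X # Xs) \<omega> =
    lie_rec A X Xs \<omega> + sgn_pow (vdeg A X - 1) *\<^sub>R ext_deriv_rec A Xs (contract X \<omega>)"

definition ext_deriv :: "'a::real_vector graded_alg \<Rightarrow> 'a form \<Rightarrow> 'a form"
  where "ext_deriv A \<omega> = on_fields A (\<lambda>Xs. ext_deriv_rec A Xs \<omega>)"

subsection \<open>Polyvector fields\<close>

text \<open>Polyvector fields form the graded symmetric algebra over \<open>A\<close> of the module of vector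
  fields, a vector field \<open>X\<close> being placed in degree \<open>|X| - 1\<close>. They are represented by
  formal linear combinations of lists of vector fields, the list \<open>[X\<^sub>1, \<dots>, X\<^sub>r]\<close> standing
  for the product \<open>X\<^sub>1 \<cdots> X\<^sub>r\<close>, to be read modulo the subspace \<open>polyvector_null\<close>.\<close>

type_synonym 'a polyvector = "('a \<Rightarrow> 'a) list \<Rightarrow>\<^sub>0 real"

definition polyvectors :: "'a::real_vector graded_alg \<Rightarrow> nat \<Rightarrow> int \<Rightarrow> 'a polyvector set"
  where "polyvectors A r k = span {basis_elt Xs | Xs js.
    list_all2 (\<lambda>X j. X \<in> vector_fields A j) Xs js \<and> length Xs = r \<and> (\<Sum>j\<leftarrow>js. j - 1) = k}"

inductive_set polyvector_relators :: "'a::real_vector graded_alg \<Rightarrow> 'a polyvector set"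
  for A where
  add: "set Us \<subseteq> homog (vector_fields A) \<Longrightarrow> set Vs \<subseteq> homog (vector_fields A) \<Longrightarrow>
    X \<in> vector_fields A j \<Longrightarrow> Y \<in> vector_fields A j \<Longrightarrow>
    basis_elt (Us @ [X + Y] @ Vs) - basis_elt (Us @ [X] @ Vs) - basis_elt (Us @ [Y] @ Vs)
      \<in> polyvector_relators A"
| scale: "set Us \<subseteq> homog (vector_fields A) \<Longrightarrow> set Vs \<subseteq> homog (vector_fields A) \<Longrightarrow>
    X \<in> vector_fields A j \<Longrightarrow>
    basis_elt (Us @ [c *\<^sub>R X] @ Vs) - c *\<^sub>R basis_elt (Us @ [X] @ Vs) \<in> polyvector_relators A"
| commute: "set Us \<subseteq> homog (vector_fields A) \<Longrightarrow> set Vs \<subseteq> homog (vector_fields A) \<Longrightarrow>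
    X \<in> vector_fields A i \<Longrightarrow> Y \<in> vector_fields A j \<Longrightarrow>
    basis_elt (Us @ [X, Y] @ Vs) - sgn_pow ((i - 1) * (j - 1)) *\<^sub>R basis_elt (Us @ [Y, X] @ Vs)
      \<in> polyvector_relators A"
| balance: "set Us \<subseteq> homog (vector_fields A) \<Longrightarrow> set Vs \<subseteq> homog (vector_fields A) \<Longrightarrow>
    X \<in> vector_fields A i \<Longrightarrow> Y \<in> homog (vector_fields A) \<Longrightarrow> f \<in> gcar A l \<Longrightarrow>
    basis_elt (Us @ [X, vf_scale A f Y] @ Vs)
      - sgn_pow ((i - 1) * l) *\<^sub>R basis_elt (Us @ [vf_scale A f X, Y] @ Vs)
      \<in> polyvector_relators A"

definition polyvector_null :: "'a::real_vector graded_alg \<Rightarrow> 'a polyvector set"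
  where "polyvector_null A = span (polyvector_relators A)"

text \<open>The Schouten--Nijenhuis bracket is the biderivation, of degree 1, that extends the bracket of
  vector fields. With \<open>|X|' = |X| - 1\<close>, the product rules are
  \<open>[X, QR] = [X, Q] R + (- 1)\<^bsup>|X| |Q|'\<^esup> Q [X, R]\<close> and
  \<open>[PY, Q] = P [Y, Q] + (- 1)\<^bsup>|Y|' (|Q|' + 1)\<^esup> [P, Q] Y\<close>.\<close>

definition schouten_basis ::
    "'a::real_vector graded_alg \<Rightarrow> ('a \<Rightarrow> 'a) list \<Rightarrow> ('a \<Rightarrow> 'a) list \<Rightarrow> 'a polyvector"
  where "schouten_basis A Xs Ys = (\<Sum>i<length Xs. \<Sum>j<length Ys.
    sgn_pow (vdeg A (Xs ! i) * (\<Sum>Y\<leftarrow>take j Ys. vdeg A Y - 1) +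
             (\<Sum>X\<leftarrow>drop (Suc i) Xs. vdeg A X - 1) * ((\<Sum>Y\<leftarrow>Ys. vdeg A Y - 1) + 1)) *\<^sub>R
    basis_elt (take i Xs @ take j Ys @ [vf_bracket A (Xs ! i) (Ys ! j)] @
               drop (Suc j) Ys @ drop (Suc i) Xs))"

definition schouten :: "'a::real_vector graded_alg \<Rightarrow> 'a polyvector \<Rightarrow> 'a polyvector \<Rightarrow> 'a polyvector"
  where "schouten A P Q = linext (\<lambda>Xs. linext (\<lambda>Ys. schouten_basis A Xs Ys) Q) P"

text \<open>The interior product by \<open>X\<^sub>1 \<cdots> X\<^sub>r\<close> is \<open>\<iota> X\<^sub>1 \<circ> \<cdots> \<circ> \<iota> X\<^sub>r\<close>.\<close>

definition interior_product :: "'a::real_vector polyvector \<Rightarrow> 'a form \<Rightarrow> 'a form"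
  where "interior_product P \<omega> = linext (\<lambda>Xs. foldr contract Xs \<omega>) P"

text \<open>\<open>P = P\<^sub>1 + P\<^sub>2 + \<cdots>\<close> with \<open>P\<^sub>n\<close> of polyvector degree \<open>n + 1\<close> and total degree
  \<open>- 2 n\<close> (that is, even, in the case of supermanifolds). The equation \<open>[P, P] = 0\<close> is imposed
  in each polyvector degree \<open>n + 1\<close>.\<close>

definition generalized_poisson :: "'a::real_vector graded_alg \<Rightarrow> (nat \<Rightarrow> 'a polyvector) \<Rightarrow> bool"
  where "generalized_poisson A P \<longleftrightarrow>
    (\<forall>n\<ge>1. P n \<in> polyvectors A (n + 1) (- 2 * int n)) \<and>
    (\<forall>n\<ge>2. (\<Sum>j = 1..n - 1. schouten A (P j) (P (n - j))) \<in> polyvector_null A)"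

definition de_rham_ecbv_algebra :: "int \<Rightarrow> ('x, 'a::real_vector) graded_ringed_space
    \<Rightarrow> (nat \<Rightarrow> 'a polyvector) \<Rightarrow> ('a form, ecbv) op_algebra \<Rightarrow> bool"
  where "de_rham_ecbv_algebra m M P \<Omega> \<longleftrightarrow>
    ecbv_algebra m (forms (global_functions M)) (ext_deriv (global_functions M))
      (wedge (global_functions M)) (\<lambda>n. interior_product (P n)) \<Omega>"

end

theory Submission
  imports Defs
begin

text \<open>The operators \<open>i\<^sub>n\<close> can be switched off along a path. Let \<open>A\<close> be a commutative DG
  algebra with operators \<open>i\<^sub>n\<close> as in the definition of the operad. The relations are
  homogeneous if \<open>i\<^sub>n\<close> has weight \<open>n\<close>, so the operators \<open>c\<^sup>n i\<^sub>n\<close> satisfy them for every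
  number \<open>c\<close>; for \<open>c = 1\<close> this is the given structure and for \<open>c = 0\<close> all operators vanish.
  These structures are the fibres of a single one on the algebra \<open>A[t, dt]\<close> of polynomial
  paths, with the operators \<open>t\<^sup>n i\<^sub>n\<close> (\<open>ecbv_calg_paths\<close>): the differential now also
  differentiates \<open>t\<^sup>n\<close>, but the summand of \<open>[d, t\<^sup>n i\<^sub>n]\<close> that arises in this way is
  \<open>n t\<^bsup>n-1\<^esup> dt i\<^sub>n\<close> up to sign. It commutes with every \<open>t\<^sup>j i\<^sub>j\<close> and disappears from the
  double commutators. The evaluations at \<open>t = 1\<close> and \<open>t = 0\<close> are morphisms, and integration along \<open>t\<close>
  shows that they are quasi-isomorphisms (\<open>quasi_iso_eval_at\<close>). They form a zig-zag between
  \<open>A\<close> and \<open>A\<close> with vanishing operators, and it remains one after restriction of scalars.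

  With vanishing operators, restriction of scalars gives the trivial structure. For degree
  reasons an operation of degree 0 acts in the same way whether or not the operators vanish,
  and an operation of any other degree acts by zero once they vanish (\<open>weight_zero_part\<close>).

  Two preparations are needed. First, the operad is given by generators and relations, so an
  algebra over it amounts to elements of an endomorphism operad that satisfy the relations.
  This uses that endomorphism operads are DG operads (\<open>dg_operad_End\<close>), the universal property
  of the presentation (\<open>operad_morphism_induced\<close>), and a reformulation of the condition on the
  order by iterated commutators with multiplication operators (\<open>order_relation\<close>). Second, the
  forms on \<open>M\<close> have to be shown to be such an algebra (\<open>ecbv_calg_forms\<close>). A contraction is a
  derivation, so interior products are differential operators of the required order, and the
  relation on double commutators is the Poisson equation because the bracket of \<open>[i\<^sub>P, d]\<close>
  with \<open>i\<^sub>Q\<close> is the interior product by the Schouten bracket (\<open>interior_schouten\<close>).\<close>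

section \<open>Signs and graded vector spaces\<close>

lemma sgn_pow_0 [simp]: "sgn_pow 0 = 1"
  by (simp add: sgn_pow_def)

lemma sgn_pow_add: "sgn_pow (k + l) = sgn_pow k * sgn_pow l"
  by (simp add: sgn_pow_def)

lemma sgn_pow_eqI: "(even k \<longleftrightarrow> even l) \<Longrightarrow> sgn_pow k = sgn_pow l"
  by (simp add: sgn_pow_def)

lemma sgn_pow_square [simp]: "sgn_pow k * sgn_pow k = 1"
  by (simp add: sgn_pow_def)

lemma sgn_pow_scaleR_twice [simp]: "sgn_pow k *\<^sub>R sgn_pow k *\<^sub>R x = (x :: 'v::real_vector)"
  by (simp add: sgn_pow_def)

lemma lin_on_add: "lin_on S f \<Longrightarrow> x \<in> S \<Longrightarrow> y \<in> S \<Longrightarrow> f (x + y) = f x + f y"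
  by (simp add: lin_on_def)

lemma lin_on_scale: "lin_on S f \<Longrightarrow> x \<in> S \<Longrightarrow> f (c *\<^sub>R x) = c *\<^sub>R f x"
  by (simp add: lin_on_def)

lemma lin_on_zero: "lin_on S f \<Longrightarrow> 0 \<in> S \<Longrightarrow> f 0 = 0"
  using lin_on_scale[of S f 0 0] by simp

lemma lin_on_diff:
  assumes "lin_on S f" "subspace S" "x \<in> S" "y \<in> S"
  shows "f (x - y) = f x - f y"
  using lin_on_add[OF assms(1,3) subspace_scale[OF assms(2,4), of "-1"]] lin_on_scale[OF assms(1,4), of "-1"]
  by simp

lemma lin_on_sum:
  assumes "lin_on S f" "subspace S" "\<And>i. i \<in> I \<Longrightarrow> x i \<in> S"
  shows "f (\<Sum>i\<in>I. x i) = (\<Sum>i\<in>I. f (x i))"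
  using assms(3)
proof (induction I rule: infinite_finite_induct)
  case (insert i I)
  then show ?case
    using lin_on_add[OF assms(1), of "x i" "\<Sum>i\<in>I. x i"] subspace_sum[OF assms(2), of I x] by simp
qed (use lin_on_zero[OF assms(1)] subspace_0[OF assms(2)] in simp_all)

lemma lin_onI:
  assumes S: "subspace S" and f: "\<And>c x y. x \<in> S \<Longrightarrow> y \<in> S \<Longrightarrow> f (c *\<^sub>R x + y) = c *\<^sub>R f x + f y"
  shows "lin_on S f"
proof -
  have "f 0 = 0" using f[of 0 0 1] subspace_0[OF S] by simp
  then show ?thesis using f[of _ _ 1] f[of _ 0] subspace_0[OF S] by (simp add: lin_on_def)
qed

lemma lin_on_comb:
  "lin_on S f \<Longrightarrow> subspace S \<Longrightarrow> x \<in> S \<Longrightarrow> y \<in> S \<Longrightarrow> f (c *\<^sub>R x + y) = c *\<^sub>R f x + f y"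
  by (simp add: lin_on_def subspace_scale)

lemma subspace_combI:
  assumes "0 \<in> S" "\<And>c x y. x \<in> S \<Longrightarrow> y \<in> S \<Longrightarrow> c *\<^sub>R x + y \<in> S"
  shows "subspace S"
  using assms(1) assms(2)[of _ _ 1] assms(2)[of _ 0] by (simp add: subspace_def)

lemma lin_on_cong: "lin_on S f \<Longrightarrow> subspace S \<Longrightarrow> (\<And>x. x \<in> S \<Longrightarrow> f x = g x) \<Longrightarrow> lin_on S g"
  by (simp add: lin_on_def subspace_add subspace_scale)

lemma lin_on_compose: "lin_on S f \<Longrightarrow> f ` S \<subseteq> T \<Longrightarrow> lin_on T g \<Longrightarrow> lin_on S (\<lambda>x. g (f x))"
  by (auto simp: lin_on_def image_subset_iff)

lemma lin_on_scaled: "lin_on S f \<Longrightarrow> lin_on S (\<lambda>x. c *\<^sub>R f x)"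
  by (simp add: lin_on_def scaleR_add_right mult.commute)

lemma lin_on_plus: "lin_on S f \<Longrightarrow> lin_on S g \<Longrightarrow> lin_on S (\<lambda>x. f x + g x)"
  by (simp add: lin_on_def scaleR_add_right)

lemma lin_on_minus: "lin_on S f \<Longrightarrow> lin_on S g \<Longrightarrow> lin_on S (\<lambda>x. f x - g x)"
  by (simp add: lin_on_def scaleR_diff_right)

lemma lin_on_const_zero: "lin_on S (\<lambda>x. 0)"
  by (simp add: lin_on_def)

lemma lin_on_setsum: "(\<And>i. i \<in> I \<Longrightarrow> lin_on S (f i)) \<Longrightarrow> lin_on S (\<lambda>x. \<Sum>i\<in>I. f i x)"
  by (simp add: lin_on_def sum.distrib scaleR_sum_right)

lemma sum_fun_apply: "(sum F I) x = (\<Sum>i\<in>I. F i x)"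
  by (induction I rule: infinite_finite_induct) auto

lemma sum_list_update_add:
  fixes js :: "int list"
  assumes "p < length js"
  shows "sum_list (js[p := js ! p + l]) = sum_list js + l"
  using assms by (induction js arbitrary: p) (auto split: nat.split)

locale graded_vs =
  fixes m :: int and V :: "int \<Rightarrow> 'v::real_vector set"
  assumes graded: "graded_space m V" and even_m: "even m"
begin

lemma subspace_V: "subspace (V k)"
  using graded by (simp add: graded_space_def)

lemma V_0 [simp]: "0 \<in> V k"
  using subspace_V by (rule subspace_0)

lemma V_add: "x \<in> V k \<Longrightarrow> y \<in> V k \<Longrightarrow> x + y \<in> V k"
  using subspace_V by (rule subspace_add)

lemma V_diff: "x \<in> V k \<Longrightarrow> y \<in> V k \<Longrightarrow> x - y \<in> V k"
  using subspace_V by (rule subspace_diff)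

lemma V_neg: "x \<in> V k \<Longrightarrow> - x \<in> V k"
  using subspace_V by (rule subspace_neg)

lemma V_scale: "x \<in> V k \<Longrightarrow> c *\<^sub>R x \<in> V k"
  using subspace_V by (rule subspace_scale)

lemma V_sum: "(\<And>i. i \<in> I \<Longrightarrow> x i \<in> V k) \<Longrightarrow> (\<Sum>i\<in>I. x i) \<in> V k"
  using subspace_V by (rule subspace_sum)

lemma homogI: "x \<in> V k \<Longrightarrow> x \<in> homog V"
  by (auto simp: homog_def)

lemma homogE: "x \<in> homog V \<Longrightarrow> (\<And>k. x \<in> V k \<Longrightarrow> thesis) \<Longrightarrow> thesis"
  by (auto simp: homog_def)

lemma homog_scale: "x \<in> homog V \<Longrightarrow> c *\<^sub>R x \<in> homog V"
  by (metis homogE homogI V_scale)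

lemma homog_0 [simp]: "0 \<in> homog V"
  using V_0 by (rule homogI)

text \<open>The modulus is even, hence components of different parity are distinct summands of a direct sum and
  share only the zero vector.\<close>

lemma degree_parity:
  assumes "x \<in> V j" "x \<in> V k" "x \<noteq> 0"
  shows "even j \<longleftrightarrow> even k"
proof (rule ccontr)
  assume *: "(even j) \<noteq> (even k)"
  define y where "y i = (if i = j then x else - x)" for i
  have "j mod m \<noteq> k mod m"
    using * even_m by (metis dvd_mod_iff)
  then have "inj_on (\<lambda>k. k mod m) {j, k}" "j \<noteq> k" by auto
  moreover have "\<forall>i\<in>{j, k}. y i \<in> V i" "(\<Sum>i\<in>{j, k}. y i) = 0"
    using assms \<open>j \<noteq> k\<close> V_neg by (auto simp: y_def)
  ultimately have "\<forall>i\<in>{j, k}. y i = 0"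
    using graded[unfolded graded_space_def, THEN conjunct2, THEN conjunct2, rule_format, of "{j, k}" y]
    by blast
  then show False using assms(3) by (simp add: y_def)
qed

lemma gdeg_parity:
  assumes "x \<in> V j" "x \<noteq> 0"
  shows "even (gdeg V x) \<longleftrightarrow> even j"
proof -
  have "x \<in> V (gdeg V x)" unfolding gdeg_def using assms(1) by (rule someI)
  then show ?thesis by (rule degree_parity[OF _ assms])
qed

text \<open>Homogeneous lists are handled together with a list of degrees. Since the degree of the
  zero vector is arbitrary, signs may be computed from any such list of degrees.\<close>

definition homs :: "'v list \<Rightarrow> int list \<Rightarrow> bool"
  where "homs = list_all2 (\<lambda>x j. x \<in> V j)"

lemma homs_Nil [simp]: "homs [] js \<longleftrightarrow> js = []" "homs xs [] \<longleftrightarrow> xs = []"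
  by (auto simp: homs_def)

lemma homs_Cons [simp]: "homs (x # xs) (j # js) \<longleftrightarrow> x \<in> V j \<and> homs xs js"
  by (simp add: homs_def)

lemma homs_append: "homs xs js \<Longrightarrow> homs ys ks \<Longrightarrow> homs (xs @ ys) (js @ ks)"
  by (simp add: homs_def list_all2_appendI)

lemma homs_length: "homs xs js \<Longrightarrow> length js = length xs"
  by (simp add: homs_def list_all2_lengthD)

lemma homs_nth: "homs xs js \<Longrightarrow> p < length xs \<Longrightarrow> xs ! p \<in> V (js ! p)"
  unfolding homs_def by (drule (1) list_all2_nthD)

lemma homs_take: "homs xs js \<Longrightarrow> homs (take n xs) (take n js)"
  by (simp add: homs_def)

lemma homs_drop: "homs xs js \<Longrightarrow> homs (drop n xs) (drop n js)"
  by (simp add: homs_def)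

lemma homs_update: "homs xs js \<Longrightarrow> x \<in> V j \<Longrightarrow> homs (xs[p := x]) (js[p := j])"
  by (simp add: homs_def list_all2_update_cong)

lemma homs_homog: "homs xs js \<Longrightarrow> set xs \<subseteq> homog V"
  unfolding homs_def by (induction xs js rule: list_all2_induct) (auto simp: homog_def)

lemma homs_ex: "set xs \<subseteq> homog V \<Longrightarrow> \<exists>js. homs xs js"
proof (induction xs)
  case (Cons x xs)
  then obtain js j where "homs xs js" "x \<in> V j" by (auto simp: homog_def)
  then have "homs (x # xs) (j # js)" by simp
  then show ?case ..
qed auto

lemma homog_nth: "set xs \<subseteq> homog V \<Longrightarrow> p < length xs \<Longrightarrow> xs ! p \<in> homog V"
  by (simp add: subset_code(1))

lemma gdeg_nth: "homs xs js \<Longrightarrow> 0 \<notin> set xs \<Longrightarrow> p < length xs \<Longrightarrow>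
    even (gdeg V (xs ! p)) \<longleftrightarrow> even (js ! p)"
  by (rule gdeg_parity) (auto simp: homs_nth in_set_conv_nth)

lemma deg_sum_parity: "homs xs js \<Longrightarrow> 0 \<notin> set xs \<Longrightarrow> even (deg_sum V xs) \<longleftrightarrow> even (sum_list js)"
  unfolding homs_def by (induction xs js rule: list_all2_induct) (auto simp: gdeg_parity)

section \<open>The endomorphism operad is a DG operad\<close>

abbreviation "ml \<equiv> multilinear_maps V"
abbreviation "ecomp \<equiv> end_comp V"
abbreviation "eact \<equiv> end_act V"

lemma ml_outside:
  "f \<in> ml n k \<Longrightarrow> \<not> (length xs = n \<and> set xs \<subseteq> homog V) \<Longrightarrow> f xs = 0"
  by (auto simp: multilinear_maps_def)

lemma ml_degree:
  "f \<in> ml n k \<Longrightarrow> homs xs js \<Longrightarrow> length xs = n \<Longrightarrow> f xs \<in> V (sum_list js + k)"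
  by (simp add: multilinear_maps_def homs_def)

lemma ml_update:
  assumes "f \<in> ml n k" "set xs \<subseteq> homog V" "p < length xs"
  shows "lin_on (V j) (\<lambda>x. f (xs[p := x]))"
proof -
  have "set (take p xs) \<subseteq> homog V" "set (drop (Suc p) xs) \<subseteq> homog V"
    using assms(2) by (meson order_trans set_take_subset set_drop_subset)+
  then show ?thesis
    using assms(1,3) by (simp add: multilinear_maps_def upd_conv_take_nth_drop)
qed

lemma ml_zero:
  assumes "f \<in> ml n k" "0 \<in> set xs"
  shows "f xs = 0"
proof (cases "set xs \<subseteq> homog V")
  case True
  obtain p where p: "p < length xs" "xs ! p = 0" using assms(2) by (auto simp: in_set_conv_nth)
  have "f (xs[p := 0]) = 0" by (rule lin_on_zero[OF ml_update[OF assms(1) True p(1)] V_0])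
  then show ?thesis using p by (metis list_update_id)
qed (use ml_outside[OF assms(1)] in auto)

text \<open>Linearity is tested by overwriting an entry of a homogeneous list, so that operations defined by
  cutting lists into pieces need not be cut again around the varying argument.\<close>

lemma ml_memI:
  assumes "\<And>xs. \<not> (length xs = n \<and> set xs \<subseteq> homog V) \<Longrightarrow> f xs = 0"
    and "\<And>xs js. homs xs js \<Longrightarrow> length xs = n \<Longrightarrow> f xs \<in> V (sum_list js + k)"
    and "\<And>xs js p j. homs xs js \<Longrightarrow> length xs = n \<Longrightarrow> p < n \<Longrightarrow> lin_on (V j) (\<lambda>x. f (xs[p := x]))"
  shows "f \<in> ml n k"
proof -
  have "lin_on (V j) (\<lambda>x. f (us @ [x] @ vs))"
    if us: "set us \<subseteq> homog V" "set vs \<subseteq> homog V" for us vs j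
  proof (cases "length us + 1 + length vs = n")
    case True
    have "set (us @ [0] @ vs) \<subseteq> homog V" using us by auto
    then obtain js where "homs (us @ [0] @ vs) js" using homs_ex by blast
    from assms(3)[OF this, of "length us" j] True show ?thesis by simp
  next
    case False
    then have "f (us @ [x] @ vs) = 0" for x by (intro assms(1)) auto
    then show ?thesis by (simp add: lin_on_const_zero)
  qed
  then show ?thesis
    using assms(1,2) unfolding multilinear_maps_def homs_def by simp
qed

lemma ml_eqI:
  assumes "f \<in> ml n k" "g \<in> ml n k'"
    and "\<And>xs js. homs xs js \<Longrightarrow> length xs = n \<Longrightarrow> f xs = g xs"
  shows "f = g"
proof
  fix xs
  show "f xs = g xs"
  proof (cases "length xs = n \<and> set xs \<subseteq> homog V")
    case True
    then show ?thesis using assms(3) homs_ex by blast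
  qed (use ml_outside[OF assms(1)] ml_outside[OF assms(2)] in auto)
qed

lemma subspace_ml: "subspace (ml n k)"
  unfolding subspace_def
proof (intro conjI allI ballI)
  show "0 \<in> ml n k"
    by (rule ml_memI) (auto simp: lin_on_const_zero)
  fix f g assume fg: "f \<in> ml n k" "g \<in> ml n k"
  show "f + g \<in> ml n k"
    by (rule ml_memI) (auto simp: ml_outside[OF fg(1)] ml_outside[OF fg(2)] dest: homs_homog[THEN subsetD]
        intro!: V_add ml_degree[OF fg(1)] ml_degree[OF fg(2)] lin_on_plus ml_update[OF fg(1)] ml_update[OF fg(2)])
next
  fix f c assume f: "f \<in> ml n k"
  show "c *\<^sub>R f \<in> ml n k"
    unfolding scaleR_fun_def
    by (rule ml_memI) (auto simp: ml_outside[OF f] dest: homs_homog[THEN subsetD]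
        intro!: V_scale ml_degree[OF f] lin_on_scaled ml_update[OF f])
qed

subsection \<open>Composition\<close>

lemma homs_appendE:
  assumes "homs (as @ bs) js"
  obtains ja jb where "js = ja @ jb" "homs as ja" "homs bs jb"
  using assms unfolding homs_def list_all2_append1 by blast

text \<open>The sign may be computed from any degrees of the entries: if one of the entries in front is zero,
  both sides vanish, and otherwise the parities are determined.\<close>

lemma end_comp_app:
  assumes f: "f \<in> ml r k" and g: "g \<in> ml n l"
    and len: "length as = i" "length bs = n" "i + 1 + length cs = r"
    and h: "homs as ja" "homs bs jb" "homs cs jc"
  shows "ecomp r i n l f g (as @ bs @ cs)
    = sgn_pow (l * sum_list ja) *\<^sub>R f (as @ [g bs] @ cs)"
proof -
  have "set (as @ bs @ cs) \<subseteq> homog V" using h by (auto dest: homs_homog)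
  moreover have "length (as @ bs @ cs) = r + n - 1" using len by simp
  ultimately have *: "ecomp r i n l f g (as @ bs @ cs)
      = sgn_pow (l * deg_sum V as) *\<^sub>R f (as @ [g bs] @ cs)"
    using len by (simp add: end_comp_def ext_map_def)
  show ?thesis
  proof (cases "0 \<in> set as")
    case True
    then have "f (as @ [g bs] @ cs) = 0" by (intro ml_zero[OF f]) simp
    with * show ?thesis by simp
  next
    case False
    then have "sgn_pow (l * deg_sum V as) = sgn_pow (l * sum_list ja)"
      by (intro sgn_pow_eqI) (simp add: deg_sum_parity[OF h(1)])
    with * show ?thesis by simp
  qed
qed

lemma list_split3:
  assumes "length xs = r + n - 1" "i < r"
  obtains as bs cs where "xs = as @ bs @ cs" "length as = i" "length bs = n" "i + 1 + length cs = r"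
proof
  show "xs = take i xs @ take n (drop i xs) @ drop (i + n) xs"
    by (metis add.commute append_take_drop_id drop_drop)
qed (use assms in auto)

lemma homs_append3E:
  assumes "homs (as @ bs @ cs) js"
  obtains ja jb jc where "js = ja @ jb @ jc" "homs as ja" "homs bs jb" "homs cs jc"
  using assms by (metis homs_appendE)

lemma list_update_tail: "(as @ [y] @ cs)[length as + 1 + q := x] = as @ [y] @ cs[q := x]"
  by (induction as) auto

lemma end_comp_mem:
  assumes f: "f \<in> ml r k" and g: "g \<in> ml n l" and i: "i < r"
  shows "ecomp r i n l f g \<in> ml (r + n - 1) (k + l)"
proof (rule ml_memI)
  fix xs js assume xs: "homs xs js" "length xs = r + n - 1"
  obtain as bs cs where s: "xs = as @ bs @ cs" "length as = i" "length bs = n" "i + 1 + length cs = r"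
    using list_split3[OF xs(2) i] .
  obtain ja jb jc where j: "js = ja @ jb @ jc" "homs as ja" "homs bs jb" "homs cs jc"
    using homs_append3E xs(1) s(1) by blast
  have "homs (as @ [g bs] @ cs) (ja @ [sum_list jb + l] @ jc)"
    by (intro homs_append j) (simp add: ml_degree[OF g j(3) s(3)])
  from ml_degree[OF f this] s have "f (as @ [g bs] @ cs) \<in> V (sum_list js + (k + l))"
    by (simp add: j(1) algebra_simps)
  then show "ecomp r i n l f g xs \<in> V (sum_list js + (k + l))"
    by (simp add: s(1) end_comp_app[OF f g s(2-4) j(2-4), simplified] V_scale)
  fix p j assume p: "p < r + n - 1"
  have hom: "set as \<subseteq> homog V" "set bs \<subseteq> homog V" "set cs \<subseteq> homog V"
    using j homs_homog by auto
  have hg: "g bs \<in> homog V" using ml_degree[OF g j(3) s(3)] by (rule homogI)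
  consider "p < i" | "i \<le> p" "p < i + n" | "i + n \<le> p" by linarith
  then show "lin_on (V j) (\<lambda>x. ecomp r i n l f g (xs[p := x]))"
  proof cases
    case 1
    have "lin_on (V j) (\<lambda>x. f ((as @ [g bs] @ cs)[p := x]))"
      by (rule ml_update[OF f]) (use hom hg s 1 in auto)
    then have "lin_on (V j) (\<lambda>x. sgn_pow (l * sum_list (ja[p := j])) *\<^sub>R f (as[p := x] @ [g bs] @ cs))"
      using 1 s by (intro lin_on_scaled) (simp add: list_update_append)
    then show ?thesis
    proof (rule lin_on_cong[OF _ subspace_V])
      fix x assume "x \<in> V j"
      then have "homs (as[p := x]) (ja[p := j])" using j by (intro homs_update)
      from end_comp_app[OF f g _ s(3,4) this j(3,4)] 1 s
      show "sgn_pow (l * sum_list (ja[p := j])) *\<^sub>R f (as[p := x] @ [g bs] @ cs)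
        = ecomp r i n l f g (xs[p := x])" by (simp add: list_update_append)
    qed
  next
    case 2
    let ?q = "p - i"
    have "lin_on (V j) (\<lambda>x. f ((as @ [0] @ cs)[i := g (bs[?q := x])]))"
    proof (rule lin_on_compose[where f = "\<lambda>x. g (bs[?q := x])" and g = "\<lambda>y. f ((as @ [0] @ cs)[i := y])"])
      show "lin_on (V j) (\<lambda>x. g (bs[?q := x]))"
        by (rule ml_update[OF g]) (use hom 2 s in auto)
      show "(\<lambda>x. g (bs[?q := x])) ` V j \<subseteq> V (sum_list (jb[?q := j]) + l)"
        using ml_degree[OF g homs_update[OF j(3)]] s by auto
      show "lin_on (V (sum_list (jb[?q := j]) + l)) (\<lambda>y. f ((as @ [0] @ cs)[i := y]))"
        by (rule ml_update[OF f]) (use hom s in auto)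
    qed
    then have "lin_on (V j) (\<lambda>x. sgn_pow (l * sum_list ja) *\<^sub>R f (as @ [g (bs[?q := x])] @ cs))"
      using s by (intro lin_on_scaled) (simp add: list_update_append)
    then show ?thesis
    proof (rule lin_on_cong[OF _ subspace_V])
      fix x assume "x \<in> V j"
      then have "homs (bs[?q := x]) (jb[?q := j])" using j by (intro homs_update)
      from end_comp_app[OF f g s(2) _ s(4) j(2) this j(4)] 2 s less_diff_conv2[OF 2(1), of n]
      show "sgn_pow (l * sum_list ja) *\<^sub>R f (as @ [g (bs[?q := x])] @ cs)
        = ecomp r i n l f g (xs[p := x])" by (simp add: list_update_append)
    qed
  next
    case 3
    let ?q = "p - i - n"
    have "lin_on (V j) (\<lambda>x. f ((as @ [g bs] @ cs)[i + 1 + ?q := x]))"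
      by (rule ml_update[OF f]) (use hom hg s 3 p in auto)
    then have "lin_on (V j) (\<lambda>x. sgn_pow (l * sum_list ja) *\<^sub>R f (as @ [g bs] @ cs[?q := x]))"
      unfolding s(2)[symmetric] list_update_tail by (intro lin_on_scaled)
    then show ?thesis
    proof (rule lin_on_cong[OF _ subspace_V])
      fix x assume "x \<in> V j"
      then have h: "homs (cs[?q := x]) (jc[?q := j])" using j by (intro homs_update)
      have "\<not> p - i < n" using 3 by linarith
      with end_comp_app[OF f g s(2,3) _ j(2,3) h] 3 s
      show "sgn_pow (l * sum_list ja) *\<^sub>R f (as @ [g bs] @ cs[?q := x])
        = ecomp r i n l f g (xs[p := x])" by (simp add: list_update_append)
    qed
  qed
qed (auto simp: end_comp_def ext_map_def)

lemma end_comp_lin_right: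
  assumes f: "f \<in> ml r k" and i: "i < r"
  shows "lin_on (ml n l) (\<lambda>g. ecomp r i n l f g)"
proof -
  define F where "F xs y = f (take i xs @ [y] @ drop (i + n) xs)" for xs y
  have F: "\<exists>j. lin_on (V j) (F xs) \<and> (\<forall>g\<in>ml n l. g (take n (drop i xs)) \<in> V j)"
    if xs: "length xs = r + n - 1" "set xs \<subseteq> homog V" for xs
  proof -
    obtain js where "homs xs js" using homs_ex xs(2) by blast
    then have "homs (take n (drop i xs)) (take n (drop i js))" by (intro homs_take homs_drop)
    moreover have "length (take n (drop i xs)) = n" using xs(1) i by simp
    ultimately have "\<forall>g\<in>ml n l.
        g (take n (drop i xs)) \<in> V (sum_list (take n (drop i js)) + l)"
      using ml_degree by blast
    moreover have "set (take i xs) \<subseteq> homog V" "set (drop (i + n) xs) \<subseteq> homog V"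
      using xs(2) by (meson order_trans set_take_subset set_drop_subset)+
    then have "lin_on (V j) (F xs)" for j
      using f unfolding F_def multilinear_maps_def by blast
    ultimately show ?thesis by blast
  qed
  have E: "ecomp r i n l f g xs = (if length xs = r + n - 1 \<and> set xs \<subseteq> homog V
      then sgn_pow (l * deg_sum V (take i xs)) *\<^sub>R F xs (g (take n (drop i xs))) else 0)" for g xs
    by (simp add: end_comp_def ext_map_def F_def)
  have "ecomp r i n l f (c *\<^sub>R g + h) xs = c *\<^sub>R ecomp r i n l f g xs + ecomp r i n l f h xs"
    if gh: "g \<in> ml n l" "h \<in> ml n l" for c g h xs
  proof (cases "length xs = r + n - 1 \<and> set xs \<subseteq> homog V")
    case True
    then obtain j where "lin_on (V j) (F xs)" "g (take n (drop i xs)) \<in> V j" "h (take n (drop i xs)) \<in> V j"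
      using F[of xs] gh by blast
    from lin_on_comb[OF this(1) subspace_V this(2,3), of c] show ?thesis
      by (simp add: E True scaleR_add_right scaleR_fun_def mult.commute)
  qed (auto simp: E)
  then show ?thesis by (intro lin_onI[OF subspace_ml] ext) (simp add: scaleR_fun_def)
qed

lemma end_comp_lin_left: "lin_on S (\<lambda>f. ecomp r i n l f g)"
  by (auto simp: lin_on_def end_comp_def ext_map_def fun_eq_iff scaleR_fun_def scaleR_add_right mult.commute)

lemma end_unit_mem: "unary_op V (\<lambda>x. x) \<in> ml 1 0"
proof (rule ml_memI)
  fix xs js p j assume xs: "homs xs js" "length xs = 1" "p < (1::nat)"
  have "lin_on (V j) (\<lambda>x. x)" by (simp add: lin_on_def)
  then show "lin_on (V j) (\<lambda>x. unary_op V (\<lambda>x. x) (xs[p := x]))"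
  proof (rule lin_on_cong[OF _ subspace_V])
    show "x = unary_op V (\<lambda>x. x) (xs[p := x])" if "x \<in> V j" for x
      using xs that by (auto simp: ext_map_def length_Suc_conv homogI)
  qed
qed (auto simp: ext_map_def length_Suc_conv homs_def list_all2_Cons1)

lemma end_unit_left:
  assumes "f \<in> ml n k"
  shows "ecomp 1 0 n k (unary_op V (\<lambda>x. x)) f = f"
proof (rule ml_eqI)
  show "ecomp 1 0 n k (unary_op V (\<lambda>x. x)) f \<in> ml (1 + n - 1) (0 + k)"
    by (rule end_comp_mem[OF end_unit_mem assms]) simp
  show "f \<in> ml (1 + n - 1) k" using assms by simp
  fix xs js assume xs: "homs xs js" "length xs = 1 + n - 1"
  from end_comp_app[OF end_unit_mem assms, of "[]" 0 xs "[]" "[]" js "[]"] xs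
  show "ecomp 1 0 n k (unary_op V (\<lambda>x. x)) f xs = f xs"
    using ml_degree[OF assms xs(1)] by (simp add: ext_map_def homogI)
qed

lemma end_unit_right:
  assumes f: "f \<in> ml n k" and i: "i < n"
  shows "ecomp n i 1 0 f (unary_op V (\<lambda>x. x)) = f"
proof (rule ml_eqI)
  show "ecomp n i 1 0 f (unary_op V (\<lambda>x. x)) \<in> ml (n + 1 - 1) (k + 0)"
    by (rule end_comp_mem[OF f end_unit_mem i])
  show "f \<in> ml (n + 1 - 1) k" using f by simp
  fix xs js assume xs: "homs xs js" "length xs = n + 1 - 1"
  obtain as bs cs where s: "xs = as @ bs @ cs" "length as = i" "length bs = 1" "i + 1 + length cs = n"
    using list_split3[OF xs(2) i] .
  obtain b where b: "bs = [b]" using s(3) by (auto simp: length_Suc_conv)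
  obtain ja jb jc where j: "js = ja @ jb @ jc" "homs as ja" "homs bs jb" "homs cs jc"
    using homs_append3E xs(1) s(1) by blast
  have "b \<in> homog V" using homs_homog[OF j(3)] b by simp
  then show "ecomp n i 1 0 f (unary_op V (\<lambda>x. x)) xs = f xs"
    using end_comp_app[OF f end_unit_mem s(2-4) j(2-4)] by (simp add: s(1) b ext_map_def)
qed

text \<open>Both sides insert \<open>h\<close> into \<open>g\<close> and the result into \<open>f\<close>. The sign for moving \<open>h\<close> past the arguments
  in front of \<open>g\<close> is produced on the right by the degree \<open>l + q\<close> of the composite.\<close>

lemma end_assoc_seq:
  assumes f: "f \<in> ml r k" and g: "g \<in> ml n l"
    and h: "h \<in> ml s q" and i: "i < r" and j: "j < n"
  shows "ecomp (r + n - 1) (i + j) s q (ecomp r i n l f g) h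
    = ecomp r i (n + s - 1) (l + q) f (ecomp n j s q g h)"
proof -
  note fg = end_comp_mem[OF f g i] and gh = end_comp_mem[OF g h j]
  have eq: "r + n - 1 + s - 1 = r + (n + s - 1) - 1" using i j by simp
  show ?thesis
  proof (rule ml_eqI)
    show "ecomp (r + n - 1) (i + j) s q (ecomp r i n l f g) h
        \<in> ml (r + n - 1 + s - 1) (k + l + q)"
      by (rule end_comp_mem[OF fg h]) (use i j in linarith)
    show "ecomp r i (n + s - 1) (l + q) f (ecomp n j s q g h)
        \<in> ml (r + n - 1 + s - 1) (k + (l + q))"
      unfolding eq by (rule end_comp_mem[OF f gh i])
    fix xs js assume xs: "homs xs js" "length xs = r + n - 1 + s - 1"
    obtain as ms es where s1: "xs = as @ ms @ es" "length as = i" "length ms = n + s - 1" "i + 1 + length es = r"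
      using list_split3[OF xs(2)[unfolded eq] i] .
    obtain bs cs ds where s2: "ms = bs @ cs @ ds" "length bs = j" "length cs = s" "j + 1 + length ds = n"
      using list_split3[OF s1(3) j] .
    obtain ja jm je where d1: "homs as ja" "homs ms jm" "homs es je"
      using homs_append3E xs(1) s1(1) by blast
    obtain jb jc jd where d2: "jm = jb @ jc @ jd" "homs bs jb" "homs cs jc" "homs ds jd"
      using homs_append3E d1(2) s2(1) by blast
    have hc: "homs [h cs] [sum_list jc + q]" using ml_degree[OF h d2(3) s2(3)] by simp
    have "ecomp (r + n - 1) (i + j) s q (ecomp r i n l f g) h ((as @ bs) @ cs @ (ds @ es))
      = sgn_pow (q * sum_list (ja @ jb)) *\<^sub>R ecomp r i n l f g ((as @ bs) @ [h cs] @ (ds @ es))"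
      by (rule end_comp_app[OF fg h]) (use s1 s2 d1 d2 in \<open>auto intro: homs_append\<close>)
    also have "ecomp r i n l f g ((as @ bs) @ [h cs] @ (ds @ es))
      = ecomp r i n l f g (as @ (bs @ [h cs] @ ds) @ es)" by simp
    also have "\<dots> = sgn_pow (l * sum_list ja) *\<^sub>R f (as @ [g (bs @ [h cs] @ ds)] @ es)"
      by (rule end_comp_app[OF f g _ _ _ d1(1) homs_append[OF d2(2) homs_append[OF hc d2(4)]] d1(3)])
        (use s1 s2 in auto)
    finally have L: "ecomp (r + n - 1) (i + j) s q (ecomp r i n l f g) h xs =
      sgn_pow (q * sum_list (ja @ jb)) *\<^sub>R sgn_pow (l * sum_list ja) *\<^sub>R f (as @ [g (bs @ [h cs] @ ds)] @ es)"
      by (simp add: s1 s2)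
    have gdeg: "g (bs @ [h cs] @ ds) \<in> V (sum_list (jb @ [sum_list jc + q] @ jd) + l)"
      by (rule ml_degree[OF g homs_append[OF d2(2) homs_append[OF hc d2(4)]]]) (use s2 in simp)
    have "ecomp r i (n + s - 1) (l + q) f (ecomp n j s q g h) (as @ ms @ es)
      = sgn_pow ((l + q) * sum_list ja) *\<^sub>R f (as @ [ecomp n j s q g h (bs @ cs @ ds)] @ es)"
      unfolding s2(1)[symmetric] by (rule end_comp_app[OF f gh s1(2-4) d1])
    also have "ecomp n j s q g h (bs @ cs @ ds) = sgn_pow (q * sum_list jb) *\<^sub>R g (bs @ [h cs] @ ds)"
      by (rule end_comp_app[OF g h s2(2-4) d2(2-4)])
    also have "f (as @ [sgn_pow (q * sum_list jb) *\<^sub>R g (bs @ [h cs] @ ds)] @ es)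
      = sgn_pow (q * sum_list jb) *\<^sub>R f (as @ [g (bs @ [h cs] @ ds)] @ es)"
      using lin_on_scale[OF ml_update[OF f, of "as @ [0] @ es" i] gdeg] s1 homs_homog[OF d1(1)] homs_homog[OF d1(3)]
      by (simp add: list_update_append)
    finally have R: "ecomp r i (n + s - 1) (l + q) f (ecomp n j s q g h) xs =
      sgn_pow ((l + q) * sum_list ja) *\<^sub>R sgn_pow (q * sum_list jb) *\<^sub>R f (as @ [g (bs @ [h cs] @ ds)] @ es)"
      by (simp add: s1)
    show "ecomp (r + n - 1) (i + j) s q (ecomp r i n l f g) h xs
      = ecomp r i (n + s - 1) (l + q) f (ecomp n j s q g h) xs"
      unfolding L R by (simp add: sgn_pow_add distrib_left distrib_right)
  qed
qed

text \<open>The two composites differ in whether \<open>h\<close> is moved past the arguments of \<open>g\<close> or past its value,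
  whose degree is larger by \<open>l\<close>; this accounts for the sign.\<close>

lemma end_assoc_par:
  assumes f: "f \<in> ml r k" and g: "g \<in> ml n l"
    and h: "h \<in> ml s q" and i: "i < j" and j: "j < r"
  shows "ecomp (r + n - 1) (j + n - 1) s q (ecomp r i n l f g) h
    = sgn_pow (l * q) *\<^sub>R ecomp (r + s - 1) i n l (ecomp r j s q f h) g"
proof -
  have ir: "i < r" using i j by simp
  note fg = end_comp_mem[OF f g ir] and fh = end_comp_mem[OF f h j]
  have eq: "r + s - 1 + n - 1 = r + n - 1 + s - 1" using i j by simp
  show ?thesis
  proof (rule ml_eqI)
    show "ecomp (r + n - 1) (j + n - 1) s q (ecomp r i n l f g) h
        \<in> ml (r + n - 1 + s - 1) (k + l + q)"
      by (rule end_comp_mem[OF fg h]) (use i j in linarith)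
    show "sgn_pow (l * q) *\<^sub>R ecomp (r + s - 1) i n l (ecomp r j s q f h) g
        \<in> ml (r + n - 1 + s - 1) (k + q + l)"
      unfolding eq[symmetric] by (intro subspace_scale[OF subspace_ml] end_comp_mem[OF fh g]) (use i j in linarith)
    fix xs js assume xs: "homs xs js" "length xs = r + n - 1 + s - 1"
    have "length xs = (r + s - 1) + n - 1" "i < r + s - 1" using xs(2) eq i j by simp_all
    then obtain as bs ms where s1: "xs = as @ bs @ ms" "length as = i" "length bs = n" "i + 1 + length ms = r + s - 1"
      by (rule list_split3)
    have "length ms = (r - i - 1) + s - 1" "j - i - 1 < r - i - 1" using s1 i j by auto
    then obtain cs ds es where s2: "ms = cs @ ds @ es" "length cs = j - i - 1" "length ds = s"
        "j - i - 1 + 1 + length es = r - i - 1"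
      by (rule list_split3)
    obtain ja jb jm where d1: "homs as ja" "homs bs jb" "homs ms jm"
      using homs_append3E xs(1) s1(1) by blast
    obtain jc jd je where d2: "homs cs jc" "homs ds jd" "homs es je"
      using homs_append3E d1(3) s2(1) by blast
    have hd: "homs [h ds] [sum_list jd + q]" using ml_degree[OF h d2(2) s2(3)] by simp
    have gb: "homs [g bs] [sum_list jb + l]" using ml_degree[OF g d1(2) s1(3)] by simp
    note ap = homs_append
    have "ecomp (r + n - 1) (j + n - 1) s q (ecomp r i n l f g) h ((as @ bs @ cs) @ ds @ es)
      = sgn_pow (q * sum_list (ja @ jb @ jc)) *\<^sub>R ecomp r i n l f g ((as @ bs @ cs) @ [h ds] @ es)"
      by (rule end_comp_app[OF fg h _ _ _ ap[OF d1(1) ap[OF d1(2) d2(1)]] d2(2,3)]) (use s1 s2 i j in auto)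
    also have "ecomp r i n l f g ((as @ bs @ cs) @ [h ds] @ es)
      = ecomp r i n l f g (as @ bs @ (cs @ [h ds] @ es))" by simp
    also have "\<dots> = sgn_pow (l * sum_list ja) *\<^sub>R f (as @ [g bs] @ (cs @ [h ds] @ es))"
      by (rule end_comp_app[OF f g _ _ _ d1(1,2) ap[OF d2(1) ap[OF hd d2(3)]]]) (use s1 s2 i j in auto)
    finally have L: "ecomp (r + n - 1) (j + n - 1) s q (ecomp r i n l f g) h xs =
      sgn_pow (q * sum_list (ja @ jb @ jc)) *\<^sub>R sgn_pow (l * sum_list ja) *\<^sub>R
        f (as @ [g bs] @ cs @ [h ds] @ es)" by (simp add: s1 s2)
    have "ecomp (r + s - 1) i n l (ecomp r j s q f h) g (as @ bs @ (cs @ ds @ es))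
      = sgn_pow (l * sum_list ja) *\<^sub>R ecomp r j s q f h (as @ [g bs] @ (cs @ ds @ es))"
      by (rule end_comp_app[OF fh g _ _ _ d1(1,2) ap[OF d2(1) ap[OF d2(2,3)]]]) (use s1 s2 i j in auto)
    also have "ecomp r j s q f h (as @ [g bs] @ (cs @ ds @ es))
      = ecomp r j s q f h ((as @ [g bs] @ cs) @ ds @ es)" by simp
    also have "\<dots> = sgn_pow (q * sum_list (ja @ [sum_list jb + l] @ jc)) *\<^sub>R
        f ((as @ [g bs] @ cs) @ [h ds] @ es)"
      by (rule end_comp_app[OF f h _ _ _ ap[OF d1(1) ap[OF gb d2(1)]] d2(2,3)]) (use s1 s2 i j in auto)
    finally have R: "ecomp (r + s - 1) i n l (ecomp r j s q f h) g xs =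
      sgn_pow (l * sum_list ja) *\<^sub>R sgn_pow (q * sum_list (ja @ [sum_list jb + l] @ jc)) *\<^sub>R
        f (as @ [g bs] @ cs @ [h ds] @ es)" by (simp add: s1 s2)
    show "ecomp (r + n - 1) (j + n - 1) s q (ecomp r i n l f g) h xs
      = (sgn_pow (l * q) *\<^sub>R ecomp (r + s - 1) i n l (ecomp r j s q f h) g) xs"
      unfolding L R scaleR_fun_def by (simp add: sgn_pow_def)
  qed
qed

end

subsection \<open>Permutations and Koszul signs\<close>

definition permuted :: "(nat \<Rightarrow> nat) \<Rightarrow> nat \<Rightarrow> 'b list \<Rightarrow> 'b list"
  where "permuted \<sigma> n xs = map (\<lambda>j. xs ! inv \<sigma> j) [0..<n]"

definition inversions :: "(nat \<Rightarrow> nat) \<Rightarrow> nat \<Rightarrow> (nat \<times> nat) set"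
  where "inversions \<sigma> n = {(a, b). a < b \<and> b < n \<and> \<sigma> b < \<sigma> a}"

text \<open>The exponent of the Koszul sign for permuting entries of degrees \<open>e\<close>.\<close>

definition koszul :: "(nat \<Rightarrow> nat) \<Rightarrow> nat \<Rightarrow> (nat \<Rightarrow> int) \<Rightarrow> int"
  where "koszul \<sigma> n e = (\<Sum>(a, b)\<in>inversions \<sigma> n. e a * e b)"

lemma koszul_pairs:
  "koszul \<sigma> n e = (\<Sum>a<n. \<Sum>b<n. if a < b \<and> \<sigma> b < \<sigma> a then e a * e b else 0)"
proof -
  have "inversions \<sigma> n = {x \<in> {..<n} \<times> {..<n}. fst x < snd x \<and> \<sigma> (snd x) < \<sigma> (fst x)}"
    by (auto simp: inversions_def)
  then show ?thesis
    by (simp add: koszul_def sum.inter_filter sum.cartesian_product case_prod_beta)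
qed

lemma koszul_cong: "(\<And>a. a < n \<Longrightarrow> e a = e' a) \<Longrightarrow> koszul \<sigma> n e = koszul \<sigma> n e'"
  unfolding koszul_pairs by (intro sum.cong refl) auto

lemma koszul_parity:
  assumes "\<And>a. a < n \<Longrightarrow> even (e a) \<longleftrightarrow> even (e' a)"
  shows "even (koszul \<sigma> n e) \<longleftrightarrow> even (koszul \<sigma> n e')"
proof -
  have "even (e a * e b - e' a * e' b)" if "(a, b) \<in> inversions \<sigma> n" for a b
    using that assms[of a] assms[of b] by (auto simp: inversions_def)
  then have "even (koszul \<sigma> n e - koszul \<sigma> n e')"
    unfolding koszul_def sum_subtractf[symmetric] by (intro dvd_sum) auto
  then show ?thesis by simp
qed

lemma length_permuted [simp]: "length (permuted \<sigma> n xs) = n"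
  by (simp add: permuted_def)

lemma permuted_nth:
  assumes "\<sigma> permutes {..<n}" "a < n"
  shows "permuted \<sigma> n xs ! \<sigma> a = xs ! a"
  using permutes_in_image[OF assms(1), of a] assms(2) permutes_inverses(2)[OF assms(1)]
  by (simp add: permuted_def)

lemma permuted_eqI:
  assumes "\<sigma> permutes {..<n}" "length ys = n" "\<And>a. a < n \<Longrightarrow> ys ! \<sigma> a = xs ! a"
  shows "permuted \<sigma> n xs = ys"
proof (rule nth_equalityI)
  fix j assume "j < length (permuted \<sigma> n xs)"
  then have "inv \<sigma> j < n" "\<sigma> (inv \<sigma> j) = j"
    using permutes_in_image[OF permutes_inv[OF assms(1)], of j] permutes_inverses(1)[OF assms(1)] by auto
  then show "permuted \<sigma> n xs ! j = ys ! j"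
    using assms(3) permuted_nth[OF assms(1)] by metis
qed (simp add: assms(2))

lemma permuted_update:
  assumes "\<sigma> permutes {..<n}" "p < n" "length xs = n"
  shows "permuted \<sigma> n (xs[p := x]) = (permuted \<sigma> n xs)[\<sigma> p := x]"
proof (rule permuted_eqI[OF assms(1)])
  fix a assume "a < n"
  then show "(permuted \<sigma> n xs)[\<sigma> p := x] ! \<sigma> a = xs[p := x] ! a"
    using permuted_nth[OF assms(1)] permutes_inj[OF assms(1)] permutes_in_image[OF assms(1), of p] assms(2,3)
    by (cases "a = p") (auto simp: inj_eq)
qed simp

lemma set_permuted:
  assumes "\<sigma> permutes {..<n}" "length xs = n"
  shows "set (permuted \<sigma> n xs) = set xs"
proof -
  have "set (permuted \<sigma> n xs) = (\<lambda>j. xs ! j) ` inv \<sigma> ` {..<n}"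
    by (auto simp: permuted_def atLeast0LessThan)
  also have "inv \<sigma> ` {..<n} = {..<n}" by (rule permutes_image[OF permutes_inv[OF assms(1)]])
  finally show ?thesis using assms(2) by (auto simp: set_conv_nth)
qed

lemma permutes_less: "\<sigma> permutes {..<n::nat} \<Longrightarrow> a < n \<Longrightarrow> \<sigma> a < n"
  using permutes_in_image[of \<sigma> "{..<n}" a] by simp

lemma sum_list_permuted:
  fixes js :: "int list"
  assumes "\<sigma> permutes {..<n}" "length js = n"
  shows "sum_list (permuted \<sigma> n js) = sum_list js"
proof -
  have "sum_list (permuted \<sigma> n js) = (\<Sum>j<n. permuted \<sigma> n js ! j)"
    by (simp add: sum_list_sum_nth atLeast0LessThan)
  also have "\<dots> = (\<Sum>a<n. permuted \<sigma> n js ! \<sigma> a)"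
    using sum.permute[OF assms(1)] by (simp add: o_def)
  also have "\<dots> = (\<Sum>a<n. js ! a)" by (intro sum.cong) (simp_all add: permuted_nth[OF assms(1)])
  finally show ?thesis using assms(2) by (simp add: sum_list_sum_nth atLeast0LessThan)
qed

text \<open>For symmetric \<open>F\<close> this is a sum over unordered pairs, which can be relabelled; it is compared with
  the sum over all ordered pairs.\<close>

lemma sum_pairs_permute:
  fixes F :: "nat \<Rightarrow> nat \<Rightarrow> int"
  assumes \<sigma>: "\<sigma> permutes {..<n}" and sym: "\<And>a b. F a b = F b a"
  shows "(\<Sum>a<n. \<Sum>b<n. if a < b then F (\<sigma> a) (\<sigma> b) else 0) = (\<Sum>a<n. \<Sum>b<n. if a < b then F a b else 0)"
proof -
  have twice: "2 * (\<Sum>a<n. \<Sum>b<n. if a < b then G a b else 0) = (\<Sum>a<n. \<Sum>b<n. if a \<noteq> b then G a b else 0)"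
    if G: "\<And>a b. G a b = G b a" for G :: "nat \<Rightarrow> nat \<Rightarrow> int"
  proof -
    have "(\<Sum>a<n. \<Sum>b<n. if a \<noteq> b then G a b else 0) =
        (\<Sum>a<n. \<Sum>b<n. if a < b then G a b else 0) + (\<Sum>a<n. \<Sum>b<n. if b < a then G a b else 0)"
      unfolding sum.distrib[symmetric] by (intro sum.cong refl) auto
    also have "(\<Sum>a<n. \<Sum>b<n. if b < a then G a b else 0) = (\<Sum>b<n. \<Sum>a<n. if b < a then G b a else 0)"
      by (subst sum.swap) (auto intro!: sum.cong simp: G)
    finally show ?thesis by simp
  qed
  have "(\<Sum>a<n. \<Sum>b<n. if \<sigma> a \<noteq> \<sigma> b then F (\<sigma> a) (\<sigma> b) else 0)
      = (\<Sum>a<n. \<Sum>b<n. if \<sigma> a \<noteq> b then F (\<sigma> a) b else 0)"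
    by (intro sum.cong refl sum.permute[OF \<sigma>, of "\<lambda>b. if \<sigma> _ \<noteq> b then F (\<sigma> _) b else 0", unfolded o_def, symmetric])
  also have "\<dots> = (\<Sum>a<n. \<Sum>b<n. if a \<noteq> b then F a b else 0)"
    by (rule sum.permute[OF \<sigma>, of "\<lambda>a. \<Sum>b<n. if a \<noteq> b then F a b else 0", unfolded o_def, symmetric])
  finally have "(\<Sum>a<n. \<Sum>b<n. if a \<noteq> b then F (\<sigma> a) (\<sigma> b) else 0) = (\<Sum>a<n. \<Sum>b<n. if a \<noteq> b then F a b else 0)"
    using permutes_inj[OF \<sigma>] by (simp add: inj_eq)
  then show ?thesis
    using twice[of F] twice[of "\<lambda>a b. F (\<sigma> a) (\<sigma> b)"] sym by simp
qed

text \<open>A pair is inverted by \<open>\<sigma> \<circ> \<tau>\<close> iff exactly one of its two steps inverts it. Pairs inverted in both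
  steps are counted twice on the right, which does not affect the parity.\<close>

lemma koszul_compose:
  assumes \<sigma>: "\<sigma> permutes {..<n}" and \<tau>: "\<tau> permutes {..<n}"
    and e: "\<And>a. a < n \<Longrightarrow> e' (\<tau> a) = e a"
  shows "even (koszul (\<sigma> \<circ> \<tau>) n e) \<longleftrightarrow> even (koszul \<tau> n e + koszul \<sigma> n e')"
proof -
  define F where "F a b = (if (a < b \<and> \<sigma> b < \<sigma> a) \<or> (b < a \<and> \<sigma> a < \<sigma> b) then e' a * e' b else 0)" for a b
  have "koszul \<sigma> n e' = (\<Sum>a<n. \<Sum>b<n. if a < b then F a b else 0)"
    unfolding koszul_pairs F_def by (intro sum.cong refl) auto
  also have "\<dots> = (\<Sum>a<n. \<Sum>b<n. if a < b then F (\<tau> a) (\<tau> b) else 0)"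
    by (rule sum_pairs_permute[OF \<tau>, symmetric]) (auto simp: F_def)
  finally have K: "koszul \<sigma> n e' = (\<Sum>a<n. \<Sum>b<n. if a < b then F (\<tau> a) (\<tau> b) else 0)" .
  have "koszul \<tau> n e + koszul \<sigma> n e' - koszul (\<sigma> \<circ> \<tau>) n e =
    (\<Sum>a<n. \<Sum>b<n. if a < b then
       (if \<tau> b < \<tau> a then e a * e b else 0) + F (\<tau> a) (\<tau> b) - (if \<sigma> (\<tau> b) < \<sigma> (\<tau> a) then e a * e b else 0) else 0)"
    unfolding K koszul_pairs[of \<tau>] koszul_pairs[of "\<sigma> \<circ> \<tau>"]
      sum.distrib[symmetric] sum_subtractf[symmetric] o_apply
    by (intro sum.cong refl) auto
  also have "even \<dots>"
  proof (intro dvd_sum)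
    fix a b assume "a \<in> {..<n}" "b \<in> {..<n}"
    then have "e' (\<tau> a) = e a" "e' (\<tau> b) = e b" using e by auto
    moreover have "\<sigma> (\<tau> a) = \<sigma> (\<tau> b) \<longleftrightarrow> a = b" "\<tau> a = \<tau> b \<longleftrightarrow> a = b"
      using permutes_inj[OF \<sigma>] permutes_inj[OF \<tau>] by (simp_all add: inj_eq)
    ultimately show "even (if a < b then
       (if \<tau> b < \<tau> a then e a * e b else 0) + F (\<tau> a) (\<tau> b) - (if \<sigma> (\<tau> b) < \<sigma> (\<tau> a) then e a * e b else 0) else 0)"
      by (auto simp: F_def)
  qed
  finally show ?thesis by simp
qed

text \<open>Changing one degree by \<open>l\<close> changes the Koszul sign by the entries that are inverted with it;
  these also account for the change of the sum of the preceding degrees.\<close>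

lemma koszul_shift:
  assumes \<sigma>: "\<sigma> permutes {..<n}" and i: "i < n"
    and e': "\<And>a. a < n \<Longrightarrow> e' (\<sigma> a) = e a"
  shows "even (koszul \<sigma> n (e(i := e i + l)) + l * (\<Sum>a<i. e a))
    \<longleftrightarrow> even (koszul \<sigma> n e + l * (\<Sum>a<\<sigma> i. e' a))"
proof -
  define I where "I a = (if (a < i \<and> \<sigma> i < \<sigma> a) \<or> (i < a \<and> \<sigma> a < \<sigma> i) then l * e a else 0)" for a
  have "koszul \<sigma> n (e(i := e i + l)) - koszul \<sigma> n e
      = (\<Sum>a<n. \<Sum>b<n. if a < b \<and> \<sigma> b < \<sigma> a
          then (if a = i then l * e b else 0) + (if b = i then l * e a else 0) else 0)"
    unfolding koszul_pairs sum_subtractf[symmetric]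
    by (intro sum.cong refl) (auto simp: algebra_simps)
  also have "\<dots> = (\<Sum>a<n. \<Sum>b<n. if a = i then (if i < b \<and> \<sigma> b < \<sigma> i then l * e b else 0) else 0)
      + (\<Sum>a<n. \<Sum>b<n. if b = i then (if a < i \<and> \<sigma> i < \<sigma> a then l * e a else 0) else 0)"
    unfolding sum.distrib[symmetric] by (intro sum.cong refl) auto
  also have "\<dots> = (\<Sum>b<n. if i < b \<and> \<sigma> b < \<sigma> i then l * e b else 0)
      + (\<Sum>a<n. if a < i \<and> \<sigma> i < \<sigma> a then l * e a else 0)"
  proof -
    have "(\<Sum>a<n. \<Sum>b<n. if a = i then (if i < b \<and> \<sigma> b < \<sigma> i then l * e b else 0) else 0)
      = (\<Sum>a<n. if a = i then (\<Sum>b<n. if i < b \<and> \<sigma> b < \<sigma> i then l * e b else 0) else 0)"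
      by (intro sum.cong refl) auto
    then show ?thesis using i by (simp add: sum.delta)
  qed
  also have "\<dots> = (\<Sum>a<n. I a)"
    unfolding sum.distrib[symmetric] I_def by (intro sum.cong refl) auto
  finally have 1: "koszul \<sigma> n (e(i := e i + l)) - koszul \<sigma> n e = (\<Sum>a<n. I a)" .
  have restr: "(\<Sum>a<p. f a) = (\<Sum>a<n. if a < p then f a else 0)" if "p \<le> n" for p and f :: "nat \<Rightarrow> int"
    using that by (intro sum.mono_neutral_cong_left) auto
  have "(\<Sum>a<\<sigma> i. e' a) = (\<Sum>a<n. if a < \<sigma> i then e' a else 0)"
    using permutes_less[OF \<sigma> i] by (intro restr) simp
  also have "\<dots> = (\<Sum>a<n. if \<sigma> a < \<sigma> i then e' (\<sigma> a) else 0)"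
    by (rule sum.permute[OF \<sigma>, of "\<lambda>a. if a < \<sigma> i then e' a else 0", unfolded o_def])
  also have "\<dots> = (\<Sum>a<n. if \<sigma> a < \<sigma> i then e a else 0)"
    by (intro sum.cong refl) (simp add: e')
  finally have "l * (\<Sum>a<\<sigma> i. e' a) = (\<Sum>a<n. if \<sigma> a < \<sigma> i then l * e a else 0)"
    by (auto simp: sum_distrib_left intro!: sum.cong)
  moreover have "l * (\<Sum>a<i. e a) = (\<Sum>a<n. if a < i then l * e a else 0)"
    using restr[of i "\<lambda>a. l * e a"] i by (simp add: sum_distrib_left)
  moreover note 1
  ultimately have "koszul \<sigma> n (e(i := e i + l)) + l * (\<Sum>a<i. e a)
      - (koszul \<sigma> n e + l * (\<Sum>a<\<sigma> i. e' a))
    = (\<Sum>a<n. I a + (if a < i then l * e a else 0) - (if \<sigma> a < \<sigma> i then l * e a else 0))"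
    by (simp add: sum.distrib sum_subtractf)
  also have "even \<dots>"
  proof (intro dvd_sum)
    fix a
    have "\<sigma> a = \<sigma> i \<longleftrightarrow> a = i" using permutes_inj[OF \<sigma>] by (simp add: inj_eq)
    then show "even (I a + (if a < i then l * e a else 0) - (if \<sigma> a < \<sigma> i then l * e a else 0))"
      by (auto simp: I_def)
  qed
  finally show ?thesis by simp
qed

context graded_vs begin

lemma homs_permute:
  assumes "\<sigma> permutes {..<n}" "homs xs js" "length xs = n"
  shows "homs (permuted \<sigma> n xs) (permuted \<sigma> n js)"
  unfolding homs_def list_all2_conv_all_nth
proof (intro conjI allI impI)
  fix j assume "j < length (permuted \<sigma> n xs)"
  then have "j < n" by simp
  moreover from this have "inv \<sigma> j < n" by (rule permutes_less[OF permutes_inv[OF assms(1)]])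
  ultimately show "permuted \<sigma> n xs ! j \<in> V (permuted \<sigma> n js ! j)"
    using homs_nth[OF assms(2)] assms(3) by (simp add: permuted_def)
qed simp

lemma end_act_app:
  assumes f: "f \<in> ml n k" and \<sigma>: "\<sigma> permutes {..<n}"
    and xs: "homs xs js" "length xs = n"
  shows "eact n \<sigma> f xs = sgn_pow (koszul \<sigma> n ((!) js)) *\<^sub>R f (permuted \<sigma> n xs)"
proof -
  have *: "eact n \<sigma> f xs
      = sgn_pow (koszul \<sigma> n (\<lambda>a. gdeg V (xs ! a))) *\<^sub>R f (permuted \<sigma> n xs)"
    using homs_homog[OF xs(1)] xs(2)
    by (simp add: end_act_def ext_map_def koszul_def inversions_def permuted_def)
  show ?thesis
  proof (cases "0 \<in> set xs")
    case True
    then have "f (permuted \<sigma> n xs) = 0"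
      using set_permuted[OF \<sigma> xs(2)] by (intro ml_zero[OF f]) simp
    then show ?thesis by (simp add: *)
  next
    case False
    then have "sgn_pow (koszul \<sigma> n (\<lambda>a. gdeg V (xs ! a))) = sgn_pow (koszul \<sigma> n ((!) js))"
      by (intro sgn_pow_eqI koszul_parity) (use xs gdeg_nth in auto)
    then show ?thesis by (simp add: *)
  qed
qed

lemma end_act_mem:
  assumes f: "f \<in> ml n k" and \<sigma>: "\<sigma> permutes {..<n}"
  shows "eact n \<sigma> f \<in> ml n k"
proof (rule ml_memI)
  fix xs js assume xs: "homs xs js" "length xs = n"
  note jl = homs_length[OF xs(1), unfolded xs(2)]
  show "eact n \<sigma> f xs \<in> V (sum_list js + k)"
    using ml_degree[OF f homs_permute[OF \<sigma> xs]] sum_list_permuted[OF \<sigma> jl]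
    by (simp add: end_act_app[OF f \<sigma> xs] V_scale)
  fix p j assume p: "p < n"
  have "lin_on (V j) (\<lambda>x. f ((permuted \<sigma> n xs)[\<sigma> p := x]))"
    by (rule ml_update[OF f])
      (use set_permuted[OF \<sigma> xs(2)] homs_homog[OF xs(1)] permutes_less[OF \<sigma> p] in auto)
  then have "lin_on (V j) (\<lambda>x. sgn_pow (koszul \<sigma> n ((!) (js[p := j]))) *\<^sub>R f ((permuted \<sigma> n xs)[\<sigma> p := x]))"
    by (rule lin_on_scaled)
  then show "lin_on (V j) (\<lambda>x. eact n \<sigma> f (xs[p := x]))"
  proof (rule lin_on_cong[OF _ subspace_V])
    fix x assume "x \<in> V j"
    from homs_update[OF xs(1) this, of p] xs(2)
    show "sgn_pow (koszul \<sigma> n ((!) (js[p := j]))) *\<^sub>R f ((permuted \<sigma> n xs)[\<sigma> p := x])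
      = eact n \<sigma> f (xs[p := x])"
      by (simp add: end_act_app[OF f \<sigma>] permuted_update[OF \<sigma> p])
  qed
qed (auto simp: end_act_def ext_map_def)

lemma end_act_lin: "lin_on S (eact n \<sigma>)"
  by (auto simp: lin_on_def end_act_def ext_map_def fun_eq_iff scaleR_fun_def scaleR_add_right mult.commute)

lemma end_act_id: 
  assumes f: "f \<in> ml n k"
  shows "eact n id f = f"
proof (rule ml_eqI[OF end_act_mem[OF f permutes_id] f])
  fix xs js assume xs: "homs xs js" "length xs = n"
  have "inversions id n = {}" by (auto simp: inversions_def)
  then have "koszul id n ((!) js) = 0" by (simp add: koszul_def)
  moreover have "permuted id n xs = xs" using xs(2) by (intro permuted_eqI permutes_id) auto
  ultimately show "eact n id f xs = f xs" by (simp add: end_act_app[OF f permutes_id xs])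
qed

lemma end_act_act:
  assumes f: "f \<in> ml n k" and \<sigma>: "\<sigma> permutes {..<n}" and \<tau>: "\<tau> permutes {..<n}"
  shows "eact n \<tau> (eact n \<sigma> f) = eact n (\<sigma> \<circ> \<tau>) f"
proof -
  note fs = end_act_mem[OF f \<sigma>] and st = permutes_compose[OF \<tau> \<sigma>]
  show ?thesis
  proof (rule ml_eqI[OF end_act_mem[OF fs \<tau>] end_act_mem[OF f st]])
    fix xs js assume xs: "homs xs js" "length xs = n"
    have eq: "permuted \<sigma> n (permuted \<tau> n xs) = permuted (\<sigma> \<circ> \<tau>) n xs"
      by (rule sym, rule permuted_eqI[OF st])
        (simp_all add: permuted_nth[OF \<sigma>] permuted_nth[OF \<tau>] permutes_less[OF \<tau>])
    have "sgn_pow (koszul (\<sigma> \<circ> \<tau>) n ((!) js))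
        = sgn_pow (koszul \<tau> n ((!) js) + koszul \<sigma> n ((!) (permuted \<tau> n js)))"
      by (intro sgn_pow_eqI koszul_compose[OF \<sigma> \<tau>]) (simp add: permuted_nth[OF \<tau>])
    then show "eact n \<tau> (eact n \<sigma> f) xs = eact n (\<sigma> \<circ> \<tau>) f xs"
      using end_act_app[OF f \<sigma> homs_permute[OF \<tau> xs]]
      by (simp add: end_act_app[OF fs \<tau> xs] end_act_app[OF f st xs] eq sgn_pow_add)
  qed
qed

end

lemma sum_lessThan_add:
  fixes f :: "nat \<Rightarrow> 'b::comm_monoid_add"
  shows "(\<Sum>p<a + b. f p) = (\<Sum>p<a. f p) + (\<Sum>p<b. f (a + p))"
  by (induction b) (simp_all add: add.assoc)

lemma sum_block:
  fixes f :: "nat \<Rightarrow> 'b::comm_monoid_add"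
  assumes "i < r"
  shows "(\<Sum>a<r + n - 1. f a) = (\<Sum>c<r. if c = i then (\<Sum>b<n. f (i + b)) else f (if c < i then c else c + n - 1))"
proof -
  define q where "q = r - i - 1"
  have r: "r + n - 1 = i + n + q" "r = Suc i + q" using assms by (simp_all add: q_def)
  let ?g = "\<lambda>c. if c = i then (\<Sum>b<n. f (i + b)) else f (if c < i then c else c + n - 1)"
  have "(\<Sum>c<i. ?g c) = (\<Sum>c<i. f c)" "(\<Sum>c<q. ?g (Suc i + c)) = (\<Sum>c<q. f (i + n + c))"
    by (intro sum.cong refl; simp add: ac_simps)+
  then have "(\<Sum>c<Suc i + q. ?g c) = (\<Sum>c<i. f c) + (\<Sum>b<n. f (i + b)) + (\<Sum>c<q. f (i + n + c))"
    unfolding sum_lessThan_add sum.lessThan_Suc by simp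
  then show ?thesis unfolding r(1) sum_lessThan_add r(2)[symmetric] by simp
qed

lemma permuted_block:
  assumes \<sigma>: "\<sigma> permutes {..<r}" and \<tau>: "\<tau> permutes {..<n}"
    and len: "length as = i" "length bs = n" "i + 1 + length cs = r"
  shows "permuted (block_perm i n \<sigma> \<tau>) (r + n - 1) (as @ bs @ cs)
    = take (\<sigma> i) (permuted \<sigma> r (as @ [y] @ cs)) @ permuted \<tau> n bs
      @ drop (Suc (\<sigma> i)) (permuted \<sigma> r (as @ [y] @ cs))" (is "_ = ?W")
proof (rule permuted_eqI)
  have i: "i < r" using len by simp
  note si = permutes_less[OF \<sigma> i]
  show "block_perm i n \<sigma> \<tau> permutes {..<r + n - 1}"
    by (rule block_perm_permutes[OF i \<sigma> \<tau>])
  show "length ?W = r + n - 1" using si by simp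
  let ?ys = "permuted \<sigma> r (as @ [y] @ cs)"
  have W1: "?W ! c = ?ys ! c" if "c < \<sigma> i" for c
    using that si by (simp add: nth_append)
  have W2: "?W ! (\<sigma> i + c) = permuted \<tau> n bs ! c" if "c < n" for c
    using that si by (simp add: nth_append)
  have W3: "?W ! (c + n - 1) = ?ys ! c" if "\<sigma> i < c" "c < r" for c
  proof -
    have "\<not> c + n - 1 < \<sigma> i" "\<not> c + n - 1 - \<sigma> i < n" "c + n - 1 - \<sigma> i - n = c - Suc (\<sigma> i)" "Suc (\<sigma> i + (c - Suc (\<sigma> i))) = c"
      using that by linarith+
    then show ?thesis using that si by (simp add: nth_append)
  qed
  fix a assume a: "a < r + n - 1"
  have inj: "\<sigma> b = \<sigma> c \<longleftrightarrow> b = c" for b c using permutes_inj[OF \<sigma>] by (simp add: inj_eq)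
  consider "a < i" | "i \<le> a" "a < i + n" | "i + n \<le> a" by linarith
  then show "?W ! block_perm i n \<sigma> \<tau> a = (as @ bs @ cs) ! a"
  proof cases
    case 1
    have "?ys ! \<sigma> a = as ! a" using 1 i len permuted_nth[OF \<sigma>, of a "as @ [y] @ cs"] by (simp add: nth_append)
    moreover have "\<sigma> a \<noteq> \<sigma> i" "\<sigma> a < r" using 1 i permutes_less[OF \<sigma>, of a] by (auto simp: inj)
    ultimately have "?W ! (if \<sigma> a < \<sigma> i then \<sigma> a else \<sigma> a + n - 1) = as ! a"
      using W1[of "\<sigma> a"] W3[of "\<sigma> a"] by auto
    then show ?thesis using 1 len by (simp add: block_perm_def nth_append)
  next
    case 2
    then have "\<tau> (a - i) < n" "permuted \<tau> n bs ! \<tau> (a - i) = bs ! (a - i)"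
      by (auto intro: permutes_less[OF \<tau>] permuted_nth[OF \<tau>])
    moreover have "a - i < n" using 2 by linarith
    ultimately show ?thesis using 2 len W2[of "\<tau> (a - i)"] by (simp add: block_perm_def nth_append)
  next
    case 3
    define c where "c = a + 1 - n"
    have c: "i < c" "c < r" "a - i - n = c - i - 1" using 3 a by (auto simp: c_def)
    have "?ys ! \<sigma> c = cs ! (c - i - 1)" using c len permuted_nth[OF \<sigma>, of c "as @ [y] @ cs"] by (simp add: nth_append)
    moreover have "\<sigma> c \<noteq> \<sigma> i" "\<sigma> c < r" using c permutes_less[OF \<sigma>, of c] by (auto simp: inj)
    ultimately have "?W ! (if \<sigma> c < \<sigma> i then \<sigma> c else \<sigma> c + n - 1) = cs ! (c - i - 1)"
      using W1[of "\<sigma> c"] W3[of "\<sigma> c"] by auto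
    moreover have "block_perm i n \<sigma> \<tau> a = (if \<sigma> c < \<sigma> i then \<sigma> c else \<sigma> c + n - 1)"
      using 3 by (simp add: block_perm_def c_def)
    moreover have "(as @ bs @ cs) ! a = cs ! (c - i - 1)"
    proof -
      have "\<not> a < i" "\<not> a - i < n" using 3 by linarith+
      then show ?thesis using len c(3) by (simp add: nth_append)
    qed
    ultimately show ?thesis by simp
  qed
qed

text \<open>A block permutation moves the block as a single entry, whose degree is the sum of the degrees in the
  block, and then permutes inside the block. Its inversions split accordingly.\<close>

lemma koszul_block:
  assumes \<sigma>: "\<sigma> permutes {..<r}" and \<tau>: "\<tau> permutes {..<n}" and i: "i < r"
  shows "koszul (block_perm i n \<sigma> \<tau>) (r + n - 1) e = koszul \<tau> n (\<lambda>b. e (i + b)) +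
    koszul \<sigma> r (\<lambda>c. if c = i then (\<Sum>b<n. e (i + b)) else e (if c < i then c else c + n - 1))"
    (is "koszul ?\<beta> ?N e = _ + koszul \<sigma> r ?E")
proof -
  define sh where "sh c = (if c < i then c else c + n - 1)" for c
  define G where "G a b = (if a < b \<and> ?\<beta> b < ?\<beta> a then e a * e b else 0)" for a b
  define H where "H c c' = (if c < c' \<and> \<sigma> c' < \<sigma> c then ?E c * ?E c' else 0)" for c c'
  have inj: "\<sigma> b = \<sigma> c \<longleftrightarrow> b = c" for b c using permutes_inj[OF \<sigma>] by (simp add: inj_eq)
  have \<beta>1: "?\<beta> (i + b) = \<sigma> i + \<tau> b" "\<tau> b < n" if "b < n" for b
    using that permutes_less[OF \<tau>] by (simp_all add: block_perm_def)
  have \<beta>2: "?\<beta> (sh c) = (if \<sigma> c < \<sigma> i then \<sigma> c else \<sigma> c + n - 1)" if "c \<noteq> i" for c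
  proof (cases "c < i")
    case False
    then have "\<not> c + n - 1 < i" "\<not> c + n - 1 < i + n" "c + n - 1 + 1 - n = c" using that by linarith+
    then show ?thesis using False by (simp add: block_perm_def sh_def)
  qed (simp add: block_perm_def sh_def)
  have sh_less: "sh c < sh c' \<longleftrightarrow> c < c'" if "c \<noteq> i" "c' \<noteq> i" for c c'
    using that by (auto simp: sh_def)
  have sh_i: "sh c < i + b \<longleftrightarrow> c < i" "i + b < sh c \<longleftrightarrow> i < c" if "c \<noteq> i" "b < n" for c b
    using that by (auto simp: sh_def)
  have \<beta>_less: "?\<beta> (sh c) < ?\<beta> (sh c') \<longleftrightarrow> \<sigma> c < \<sigma> c'" if "c \<noteq> i" "c' \<noteq> i" for c c'
    using that inj[of c i] inj[of c' i] unfolding \<beta>2[OF that(1)] \<beta>2[OF that(2)] by (auto split: if_splits)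
  have \<beta>_i: "?\<beta> (sh c) < ?\<beta> (i + b) \<longleftrightarrow> \<sigma> c < \<sigma> i" "?\<beta> (i + b) < ?\<beta> (sh c) \<longleftrightarrow> \<sigma> i < \<sigma> c"
    if "c \<noteq> i" "b < n" for c b
    using that inj[of c i] \<beta>1[OF that(2)] unfolding \<beta>2[OF that(1)] by (auto split: if_splits)
  have block: "(\<Sum>a<?N. f a) = (\<Sum>c<r. if c = i then (\<Sum>b<n. f (i + b)) else f (sh c))" for f :: "nat \<Rightarrow> int"
    unfolding sh_def by (rule sum_block[OF i])
  have K: "(\<Sum>b<n. \<Sum>b'<n. G (i + b) (i + b')) = koszul \<tau> n (\<lambda>b. e (i + b))"
    unfolding koszul_pairs by (intro sum.cong refl) (simp add: G_def \<beta>1)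
  have "koszul ?\<beta> ?N e = (\<Sum>a<?N. \<Sum>b<?N. G a b)"
    by (simp add: koszul_pairs G_def)
  also have "\<dots> = (\<Sum>c<r. \<Sum>c'<r. if c = i
      then (if c' = i then (\<Sum>b<n. \<Sum>b'<n. G (i + b) (i + b')) else (\<Sum>b<n. G (i + b) (sh c')))
      else (if c' = i then (\<Sum>b<n. G (sh c) (i + b)) else G (sh c) (sh c')))"
  proof -
    define G' where "G' a c' = (if c' = i then (\<Sum>b'<n. G a (i + b')) else G a (sh c'))" for a c'
    have "(\<Sum>a<?N. \<Sum>b<?N. G a b) = (\<Sum>a<?N. \<Sum>c'<r. G' a c')"
      unfolding G'_def by (intro sum.cong refl block)
    also have "\<dots> = (\<Sum>c<r. if c = i then (\<Sum>b<n. \<Sum>c'<r. G' (i + b) c') else (\<Sum>c'<r. G' (sh c) c'))"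
      by (rule block)
    also have "\<dots> = (\<Sum>c<r. \<Sum>c'<r. if c = i then (\<Sum>b<n. G' (i + b) c') else G' (sh c) c')"
      by (intro sum.cong refl) (auto intro: sum.swap)
    also have "\<dots> = (\<Sum>c<r. \<Sum>c'<r. if c = i
      then (if c' = i then (\<Sum>b<n. \<Sum>b'<n. G (i + b) (i + b')) else (\<Sum>b<n. G (i + b) (sh c')))
      else (if c' = i then (\<Sum>b<n. G (sh c) (i + b)) else G (sh c) (sh c')))"
      by (intro sum.cong refl) (simp add: G'_def)
    finally show ?thesis .
  qed
  also have "\<dots> = (\<Sum>c<r. \<Sum>c'<r. (if c = i then (if c' = i then koszul \<tau> n (\<lambda>b. e (i + b)) else 0) else 0) + H c c')"
  proof (intro sum.cong refl)
    fix c c'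
    have E: "?E c = e (sh c)" if "c \<noteq> i" for c using that by (simp add: sh_def)
    have "(\<Sum>b<n. G (i + b) (sh c')) = H i c'" if "c' \<noteq> i"
    proof -
      have "(\<Sum>b<n. G (i + b) (sh c')) = (\<Sum>b<n. if i < c' \<and> \<sigma> c' < \<sigma> i then e (i + b) * e (sh c') else 0)"
        by (intro sum.cong refl) (simp only: G_def lessThan_iff sh_i \<beta>_i that simp_thms)
      then show ?thesis unfolding H_def E[OF that]
        by (cases "i < c' \<and> \<sigma> c' < \<sigma> i") (simp_all only: if_True if_False simp_thms sum.neutral_const sum_distrib_right)
    qed
    moreover have "(\<Sum>b<n. G (sh c) (i + b)) = H c i" if "c \<noteq> i"
    proof -
      have "(\<Sum>b<n. G (sh c) (i + b)) = (\<Sum>b<n. if c < i \<and> \<sigma> i < \<sigma> c then e (sh c) * e (i + b) else 0)"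
        by (intro sum.cong refl) (simp only: G_def lessThan_iff sh_i \<beta>_i that simp_thms)
      then show ?thesis unfolding H_def E[OF that]
        by (cases "c < i \<and> \<sigma> i < \<sigma> c") (simp_all only: if_True if_False simp_thms sum.neutral_const sum_distrib_left)
    qed
    moreover have "G (sh c) (sh c') = H c c'" if "c \<noteq> i" "c' \<noteq> i"
      unfolding G_def H_def sh_less[OF that] \<beta>_less[OF that(2,1)] using that by (simp add: sh_def)
    moreover have "H i i = 0" by (simp add: H_def)
    ultimately show "(if c = i
      then (if c' = i then (\<Sum>b<n. \<Sum>b'<n. G (i + b) (i + b')) else (\<Sum>b<n. G (i + b) (sh c')))
      else (if c' = i then (\<Sum>b<n. G (sh c) (i + b)) else G (sh c) (sh c')))
      = (if c = i then (if c' = i then koszul \<tau> n (\<lambda>b. e (i + b)) else 0) else 0) + H c c'"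
      by (simp add: K)
  qed
  also have "\<dots> = (\<Sum>c<r. \<Sum>c'<r. if c = i then (if c' = i then koszul \<tau> n (\<lambda>b. e (i + b)) else 0) else 0)
      + koszul \<sigma> r ?E"
    by (simp add: sum.distrib koszul_pairs H_def)
  also have "(\<Sum>c<r. \<Sum>c'<r. if c = i then (if c' = i then koszul \<tau> n (\<lambda>b. e (i + b)) else 0) else 0)
      = (\<Sum>c<r. if c = i then koszul \<tau> n (\<lambda>b. e (i + b)) else 0)"
    using i by (intro sum.cong refl) (simp add: sum.delta)
  also have "\<dots> = koszul \<tau> n (\<lambda>b. e (i + b))" using i by (simp add: sum.delta)
  finally show ?thesis .
qed

lemma sum_list_take_nth:
  fixes js :: "int list"
  shows "p \<le> length js \<Longrightarrow> sum_list (take p js) = (\<Sum>a<p. js ! a)"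
  by (simp add: sum_list_sum_nth atLeast0LessThan)

context graded_vs begin

text \<open>Both sides evaluate \<open>f\<close> on the same list. The signs agree up to a multiple of the degree \<open>l\<close> of \<open>g\<close>,
  which enters the Koszul sign on the left and the composition sign on the right; this is the
  situation of \<open>koszul_shift\<close>.\<close>

lemma end_equivariance:
  assumes f: "f \<in> ml r k" and g: "g \<in> ml n l"
    and i: "i < r" and \<sigma>: "\<sigma> permutes {..<r}" and \<tau>: "\<tau> permutes {..<n}"
  shows "ecomp r i n l (eact r \<sigma> f) (eact n \<tau> g)
    = eact (r + n - 1) (block_perm i n \<sigma> \<tau>) (ecomp r (\<sigma> i) n l f g)"
proof -
  let ?\<beta> = "block_perm i n \<sigma> \<tau>" and ?N = "r + n - 1"
  note fs = end_act_mem[OF f \<sigma>] and gt = end_act_mem[OF g \<tau>] and si = permutes_less[OF \<sigma> i]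
  note fg = end_comp_mem[OF f g si] and \<beta> = block_perm_permutes[OF i \<sigma> \<tau>]
  show ?thesis
  proof (rule ml_eqI[OF end_comp_mem[OF fs gt i] end_act_mem[OF fg \<beta>]])
    fix xs js assume xs: "homs xs js" "length xs = ?N"
    obtain as bs cs where s: "xs = as @ bs @ cs" "length as = i" "length bs = n" "i + 1 + length cs = r"
      using list_split3[OF xs(2) i] .
    obtain ja jb jc where j: "js = ja @ jb @ jc" "homs as ja" "homs bs jb" "homs cs jc"
      using homs_append3E xs(1) s(1) by blast
    have jl: "length ja = i" "length jb = n" "i + 1 + length jc = r"
      using j s homs_length by metis+
    define bs' where "bs' = permuted \<tau> n bs"
    define y where "y = g bs'"
    define Y where "Y = sum_list jb + l"
    define K where "K = sgn_pow (koszul \<tau> n ((!) jb))"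
    define ys where "ys = permuted \<sigma> r (as @ [y] @ cs)"
    define ks where "ks = permuted \<sigma> r (ja @ [Y] @ jc)"
    have hbs': "homs bs' (permuted \<tau> n jb)" unfolding bs'_def by (rule homs_permute[OF \<tau> j(3) s(3)])
    have y: "y \<in> V Y"
      using ml_degree[OF g hbs'] sum_list_permuted[OF \<tau> jl(2)] by (simp add: y_def Y_def bs'_def)
    have hy: "homs (as @ [y] @ cs) (ja @ [Y] @ jc)" by (intro homs_append j) (simp add: y)
    have ly: "length (as @ [y] @ cs) = r" using s by simp
    have hys: "homs ys ks" unfolding ys_def ks_def by (rule homs_permute[OF \<sigma> hy ly])
    have ys_i: "ys ! \<sigma> i = y" using permuted_nth[OF \<sigma> i, of "as @ [y] @ cs"] s by (simp add: ys_def nth_append)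
    have gt_bs: "eact n \<tau> g bs = K *\<^sub>R y"
      unfolding K_def y_def bs'_def by (rule end_act_app[OF g \<tau> j(3) s(3)])
    have "ecomp r i n l (eact r \<sigma> f) (eact n \<tau> g) (as @ bs @ cs)
        = sgn_pow (l * sum_list ja) *\<^sub>R eact r \<sigma> f (as @ [K *\<^sub>R y] @ cs)"
      unfolding gt_bs[symmetric] by (rule end_comp_app[OF fs gt s(2-4) j(2-4)])
    also have "eact r \<sigma> f (as @ [K *\<^sub>R y] @ cs) = K *\<^sub>R eact r \<sigma> f (as @ [y] @ cs)"
      using lin_on_scale[OF ml_update[OF fs homs_homog[OF hy], of i] y] s by (simp add: list_update_append)
    also have "eact r \<sigma> f (as @ [y] @ cs) = sgn_pow (koszul \<sigma> r ((!) (ja @ [Y] @ jc))) *\<^sub>R f ys"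
      unfolding ys_def by (rule end_act_app[OF f \<sigma> hy ly])
    finally have L: "ecomp r i n l (eact r \<sigma> f) (eact n \<tau> g) xs =
      sgn_pow (l * sum_list ja) *\<^sub>R K *\<^sub>R sgn_pow (koszul \<sigma> r ((!) (ja @ [Y] @ jc))) *\<^sub>R f ys"
      by (simp add: s(1))
    have "eact ?N ?\<beta> (ecomp r (\<sigma> i) n l f g) (as @ bs @ cs)
        = sgn_pow (koszul ?\<beta> ?N ((!) js)) *\<^sub>R
          ecomp r (\<sigma> i) n l f g (permuted ?\<beta> ?N (as @ bs @ cs))"
      unfolding s(1)[symmetric] by (rule end_act_app[OF fg \<beta> xs])
    also have "permuted ?\<beta> ?N (as @ bs @ cs) = take (\<sigma> i) ys @ bs' @ drop (Suc (\<sigma> i)) ys"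
      unfolding ys_def bs'_def by (rule permuted_block[OF \<sigma> \<tau> s(2-4)])
    also have "ecomp r (\<sigma> i) n l f g (take (\<sigma> i) ys @ bs' @ drop (Suc (\<sigma> i)) ys) =
        sgn_pow (l * sum_list (take (\<sigma> i) ks)) *\<^sub>R f (take (\<sigma> i) ys @ [y] @ drop (Suc (\<sigma> i)) ys)"
      unfolding y_def
      by (rule end_comp_app[OF f g _ _ _ homs_take[OF hys] hbs' homs_drop[OF hys]])
        (use si in \<open>simp_all add: ys_def bs'_def\<close>)
    also have "take (\<sigma> i) ys @ [y] @ drop (Suc (\<sigma> i)) ys = ys"
      using id_take_nth_drop[of "\<sigma> i" ys] si ys_i by (simp add: ys_def)
    finally have R: "eact ?N ?\<beta> (ecomp r (\<sigma> i) n l f g) xs =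
      sgn_pow (koszul ?\<beta> ?N ((!) js)) *\<^sub>R sgn_pow (l * sum_list (take (\<sigma> i) ks)) *\<^sub>R f ys"
      by (simp add: s(1))
    define e where "e c = (if c = i then sum_list jb else (ja @ [Y] @ jc) ! c)" for c
    have "koszul ?\<beta> ?N ((!) js) = koszul \<tau> n (\<lambda>b. js ! (i + b)) +
        koszul \<sigma> r (\<lambda>c. if c = i then (\<Sum>b<n. js ! (i + b)) else js ! (if c < i then c else c + n - 1))"
      by (rule koszul_block[OF \<sigma> \<tau> i])
    also have "koszul \<tau> n (\<lambda>b. js ! (i + b)) = koszul \<tau> n ((!) jb)"
      by (rule koszul_cong) (simp add: j(1) nth_append jl)
    also have "koszul \<sigma> r (\<lambda>c. if c = i then (\<Sum>b<n. js ! (i + b)) else js ! (if c < i then c else c + n - 1))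
        = koszul \<sigma> r e"
    proof (rule koszul_cong)
      fix c assume "c < r"
      have "(\<Sum>b<n. js ! (i + b)) = sum_list jb"
        by (simp add: j(1) nth_append jl sum_list_sum_nth atLeast0LessThan)
      moreover have "js ! (c + n - 1) = (ja @ [Y] @ jc) ! c" if "i < c"
      proof -
        have "\<not> c + n - 1 < i" "\<not> c + n - 1 - i < n" "c + n - 1 - i - n = c - i - 1" using that by linarith+
        then show ?thesis using that by (simp add: j(1) nth_append jl nth_Cons')
      qed
      ultimately show "(if c = i then (\<Sum>b<n. js ! (i + b)) else js ! (if c < i then c else c + n - 1)) = e c"
        using jl by (auto simp: e_def j(1) nth_append)
    qed
    finally have kb: "koszul ?\<beta> ?N ((!) js) = koszul \<tau> n ((!) jb) + koszul \<sigma> r e" .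
    define e' where "e' c = e (inv \<sigma> c)" for c
    have e': "e' (\<sigma> a) = e a" for a by (simp add: e'_def permutes_inverses(2)[OF \<sigma>])
    have E1: "e(i := e i + l) = (!) (ja @ [Y] @ jc)"
      by (rule ext) (auto simp: e_def Y_def nth_append jl)
    have E2: "(\<Sum>a<i. e a) = sum_list ja"
      by (simp add: e_def nth_append jl sum_list_sum_nth atLeast0LessThan)
    have E3: "(\<Sum>a<\<sigma> i. e' a) = sum_list (take (\<sigma> i) ks)"
    proof -
      have "sum_list (take (\<sigma> i) ks) = (\<Sum>a<\<sigma> i. ks ! a)"
        using si by (intro sum_list_take_nth) (simp add: ks_def)
      also have "\<dots> = (\<Sum>a<\<sigma> i. e' a)"
      proof (intro sum.cong refl)
        fix a assume "a \<in> {..<\<sigma> i}"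
        then have "a < r" "inv \<sigma> a \<noteq> i" using si permutes_inverses(1)[OF \<sigma>, of a] by auto
        then show "ks ! a = e' a" by (simp add: ks_def e'_def e_def permuted_def)
      qed
      finally show ?thesis by simp
    qed
    have "even (koszul \<sigma> r ((!) (ja @ [Y] @ jc)) + l * sum_list ja)
        \<longleftrightarrow> even (koszul \<sigma> r e + l * sum_list (take (\<sigma> i) ks))"
      using koszul_shift[where \<sigma> = \<sigma> and e = e and e' = e' and l = l, OF \<sigma> i e'] unfolding E1 E2 E3 .
    then show "ecomp r i n l (eact r \<sigma> f) (eact n \<tau> g) xs
      = eact ?N ?\<beta> (ecomp r (\<sigma> i) n l f g) xs"
      unfolding L R kb K_def scaleR_scaleR sgn_pow_add[symmetric]
      by (intro arg_cong2[where f = scaleR] sgn_pow_eqI refl) auto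
  qed
qed

end

subsection \<open>The differential\<close>

locale graded_cx = graded_vs m V for m and V :: "int \<Rightarrow> 'v::real_vector set" +
  fixes d :: "'v \<Rightarrow> 'v"
  assumes complex: "cochain_complex m V d"
begin

abbreviation "ediff \<equiv> end_diff V d"

lemma d_lin: "lin_on (V k) d"
  using complex by (simp add: cochain_complex_def)

lemma d_mem: "x \<in> V k \<Longrightarrow> d x \<in> V (k + 1)"
  using complex by (auto simp: cochain_complex_def)

lemma d_d: "x \<in> homog V \<Longrightarrow> d (d x) = 0"
  using complex by (simp add: cochain_complex_def)

lemma d_0 [simp]: "d 0 = 0"
  using lin_on_zero[OF d_lin V_0] .

lemma d_homog: "x \<in> homog V \<Longrightarrow> d x \<in> homog V"
  by (metis homogE homogI d_mem)

lemma homs_d: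
  assumes "homs xs js" "p < length xs"
  shows "homs (xs[p := d (xs ! p)]) (js[p := js ! p + 1])"
  by (intro homs_update assms(1) d_mem homs_nth assms(2))

lemma end_diff_app:
  assumes f: "f \<in> ml n k" and xs: "homs xs js" "length xs = n"
  shows "ediff n k f xs = d (f xs) - sgn_pow k *\<^sub>R
    (\<Sum>p<n. sgn_pow (sum_list (take p js)) *\<^sub>R f (xs[p := d (xs ! p)]))"
proof -
  have *: "ediff n k f xs = d (f xs) - sgn_pow k *\<^sub>R
    (\<Sum>p<n. sgn_pow (deg_sum V (take p xs)) *\<^sub>R f (xs[p := d (xs ! p)]))"
    using homs_homog[OF xs(1)] xs(2) by (simp add: end_diff_def ext_map_def)
  show ?thesis
  proof (cases "0 \<in> set xs")
    case True
    then obtain q where q: "q < n" "xs ! q = 0" using xs(2) by (auto simp: in_set_conv_nth)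
    have "f (xs[p := d (xs ! p)]) = 0" if "p < n" for p
    proof (rule ml_zero[OF f])
      have "xs[p := d (xs ! p)] ! q = 0" using q xs(2) that by (simp add: nth_list_update)
      then show "0 \<in> set (xs[p := d (xs ! p)])" using q(1) xs(2) by (metis length_list_update nth_mem)
    qed
    then show ?thesis by (simp add: *)
  next
    case False
    have "sgn_pow (deg_sum V (take p xs)) = sgn_pow (sum_list (take p js))" for p
      by (rule sgn_pow_eqI, rule deg_sum_parity[OF homs_take[OF xs(1)]])
        (use False in_set_takeD in fast)
    then show ?thesis by (simp add: *)
  qed
qed

lemma end_diff_mem:
  assumes f: "f \<in> ml n k"
  shows "ediff n k f \<in> ml n (k + 1)"
proof (rule ml_memI)
  fix xs js assume xs: "homs xs js" "length xs = n"
  note jl = homs_length[OF xs(1), unfolded xs(2)]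
  have "f (xs[p := d (xs ! p)]) \<in> V (sum_list js + (k + 1))" if "p < n" for p
    using ml_degree[OF f homs_d[OF xs(1), of p]] that xs(2) sum_list_update_add[of p js 1] jl
    by (simp add: ac_simps)
  moreover have "d (f xs) \<in> V (sum_list js + (k + 1))"
    using d_mem[OF ml_degree[OF f xs]] by (simp add: algebra_simps)
  ultimately show "ediff n k f xs \<in> V (sum_list js + (k + 1))"
    unfolding end_diff_app[OF f xs] by (intro V_diff V_scale V_sum) auto
  fix q j assume q: "q < n"
  note hom = homs_homog[OF xs(1)]
  have "lin_on (V j) (\<lambda>x. d (f (xs[q := x])) - sgn_pow k *\<^sub>R
    (\<Sum>p<n. sgn_pow (sum_list (take p (js[q := j]))) *\<^sub>R f ((xs[q := x])[p := d (xs[q := x] ! p)])))"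
  proof (intro lin_on_minus lin_on_scaled lin_on_setsum)
    show "lin_on (V j) (\<lambda>x. d (f (xs[q := x])))"
    proof (rule lin_on_compose[where f = "\<lambda>x. f (xs[q := x])" and g = d])
      show "lin_on (V j) (\<lambda>x. f (xs[q := x]))" using ml_update[OF f hom] q xs(2) by simp
      show "(\<lambda>x. f (xs[q := x])) ` V j \<subseteq> V (sum_list (js[q := j]) + k)"
        using ml_degree[OF f homs_update[OF xs(1)]] xs(2) by auto
    qed (rule d_lin)
    fix p assume "p \<in> {..<n}"
    then have p: "p < n" by simp
    show "lin_on (V j) (\<lambda>x. f (xs[q := x, p := d (xs[q := x] ! p)]))"
    proof (cases "p = q")
      case True
      have "lin_on (V j) (\<lambda>x. f (xs[q := d x]))"
        by (rule lin_on_compose[OF d_lin _ ml_update[OF f hom], of _ "j + 1"]) (use q xs(2) d_mem in auto)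
      then show ?thesis using True q xs(2) by simp
    next
      case False
      have "lin_on (V j) (\<lambda>x. f (xs[p := d (xs ! p), q := x]))"
        by (rule ml_update[OF f homs_homog[OF homs_d[OF xs(1)]]]) (use p q xs(2) in auto)
      moreover have "xs[q := x, p := d (xs[q := x] ! p)] = xs[p := d (xs ! p), q := x]" for x
        using False by (simp add: list_update_swap)
      ultimately show ?thesis by simp
    qed
  qed
  then show "lin_on (V j) (\<lambda>x. ediff n k f (xs[q := x]))"
  proof (rule lin_on_cong[OF _ subspace_V])
    fix x assume "x \<in> V j"
    from end_diff_app[OF f homs_update[OF xs(1) this, of q]] xs(2)
    show "d (f (xs[q := x])) - sgn_pow k *\<^sub>R
      (\<Sum>p<n. sgn_pow (sum_list (take p (js[q := j]))) *\<^sub>R f ((xs[q := x])[p := d (xs[q := x] ! p)]))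
      = ediff n k f (xs[q := x])" by simp
  qed
qed (auto simp: end_diff_def ext_map_def)

lemma end_diff_lin: "lin_on (ml n k) (ediff n k)"
proof (rule lin_onI[OF subspace_ml])
  fix c f g assume f: "f \<in> ml n k" and g: "g \<in> ml n k"
  have fg: "c *\<^sub>R f + g \<in> ml n k" by (intro subspace_add subspace_scale subspace_ml f g)
  have "ediff n k (c *\<^sub>R f + g) xs = c *\<^sub>R ediff n k f xs + ediff n k g xs" for xs
  proof (cases "length xs = n \<and> set xs \<subseteq> homog V")
    case True
    then obtain js where xs: "homs xs js" "length xs = n" using homs_ex by blast
    show ?thesis
      using end_diff_app[OF fg xs] lin_on_comb[OF d_lin subspace_V ml_degree[OF f xs] ml_degree[OF g xs]]
      by (simp add: end_diff_app[OF f xs] end_diff_app[OF g xs] scaleR_fun_def scaleR_add_right scaleR_diff_right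
          scaleR_sum_right sum.distrib ac_simps)
  qed (auto simp: end_diff_def ext_map_def)
  then show "ediff n k (c *\<^sub>R f + g) = c *\<^sub>R ediff n k f + ediff n k g"
    by (intro ext) (simp add: scaleR_fun_def)
qed

text \<open>Differentiating two different arguments in the two possible orders gives opposite signs, since the
  second differential passes an argument whose degree has been raised by one.\<close>

lemma end_diff_diff:
  assumes f: "f \<in> ml n k"
  shows "ediff n (k + 1) (ediff n k f) = 0"
proof (rule ml_eqI[OF end_diff_mem[OF end_diff_mem[OF f]] subspace_0[OF subspace_ml]])
  fix xs js assume xs: "homs xs js" "length xs = n"
  note jl = homs_length[OF xs(1), unfolded xs(2)]
  define x' where "x' p = xs[p := d (xs ! p)]" for p
  define s where "s p = sgn_pow (sum_list (take p js))" for p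
  define F where "F p q = s p *\<^sub>R (if p < q then - s q else s q) *\<^sub>R f ((x' p)[q := d (x' p ! q)])" for p q
  have fx: "f (x' p) \<in> V (sum_list js + k + 1)" if "p < n" for p
    using ml_degree[OF f homs_d[OF xs(1), of p]] that xs(2) jl sum_list_update_add[of p js 1]
    by (simp add: x'_def algebra_simps)
  have swap: "F p q = - F q p" if "p < n" "q < n" for p q
  proof (cases "p = q")
    case True
    have "(x' p)[p := d (x' p ! p)] ! p = 0"
      using that xs(2) homog_nth[OF homs_homog[OF xs(1)], of p] by (simp add: x'_def d_d)
    then have "0 \<in> set ((x' p)[p := d (x' p ! p)])"
      using that xs(2) by (metis length_list_update nth_mem x'_def)
    then show ?thesis using True ml_zero[OF f] by (simp add: F_def)
  next
    case False
    then have "(x' p)[q := d (x' p ! q)] = (x' q)[p := d (x' q ! p)]"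
      by (simp add: x'_def list_update_swap)
    then show ?thesis using False by (auto simp: F_def mult.commute)
  qed
  have "(\<Sum>p<n. \<Sum>q<n. F p q) = (\<Sum>p<n. \<Sum>q<n. - F q p)"
    by (intro sum.cong refl swap) auto
  also have "\<dots> = - (\<Sum>p<n. \<Sum>q<n. F p q)"
    by (subst sum.swap) (simp add: sum_negf)
  finally have "2 *\<^sub>R (\<Sum>p<n. \<Sum>q<n. F p q) = 0"
    unfolding eq_neg_iff_add_eq_0 scaleR_2 .
  then have F0: "(\<Sum>p<n. \<Sum>q<n. F p q) = 0" by simp
  have inner: "ediff n k f (x' p) = d (f (x' p)) - sgn_pow k *\<^sub>R (\<Sum>q<n. s p *\<^sub>R F p q)"
    if p: "p < n" for p
  proof -
    have "ediff n k f (x' p) = d (f (x' p)) - sgn_pow k *\<^sub>R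
      (\<Sum>q<n. sgn_pow (sum_list (take q (js[p := js ! p + 1]))) *\<^sub>R f ((x' p)[q := d (x' p ! q)]))"
      unfolding x'_def by (rule end_diff_app[OF f homs_d[OF xs(1)]]) (use p xs(2) in auto)
    moreover have "sgn_pow (sum_list (take q (js[p := js ! p + 1]))) = (if p < q then - s q else s q)"
      if "q < n" for q
      using sum_list_update_add[of p "take q js" 1] p that jl
      by (cases "p < q") (auto simp: s_def take_update_swap sgn_pow_def list_update_beyond)
    moreover have "s p *\<^sub>R F p q = (if p < q then - s q else s q) *\<^sub>R f ((x' p)[q := d (x' p ! q)])" for q
      unfolding F_def s_def by simp
    ultimately show ?thesis by simp
  qed
  have dsum: "d (\<Sum>p<n. s p *\<^sub>R f (x' p)) = (\<Sum>p<n. s p *\<^sub>R d (f (x' p)))"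
  proof -
    have "d (\<Sum>p<n. s p *\<^sub>R f (x' p)) = (\<Sum>p<n. d (s p *\<^sub>R f (x' p)))"
      by (rule lin_on_sum[OF d_lin subspace_V]) (auto intro: V_scale fx)
    also have "\<dots> = (\<Sum>p<n. s p *\<^sub>R d (f (x' p)))"
      by (intro sum.cong refl lin_on_scale[OF d_lin]) (auto intro: fx)
    finally show ?thesis .
  qed
  have fs: "(\<Sum>p<n. s p *\<^sub>R f (x' p)) \<in> V (sum_list js + k + 1)"
    by (intro V_sum V_scale fx) auto
  have "ediff n (k + 1) (ediff n k f) xs = d (ediff n k f xs)
      - sgn_pow (k + 1) *\<^sub>R (\<Sum>p<n. s p *\<^sub>R ediff n k f (x' p))"
    unfolding s_def x'_def by (rule end_diff_app[OF end_diff_mem[OF f] xs])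
  also have "ediff n k f xs = d (f xs) - sgn_pow k *\<^sub>R (\<Sum>p<n. s p *\<^sub>R f (x' p))"
    unfolding s_def x'_def by (rule end_diff_app[OF f xs])
  also have "d (d (f xs) - sgn_pow k *\<^sub>R (\<Sum>p<n. s p *\<^sub>R f (x' p)))
      = - (sgn_pow k *\<^sub>R (\<Sum>p<n. s p *\<^sub>R d (f (x' p))))"
    using lin_on_diff[OF d_lin subspace_V d_mem[OF ml_degree[OF f xs]] V_scale[OF fs]]
      lin_on_scale[OF d_lin fs] d_d[OF homogI[OF ml_degree[OF f xs]]]
    by (simp add: dsum)
  also have "(\<Sum>p<n. s p *\<^sub>R ediff n k f (x' p))
    = (\<Sum>p<n. s p *\<^sub>R d (f (x' p))) - sgn_pow k *\<^sub>R (\<Sum>p<n. \<Sum>q<n. F p q)"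
  proof -
    have "s p *\<^sub>R ediff n k f (x' p) = s p *\<^sub>R d (f (x' p)) - sgn_pow k *\<^sub>R (\<Sum>q<n. F p q)" if "p < n" for p
      using that by (simp add: inner scaleR_diff_right scaleR_sum_right s_def mult.left_commute[of _ "sgn_pow k"])
    then show ?thesis by (simp add: sum_subtractf scaleR_sum_right)
  qed
  finally show "ediff n (k + 1) (ediff n k f) xs = 0 xs"
    by (simp add: F0 sgn_pow_def)
qed

lemma end_diff_act:
  assumes f: "f \<in> ml n k" and \<sigma>: "\<sigma> permutes {..<n}"
  shows "ediff n k (eact n \<sigma> f) = eact n \<sigma> (ediff n k f)"
proof -
  note fs = end_act_mem[OF f \<sigma>] and df = end_diff_mem[OF f]
  show ?thesis
  proof (rule ml_eqI[OF end_diff_mem[OF fs] end_act_mem[OF df \<sigma>]])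
    fix xs js assume xs: "homs xs js" "length xs = n"
    note jl = homs_length[OF xs(1), unfolded xs(2)]
    define ys where "ys = permuted \<sigma> n xs"
    define ks where "ks = permuted \<sigma> n js"
    define K where "K = koszul \<sigma> n ((!) js)"
    have ys: "homs ys ks" "length ys = n" unfolding ys_def ks_def by (simp_all add: homs_permute[OF \<sigma> xs])
    have summand: "sgn_pow (sum_list (take p js)) *\<^sub>R eact n \<sigma> f (xs[p := d (xs ! p)])
        = sgn_pow K *\<^sub>R sgn_pow (sum_list (take (\<sigma> p) ks)) *\<^sub>R f (ys[\<sigma> p := d (ys ! \<sigma> p)])"
      if p: "p < n" for p
    proof -
      have 1: "eact n \<sigma> f (xs[p := d (xs ! p)]) = sgn_pow (koszul \<sigma> n ((!) (js[p := js ! p + 1]))) *\<^sub>R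
          f (permuted \<sigma> n (xs[p := d (xs ! p)]))"
        by (rule end_act_app[OF f \<sigma> homs_d[OF xs(1)]]) (use p xs(2) in auto)
      have 2: "permuted \<sigma> n (xs[p := d (xs ! p)]) = ys[\<sigma> p := d (ys ! \<sigma> p)]"
        using permuted_update[OF \<sigma> p xs(2)] permuted_nth[OF \<sigma> p, of xs] by (simp add: ys_def)
      have 3: "koszul \<sigma> n (((!) js)(p := js ! p + 1)) = koszul \<sigma> n ((!) (js[p := js ! p + 1]))"
        by (rule koszul_cong) (simp add: jl)
      have 4: "(\<Sum>a<p. js ! a) = sum_list (take p js)" "(\<Sum>a<\<sigma> p. ks ! a) = sum_list (take (\<sigma> p) ks)"
        using p permutes_less[OF \<sigma> p] by (simp_all add: sum_list_take_nth jl ks_def)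
      have "ks ! \<sigma> a = js ! a" if "a < n" for a
        using permuted_nth[OF \<sigma> that] by (simp add: ks_def)
      from koszul_shift[where \<sigma> = \<sigma> and e = "(!) js" and e' = "(!) ks" and l = 1, OF \<sigma> p this]
      have "sgn_pow (koszul \<sigma> n ((!) (js[p := js ! p + 1])) + sum_list (take p js))
          = sgn_pow (K + sum_list (take (\<sigma> p) ks))"
        by (intro sgn_pow_eqI) (simp add: 3 4 K_def)
      then show ?thesis by (simp add: 1 2 sgn_pow_add mult.commute)
    qed
    have "(\<Sum>p<n. sgn_pow (sum_list (take p js)) *\<^sub>R eact n \<sigma> f (xs[p := d (xs ! p)]))
        = (\<Sum>p<n. sgn_pow K *\<^sub>R sgn_pow (sum_list (take (\<sigma> p) ks)) *\<^sub>R f (ys[\<sigma> p := d (ys ! \<sigma> p)]))"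
      by (intro sum.cong refl summand) simp
    also have "\<dots> = (\<Sum>q<n. sgn_pow K *\<^sub>R sgn_pow (sum_list (take q ks)) *\<^sub>R f (ys[q := d (ys ! q)]))"
      by (rule sum.permute[OF \<sigma>, of "\<lambda>q. sgn_pow K *\<^sub>R sgn_pow (sum_list (take q ks)) *\<^sub>R f (ys[q := d (ys ! q)])",
            unfolded o_def, symmetric])
    finally have sum: "(\<Sum>p<n. sgn_pow (sum_list (take p js)) *\<^sub>R eact n \<sigma> f (xs[p := d (xs ! p)]))
        = sgn_pow K *\<^sub>R (\<Sum>q<n. sgn_pow (sum_list (take q ks)) *\<^sub>R f (ys[q := d (ys ! q)]))"
      by (simp add: scaleR_sum_right)
    have "eact n \<sigma> f xs = sgn_pow K *\<^sub>R f ys"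
      unfolding K_def ys_def by (rule end_act_app[OF f \<sigma> xs])
    moreover have "eact n \<sigma> (ediff n k f) xs = sgn_pow K *\<^sub>R ediff n k f ys"
      unfolding K_def ys_def by (rule end_act_app[OF df \<sigma> xs])
    ultimately show "ediff n k (eact n \<sigma> f) xs = eact n \<sigma> (ediff n k f) xs"
      using lin_on_scale[OF d_lin ml_degree[OF f ys], of "sgn_pow K"]
      by (simp add: end_diff_app[OF fs xs] end_diff_app[OF f ys] sum scaleR_diff_right mult.commute)
  qed
qed

text \<open>The terms on the left differentiate the output or one of the arguments in front of, inside, or behind
  the inner operation. The terms where the value of \<open>g\<close> is differentiated occur twice on the right,
  with opposite signs.\<close>

lemma end_diff_comp:
  assumes f: "f \<in> ml r k" and g: "g \<in> ml n l" and i: "i < r"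
  shows "ediff (r + n - 1) (k + l) (ecomp r i n l f g)
    = ecomp r i n l (ediff r k f) g
      + sgn_pow k *\<^sub>R ecomp r i n (l + 1) f (ediff n l g)"
proof -
  note df = end_diff_mem[OF f] and dg = end_diff_mem[OF g] and fg = end_comp_mem[OF f g i]
  have m1: "ecomp r i n l (ediff r k f) g \<in> ml (r + n - 1) (k + l + 1)"
    using end_comp_mem[OF df g i] by (simp add: algebra_simps)
  have m2: "ecomp r i n (l + 1) f (ediff n l g) \<in> ml (r + n - 1) (k + l + 1)"
    using end_comp_mem[OF f dg i] by (simp add: algebra_simps)
  show ?thesis
  proof (rule ml_eqI[OF end_diff_mem[OF fg] subspace_add[OF subspace_ml m1 subspace_scale[OF subspace_ml m2]]])
    fix xs js assume xs: "homs xs js" "length xs = r + n - 1"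
    obtain as bs cs where s: "xs = as @ bs @ cs" "length as = i" "length bs = n" "i + 1 + length cs = r"
      using list_split3[OF xs(2) i] .
    obtain ja jb jc where j: "js = ja @ jb @ jc" "homs as ja" "homs bs jb" "homs cs jc"
      using homs_append3E xs(1) s(1) by blast
    define q where "q = length cs"
    have jl: "length ja = i" "length jb = n" "length jc = q"
      using j s homs_length by (metis q_def)+
    have N: "r + n - 1 = i + n + q" "r = Suc i + q" using s(4) by (simp_all add: q_def)
    define y where "y = g bs"
    define Y where "Y = sum_list jb + l"
    have y: "y \<in> V Y" using ml_degree[OF g j(3) s(3)] by (simp add: y_def Y_def)
    have hy: "homs (as @ [y] @ cs) (ja @ [Y] @ jc)" by (intro homs_append j) (simp add: y)
    have ly: "length (as @ [y] @ cs) = r" using s by simp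
    define J where "J = sum_list ja"
    define Z where "Z = d (f (as @ [y] @ cs))"
    define Dy where "Dy = f (as @ [d y] @ cs)"
    define SA where "SA = (\<Sum>p<i. sgn_pow (sum_list (take p ja)) *\<^sub>R f (as[p := d (as ! p)] @ [y] @ cs))"
    define SB where "SB = (\<Sum>b<n. sgn_pow (sum_list (take b jb)) *\<^sub>R f (as @ [g (bs[b := d (bs ! b)])] @ cs))"
    define SC where "SC = (\<Sum>c<q. sgn_pow (sum_list (take c jc)) *\<^sub>R f (as @ [y] @ cs[c := d (cs ! c)]))"
    define T where "T p = sgn_pow (sum_list (take p js)) *\<^sub>R ecomp r i n l f g (xs[p := d (xs ! p)])" for p
    have T1: "T p = sgn_pow (l * (J + 1)) *\<^sub>R sgn_pow (sum_list (take p ja)) *\<^sub>R f (as[p := d (as ! p)] @ [y] @ cs)"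
      if "p < i" for p
    proof -
      have "xs[p := d (xs ! p)] = as[p := d (as ! p)] @ bs @ cs" "take p js = take p ja"
        using that s jl by (simp_all add: list_update_append nth_append j(1))
      moreover have "ecomp r i n l f g (as[p := d (as ! p)] @ bs @ cs)
        = sgn_pow (l * sum_list (ja[p := ja ! p + 1])) *\<^sub>R f (as[p := d (as ! p)] @ [g bs] @ cs)"
        by (rule end_comp_app[OF f g _ s(3,4) homs_d[OF j(2)] j(3,4)]) (use that s in auto)
      ultimately show ?thesis
        using that jl sum_list_update_add[of p ja 1] by (simp add: T_def J_def y_def mult.commute)
    qed
    have T2: "T (i + b) = sgn_pow (J + l * J) *\<^sub>R sgn_pow (sum_list (take b jb)) *\<^sub>R f (as @ [g (bs[b := d (bs ! b)])] @ cs)"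
      if "b < n" for b
    proof -
      have "xs[i + b := d (xs ! (i + b))] = as @ bs[b := d (bs ! b)] @ cs" "take (i + b) js = ja @ take b jb"
        using that s jl by (simp_all add: list_update_append nth_append j(1))
      moreover have "ecomp r i n l f g (as @ bs[b := d (bs ! b)] @ cs)
        = sgn_pow (l * sum_list ja) *\<^sub>R f (as @ [g (bs[b := d (bs ! b)])] @ cs)"
        by (rule end_comp_app[OF f g s(2) _ s(4) j(2) homs_d[OF j(3)] j(4)]) (use that s in auto)
      ultimately show ?thesis by (simp add: T_def J_def sgn_pow_add ac_simps)
    qed
    have T3: "T (i + n + c) = sgn_pow (J + sum_list jb + l * J) *\<^sub>R sgn_pow (sum_list (take c jc)) *\<^sub>R f (as @ [y] @ cs[c := d (cs ! c)])"
      if "c < q" for c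
    proof -
      have "xs[i + n + c := d (xs ! (i + n + c))] = as @ bs @ cs[c := d (cs ! c)]" "take (i + n + c) js = ja @ jb @ take c jc"
        using that s jl by (simp_all add: list_update_append nth_append j(1))
      moreover have "ecomp r i n l f g (as @ bs @ cs[c := d (cs ! c)])
        = sgn_pow (l * sum_list ja) *\<^sub>R f (as @ [g bs] @ cs[c := d (cs ! c)])"
        by (rule end_comp_app[OF f g s(2,3) _ j(2,3) homs_d[OF j(4)]]) (use that s q_def in auto)
      ultimately show ?thesis by (simp add: T_def J_def y_def sgn_pow_add ac_simps)
    qed
    have "ediff (r + n - 1) (k + l) (ecomp r i n l f g) xs
      = d (ecomp r i n l f g xs) - sgn_pow (k + l) *\<^sub>R (\<Sum>p<r + n - 1. T p)"
      unfolding T_def by (rule end_diff_app[OF fg xs])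
    also have "(\<Sum>p<r + n - 1. T p) = (\<Sum>p<i. T p) + (\<Sum>b<n. T (i + b)) + (\<Sum>c<q. T (i + n + c))"
      unfolding N(1) sum_lessThan_add ..
    also have "\<dots> = sgn_pow (l * (J + 1)) *\<^sub>R SA + sgn_pow (J + l * J) *\<^sub>R SB + sgn_pow (J + sum_list jb + l * J) *\<^sub>R SC"
      unfolding SA_def SB_def SC_def scaleR_sum_right
      by (intro arg_cong2[where f = "(+)"] sum.cong refl T1 T2 T3) auto
    also have "d (ecomp r i n l f g xs) = sgn_pow (l * J) *\<^sub>R Z"
      using end_comp_app[OF f g s(2-4) j(2-4)] lin_on_scale[OF d_lin ml_degree[OF f hy ly], of "sgn_pow (l * J)"]
      by (simp add: s(1) J_def Z_def y_def)
    finally have L: "ediff (r + n - 1) (k + l) (ecomp r i n l f g) xs =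
      sgn_pow (l * J) *\<^sub>R Z - sgn_pow (k + l) *\<^sub>R (sgn_pow (l * (J + 1)) *\<^sub>R SA + sgn_pow (J + l * J) *\<^sub>R SB
        + sgn_pow (J + sum_list jb + l * J) *\<^sub>R SC)" .
    define U where "U p = sgn_pow (sum_list (take p (ja @ [Y] @ jc))) *\<^sub>R
      f ((as @ [y] @ cs)[p := d ((as @ [y] @ cs) ! p)])" for p
    have U1: "U p = sgn_pow (sum_list (take p ja)) *\<^sub>R f (as[p := d (as ! p)] @ [y] @ cs)" if "p < i" for p
      using that s jl by (simp add: U_def list_update_append nth_append)
    have U2: "U i = sgn_pow J *\<^sub>R Dy"
      using s jl by (simp add: U_def list_update_append nth_append Dy_def J_def)
    have U3: "U (Suc i + c) = sgn_pow (J + Y) *\<^sub>R sgn_pow (sum_list (take c jc)) *\<^sub>R f (as @ [y] @ cs[c := d (cs ! c)])" for c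
      using s jl list_update_tail[of as y cs c] by (simp add: U_def nth_append J_def sgn_pow_add ac_simps)
    have "ediff r k f (as @ [y] @ cs) = Z - sgn_pow k *\<^sub>R (\<Sum>p<r. U p)"
      unfolding U_def Z_def by (rule end_diff_app[OF f hy ly])
    also have "(\<Sum>p<r. U p) = (\<Sum>p<i. U p) + U i + (\<Sum>c<q. U (Suc i + c))"
      unfolding N(2) sum_lessThan_add sum.lessThan_Suc ..
    also have "\<dots> = SA + sgn_pow J *\<^sub>R Dy + sgn_pow (J + Y) *\<^sub>R SC"
      unfolding SA_def SC_def scaleR_sum_right U2 U3 using U1 by simp
    finally have R1: "ecomp r i n l (ediff r k f) g xs = sgn_pow (l * J) *\<^sub>R
      (Z - sgn_pow k *\<^sub>R (SA + sgn_pow J *\<^sub>R Dy + sgn_pow (J + Y) *\<^sub>R SC))"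
      using end_comp_app[OF df g s(2-4) j(2-4)] by (simp add: s(1) J_def y_def)
    have lin: "lin_on (V (Y + 1)) (\<lambda>z. f (as @ [z] @ cs))"
      using ml_update[OF f homs_homog[OF hy], of i] s by (simp add: list_update_append)
    have gb: "g (bs[b := d (bs ! b)]) \<in> V (Y + 1)" if "b < n" for b
      using ml_degree[OF g homs_d[OF j(3)], of b] that s jl sum_list_update_add[of b jb 1]
      by (simp add: Y_def algebra_simps)
    have sgb: "(\<Sum>b<n. sgn_pow (sum_list (take b jb)) *\<^sub>R g (bs[b := d (bs ! b)])) \<in> V (Y + 1)"
      by (intro V_sum V_scale gb) auto
    have "ediff n l g bs = d y - sgn_pow l *\<^sub>R (\<Sum>b<n. sgn_pow (sum_list (take b jb)) *\<^sub>R g (bs[b := d (bs ! b)]))"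
      unfolding y_def by (rule end_diff_app[OF g j(3) s(3)])
    then have "f (as @ [ediff n l g bs] @ cs)
      = Dy - sgn_pow l *\<^sub>R f (as @ [\<Sum>b<n. sgn_pow (sum_list (take b jb)) *\<^sub>R g (bs[b := d (bs ! b)])] @ cs)"
      using lin_on_diff[OF lin subspace_V d_mem[OF y] V_scale[OF sgb]] lin_on_scale[OF lin sgb] by (simp add: Dy_def)
    also have "f (as @ [\<Sum>b<n. sgn_pow (sum_list (take b jb)) *\<^sub>R g (bs[b := d (bs ! b)])] @ cs) = SB"
    proof -
      have "f (as @ [\<Sum>b<n. sgn_pow (sum_list (take b jb)) *\<^sub>R g (bs[b := d (bs ! b)])] @ cs)
        = (\<Sum>b<n. f (as @ [sgn_pow (sum_list (take b jb)) *\<^sub>R g (bs[b := d (bs ! b)])] @ cs))"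
        by (rule lin_on_sum[OF lin subspace_V]) (auto intro: V_scale gb)
      also have "\<dots> = SB" unfolding SB_def by (intro sum.cong refl lin_on_scale[OF lin] gb) auto
      finally show ?thesis .
    qed
    finally have R2: "ecomp r i n (l + 1) f (ediff n l g) xs
      = sgn_pow ((l + 1) * J) *\<^sub>R (Dy - sgn_pow l *\<^sub>R SB)"
      using end_comp_app[OF f dg s(2-4) j(2-4)] by (simp add: s(1) J_def)
    show "ediff (r + n - 1) (k + l) (ecomp r i n l f g) xs =
      (ecomp r i n l (ediff r k f) g
        + sgn_pow k *\<^sub>R ecomp r i n (l + 1) f (ediff n l g)) xs"
      unfolding plus_fun_apply scaleR_fun_def L R1 R2 Y_def
      by (simp add: sgn_pow_def algebra_simps)
  qed
qed

theorem dg_operad_End: "dg_operad (End_operad V d)"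
  unfolding dg_operad_def End_operad_def operad.simps
  apply (intro conjI allI impI ballI; (elim conjE)?)
  subgoal by (rule subspace_ml)
  subgoal by (rule end_unit_mem)
  subgoal by (rule end_comp_mem)
  subgoal by (rule end_comp_lin_right)
  subgoal by (rule end_comp_lin_left)
  subgoal by (rule end_unit_left)
  subgoal by (rule end_unit_right)
  subgoal by (rule end_assoc_seq)
  subgoal by (rule end_assoc_par)
  subgoal by (auto intro: end_act_mem)
  subgoal by (rule end_act_lin)
  subgoal by (rule end_act_id)
  subgoal by (rule end_act_act)
  subgoal by (rule end_equivariance)
  subgoal by (auto intro: end_diff_mem)
  subgoal by (rule end_diff_lin)
  subgoal by (rule end_diff_diff)
  subgoal by (rule end_diff_act)
  subgoal by (rule end_diff_comp)
  done

end

section \<open>The universal property of the presented operad\<close>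

primrec interp :: "'q::real_vector operad \<Rightarrow> 'q \<Rightarrow> (nat \<Rightarrow> 'q) \<Rightarrow> expr \<Rightarrow> 'q" where
  "interp Q \<mu> \<iota> EMu = \<mu>"
| "interp Q \<mu> \<iota> (EI n) = \<iota> n"
| "interp Q \<mu> \<iota> EId = opid Q"
| "interp Q \<mu> \<iota> (EComp s i t) =
    opcomp Q (earity s) (edeg s) i (earity t) (edeg t) (interp Q \<mu> \<iota> s) (interp Q \<mu> \<iota> t)"
| "interp Q \<mu> \<iota> (EAct s \<sigma>) = opact Q (earity s) (edeg s) \<sigma> (interp Q \<mu> \<iota> s)"
| "interp Q \<mu> \<iota> (EDiff s) = opdiff Q (earity s) (edeg s) (interp Q \<mu> \<iota> s)"

text \<open>These are the data that determine a morphism from the presented operad to \<open>Q\<close>.\<close>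

locale ecbv_presentation =
  fixes Q :: "'q::real_vector operad" and \<mu> :: 'q and \<iota> :: "nat \<Rightarrow> 'q"
  assumes dg: "dg_operad Q"
    and mu_mem: "\<mu> \<in> opc Q 2 0"
    and iota_mem: "1 \<le> n \<Longrightarrow> \<iota> n \<in> opc Q 1 (- 2 * int n)"
    and rel_mu_sym: "opact Q 2 0 (Transposition.transpose 0 1) \<mu> = \<mu>"
    and rel_mu_assoc: "opcomp Q 2 0 0 2 0 \<mu> \<mu> = opcomp Q 2 0 1 2 0 \<mu> \<mu>"
    and rel_mu_closed: "opdiff Q 2 0 \<mu> = 0"
    and rel_order: "1 \<le> n \<Longrightarrow> linext (interp Q \<mu> \<iota>) (order_rel n (n + 1)) = 0"
    and rel_commute: "1 \<le> n \<Longrightarrow> 1 \<le> k \<Longrightarrow>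
      opcomp Q 1 (- 2 * int n) 0 1 (- 2 * int k) (\<iota> n) (\<iota> k) = opcomp Q 1 (- 2 * int k) 0 1 (- 2 * int n) (\<iota> k) (\<iota> n)"
    and rel_exact: "2 \<le> n \<Longrightarrow>
      (\<Sum>j = 1..n - 1. opcomp Q 1 (- 2 * int j) 0 1 (- 2 * int (n - j) + 1) (\<iota> j) (opdiff Q 1 (- 2 * int (n - j)) (\<iota> (n - j)))
        - opcomp Q 1 (- 2 * int (n - j) + 1) 0 1 (- 2 * int j) (opdiff Q 1 (- 2 * int (n - j)) (\<iota> (n - j))) (\<iota> j)) = 0"
begin

abbreviation "ev \<equiv> interp Q \<mu> \<iota>"

lemma
  shows sub: "subspace (opc Q n k)"
    and id_mem: "opid Q \<in> opc Q 1 0"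
    and comp_mem: "i < r \<Longrightarrow> x \<in> opc Q r k \<Longrightarrow> y \<in> opc Q n l \<Longrightarrow> opcomp Q r k i n l x y \<in> opc Q (r + n - 1) (k + l)"
    and comp_lin_right: "i < r \<Longrightarrow> x \<in> opc Q r k \<Longrightarrow> lin_on (opc Q n l) (\<lambda>y. opcomp Q r k i n l x y)"
    and comp_lin_left: "i < r \<Longrightarrow> y \<in> opc Q n l \<Longrightarrow> lin_on (opc Q r k) (\<lambda>x. opcomp Q r k i n l x y)"
    and id_left: "x \<in> opc Q n k \<Longrightarrow> opcomp Q 1 0 0 n k (opid Q) x = x"
    and id_right: "i < n \<Longrightarrow> x \<in> opc Q n k \<Longrightarrow> opcomp Q n k i 1 0 x (opid Q) = x"
    and q_assoc_seq: "i < r \<Longrightarrow> j < n \<Longrightarrow> x \<in> opc Q r k \<Longrightarrow> y \<in> opc Q n l \<Longrightarrow> z \<in> opc Q s q \<Longrightarrow>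
        opcomp Q (r + n - 1) (k + l) (i + j) s q (opcomp Q r k i n l x y) z =
        opcomp Q r k i (n + s - 1) (l + q) x (opcomp Q n l j s q y z)"
    and q_assoc_par: "i < j \<Longrightarrow> j < r \<Longrightarrow> x \<in> opc Q r k \<Longrightarrow> y \<in> opc Q n l \<Longrightarrow> z \<in> opc Q s q \<Longrightarrow>
        opcomp Q (r + n - 1) (k + l) (j + n - 1) s q (opcomp Q r k i n l x y) z =
        sgn_pow (l * q) *\<^sub>R
        opcomp Q (r + s - 1) (k + q) i n l (opcomp Q r k j s q x z) y"
    and act_mem: "\<sigma> permutes {..<n} \<Longrightarrow> x \<in> opc Q n k \<Longrightarrow> opact Q n k \<sigma> x \<in> opc Q n k"
    and act_lin: "\<sigma> permutes {..<n} \<Longrightarrow> lin_on (opc Q n k) (opact Q n k \<sigma>)"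
    and q_act_id: "x \<in> opc Q n k \<Longrightarrow> opact Q n k id x = x"
    and q_act_act: "\<sigma> permutes {..<n} \<Longrightarrow> \<tau> permutes {..<n} \<Longrightarrow> x \<in> opc Q n k \<Longrightarrow>
        opact Q n k \<tau> (opact Q n k \<sigma> x) = opact Q n k (\<sigma> \<circ> \<tau>) x"
    and q_equivariance: "i < r \<Longrightarrow> \<sigma> permutes {..<r} \<Longrightarrow> \<tau> permutes {..<n} \<Longrightarrow> x \<in> opc Q r k \<Longrightarrow> y \<in> opc Q n l \<Longrightarrow>
        opcomp Q r k i n l (opact Q r k \<sigma> x) (opact Q n l \<tau> y) =
        opact Q (r + n - 1) (k + l) (block_perm i n \<sigma> \<tau>) (opcomp Q r k (\<sigma> i) n l x y)"
    and diff_mem: "x \<in> opc Q n k \<Longrightarrow> opdiff Q n k x \<in> opc Q n (k + 1)"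
    and diff_lin: "lin_on (opc Q n k) (opdiff Q n k)"
    and q_diff_diff: "x \<in> opc Q n k \<Longrightarrow> opdiff Q n (k + 1) (opdiff Q n k x) = 0"
    and q_diff_act: "\<sigma> permutes {..<n} \<Longrightarrow> x \<in> opc Q n k \<Longrightarrow>
        opdiff Q n k (opact Q n k \<sigma> x) = opact Q n (k + 1) \<sigma> (opdiff Q n k x)"
    and q_diff_comp: "i < r \<Longrightarrow> x \<in> opc Q r k \<Longrightarrow> y \<in> opc Q n l \<Longrightarrow>
        opdiff Q (r + n - 1) (k + l) (opcomp Q r k i n l x y) =
        opcomp Q r (k + 1) i n l (opdiff Q r k x) y + sgn_pow k *\<^sub>R opcomp Q r k i n (l + 1) x (opdiff Q n l y)"
  using dg unfolding dg_operad_def image_subset_iff by simp_all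

lemma ev_mem: "t \<in> exprs n k \<Longrightarrow> ev t \<in> opc Q n k"
proof (induction t arbitrary: n k)
  case (EComp s i t)
  then show ?case using comp_mem[of i "earity s" "ev s" "edeg s" "ev t" "earity t" "edeg t"]
    by (simp add: exprs_def)
next
  case (EDiff t)
  then show ?case using diff_mem[of "ev t" "earity t" "edeg t"] by (auto simp: exprs_def)
next
  case EMu
  then show ?case using mu_mem by (simp add: exprs_def)
next
  case (EI i)
  then have "1 \<le> i" "n = 1" "k = - 2 * int i" by (auto simp: exprs_def)
  then show ?case using iota_mem[of i] by simp
next
  case EId
  then show ?case using id_mem by (simp add: exprs_def)
next
  case (EAct t \<sigma>)
  then show ?case using act_mem[of \<sigma> n "ev t" k] by (auto simp: exprs_def)
qed

abbreviation "Ev \<equiv> linext ev"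

lemma Ev_add: "Ev (x + y) = Ev x + Ev y"
  and Ev_diff: "Ev (x - y) = Ev x - Ev y"
  and Ev_scale: "Ev (c *\<^sub>R x) = c *\<^sub>R Ev x"
  and Ev_0: "Ev 0 = 0"
  and Ev_sum: "Ev (sum f I) = (\<Sum>i\<in>I. Ev (f i))"
  by (simp_all add: linear_linext linear_add linear_diff linear_scale linear_0 linear_sum)

lemma Ev_basis: "Ev (basis_elt t) = ev t" by simp

lemma Ev_mem: "x \<in> fexprs n k \<Longrightarrow> Ev x \<in> opc Q n k"
  unfolding fexprs_eq_span by (erule linear_maps_span[OF linear_linext _ _ sub]) (auto simp: ev_mem)

lemma fexprs_linear_eq:
  assumes "x \<in> fexprs n k" "lin_on (fexprs n k) f" "lin_on (fexprs n k) g"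
    and "\<And>t. t \<in> exprs n k \<Longrightarrow> f (basis_elt t) = g (basis_elt t)"
  shows "f x = g x"
proof -
  have "x \<in> fexprs n k \<and> f x = g x"
    using assms(1)[unfolded fexprs_eq_span]
  proof (induction rule: span_induct_alt)
    case base
    then show ?case using lin_on_zero[OF assms(2)] lin_on_zero[OF assms(3)] subspace_0[OF subspace_fexprs] by simp
  next
    case (step c x y)
    then obtain t where t: "x = basis_elt t" "t \<in> exprs n k" by auto
    then have x: "x \<in> fexprs n k" by simp
    then have cx: "c *\<^sub>R x \<in> fexprs n k" by (rule subspace_scale[OF subspace_fexprs])
    then show ?case
      using step t x assms(4) lin_on_add[OF assms(2) cx] lin_on_add[OF assms(3) cx]
        lin_on_scale[OF assms(2) x] lin_on_scale[OF assms(3) x]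
      by (simp add: subspace_add[OF subspace_fexprs])
  qed
  then show ?thesis by simp
qed

lemma lin_on_linear: "linear f \<Longrightarrow> lin_on S f"
  by (simp add: lin_on_def linear_add linear_scale)

lemma Ev_comp:
  assumes x: "x \<in> fexprs r k" and y: "y \<in> fexprs n l" and i: "i < r"
  shows "Ev (expr_comp i x y) = opcomp Q r k i n l (Ev x) (Ev y)"
proof (rule fexprs_linear_eq[OF x])
  show "lin_on (fexprs r k) (\<lambda>x. Ev (expr_comp i x y))"
    using linear_compose[OF linear_expr_comp_left linear_linext] by (intro lin_on_linear) (simp add: o_def)
  show "lin_on (fexprs r k) (\<lambda>x. opcomp Q r k i n l (Ev x) (Ev y))"
    by (rule lin_on_compose[OF lin_on_linear[OF linear_linext] _ comp_lin_left[OF i Ev_mem[OF y]]])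
      (auto intro: Ev_mem)
  fix s assume s: "s \<in> exprs r k"
  then have s': "Ev (basis_elt s) \<in> opc Q r k" by (simp add: ev_mem)
  show "Ev (expr_comp i (basis_elt s) y) = opcomp Q r k i n l (Ev (basis_elt s)) (Ev y)"
  proof (rule fexprs_linear_eq[OF y])
    show "lin_on (fexprs n l) (\<lambda>y. Ev (expr_comp i (basis_elt s) y))"
      using linear_compose[OF linear_expr_comp_right linear_linext] by (intro lin_on_linear) (simp add: o_def)
    show "lin_on (fexprs n l) (\<lambda>y. opcomp Q r k i n l (Ev (basis_elt s)) (Ev y))"
      by (rule lin_on_compose[OF lin_on_linear[OF linear_linext] _ comp_lin_right[OF i s']])
        (auto intro: Ev_mem)
    fix t assume "t \<in> exprs n l"
    then show "Ev (expr_comp i (basis_elt s) (basis_elt t)) = opcomp Q r k i n l (Ev (basis_elt s)) (Ev (basis_elt t))"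
      using s i by (simp add: expr_basis_simps exprs_def)
  qed
qed

lemma Ev_perm:
  assumes x: "x \<in> fexprs n k" and \<sigma>: "\<sigma> permutes {..<n}"
  shows "Ev (expr_perm \<sigma> x) = opact Q n k \<sigma> (Ev x)"
proof (rule fexprs_linear_eq[OF x])
  show "lin_on (fexprs n k) (\<lambda>x. Ev (expr_perm \<sigma> x))"
    using linear_compose[OF linear_expr_perm linear_linext] by (intro lin_on_linear) (simp add: o_def)
  show "lin_on (fexprs n k) (\<lambda>x. opact Q n k \<sigma> (Ev x))"
    by (rule lin_on_compose[OF lin_on_linear[OF linear_linext] _ act_lin[OF \<sigma>]]) (auto intro: Ev_mem)
qed (use \<sigma> in \<open>simp add: expr_basis_simps exprs_def\<close>)

lemma Ev_expr_diff:
  assumes x: "x \<in> fexprs n k"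
  shows "Ev (expr_diff x) = opdiff Q n k (Ev x)"
proof (rule fexprs_linear_eq[OF x])
  show "lin_on (fexprs n k) (\<lambda>x. Ev (expr_diff x))"
    using linear_compose[OF linear_expr_diff linear_linext] by (intro lin_on_linear) (simp add: o_def)
  show "lin_on (fexprs n k) (\<lambda>x. opdiff Q n k (Ev x))"
    by (rule lin_on_compose[OF lin_on_linear[OF linear_linext] _ diff_lin]) (auto intro: Ev_mem)
qed (simp add: expr_basis_simps exprs_def)

text \<open>Relations of DG operads hold because the target is a DG operad, the defining relations by assumption,
  and the closure rules by linearity. Hence evaluation descends to the quotient.\<close>

lemma Ev_null: "ecbv_null n k x \<Longrightarrow> Ev x = 0"
proof (induction rule: ecbv_null.induct)
  case (comp_left n k x t r l i)
  have "Ev (basis_elt t) \<in> opc Q r l" using comp_left.hyps by (simp add: ev_mem)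
  from lin_on_zero[OF comp_lin_left[OF comp_left.hyps(3) this] subspace_0[OF sub]]
  show ?case
    using comp_left Ev_comp[OF ecbv_null_fexprs, of n k x "basis_elt t" r l i] by simp
next
  case (comp_right n k x s r l i)
  have "Ev (basis_elt s) \<in> opc Q r l" using comp_right.hyps by (simp add: ev_mem)
  from lin_on_zero[OF comp_lin_right[OF comp_right.hyps(3) this] subspace_0[OF sub]]
  show ?case
    using comp_right Ev_comp[OF _ ecbv_null_fexprs, of "basis_elt s" r l n k x i] by simp
next
  case (act n k x \<sigma>)
  then show ?case
    using Ev_perm[OF ecbv_null_fexprs, of n k x \<sigma>] lin_on_zero[OF act_lin subspace_0[OF sub]] by simp
next
  case (diff n k x)
  then show ?case
    using Ev_expr_diff[OF ecbv_null_fexprs, of n k x] lin_on_zero[OF diff_lin subspace_0[OF sub]] by simp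
next
  case (unit_left t n k)
  then show ?case using id_left[OF ev_mem, of t n k] by (simp add: Ev_diff exprs_def)
next
  case (unit_right t n k i)
  then show ?case using id_right[OF _ ev_mem, of i n t k] by (simp add: Ev_diff exprs_def)
next
  case (assoc_seq s m k t n l u r q i j)
  then show ?case
    using q_assoc_seq[of i m j n "ev s" k "ev t" l "ev u" r q] ev_mem[of s m k] ev_mem[of t n l] ev_mem[of u r q]
    by (simp add: Ev_diff exprs_def)
next
  case (assoc_par s m k t n l u r q i j)
  then show ?case
    using q_assoc_par[of i j m "ev s" k "ev t" n l "ev u" r q] ev_mem[of s m k] ev_mem[of t n l] ev_mem[of u r q]
    by (simp add: Ev_diff Ev_scale exprs_def)
next
  case (act_id t n k)
  then show ?case using q_act_id[of "ev t" n k] ev_mem[of t n k] by (simp add: Ev_diff exprs_def)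
next
  case (act_act t n k \<sigma> \<tau>)
  then show ?case using q_act_act[of \<sigma> n \<tau> "ev t" k] ev_mem[of t n k] by (simp add: Ev_diff exprs_def)
next
  case (equivariance s m k t n l i \<sigma> \<tau>)
  then show ?case
    using q_equivariance[of i m \<sigma> \<tau> n "ev s" k "ev t" l] ev_mem[of s m k] ev_mem[of t n l]
    by (simp add: Ev_diff exprs_def)
next
  case (diff_diff t n k)
  then show ?case using q_diff_diff[of "ev t" n k] ev_mem[of t n k] by (simp add: exprs_def)
next
  case (diff_act t n k \<sigma>)
  then show ?case using q_diff_act[of \<sigma> n "ev t" k] ev_mem[of t n k] by (simp add: Ev_diff exprs_def)
next
  case (diff_comp s m k t n l i)
  then show ?case
    using q_diff_comp[of i m "ev s" k "ev t" n l] ev_mem[of s m k] ev_mem[of t n l]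
    by (simp add: Ev_diff Ev_add Ev_scale exprs_def)
next
  case mu_sym
  show ?case using rel_mu_sym by (simp add: Ev_diff)
next
  case mu_assoc
  show ?case using rel_mu_assoc by (simp add: Ev_diff)
next
  case mu_closed
  show ?case using rel_mu_closed by simp
next
  case (order n)
  then show ?case using rel_order by blast
next
  case (commute n k)
  then show ?case using rel_commute[of n k] by (simp add: Ev_diff)
next
  case (exact n)
  then show ?case using rel_exact[of n]
    by (simp only: Ev_sum Ev_diff Ev_basis interp.simps earity.simps edeg.simps simp_thms)
next
  case (zero n k)
  show ?case by (rule Ev_0)
next
  case (add n k x y)
  then show ?case by (simp only: Ev_add add_0_right)
next
  case (scale n k x c)
  then show ?case by (simp only: Ev_scale scaleR_zero_right)
qed

lemma Ev_ideal: "x \<in> ecbv_ideal \<Longrightarrow> Ev x = 0"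
proof -
  assume "x \<in> ecbv_ideal"
  then have "Ev x \<in> {0}"
    unfolding ecbv_ideal_def by (rule linear_maps_span[OF linear_linext]) (auto simp: Ev_null)
  then show ?thesis by simp
qed

definition induced :: "ecbv \<Rightarrow> 'q"
  where "induced X = Ev (rep_ecbv X)"

lemma induced_abs: "induced (abs_ecbv x) = Ev x"
proof -
  have "rep_ecbv (abs_ecbv x) - x \<in> ecbv_ideal"
    unfolding abs_ecbv_eq_iff[symmetric] by (rule Quotient3_abs_rep[OF Quotient3_ecbv])
  from Ev_ideal[OF this] show ?thesis by (simp add: induced_def Ev_diff)
qed

lemma induced_class: "induced (ecbv_class t) = ev t"
  by (simp add: ecbv_class.abs_eq induced_abs)

theorem operad_morphism_induced: "operad_morphism ECBV Q (\<lambda>n k. induced)"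
proof -
  have lin: "lin_on S induced" for S
  proof -
    have "induced (X + Y) = induced X + induced Y" "induced (c *\<^sub>R X) = c *\<^sub>R induced X" for X Y c
      by (induction X, induction Y; simp add: plus_ecbv.abs_eq scaleR_ecbv.abs_eq induced_abs Ev_add Ev_scale)+
    then show ?thesis by (simp add: lin_on_def)
  qed
  show ?thesis
    unfolding operad_morphism_def ECBV_def operad.simps
    apply (intro conjI allI impI ballI; (elim imageE)?; (hypsubst)?;
        (simp only: ecbv_comp.abs_eq ecbv_perm.abs_eq ecbv_diff.abs_eq induced_abs induced_class interp.simps)?)
    subgoal by (auto simp: induced_abs Ev_mem)
    subgoal by (rule lin)
    subgoal by (rule Ev_comp)
    subgoal by (rule Ev_perm)
    subgoal by (rule Ev_expr_diff)
    done
qed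

end

section \<open>Commutative algebras with differential operators\<close>

definition hom_op :: "(int \<Rightarrow> 'v::real_vector set) \<Rightarrow> int \<Rightarrow> ('v \<Rightarrow> 'v) \<Rightarrow> bool"
  where "hom_op V e D \<longleftrightarrow> (\<forall>k. D ` V k \<subseteq> V (k + e) \<and> lin_on (V k) D)"

lemma hom_op_mem: "hom_op V e D \<Longrightarrow> x \<in> V k \<Longrightarrow> D x \<in> V (k + e)"
  by (auto simp: hom_op_def)

lemma hom_op_lin: "hom_op V e D \<Longrightarrow> lin_on (V k) D"
  by (simp add: hom_op_def)

definition pick :: "'b list \<Rightarrow> nat set \<Rightarrow> 'b list"
  where "pick xs S = map ((!) xs) (sorted_list_of_set S)"

lemma length_pick [simp]: "length (pick xs S) = card S"
  by (simp add: pick_def)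

lemma pick_snoc:
  assumes "S \<subseteq> {..<length xs}"
  shows "pick (xs @ [x]) S = pick xs S" "pick (xs @ [x]) (insert (length xs) S) = pick xs S @ [x]"
proof -
  have fin: "finite S" using assms finite_subset by blast
  have *: "map ((!) (xs @ [x])) (sorted_list_of_set S) = map ((!) xs) (sorted_list_of_set S)"
    using assms fin by (auto simp: nth_append)
  then show "pick (xs @ [x]) S = pick xs S" by (simp add: pick_def)
  have "sorted_list_of_set (insert (length xs) S) = sorted_list_of_set S @ [length xs]"
    by (rule sorted_distinct_set_unique)
      (use assms fin in \<open>auto simp: sorted_append less_imp_le simp del: sorted_list_of_set_insert_remove\<close>)
  then show "pick (xs @ [x]) (insert (length xs) S) = pick xs S @ [x]"
    using * by (simp add: pick_def)
qed

text \<open>The Koszul exponent for moving the entries at the positions in \<open>S\<close> in front of the others.\<close>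

definition crossing_exp :: "nat \<Rightarrow> nat set \<Rightarrow> (nat \<Rightarrow> int) \<Rightarrow> int"
  where "crossing_exp N S e = (\<Sum>(a, b) | a < b \<and> b < N \<and> a \<notin> S \<and> b \<in> S. e a * e b)"

lemma finite_crossing [simp]: "finite {(a, b). a < b \<and> b < (N::nat) \<and> a \<notin> S \<and> b \<in> S}"
  by (rule finite_subset[of _ "{..<N} \<times> {..<N}"]) auto

lemma crossing_exp_Suc:
  assumes "S \<subseteq> {..<N}"
  shows "crossing_exp (Suc N) S e = crossing_exp N S e"
    "crossing_exp (Suc N) (insert N S) e = crossing_exp N S e + e N * (\<Sum>a\<in>{..<N} - S. e a)"
proof -
  have "{(a, b). a < b \<and> b < Suc N \<and> a \<notin> S \<and> b \<in> S} = {(a, b). a < b \<and> b < N \<and> a \<notin> S \<and> b \<in> S}"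
    using assms by (auto simp: less_Suc_eq)
  then show "crossing_exp (Suc N) S e = crossing_exp N S e" by (simp add: crossing_exp_def)
  have eq: "{(a, b). a < b \<and> b < Suc N \<and> a \<notin> insert N S \<and> b \<in> insert N S}
      = {(a, b). a < b \<and> b < N \<and> a \<notin> S \<and> b \<in> S} \<union> (\<lambda>a. (a, N)) ` ({..<N} - S)"
    using assms by (auto simp: less_Suc_eq)
  have "crossing_exp (Suc N) (insert N S) e = crossing_exp N S e + (\<Sum>(a, b)\<in>(\<lambda>a. (a, N)) ` ({..<N} - S). e a * e b)"
    unfolding crossing_exp_def eq by (rule sum.union_disjoint) auto
  also have "(\<Sum>(a, b)\<in>(\<lambda>a. (a, N)) ` ({..<N} - S). e a * e b) = (\<Sum>a\<in>{..<N} - S. e a * e N)"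
    by (subst sum.reindex) (auto simp: inj_on_def)
  finally show "crossing_exp (Suc N) (insert N S) e = crossing_exp N S e + e N * (\<Sum>a\<in>{..<N} - S. e a)"
    by (simp add: sum_distrib_left mult.commute)
qed

lemma crossing_exp_cong: "(\<And>a. a < N \<Longrightarrow> e a = e' a) \<Longrightarrow> crossing_exp N S e = crossing_exp N S e'"
  unfolding crossing_exp_def by (rule sum.cong) auto

locale gca =
  fixes m :: int and A :: "'a::real_vector graded_alg"
  assumes alg: "graded_comm_alg m A" and even_m': "even m"
begin

sublocale graded_vs m "gcar A"
  using alg even_m' unfolding graded_comm_alg_def by unfold_locales blast+

abbreviation mul (infixl "\<odot>" 70) where "x \<odot> y \<equiv> gmul A x y"
abbreviation "one \<equiv> gone A"
abbreviation homog_elts ("\<H>") where "\<H> \<equiv> homog (gcar A)"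

lemma one_mem: "one \<in> gcar A 0"
  using alg unfolding graded_comm_alg_def by blast

lemma mul_mem: "x \<in> gcar A j \<Longrightarrow> y \<in> gcar A k \<Longrightarrow> x \<odot> y \<in> gcar A (j + k)"
  using alg unfolding graded_comm_alg_def by blast

lemma mul_comm: "x \<in> gcar A j \<Longrightarrow> y \<in> gcar A k \<Longrightarrow> x \<odot> y = sgn_pow (j * k) *\<^sub>R (y \<odot> x)"
  using alg unfolding graded_comm_alg_def by blast

lemma mul_lin_right: "x \<in> \<H> \<Longrightarrow> lin_on (gcar A k) (\<lambda>y. x \<odot> y)"
  using alg unfolding graded_comm_alg_def by blast

lemma mul_assoc: "x \<in> \<H> \<Longrightarrow> y \<in> \<H> \<Longrightarrow> z \<in> \<H> \<Longrightarrow> x \<odot> y \<odot> z = x \<odot> (y \<odot> z)"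
  using alg unfolding graded_comm_alg_def by blast

lemma one_left: "x \<in> \<H> \<Longrightarrow> one \<odot> x = x"
  using alg unfolding graded_comm_alg_def by blast

lemma mul_homog: "x \<in> \<H> \<Longrightarrow> y \<in> \<H> \<Longrightarrow> x \<odot> y \<in> \<H>"
  by (auto simp: homog_def intro: mul_mem)

lemma one_homog: "one \<in> \<H>"
  using one_mem by (rule homogI)

lemma one_right:
  assumes "x \<in> \<H>"
  shows "x \<odot> one = x"
proof -
  obtain j where "x \<in> gcar A j" using assms by (auto simp: homog_def)
  from mul_comm[OF this one_mem] show ?thesis by (simp add: one_left[OF assms])
qed

lemma mul_lin_left:
  assumes "y \<in> \<H>"
  shows "lin_on (gcar A k) (\<lambda>x. x \<odot> y)"
proof -
  obtain j where y: "y \<in> gcar A j" using assms by (auto simp: homog_def)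
  have "lin_on (gcar A k) (\<lambda>x. sgn_pow (k * j) *\<^sub>R (y \<odot> x))"
    by (intro lin_on_scaled mul_lin_right assms)
  then show ?thesis by (rule lin_on_cong[OF _ subspace_V]) (rule mul_comm[OF _ y, symmetric])
qed

lemma mul_0_right: "x \<in> \<H> \<Longrightarrow> x \<odot> 0 = 0"
  by (rule lin_on_zero[OF mul_lin_right V_0])

lemma mul_0_left: "x \<in> \<H> \<Longrightarrow> 0 \<odot> x = 0"
  by (rule lin_on_zero[OF mul_lin_left V_0])

lemma mul_scale_right: "x \<in> \<H> \<Longrightarrow> y \<in> \<H> \<Longrightarrow> x \<odot> (c *\<^sub>R y) = c *\<^sub>R (x \<odot> y)"
  using lin_on_scale[OF mul_lin_right] unfolding homog_def by fast

lemma mul_scale_left: "x \<in> \<H> \<Longrightarrow> y \<in> \<H> \<Longrightarrow> (c *\<^sub>R x) \<odot> y = c *\<^sub>R (x \<odot> y)"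
  using lin_on_scale[OF mul_lin_left] unfolding homog_def by fast

lemma mul_add_right: "x \<in> \<H> \<Longrightarrow> y \<in> gcar A k \<Longrightarrow> z \<in> gcar A k \<Longrightarrow> x \<odot> (y + z) = x \<odot> y + x \<odot> z"
  by (rule lin_on_add[OF mul_lin_right])

lemma mul_diff_right: "x \<in> \<H> \<Longrightarrow> y \<in> gcar A k \<Longrightarrow> z \<in> gcar A k \<Longrightarrow> x \<odot> (y - z) = x \<odot> y - x \<odot> z"
  by (rule lin_on_diff[OF mul_lin_right subspace_V])

lemma mul_diff_left: "x \<in> \<H> \<Longrightarrow> y \<in> gcar A k \<Longrightarrow> z \<in> gcar A k \<Longrightarrow> (y - z) \<odot> x = y \<odot> x - z \<odot> x"
  by (rule lin_on_diff[OF mul_lin_left subspace_V])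

definition mprod :: "'a list \<Rightarrow> 'a"
  where "mprod xs = foldr (\<odot>) xs one"

lemma mprod_mem: "homs xs js \<Longrightarrow> mprod xs \<in> gcar A (sum_list js)"
  unfolding homs_def by (induction xs js rule: list_all2_induct) (auto simp: mprod_def one_mem mul_mem)

lemma mprod_homog: "set xs \<subseteq> \<H> \<Longrightarrow> mprod xs \<in> \<H>"
  using homs_ex mprod_mem homogI by blast

lemma mprod_append:
  "set xs \<subseteq> \<H> \<Longrightarrow> set ys \<subseteq> \<H> \<Longrightarrow> mprod (xs @ ys) = mprod xs \<odot> mprod ys"
proof (induction xs)
  case Nil
  then show ?case using mprod_homog by (simp add: mprod_def one_left)
next
  case (Cons x xs)
  then show ?case using mul_assoc[of x "mprod xs" "mprod ys"] mprod_homog by (simp add: mprod_def)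
qed

lemma mprod_snoc: "set xs \<subseteq> \<H> \<Longrightarrow> x \<in> \<H> \<Longrightarrow> mprod (xs @ [x]) = mprod xs \<odot> x"
  using mprod_append[of xs "[x]"] by (simp add: mprod_def one_right)

lemma homs_pick:
  assumes "homs xs js" "S \<subseteq> {..<length xs}"
  shows "homs (pick xs S) (pick js S)"
proof -
  have fin: "finite S" using assms(2) finite_subset by blast
  have "pick xs S ! p \<in> gcar A (pick js S ! p)" if "p < card S" for p
  proof -
    have "sorted_list_of_set S ! p \<in> set (sorted_list_of_set S)"
      using that by (intro nth_mem) simp
    then have "sorted_list_of_set S ! p < length xs" using fin assms(2) by auto
    then show ?thesis using homs_nth[OF assms(1)] that by (simp add: pick_def)
  qed
  then show ?thesis by (simp add: homs_def list_all2_conv_all_nth)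
qed

lemma sum_list_pick: "finite S \<Longrightarrow> sum_list (pick js S) = (\<Sum>a\<in>S. (js ! a :: int))"
  by (simp add: pick_def sum_list_distinct_conv_sum_set)

subsection \<open>Differential operators\<close>

definition mult_bracket :: "int \<Rightarrow> ('a \<Rightarrow> 'a) \<Rightarrow> int \<Rightarrow> 'a \<Rightarrow> 'a \<Rightarrow> 'a"
  where "mult_bracket e D j x = (\<lambda>u. D (x \<odot> u) - sgn_pow (e * j) *\<^sub>R (x \<odot> D u))"

text \<open>Order less than \<open>r\<close> in the sense of Grothendieck: all \<open>r\<close>-fold iterated commutators with
  multiplication operators vanish. Unlike the shuffle formula, this is inductive in \<open>r\<close>, which
  makes it easy to bound the order of sums, multiples and compositions.\<close>

primrec diffop :: "nat \<Rightarrow> int \<Rightarrow> ('a \<Rightarrow> 'a) \<Rightarrow> bool" where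
  "diffop 0 e D \<longleftrightarrow> (\<forall>u\<in>\<H>. D u = 0)"
| "diffop (Suc r) e D \<longleftrightarrow> (\<forall>j. \<forall>x\<in>gcar A j. diffop r (e + j) (mult_bracket e D j x))"

lemma mult_op: "x \<in> gcar A j \<Longrightarrow> hom_op (gcar A) j (\<lambda>u. x \<odot> u)"
  unfolding hom_op_def by (auto simp: add.commute[of _ j] intro!: mul_mem mul_lin_right homogI)

lemma hom_op_compose:
  assumes "hom_op (gcar A) e D" "hom_op (gcar A) f E"
  shows "hom_op (gcar A) (e + f) (\<lambda>u. D (E u))"
  unfolding hom_op_def
proof (intro allI conjI)
  fix k
  show "(\<lambda>u. D (E u)) ` gcar A k \<subseteq> gcar A (k + (e + f))"
  proof (rule image_subsetI)
    fix u assume "u \<in> gcar A k"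
    from hom_op_mem[OF assms(1) hom_op_mem[OF assms(2) this]]
    show "D (E u) \<in> gcar A (k + (e + f))" by (simp add: ac_simps)
  qed
  show "lin_on (gcar A k) (\<lambda>u. D (E u))"
    by (rule lin_on_compose[OF hom_op_lin[OF assms(2)] _ hom_op_lin[OF assms(1)]])
      (use hom_op_mem[OF assms(2)] in blast)
qed

lemma hom_op_scale: "hom_op (gcar A) e D \<Longrightarrow> hom_op (gcar A) e (\<lambda>u. c *\<^sub>R D u)"
  unfolding hom_op_def by (auto intro!: V_scale lin_on_scaled)

lemma hom_op_add: "hom_op (gcar A) e D \<Longrightarrow> hom_op (gcar A) e E \<Longrightarrow> hom_op (gcar A) e (\<lambda>u. D u + E u)"
  by (auto simp: hom_op_def image_subset_iff intro!: V_add lin_on_plus)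

lemma hom_op_diff: "hom_op (gcar A) e D \<Longrightarrow> hom_op (gcar A) e E \<Longrightarrow> hom_op (gcar A) e (\<lambda>u. D u - E u)"
  by (auto simp: hom_op_def image_subset_iff intro!: V_diff lin_on_minus)

lemma hom_op_zero: "hom_op (gcar A) e (\<lambda>u. 0)"
  unfolding hom_op_def by (auto intro!: lin_on_const_zero)

lemma hom_op_homog: "hom_op (gcar A) e D \<Longrightarrow> x \<in> \<H> \<Longrightarrow> D x \<in> \<H>"
  by (metis homogE homogI hom_op_mem)

lemma hom_op_bracket:
  assumes "hom_op (gcar A) e D" "x \<in> gcar A j"
  shows "hom_op (gcar A) (e + j) (mult_bracket e D j x)"
  unfolding mult_bracket_def
  by (intro hom_op_diff hom_op_scale hom_op_compose[OF assms(1) mult_op[OF assms(2)]])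
    (use hom_op_compose[OF mult_op[OF assms(2)] assms(1)] in \<open>simp add: add.commute\<close>)

lemma diffop_cong:
  "diffop r e D \<Longrightarrow> (\<And>u. u \<in> \<H> \<Longrightarrow> D u = D' u) \<Longrightarrow> diffop r e D'"
proof (induction r arbitrary: e D D')
  case (Suc r)
  show ?case unfolding diffop.simps
  proof (intro allI ballI)
    fix j x assume x: "x \<in> gcar A j"
    then have "diffop r (e + j) (mult_bracket e D j x)" using Suc.prems(1) by simp
    then show "diffop r (e + j) (mult_bracket e D' j x)"
      by (rule Suc.IH) (use Suc.prems(2) mul_homog homogI[OF x] in \<open>auto simp: mult_bracket_def\<close>)
  qed
qed simp

lemma diffop_zero: "diffop r e (\<lambda>u. 0)"
proof (induction r arbitrary: e)
  case (Suc r)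
  show ?case unfolding diffop.simps
  proof (intro allI ballI)
    fix j x assume x: "x \<in> gcar A j"
    show "diffop r (e + j) (mult_bracket e (\<lambda>u. 0) j x)"
      by (rule diffop_cong[OF Suc.IH]) (use homogI[OF x] in \<open>simp add: mult_bracket_def mul_0_right\<close>)
  qed
qed simp

lemma diffop_add:
  "diffop r e D \<Longrightarrow> diffop r e E \<Longrightarrow> hom_op (gcar A) e D \<Longrightarrow> hom_op (gcar A) e E \<Longrightarrow> diffop r e (\<lambda>u. D u + E u)"
proof (induction r arbitrary: e D E)
  case (Suc r)
  show ?case unfolding diffop.simps
  proof (intro allI ballI)
    fix j x assume x: "x \<in> gcar A j"
    have "diffop r (e + j) (\<lambda>u. mult_bracket e D j x u + mult_bracket e E j x u)"
      using Suc.prems x by (intro Suc.IH hom_op_bracket) auto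
    then show "diffop r (e + j) (mult_bracket e (\<lambda>u. D u + E u) j x)"
    proof (rule diffop_cong)
      fix u assume "u \<in> \<H>"
      then obtain k where "u \<in> gcar A k" by (auto simp: homog_def)
      then have "x \<odot> (D u + E u) = x \<odot> D u + x \<odot> E u"
        using mul_add_right[OF homogI[OF x] hom_op_mem[OF Suc.prems(3)] hom_op_mem[OF Suc.prems(4)]] by blast
      then show "mult_bracket e D j x u + mult_bracket e E j x u = mult_bracket e (\<lambda>u. D u + E u) j x u"
        by (simp add: mult_bracket_def scaleR_add_right)
    qed
  qed
qed simp

lemma diffop_scale:
  "diffop r e D \<Longrightarrow> hom_op (gcar A) e D \<Longrightarrow> diffop r e (\<lambda>u. c *\<^sub>R D u)"
proof (induction r arbitrary: e D)
  case (Suc r)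
  show ?case unfolding diffop.simps
  proof (intro allI ballI)
    fix j x assume x: "x \<in> gcar A j"
    have "diffop r (e + j) (\<lambda>u. c *\<^sub>R mult_bracket e D j x u)"
      using Suc.prems x by (intro Suc.IH hom_op_bracket) auto
    then show "diffop r (e + j) (mult_bracket e (\<lambda>u. c *\<^sub>R D u) j x)"
      by (rule diffop_cong) (use hom_op_homog[OF Suc.prems(2)] homogI[OF x] in
          \<open>simp add: mult_bracket_def mul_scale_right scaleR_diff_right mult.commute\<close>)
  qed
qed simp

lemma diffop_mult_left:
  "diffop r e D \<Longrightarrow> hom_op (gcar A) e D \<Longrightarrow> y \<in> gcar A l \<Longrightarrow> diffop r (e + l) (\<lambda>u. y \<odot> D u)"
proof (induction r arbitrary: e D)
  case 0
  then show ?case by (simp add: mul_0_right homogI)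
next
  case (Suc r)
  note y = Suc.prems(3)
  show ?case unfolding diffop.simps
  proof (intro allI ballI)
    fix j x assume x: "x \<in> gcar A j"
    have "diffop r (e + j + l) (\<lambda>u. y \<odot> mult_bracket e D j x u)"
      using Suc.prems x by (intro Suc.IH hom_op_bracket) auto
    then have "diffop r (e + l + j) (\<lambda>u. y \<odot> mult_bracket e D j x u)" by (simp add: ac_simps)
    then show "diffop r (e + l + j) (mult_bracket (e + l) (\<lambda>u. y \<odot> D u) j x)"
    proof (rule diffop_cong)
      fix u assume u: "u \<in> \<H>"
      then obtain k where k: "u \<in> gcar A k" by (auto simp: homog_def)
      have Du: "D u \<in> \<H>" by (rule hom_op_homog[OF Suc.prems(2) u])
      have xD: "x \<odot> D u \<in> gcar A (e + j + k)"
        using mul_mem[OF x hom_op_mem[OF Suc.prems(2) k]] by (simp add: ac_simps)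
      have Dx: "D (x \<odot> u) \<in> gcar A (e + j + k)"
        using hom_op_mem[OF Suc.prems(2) mul_mem[OF x k]] by (simp add: ac_simps)
      have "x \<odot> (y \<odot> D u) = sgn_pow (j * l) *\<^sub>R (y \<odot> (x \<odot> D u))"
        using mul_assoc[of x y "D u"] mul_assoc[of y x "D u"] mul_comm[OF x y]
          mul_scale_left[of "y \<odot> x" "D u"] mul_homog x y Du by (simp add: homogI)
      moreover have "y \<odot> mult_bracket e D j x u = y \<odot> D (x \<odot> u) - sgn_pow (e * j) *\<^sub>R (y \<odot> (x \<odot> D u))"
        unfolding mult_bracket_def
        using mul_diff_right[OF homogI[OF y] Dx V_scale[OF xD, of "sgn_pow (e * j)"]]
          mul_scale_right[OF homogI[OF y] homogI[OF xD]] by simp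
      moreover have "sgn_pow ((e + l) * j) * sgn_pow (j * l) = sgn_pow (e * j)"
        unfolding sgn_pow_add[symmetric] by (rule sgn_pow_eqI) auto
      ultimately show "y \<odot> mult_bracket e D j x u = mult_bracket (e + l) (\<lambda>u. y \<odot> D u) j x u"
        by (simp add: mult_bracket_def)
    qed
  qed
qed

definition derivation :: "int \<Rightarrow> ('a \<Rightarrow> 'a) \<Rightarrow> bool"
  where "derivation e D \<longleftrightarrow> hom_op (gcar A) e D \<and>
    (\<forall>j. \<forall>x\<in>gcar A j. \<forall>y\<in>\<H>. D (x \<odot> y) = D x \<odot> y + sgn_pow (e * j) *\<^sub>R (x \<odot> D y))"

text \<open>The commutator of \<open>D \<circ> E\<close> with \<open>x\<close> is \<open>D \<circ> [E, x]\<close> plus the product of \<open>[D, x]\<close> and \<open>E\<close>, and for a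
  derivation \<open>[D, x]\<close> is the multiplication by \<open>D x\<close>.\<close>

lemma diffop_derivation_step:
  assumes D: "derivation e D" and E: "diffop (Suc r) f E" "hom_op (gcar A) f E"
    and br: "\<And>j x. x \<in> gcar A j \<Longrightarrow> diffop (Suc r) (e + (f + j)) (\<lambda>u. D (mult_bracket f E j x u))"
  shows "diffop (Suc (Suc r)) (e + f) (\<lambda>u. D (E u))"
  unfolding diffop.simps(2)[of "Suc r"]
proof (intro allI ballI)
  fix j x assume x: "x \<in> gcar A j"
  have hD: "hom_op (gcar A) e D" using D by (simp add: derivation_def)
  have Dx: "D x \<in> gcar A (j + e)" by (rule hom_op_mem[OF hD x])
  have h1: "hom_op (gcar A) (e + (f + j)) (\<lambda>u. D (mult_bracket f E j x u))"
    by (rule hom_op_compose[OF hD hom_op_bracket[OF E(2) x]])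
  have h2: "hom_op (gcar A) (f + (j + e)) (\<lambda>u. D x \<odot> E u)"
    using hom_op_compose[OF mult_op[OF Dx] E(2)] by (simp add: ac_simps)
  have "diffop (Suc r) (f + (j + e)) (\<lambda>u. sgn_pow (f * j) *\<^sub>R (D x \<odot> E u))"
    by (rule diffop_scale[OF diffop_mult_left[OF E Dx] h2])
  then have "diffop (Suc r) (e + (f + j)) (\<lambda>u. sgn_pow (f * j) *\<^sub>R (D x \<odot> E u))"
    "hom_op (gcar A) (e + (f + j)) (\<lambda>u. sgn_pow (f * j) *\<^sub>R (D x \<odot> E u))"
    using hom_op_scale[OF h2] by (simp_all only: ac_simps)
  from diffop_add[OF br[OF x] this(1) h1 this(2)]
  have "diffop (Suc r) (e + (f + j)) (\<lambda>u. D (mult_bracket f E j x u) + sgn_pow (f * j) *\<^sub>R (D x \<odot> E u))" .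
  then have "diffop (Suc r) (e + f + j) (\<lambda>u. D (mult_bracket f E j x u) + sgn_pow (f * j) *\<^sub>R (D x \<odot> E u))"
    by (simp only: ac_simps)
  then show "diffop (Suc r) (e + f + j) (mult_bracket (e + f) (\<lambda>u. D (E u)) j x)"
  proof (rule diffop_cong)
    fix u assume "u \<in> \<H>"
    then obtain k where k: "u \<in> gcar A k" by (auto simp: homog_def)
    have Eu: "E u \<in> gcar A (k + f)" by (rule hom_op_mem[OF E(2) k])
    have b: "mult_bracket f E j x u \<in> gcar A (k + (f + j))"
      by (rule hom_op_mem[OF hom_op_bracket[OF E(2) x] k])
    have xE: "x \<odot> E u \<in> gcar A (k + (f + j))" using mul_mem[OF x Eu] by (simp add: ac_simps)
    have "E (x \<odot> u) = mult_bracket f E j x u + sgn_pow (f * j) *\<^sub>R (x \<odot> E u)"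
      by (simp add: mult_bracket_def)
    then have "D (E (x \<odot> u)) = D (mult_bracket f E j x u) + sgn_pow (f * j) *\<^sub>R D (x \<odot> E u)"
      using lin_on_add[OF hom_op_lin[OF hD] b V_scale[OF xE]] lin_on_scale[OF hom_op_lin[OF hD] xE] by simp
    also have "D (x \<odot> E u) = D x \<odot> E u + sgn_pow (e * j) *\<^sub>R (x \<odot> D (E u))"
      using D x homogI[OF Eu] by (simp add: derivation_def)
    finally show "D (mult_bracket f E j x u) + sgn_pow (f * j) *\<^sub>R (D x \<odot> E u)
        = mult_bracket (e + f) (\<lambda>u. D (E u)) j x u"
      by (simp add: mult_bracket_def scaleR_add_right sgn_pow_add distrib_right mult.commute[of "sgn_pow (f * j)"])
  qed
qed

lemma diffop_derivation_compose:
  "derivation e D \<Longrightarrow> diffop (Suc r) f E \<Longrightarrow> hom_op (gcar A) f E \<Longrightarrow> diffop (Suc (Suc r)) (e + f) (\<lambda>u. D (E u))"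
proof (induction r arbitrary: f E)
  case 0
  have "hom_op (gcar A) e D" using 0(1) by (simp add: derivation_def)
  then have "D 0 = 0" by (rule lin_on_zero[OF hom_op_lin V_0])
  moreover have "\<forall>u\<in>\<H>. mult_bracket f E j x u = 0" if "x \<in> gcar A j" for j x
    using 0(2) that by simp
  ultimately have "diffop (Suc 0) (e + (f + j)) (\<lambda>u. D (mult_bracket f E j x u))" if "x \<in> gcar A j" for j x
    using that by (intro diffop_cong[OF diffop_zero]) simp
  then show ?case by (rule diffop_derivation_step[OF 0])
next
  case (Suc r)
  have "diffop (Suc (Suc r)) (e + (f + j)) (\<lambda>u. D (mult_bracket f E j x u))" if x: "x \<in> gcar A j" for j x
  proof (rule Suc.IH[OF Suc.prems(1)])
    show "diffop (Suc r) (f + j) (mult_bracket f E j x)"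
      using Suc.prems(2) x unfolding diffop.simps(2)[of "Suc r"] by blast
    show "hom_op (gcar A) (f + j) (mult_bracket f E j x)" by (rule hom_op_bracket[OF Suc.prems(3) x])
  qed
  then show ?case by (rule diffop_derivation_step[OF Suc.prems])
qed

subsection \<open>The shuffle formula for the order\<close>

text \<open>The defining sum of the order condition, with a shuffle encoded by the set \<open>S\<close> of positions on which
  \<open>D\<close> acts. The term with empty \<open>S\<close>, which contains \<open>D 1\<close>, is included.\<close>

definition shuffle_sum :: "('a \<Rightarrow> 'a) \<Rightarrow> 'a list \<Rightarrow> int list \<Rightarrow> 'a"
  where "shuffle_sum D xs js = (\<Sum>S\<in>Pow {..<length xs}. ((- 1) ^ card S * sgn_pow (crossing_exp (length xs) S ((!) js))) *\<^sub>R
    (D (mprod (pick xs S)) \<odot> mprod (pick xs ({..<length xs} - S))))"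

text \<open>Subsets come in pairs, without and with the last position. Together such a pair contributes a term of
  the sum for the commutator with the last entry. Iteration turns the shuffle formula into iterated
  commutators.\<close>

lemma shuffle_sum_snoc:
  assumes D: "hom_op (gcar A) e D" and xs: "homs xs js" and x: "x \<in> gcar A j"
  shows "shuffle_sum D (xs @ [x]) (js @ [j])
    = - sgn_pow (j * sum_list js) *\<^sub>R shuffle_sum (mult_bracket e D j x) xs js"
proof -
  define N where "N = length xs"
  have N: "length js = N" using homs_length[OF xs] by (simp add: N_def)
  define T where "T S = ((- 1) ^ card S * sgn_pow (crossing_exp (Suc N) S ((!) (js @ [j])))) *\<^sub>R
    (D (mprod (pick (xs @ [x]) S)) \<odot> mprod (pick (xs @ [x]) ({..<Suc N} - S)))" for S
  have pow: "Pow {..<Suc N} = Pow {..<N} \<union> insert N ` Pow {..<N}"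
    by (simp add: lessThan_Suc Pow_insert)
  have "shuffle_sum D (xs @ [x]) (js @ [j]) = (\<Sum>S\<in>Pow {..<Suc N}. T S)"
    by (simp add: shuffle_sum_def T_def N_def)
  also have "\<dots> = (\<Sum>S\<in>Pow {..<N}. T S) + (\<Sum>S\<in>insert N ` Pow {..<N}. T S)"
    unfolding pow by (rule sum.union_disjoint) auto
  also have "(\<Sum>S\<in>insert N ` Pow {..<N}. T S) = (\<Sum>S\<in>Pow {..<N}. T (insert N S))"
    by (subst sum.reindex) (auto intro!: inj_onI simp: insert_eq_iff)
  also have "(\<Sum>S\<in>Pow {..<N}. T S) + (\<Sum>S\<in>Pow {..<N}. T (insert N S))
    = (\<Sum>S\<in>Pow {..<N}. - sgn_pow (j * sum_list js) *\<^sub>R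
      ((- 1) ^ card S * sgn_pow (crossing_exp N S ((!) js))) *\<^sub>R
      (mult_bracket e D j x (mprod (pick xs S)) \<odot> mprod (pick xs ({..<N} - S))))"
    unfolding sum.distrib[symmetric]
  proof (rule sum.cong[OF refl])
    fix S assume "S \<in> Pow {..<N}"
    then have S: "S \<subseteq> {..<N}" and fin: "finite S" and notin: "N \<notin> S" using finite_subset by auto
    define C where "C = {..<N} - S"
    have C: "C \<subseteq> {..<N}" "finite C" by (auto simp: C_def)
    define u v where "u = mprod (pick xs S)" and "v = mprod (pick xs C)"
    define a b where "a = sum_list (pick js S)" and "b = sum_list (pick js C)"
    have hS: "homs (pick xs S) (pick js S)" and hC: "homs (pick xs C) (pick js C)"
      using S C homs_pick[OF xs] by (simp_all add: N_def)
    have u: "u \<in> gcar A a" and v: "v \<in> gcar A b"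
      unfolding u_def v_def a_def b_def by (rule mprod_mem[OF hS], rule mprod_mem[OF hC])
    have ab: "sum_list js = a + b"
    proof -
      have "sum_list js = (\<Sum>i\<in>{..<N}. js ! i)" by (simp add: sum_list_sum_nth N atLeast0LessThan)
      also have "{..<N} = S \<union> C" using S by (auto simp: C_def)
      also have "(\<Sum>i\<in>S \<union> C. js ! i) = a + b"
        using fin C(2) by (subst sum.union_disjoint) (auto simp: a_def b_def sum_list_pick C_def)
      finally show ?thesis .
    qed
    have bC: "b = (\<Sum>i\<in>{..<N} - S. js ! i)" by (simp add: b_def sum_list_pick C_def)
    have ce: "crossing_exp N S ((!) (js @ [j])) = crossing_exp N S ((!) js)"
      by (rule crossing_exp_cong) (simp add: nth_append N)
    define c where "c = (- 1) ^ card S * sgn_pow (crossing_exp N S ((!) js))"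
    have compl: "{..<Suc N} - S = insert N C" "{..<Suc N} - insert N S = C" using notin by (auto simp: C_def less_Suc_eq)
    have sets: "set (pick xs S) \<subseteq> \<H>" "set (pick xs C) \<subseteq> \<H>"
      using homs_homog[OF hS] homs_homog[OF hC] .
    have T1: "T S = c *\<^sub>R (D u \<odot> (v \<odot> x))"
      using pick_snoc(1)[of S xs x] pick_snoc(2)[of C xs x] S C(1)
      by (simp add: T_def compl crossing_exp_Suc(1)[OF S] ce c_def u_def v_def mprod_snoc[OF sets(2) homogI[OF x]] flip: N_def)
    have "crossing_exp (Suc N) (insert N S) ((!) (js @ [j])) = crossing_exp N S ((!) js) + j * b"
      unfolding crossing_exp_Suc(2)[OF S] ce bC by (simp add: nth_append N)
    then have T2: "T (insert N S) = - (c * sgn_pow (j * b)) *\<^sub>R (D (u \<odot> x) \<odot> v)"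
      using pick_snoc(2)[of S xs x] pick_snoc(1)[of C xs x] S C(1) notin fin
      by (simp add: T_def compl c_def u_def v_def mprod_snoc[OF sets(1) homogI[OF x]] sgn_pow_add flip: N_def)
    have Du: "D u \<in> gcar A (a + e)" by (rule hom_op_mem[OF D u])
    have xDu: "x \<odot> D u \<in> gcar A (j + (a + e))" by (rule mul_mem[OF x Du])
    have Dxu: "D (x \<odot> u) \<in> gcar A (j + (a + e))" using hom_op_mem[OF D mul_mem[OF x u]] by (simp add: ac_simps)
    have e1: "D u \<odot> (v \<odot> x) = sgn_pow (j * (a + e + b)) *\<^sub>R (x \<odot> D u \<odot> v)"
      using mul_comm[OF mul_mem[OF Du v] x] mul_assoc[OF homogI[OF Du] homogI[OF v] homogI[OF x]]
        mul_assoc[OF homogI[OF x] homogI[OF Du] homogI[OF v]] by (simp add: mult.commute)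
    have e2: "D (u \<odot> x) \<odot> v = sgn_pow (j * a) *\<^sub>R (D (x \<odot> u) \<odot> v)"
      using mul_comm[OF u x] lin_on_scale[OF hom_op_lin[OF D] mul_mem[OF x u]] mul_scale_left[OF homogI[OF Dxu] homogI[OF v]]
      by (simp add: mult.commute)
    have e3: "mult_bracket e D j x u \<odot> v = D (x \<odot> u) \<odot> v - sgn_pow (e * j) *\<^sub>R (x \<odot> D u \<odot> v)"
      unfolding mult_bracket_def
      using mul_diff_left[OF homogI[OF v] Dxu V_scale[OF xDu]] mul_scale_left[OF homogI[OF xDu] homogI[OF v]] by simp
    have s1: "sgn_pow (j * (a + e + b)) = sgn_pow (j * sum_list js) * sgn_pow (e * j)"
      unfolding ab sgn_pow_add[symmetric] by (rule sgn_pow_eqI) auto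
    have s2: "sgn_pow (j * b) * sgn_pow (j * a) = sgn_pow (j * sum_list js)"
      unfolding ab sgn_pow_add[symmetric] by (rule sgn_pow_eqI) auto
    show "T S + T (insert N S) = - sgn_pow (j * sum_list js) *\<^sub>R
      ((- 1) ^ card S * sgn_pow (crossing_exp N S ((!) js))) *\<^sub>R
      (mult_bracket e D j x (mprod (pick xs S)) \<odot> mprod (pick xs ({..<N} - S)))"
      unfolding T1 T2 e1 e2 c_def[symmetric] u_def[symmetric] C_def[symmetric] v_def[symmetric] e3
      by (simp add: scaleR_diff_right s1 s2 mult.assoc mult.left_commute[of c])
  qed
  finally show ?thesis by (simp add: shuffle_sum_def N_def scaleR_sum_right sum_negf)
qed

lemma shuffle_sum_diffop:
  "diffop (length xs) e D \<Longrightarrow> hom_op (gcar A) e D \<Longrightarrow> homs xs js \<Longrightarrow> shuffle_sum D xs js = 0"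
proof (induction xs arbitrary: e D js rule: rev_induct)
  case Nil
  then show ?case using one_homog mul_0_left[OF one_homog]
    by (simp add: shuffle_sum_def pick_def mprod_def)
next
  case (snoc x xs)
  obtain ks l where l: "js = ks @ l" "homs xs ks" "homs [x] l"
    using homs_appendE[OF snoc.prems(3)] .
  obtain j where js: "js = ks @ [j]" "homs xs ks" "x \<in> gcar A j"
    using l by (auto simp: homs_def list_all2_Cons1)
  have "shuffle_sum (mult_bracket e D j x) xs ks = 0"
    using snoc.prems js by (intro snoc.IH[OF _ hom_op_bracket]) auto
  then show ?case using shuffle_sum_snoc[OF snoc.prems(2) js(2,3)] js(1) by simp
qed

end

subsection \<open>Shuffles and subsets\<close>

text \<open>The shuffle that lists \<open>S\<close> first and its complement afterwards.\<close>

definition subset_perm :: "nat \<Rightarrow> nat set \<Rightarrow> nat \<Rightarrow> nat"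
  where "subset_perm N S j =
    (if j < N then (sorted_list_of_set S @ sorted_list_of_set ({..<N} - S)) ! j else j)"

lemma subset_perm_shuffle:
  assumes S: "S \<subseteq> {..<N}" and card: "card S = p" and N: "N = p + q"
  shows "subset_perm N S \<in> shuffles_perm p q" "subset_perm N S ` {..<p} = S"
proof -
  have fin: "finite S" using S finite_subset by blast
  let ?l = "sorted_list_of_set S" and ?r = "sorted_list_of_set ({..<N} - S)"
  have len: "length ?l = p" "length ?r = q"
    using card N card_Diff_subset[OF fin S] by simp_all
  have d: "distinct (?l @ ?r)" "set (?l @ ?r) = {..<N}" using fin S by auto
  have bij: "bij_betw (\<lambda>j. (?l @ ?r) ! j) {..<N} {..<N}"
    using bij_betw_nth[OF d(1), of "{..<N}" "{..<N}"] d(2) len N by simp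
  then have bij': "bij_betw (subset_perm N S) {..<N} {..<N}"
    by (rule bij_betw_cong[THEN iffD1, rotated]) (simp add: subset_perm_def)
  have "subset_perm N S permutes {..<N}"
    by (rule bij_imp_permutes[OF bij']) (simp add: subset_perm_def)
  moreover have "strict_mono_on {..<p} (subset_perm N S)"
  proof (rule strict_mono_onI)
    fix a b assume "a \<in> {..<p}" "b \<in> {..<p}" "a < b"
    then show "subset_perm N S a < subset_perm N S b"
      using len N sorted_wrt_nth_less[OF strict_sorted_list_of_set[of S], of a b]
      by (simp add: subset_perm_def nth_append)
  qed
  moreover have "strict_mono_on {p..<p + q} (subset_perm N S)"
  proof (rule strict_mono_onI)
    fix a b assume "a \<in> {p..<p + q}" "b \<in> {p..<p + q}" "a < b"
    then show "subset_perm N S a < subset_perm N S b"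
      using len N sorted_wrt_nth_less[OF strict_sorted_list_of_set[of "{..<N} - S"], of "a - p" "b - p"]
      by (simp add: subset_perm_def nth_append)
  qed
  ultimately show "subset_perm N S \<in> shuffles_perm p q" by (simp add: shuffles_perm_def N)
  have "subset_perm N S ` {..<p} = (\<lambda>j. ?l ! j) ` {..<p}"
    by (rule image_cong) (use len N in \<open>simp_all add: subset_perm_def nth_append\<close>)
  also have "\<dots> = set ?l" using len by (auto simp: set_conv_nth)
  finally show "subset_perm N S ` {..<p} = S" using fin by simp
qed

lemma shuffle_lists:
  assumes "\<sigma> \<in> shuffles_perm p q" "S = \<sigma> ` {..<p}"
  shows "map \<sigma> [0..<p] = sorted_list_of_set S" "map \<sigma> [p..<p + q] = sorted_list_of_set ({..<p + q} - S)"
    "S \<subseteq> {..<p + q}" "card S = p"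
proof -
  have \<sigma>: "\<sigma> permutes {..<p + q}" and m: "strict_mono_on {..<p} \<sigma>" "strict_mono_on {p..<p + q} \<sigma>"
    using assms(1) by (auto simp: shuffles_perm_def)
  have inj: "inj_on \<sigma> T" for T using permutes_inj[OF \<sigma>] inj_on_subset by blast
  show S: "S \<subseteq> {..<p + q}" using permutes_less[OF \<sigma>] by (auto simp: assms(2))
  show "card S = p" unfolding assms(2) by (simp add: card_image[OF inj])
  have "\<sigma> a \<le> \<sigma> b" if "a \<le> b" "b < p" for a b
    using that strict_mono_onD[OF m(1), of a b] by (cases "a = b") auto
  then have "sorted (map \<sigma> [0..<p])" by (simp add: sorted_iff_nth_mono)
  moreover have "\<sigma> (p + a) \<le> \<sigma> (p + b)" if "a \<le> b" "b < q" for a b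
    using that strict_mono_onD[OF m(2), of "p + a" "p + b"] by (cases "a = b") auto
  then have "sorted (map \<sigma> [p..<p + q])" by (simp add: sorted_iff_nth_mono)
  moreover have "set (map \<sigma> [p..<p + q]) = {..<p + q} - S"
  proof -
    have "set (map \<sigma> [p..<p + q]) = \<sigma> ` ({..<p + q} - {..<p})" by (auto intro!: image_cong)
    also have "\<dots> = \<sigma> ` {..<p + q} - \<sigma> ` {..<p}" by (rule inj_on_image_set_diff[OF inj[of UNIV]]) auto
    finally show ?thesis by (simp add: permutes_image[OF \<sigma>] assms(2))
  qed
  moreover have "set (map \<sigma> [0..<p]) = S" by (auto simp: assms(2) atLeast0LessThan)
  ultimately show "map \<sigma> [0..<p] = sorted_list_of_set S" "map \<sigma> [p..<p + q] = sorted_list_of_set ({..<p + q} - S)"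
    using S finite_subset[OF S] by (auto intro!: sorted_distinct_set_unique simp: distinct_map inj)
qed

lemma sum_shuffles_subsets:
  fixes h :: "nat set \<Rightarrow> 'b::comm_monoid_add"
  assumes N: "N = p + q"
  shows "(\<Sum>\<sigma>\<in>shuffles_perm p q. h (\<sigma> ` {..<p})) = (\<Sum>S | S \<subseteq> {..<N} \<and> card S = p. h S)"
proof (rule sum.reindex_bij_witness[where i = "subset_perm N" and j = "\<lambda>\<sigma>. \<sigma> ` {..<p}"])
  fix \<sigma> assume s: "\<sigma> \<in> shuffles_perm p q"
  then have \<sigma>: "\<sigma> permutes {..<N}" by (simp add: shuffles_perm_def N)
  note l = shuffle_lists[OF s refl, folded N]
  show "\<sigma> ` {..<p} \<in> {S. S \<subseteq> {..<N} \<and> card S = p}" using l by simp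
  show "subset_perm N (\<sigma> ` {..<p}) = \<sigma>"
  proof
    fix j
    have "subset_perm N (\<sigma> ` {..<p}) j = (map \<sigma> [0..<p] @ map \<sigma> [p..<N]) ! j" if "j < N"
      unfolding l(1,2) using that by (simp add: subset_perm_def)
    then show "subset_perm N (\<sigma> ` {..<p}) j = \<sigma> j"
      using permutes_not_in[OF \<sigma>, of j] N by (cases "j < N") (auto simp: nth_append subset_perm_def)
  qed
qed (use subset_perm_shuffle[OF _ _ N] in auto)

lemma sum_nonempty_subsets:
  fixes h :: "nat set \<Rightarrow> 'b::ab_group_add"
  shows "(\<Sum>p = 1..N. \<Sum>\<sigma>\<in>shuffles_perm p (N - p). h (\<sigma> ` {..<p})) = (\<Sum>S\<in>Pow {..<N}. h S) - h {}"
proof -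
  have "(\<Sum>p = 1..N. \<Sum>\<sigma>\<in>shuffles_perm p (N - p). h (\<sigma> ` {..<p}))
      = (\<Sum>p = 1..N. \<Sum>S | S \<in> Pow {..<N} - {{}} \<and> card S = p. h S)"
  proof (rule sum.cong[OF refl])
    fix p assume p: "p \<in> {1..N}"
    then have "{S. S \<subseteq> {..<N} \<and> card S = p} = {S. S \<in> Pow {..<N} - {{}} \<and> card S = p}" by auto
    then show "(\<Sum>\<sigma>\<in>shuffles_perm p (N - p). h (\<sigma> ` {..<p})) = (\<Sum>S | S \<in> Pow {..<N} - {{}} \<and> card S = p. h S)"
      using sum_shuffles_subsets[of N p "N - p" h] p by simp
  qed
  also have "\<dots> = (\<Sum>S\<in>Pow {..<N} - {{}}. h S)"
  proof (rule sum.group)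
    show "card ` (Pow {..<N} - {{}}) \<subseteq> {1..N}"
    proof (rule image_subsetI)
      fix S assume S: "S \<in> Pow {..<N} - {{}}"
      then have "finite S" using finite_subset by blast
      then have "1 \<le> card S" using S by (simp add: Suc_leI card_gt_0_iff)
      moreover have "card S \<le> N" using S card_mono[of "{..<N}" S] by simp
      ultimately show "card S \<in> {1..N}" by simp
    qed
  qed simp_all
  finally show ?thesis by (simp add: sum_diff1)
qed

text \<open>The inverse of a shuffle inverts exactly the pairs whose second member is moved in front of the first.\<close>

lemma koszul_shuffle:
  assumes s: "\<sigma> \<in> shuffles_perm p q"
  shows "koszul (inv \<sigma>) (p + q) e = crossing_exp (p + q) (\<sigma> ` {..<p}) e"
proof -
  have \<sigma>: "\<sigma> permutes {..<p + q}" and m: "strict_mono_on {..<p} \<sigma>" "strict_mono_on {p..<p + q} \<sigma>"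
    using s by (auto simp: shuffles_perm_def)
  have i: "\<sigma> (inv \<sigma> a) = a" "inv \<sigma> (\<sigma> a) = a" for a using permutes_inverses[OF \<sigma>] by auto
  have mem: "a \<in> \<sigma> ` {..<p} \<longleftrightarrow> inv \<sigma> a < p" for a
    using i by (metis image_iff lessThan_iff)
  have less: "a < p + q \<Longrightarrow> inv \<sigma> a < p + q" for a by (rule permutes_less[OF permutes_inv[OF \<sigma>]])
  have "inv \<sigma> b < inv \<sigma> a \<longleftrightarrow> a \<notin> \<sigma> ` {..<p} \<and> b \<in> \<sigma> ` {..<p}" if "a < b" "b < p + q" for a b
  proof
    assume l: "inv \<sigma> b < inv \<sigma> a"
    have "inv \<sigma> a < p + q" using that less by simp
    with strict_mono_onD[OF m(1), of "inv \<sigma> b" "inv \<sigma> a", unfolded i]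
      strict_mono_onD[OF m(2), of "inv \<sigma> b" "inv \<sigma> a", unfolded i] l that
    have "\<not> inv \<sigma> a < p" "inv \<sigma> b < p" by force+
    then show "a \<notin> \<sigma> ` {..<p} \<and> b \<in> \<sigma> ` {..<p}" by (simp add: mem)
  qed (simp add: mem)
  then have "inversions (inv \<sigma>) (p + q) = {(a, b). a < b \<and> b < p + q \<and> a \<notin> \<sigma> ` {..<p} \<and> b \<in> \<sigma> ` {..<p}}"
    unfolding inversions_def by auto
  then show ?thesis by (simp add: koszul_def crossing_exp_def)
qed

section \<open>Algebras over the presented operad\<close>

text \<open>In the last assumption the double commutator is written out; the \<open>i n\<close> have even degree, hence no
  signs. The assumption \<open>i_one\<close> makes the term with empty \<open>S\<close> in \<open>shuffle_sum\<close> vanish, which is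
  absent from the defining relation on the order.\<close>

locale ecbv_calg = gca m A for m and A :: "'a::real_vector graded_alg" +
  fixes d :: "'a \<Rightarrow> 'a" and i :: "nat \<Rightarrow> 'a \<Rightarrow> 'a"
  assumes complex: "cochain_complex m (gcar A) d"
    and d_deriv: "x \<in> gcar A j \<Longrightarrow> y \<in> \<H> \<Longrightarrow>
      d (gmul A x y) = gmul A (d x) y + sgn_pow j *\<^sub>R gmul A x (d y)"
    and i_op: "1 \<le> n \<Longrightarrow> hom_op (gcar A) (- 2 * int n) (i n)"
    and i_one: "1 \<le> n \<Longrightarrow> i n (gone A) = 0"
    and i_order: "1 \<le> n \<Longrightarrow> diffop (n + 2) (- 2 * int n) (i n)"
    and i_commute: "1 \<le> n \<Longrightarrow> 1 \<le> k \<Longrightarrow> x \<in> \<H> \<Longrightarrow> i n (i k x) = i k (i n x)"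
    and i_exact: "2 \<le> n \<Longrightarrow> x \<in> \<H> \<Longrightarrow>
      (\<Sum>j = 1..n - 1. i j (d (i (n - j) x) - i (n - j) (d x)) - (d (i (n - j) (i j x)) - i (n - j) (d (i j x)))) = 0"
begin

sublocale graded_cx m "gcar A" d
  by unfold_locales (rule complex)

abbreviation "\<mu> \<equiv> binary_op (gcar A) (gmul A)"
abbreviation "\<iota> n \<equiv> unary_op (gcar A) (i n)"
abbreviation "Q \<equiv> End_operad (gcar A) d"

lemma mu_app: "x \<in> \<H> \<Longrightarrow> y \<in> \<H> \<Longrightarrow> ext_map (gcar A) 2 f [x, y] = f [x, y]"
  by (simp add: ext_map_def)

lemma unary_app: "x \<in> \<H> \<Longrightarrow> ext_map (gcar A) (Suc 0) f [x] = f [x]"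
  by (simp add: ext_map_def)

lemma mu_ml: "\<mu> \<in> ml 2 0"
proof (rule ml_memI)
  fix xs js assume xs: "homs xs js" "length xs = 2"
  obtain x y where xy: "xs = [x, y]" using xs(2) by (auto simp: numeral_2_eq_2 length_Suc_conv)
  obtain a b where ab: "js = [a, b]" using homs_length[OF xs(1)] xs(2) by (auto simp: numeral_2_eq_2 length_Suc_conv)
  have h: "x \<in> gcar A a" "y \<in> gcar A b" using xs(1) by (simp_all add: xy ab)
  then show "\<mu> xs \<in> gcar A (sum_list js + 0)" using mul_mem[OF h] by (simp add: xy ab mu_app homogI)
  fix p j assume p: "p < (2::nat)"
  have lin: "lin_on (gcar A j) (\<lambda>z. z \<odot> y)" "lin_on (gcar A j) (\<lambda>z. x \<odot> z)"
    using mul_lin_left mul_lin_right homogI h by blast+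
  consider "p = 0" | "p = 1" using p by linarith
  then show "lin_on (gcar A j) (\<lambda>z. \<mu> (xs[p := z]))"
  proof cases
    case 1
    show ?thesis by (rule lin_on_cong[OF lin(1) subspace_V]) (use 1 h in \<open>simp add: xy mu_app homogI\<close>)
  next
    case 2
    show ?thesis by (rule lin_on_cong[OF lin(2) subspace_V]) (use 2 h in \<open>simp add: xy mu_app homogI\<close>)
  qed
qed (auto simp: ext_map_def)

lemma unary_ml:
  assumes f: "hom_op (gcar A) e f"
  shows "unary_op (gcar A) f \<in> ml 1 e"
proof (rule ml_memI)
  fix xs js assume xs: "homs xs js" "length xs = 1"
  obtain x where x: "xs = [x]" using xs(2) by (auto simp: length_Suc_conv)
  obtain a where a: "js = [a]" using homs_length[OF xs(1)] xs(2) by (auto simp: length_Suc_conv)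
  have h: "x \<in> gcar A a" using xs(1) by (simp add: x a)
  then show "unary_op (gcar A) f xs \<in> gcar A (sum_list js + e)"
    using hom_op_mem[OF f h] by (simp add: x a unary_app homogI)
  fix p j assume p: "p < (1::nat)"
  show "lin_on (gcar A j) (\<lambda>z. unary_op (gcar A) f (xs[p := z]))"
    by (rule lin_on_cong[OF hom_op_lin[OF f] subspace_V]) (use p in \<open>simp add: x unary_app homogI\<close>)
qed (auto simp: ext_map_def)

lemma iota_ml: "1 \<le> n \<Longrightarrow> \<iota> n \<in> ml 1 (- 2 * int n)"
  by (rule unary_ml[OF i_op])

lemma unary_comp:
  assumes f: "f \<in> ml 1 k" and g: "g \<in> ml 1 l"
    and x: "x \<in> \<H>"
  shows "ecomp 1 0 1 l f g [x] = f [g [x]]"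
proof -
  obtain j where "homs [x] j" using homs_ex[of "[x]"] x by auto
  then show ?thesis using end_comp_app[OF f g, of "[]" 0 "[x]" "[]" "[]" j "[]"] by simp
qed

lemma unary_diff:
  assumes f: "f \<in> ml 1 k" and x: "x \<in> \<H>"
  shows "ediff 1 k f [x] = d (f [x]) - sgn_pow k *\<^sub>R f [d x]"
proof -
  obtain j where "homs [x] j" using homs_ex[of "[x]"] x by auto
  then show ?thesis using end_diff_app[OF f, of "[x]" j] by simp
qed

lemma unary_eqI:
  assumes "f \<in> ml 1 k" "g \<in> ml 1 l"
    "\<And>x. x \<in> \<H> \<Longrightarrow> f [x] = g [x]"
  shows "f = g"
  by (rule ml_eqI[OF assms(1,2)]) (use assms(3) homs_homog in \<open>force simp: length_Suc_conv\<close>)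

abbreviation "ev \<equiv> interp Q \<mu> \<iota>"

lemma interp_mu_pow:
  "1 \<le> p \<Longrightarrow> ev (mu_pow p) \<in> ml p 0 \<and>
    (\<forall>xs. length xs = p \<and> set xs \<subseteq> \<H> \<longrightarrow> ev (mu_pow p) xs = mprod xs)"
proof (induction p rule: mu_pow.induct)
  case 2
  show ?case using end_unit_mem
    by (auto simp: End_operad_def length_Suc_conv unary_app mprod_def one_right)
next
  case (3 n)
  let ?f = "ev (mu_pow (Suc n))"
  have f: "?f \<in> ml (Suc n) 0"
    and app: "\<And>xs. length xs = Suc n \<Longrightarrow> set xs \<subseteq> \<H> \<Longrightarrow> ?f xs = mprod xs"
    using 3 by auto
  have ar: "earity (mu_pow (Suc n)) = Suc n" "edeg (mu_pow (Suc n)) = 0"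
    using mu_pow_exprs[of "Suc n"] by (auto simp: exprs_def)
  have E: "ev (mu_pow (Suc (Suc n))) = ecomp 2 0 (Suc n) 0 \<mu> ?f"
    by (simp add: End_operad_def ar)
  have "ecomp 2 0 (Suc n) 0 \<mu> ?f xs = mprod xs"
    if xs: "length xs = Suc (Suc n)" "set xs \<subseteq> \<H>" for xs
  proof -
    obtain ys y where ys: "xs = ys @ [y]" "length ys = Suc n" using xs(1) by (metis length_Suc_conv_rev)
    have h: "set ys \<subseteq> \<H>" "y \<in> \<H>" using xs(2) ys by auto
    obtain js j where j: "homs ys js" "homs [y] j" using homs_ex h by (metis empty_subsetI insert_subset list.set)
    have "ecomp 2 0 (Suc n) 0 \<mu> ?f ([] @ ys @ [y]) = sgn_pow (0 * sum_list []) *\<^sub>R \<mu> ([] @ [?f ys] @ [y])"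
      by (rule end_comp_app[OF mu_ml f]) (use ys j in auto)
    then show ?thesis
      using app[OF ys(2) h(1)] mprod_homog[OF h(1)] h by (simp add: ys mu_app mprod_snoc)
  qed
  moreover have "ecomp 2 0 (Suc n) 0 \<mu> ?f \<in> ml (Suc (Suc n)) 0"
    using end_comp_mem[OF mu_ml f, of 0] by simp
  ultimately show ?case unfolding E by blast
qed simp

lemma interp_shuffle_term:
  assumes n: "1 \<le> n" and s: "\<sigma> \<in> shuffles_perm p q" and p: "1 \<le> p" and xs: "homs xs js" "length xs = p + q"
  shows "ev (EAct (EComp (mu_pow (q + 1)) 0 (EComp (EI n) 0 (mu_pow p))) (inv \<sigma>)) xs =
    sgn_pow (crossing_exp (p + q) (\<sigma> ` {..<p}) ((!) js)) *\<^sub>R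
      (i n (mprod (pick xs (\<sigma> ` {..<p}))) \<odot> mprod (pick xs ({..<p + q} - \<sigma> ` {..<p})))"
proof -
  define S where "S = \<sigma> ` {..<p}"
  have \<sigma>: "\<sigma> permutes {..<p + q}" using s by (simp add: shuffles_perm_def)
  have i\<sigma>: "inv \<sigma> permutes {..<p + q}" by (rule permutes_inv[OF \<sigma>])
  note l = shuffle_lists[OF s S_def]
  have ar: "earity (mu_pow p) = p" "edeg (mu_pow p) = 0" "earity (mu_pow (q + 1)) = q + 1" "edeg (mu_pow (q + 1)) = 0"
    using mu_pow_exprs[of p] mu_pow_exprs[of "q + 1"] p by (auto simp: exprs_def)
  let ?f = "ev (mu_pow p)" and ?g = "ev (mu_pow (q + 1))"
  have f: "?f \<in> ml p 0" and g: "?g \<in> ml (q + 1) 0"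
    using interp_mu_pow[of p] interp_mu_pow[of "q + 1"] p by auto
  let ?h = "ecomp 1 0 p 0 (\<iota> n) ?f"
  let ?k = "ecomp (q + 1) 0 p (- 2 * int n) ?g ?h"
  have h: "?h \<in> ml p (- 2 * int n)"
    using end_comp_mem[OF iota_ml[OF n] f, of 0] by simp
  have k: "?k \<in> ml (p + q) (- 2 * int n)"
    using end_comp_mem[OF g h, of 0] by (simp add: add.commute)
  have E: "ev (EAct (EComp (mu_pow (q + 1)) 0 (EComp (EI n) 0 (mu_pow p))) (inv \<sigma>)) = eact (p + q) (inv \<sigma>) ?k"
    using ar by (simp add: End_operad_def add.commute)
  define bs cs where "bs = pick xs S" and "cs = pick xs ({..<p + q} - S)"
  have perm: "permuted (inv \<sigma>) (p + q) xs = bs @ cs"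
  proof -
    have "permuted (inv \<sigma>) (p + q) xs = map ((!) xs) (map \<sigma> [0..<p + q])"
      by (simp add: permuted_def inv_inv_eq[OF permutes_bij[OF \<sigma>]])
    also have "[0..<p + q] = [0..<p] @ [p..<p + q]" by (rule upt_add_eq_append) simp
    finally show ?thesis by (simp only: map_append l(1,2) bs_def cs_def pick_def)
  qed
  have hb: "homs bs (pick js S)" "homs cs (pick js ({..<p + q} - S))"
    unfolding bs_def cs_def using l(3) xs by (auto intro!: homs_pick)
  have len: "length bs = p" "length cs = q"
    using l(3,4) finite_subset[OF l(3)] by (auto simp: bs_def cs_def card_Diff_subset)
  have b: "mprod bs \<in> \<H>" using mprod_mem[OF hb(1)] by (rule homogI)
  have ib: "i n (mprod bs) \<in> \<H>" by (rule hom_op_homog[OF i_op[OF n] b])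
  have "?h bs = i n (mprod bs)"
  proof -
    have "?h ([] @ bs @ []) = sgn_pow (0 * sum_list []) *\<^sub>R \<iota> n ([] @ [?f bs] @ [])"
      by (rule end_comp_app[OF iota_ml[OF n] f _ _ _ _ hb(1)]) (use len in auto)
    moreover have "?f bs = mprod bs" using interp_mu_pow[of p] p len homs_homog[OF hb(1)] by simp
    ultimately show ?thesis using b by (simp add: unary_app)
  qed
  moreover have "?k ([] @ bs @ cs) = sgn_pow (- 2 * int n * sum_list []) *\<^sub>R ?g ([] @ [?h bs] @ cs)"
    by (rule end_comp_app[OF g h _ _ _ _ hb]) (use len in auto)
  moreover have "?g ([] @ [i n (mprod bs)] @ cs) = mprod (i n (mprod bs) # cs)"
    using interp_mu_pow[of "q + 1"] len ib homs_homog[OF hb(2)] by simp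
  ultimately have "?k (bs @ cs) = i n (mprod bs) \<odot> mprod cs" by (simp add: mprod_def)
  then show ?thesis
    unfolding E end_act_app[OF k i\<sigma> xs] perm
    using koszul_shuffle[OF s] by (simp add: S_def bs_def cs_def)
qed

text \<open>The value of the relation on a homogeneous list is \<open>shuffle_sum\<close> without the term for the empty set.\<close>

lemma order_relation:
  assumes n: "1 \<le> n"
  shows "linext ev (order_rel n (n + 1)) = 0"
proof -
  define N where "N = n + 2"
  let ?t = "\<lambda>p \<sigma>. EAct (EComp (mu_pow (N - p + 1)) 0 (EComp (EI n) 0 (mu_pow p))) (inv \<sigma>)"
  have rel: "order_rel n (n + 1) = (\<Sum>p = 1..N. \<Sum>\<sigma>\<in>shuffles_perm p (N - p). (- 1) ^ p *\<^sub>R basis_elt (?t p \<sigma>))"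
    by (simp add: order_rel_def N_def)
  have lin: "linext ev (order_rel n (n + 1)) = (\<Sum>p = 1..N. \<Sum>\<sigma>\<in>shuffles_perm p (N - p). (- 1) ^ p *\<^sub>R ev (?t p \<sigma>))"
    unfolding rel by (simp only: linear_sum[OF linear_linext] linear_scale[OF linear_linext] linext_basis)
  have app: "(\<Sum>p = 1..N. \<Sum>\<sigma>\<in>shuffles_perm p (N - p). (- 1) ^ p *\<^sub>R ev (?t p \<sigma>)) xs
      = (\<Sum>p = 1..N. \<Sum>\<sigma>\<in>shuffles_perm p (N - p). (- 1) ^ p *\<^sub>R ev (?t p \<sigma>) xs)" for xs
    by (simp add: sum_fun_apply scaleR_fun_def)
  show ?thesis
  proof
    fix xs
    show "linext ev (order_rel n (n + 1)) xs = 0 xs"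
    proof (cases "length xs = N \<and> set xs \<subseteq> \<H>")
      case True
      then obtain js where xs: "homs xs js" "length xs = N" using homs_ex by blast
      define h where "h S = ((- 1) ^ card S * sgn_pow (crossing_exp N S ((!) js))) *\<^sub>R
        (i n (mprod (pick xs S)) \<odot> mprod (pick xs ({..<N} - S)))" for S
      have "linext ev (order_rel n (n + 1)) xs = (\<Sum>p = 1..N. \<Sum>\<sigma>\<in>shuffles_perm p (N - p). h (\<sigma> ` {..<p}))"
        unfolding lin app
      proof (intro sum.cong refl)
        fix p \<sigma> assume p: "p \<in> {1..N}" and s: "\<sigma> \<in> shuffles_perm p (N - p)"
        have len: "length xs = p + (N - p)" using p xs by simp
        have "1 \<le> p" using p by simp
        from interp_shuffle_term[OF n s this xs(1) len] shuffle_lists(4)[OF s refl] p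
        show "(- 1) ^ p *\<^sub>R ev (?t p \<sigma>) xs = h (\<sigma> ` {..<p})" by (simp add: h_def)
      qed
      also have "\<dots> = (\<Sum>S\<in>Pow {..<N}. h S) - h {}" by (rule sum_nonempty_subsets)
      also have "(\<Sum>S\<in>Pow {..<N}. h S) = shuffle_sum (i n) xs js"
        by (simp add: shuffle_sum_def h_def xs)
      also have "\<dots> = 0"
        using shuffle_sum_diffop[OF _ i_op[OF n] xs(1)] i_order[OF n] xs(2) by (simp add: N_def)
      also have "h {} = 0"
        using mprod_homog[of "pick xs {..<N}"] homs_homog[OF homs_pick[OF xs(1), of "{..<N}"]] xs i_one[OF n]
        by (simp add: h_def pick_def[of _ "{}"] mprod_def[of "[]"] mul_0_left)
      finally show ?thesis by simp
    next
      case False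
      have "ev (?t p \<sigma>) xs = 0" if "p \<in> {1..N}" for p \<sigma>
      proof -
        have "earity (?t p \<sigma>) = N"
          using that mu_pow_exprs[of p] mu_pow_exprs[of "N - p + 1"] by (auto simp: exprs_def)
        then have "ev (?t p \<sigma>) = eact N (inv \<sigma>) (ev (EComp (mu_pow (N - p + 1)) 0 (EComp (EI n) 0 (mu_pow p))))"
          by (simp add: End_operad_def)
        then show ?thesis using False by (auto simp: end_act_def ext_map_def)
      qed
      then show ?thesis unfolding lin app by simp
    qed
  qed
qed

end

context ecbv_calg begin

lemma ecbv_presentation_End: "ecbv_presentation Q \<mu> \<iota>"
proof (unfold_locales)
  show "dg_operad Q" by (rule dg_operad_End)
  show "\<mu> \<in> opc Q 2 0" using mu_ml by (simp add: End_operad_def)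
  show "\<iota> n \<in> opc Q 1 (- 2 * int n)" if "1 \<le> n" for n
    using iota_ml[OF that] by (simp add: End_operad_def)
  show "opact Q 2 0 (Transposition.transpose 0 1) \<mu> = \<mu>"
  proof -
    let ?\<tau> = "Transposition.transpose 0 1 :: nat \<Rightarrow> nat"
    have \<tau>: "?\<tau> permutes {..<2}" by (rule permutes_swap_id) auto
    have "eact 2 ?\<tau> \<mu> = \<mu>"
    proof (rule ml_eqI[OF end_act_mem[OF mu_ml \<tau>] mu_ml])
      fix xs js assume xs: "homs xs js" "length xs = 2"
      obtain x y where xy: "xs = [x, y]" using xs(2) by (auto simp: numeral_2_eq_2 length_Suc_conv)
      obtain a b where ab: "js = [a, b]" using homs_length[OF xs(1)] xs(2) by (auto simp: numeral_2_eq_2 length_Suc_conv)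
      have h: "x \<in> gcar A a" "y \<in> gcar A b" using xs(1) by (simp_all add: xy ab)
      have "permuted ?\<tau> 2 xs = [y, x]"
        by (rule permuted_eqI[OF \<tau>]) (auto simp: xy numeral_2_eq_2 less_Suc_eq)
      moreover have "inversions ?\<tau> 2 = {(0, 1)}"
        by (auto simp: inversions_def numeral_2_eq_2 less_Suc_eq)
      then have "koszul ?\<tau> 2 ((!) js) = a * b" by (simp add: koszul_def ab)
      ultimately show "eact 2 ?\<tau> \<mu> xs = \<mu> xs"
        using end_act_app[OF mu_ml \<tau> xs] mul_comm[OF h] h by (simp add: xy mu_app homogI)
    qed
    then show ?thesis by (simp add: End_operad_def)
  qed
  show "opcomp Q 2 0 0 2 0 \<mu> \<mu> = opcomp Q 2 0 1 2 0 \<mu> \<mu>"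
  proof -
    have m: "ecomp 2 0 2 0 \<mu> \<mu> \<in> ml 3 0"
      "ecomp 2 1 2 0 \<mu> \<mu> \<in> ml 3 0"
      using end_comp_mem[OF mu_ml mu_ml, of 0] end_comp_mem[OF mu_ml mu_ml, of 1] by simp_all
    have "ecomp 2 0 2 0 \<mu> \<mu> = ecomp 2 1 2 0 \<mu> \<mu>"
    proof (rule ml_eqI[OF m])
      fix xs js assume xs: "homs xs js" "length xs = 3"
      obtain x y z where xyz: "xs = [x, y, z]" using xs(2) by (auto simp: numeral_3_eq_3 length_Suc_conv)
      obtain a b c where abc: "js = [a, b, c]" using homs_length[OF xs(1)] xs(2) by (auto simp: numeral_3_eq_3 length_Suc_conv)
      have h: "homs [x] [a]" "homs [y] [b]" "homs [z] [c]" using xs(1) by (simp_all add: xyz abc)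
      have hh: "x \<in> \<H>" "y \<in> \<H>" "z \<in> \<H>" using h by (auto simp: homogI)
      have "ecomp 2 0 2 0 \<mu> \<mu> ([] @ [x, y] @ [z]) = sgn_pow (0 * sum_list []) *\<^sub>R \<mu> ([] @ [\<mu> [x, y]] @ [z])"
        by (rule end_comp_app[OF mu_ml mu_ml, where jb = "[a, b]" and jc = "[c]"]) (use h in auto)
      moreover have "ecomp 2 1 2 0 \<mu> \<mu> ([x] @ [y, z] @ []) = sgn_pow (0 * sum_list [a]) *\<^sub>R \<mu> ([x] @ [\<mu> [y, z]] @ [])"
        by (rule end_comp_app[OF mu_ml mu_ml, where jb = "[b, c]" and jc = "[]"]) (use h in auto)
      ultimately show "ecomp 2 0 2 0 \<mu> \<mu> xs = ecomp 2 1 2 0 \<mu> \<mu> xs"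
        using hh by (simp add: xyz mu_app mul_homog mul_assoc)
    qed
    then show ?thesis by (simp add: End_operad_def)
  qed
  show "opdiff Q 2 0 \<mu> = 0"
  proof -
    have "ediff 2 0 \<mu> = 0"
    proof (rule ml_eqI[OF end_diff_mem[OF mu_ml] subspace_0[OF subspace_ml]])
      fix xs js assume xs: "homs xs js" "length xs = 2"
      obtain x y where xy: "xs = [x, y]" using xs(2) by (auto simp: numeral_2_eq_2 length_Suc_conv)
      obtain a b where ab: "js = [a, b]" using homs_length[OF xs(1)] xs(2) by (auto simp: numeral_2_eq_2 length_Suc_conv)
      have h: "x \<in> gcar A a" "y \<in> gcar A b" using xs(1) by (simp_all add: xy ab)
      have hh: "x \<in> \<H>" "y \<in> \<H>" "d x \<in> \<H>" "d y \<in> \<H>"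
        using h by (auto intro: homogI d_mem)
      have "{..<2} = {0, 1::nat}" by auto
      then show "ediff 2 0 \<mu> xs = 0 xs"
        using end_diff_app[OF mu_ml xs] d_deriv[OF h(1) hh(2)] hh by (simp add: xy ab mu_app)
    qed
    then show ?thesis by (simp add: End_operad_def)
  qed
  show "linext ev (order_rel n (n + 1)) = 0" if "1 \<le> n" for n
    by (rule order_relation[OF that])
  show "opcomp Q 1 (- 2 * int n) 0 1 (- 2 * int k) (\<iota> n) (\<iota> k) = opcomp Q 1 (- 2 * int k) 0 1 (- 2 * int n) (\<iota> k) (\<iota> n)"
    if "1 \<le> n" "1 \<le> k" for n k
  proof -
    note n = iota_ml[OF that(1)] and k = iota_ml[OF that(2)]
    have "ecomp 1 0 1 (- 2 * int k) (\<iota> n) (\<iota> k) = ecomp 1 0 1 (- 2 * int n) (\<iota> k) (\<iota> n)"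
    proof (rule unary_eqI)
      show "ecomp 1 0 1 (- 2 * int k) (\<iota> n) (\<iota> k) \<in> ml 1 (- 2 * int n + - 2 * int k)"
        using end_comp_mem[OF n k, of 0] by simp
      show "ecomp 1 0 1 (- 2 * int n) (\<iota> k) (\<iota> n) \<in> ml 1 (- 2 * int k + - 2 * int n)"
        using end_comp_mem[OF k n, of 0] by simp
      fix x assume x: "x \<in> \<H>"
      show "ecomp 1 0 1 (- 2 * int k) (\<iota> n) (\<iota> k) [x] = ecomp 1 0 1 (- 2 * int n) (\<iota> k) (\<iota> n) [x]"
        unfolding unary_comp[OF n k x] unary_comp[OF k n x]
        using x i_commute[OF that x] hom_op_homog[OF i_op[OF that(1)] x] hom_op_homog[OF i_op[OF that(2)] x]
        by (simp add: unary_app)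
    qed
    then show ?thesis by (simp add: End_operad_def)
  qed
  show "(\<Sum>j = 1..n - 1.
        opcomp Q 1 (- 2 * int j) 0 1 (- 2 * int (n - j) + 1) (\<iota> j) (opdiff Q 1 (- 2 * int (n - j)) (\<iota> (n - j)))
      - opcomp Q 1 (- 2 * int (n - j) + 1) 0 1 (- 2 * int j) (opdiff Q 1 (- 2 * int (n - j)) (\<iota> (n - j))) (\<iota> j)) = 0"
    (is "(\<Sum>j = 1..n - 1. ?F j) = 0") if n: "2 \<le> n" for n
  proof -
    define G where "G j = ecomp 1 0 1 (- 2 * int (n - j) + 1) (\<iota> j) (ediff 1 (- 2 * int (n - j)) (\<iota> (n - j)))
      - ecomp 1 0 1 (- 2 * int j) (ediff 1 (- 2 * int (n - j)) (\<iota> (n - j))) (\<iota> j)" for j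
    have G: "G j \<in> ml 1 (1 - 2 * int n)" and
      G_app: "x \<in> \<H> \<Longrightarrow> G j [x] =
        i j (d (i (n - j) x) - i (n - j) (d x)) - (d (i (n - j) (i j x)) - i (n - j) (d (i j x)))"
      if j: "j \<in> {1..n - 1}" for j x
    proof -
      have j1: "1 \<le> j" "1 \<le> n - j" using j n by auto
      note a = iota_ml[OF j1(1)] and b = iota_ml[OF j1(2)]
      note b' = end_diff_mem[OF b]
      have deg: "- 2 * int j + (- 2 * int (n - j) + 1) = 1 - 2 * int n" "- 2 * int (n - j) + 1 + - 2 * int j = 1 - 2 * int n"
        using j n by (auto simp: of_nat_diff)
      show "G j \<in> ml 1 (1 - 2 * int n)"
        unfolding G_def using end_comp_mem[OF a b', of 0] end_comp_mem[OF b' a, of 0]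
        by (intro subspace_diff[OF subspace_ml]) (simp_all only: deg, simp_all)
      assume x: "x \<in> \<H>"
      have hx: "i j x \<in> \<H>" "i (n - j) x \<in> \<H>" "d x \<in> \<H>"
        using x hom_op_homog[OF i_op[OF j1(1)]] hom_op_homog[OF i_op[OF j1(2)]] d_homog by auto
      have s: "sgn_pow (- 2 * int (n - j)) = 1" by (simp add: sgn_pow_def)
      have D: "ediff 1 (- 2 * int (n - j)) (\<iota> (n - j)) [y] = d (i (n - j) y) - i (n - j) (d y)"
        if y: "y \<in> \<H>" for y
        using unary_diff[OF b y] y d_homog[OF y] s by (simp add: unary_app)
      obtain k where k: "x \<in> gcar A k" using x by (auto simp: homog_def)
      have "d (i (n - j) x) - i (n - j) (d x) \<in> \<H>"
      proof (rule homogI[OF V_diff])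
        show "d (i (n - j) x) \<in> gcar A (k + - 2 * int (n - j) + 1)"
          by (rule d_mem[OF hom_op_mem[OF i_op[OF j1(2)] k]])
        show "i (n - j) (d x) \<in> gcar A (k + - 2 * int (n - j) + 1)"
          using hom_op_mem[OF i_op[OF j1(2)] d_mem[OF k]] by (simp add: algebra_simps)
      qed
      then show "G j [x] = i j (d (i (n - j) x) - i (n - j) (d x)) - (d (i (n - j) (i j x)) - i (n - j) (d (i j x)))"
        unfolding G_def fun_diff_def unary_comp[OF a b' x] unary_comp[OF b' a x] D[OF x]
        using x hx D[OF hx(1)] by (simp add: unary_app)
    qed
    have app: "(sum G I) xs = (\<Sum>j\<in>I. G j xs)" for I xs
      by (induction I rule: infinite_finite_induct) auto
    have "(\<Sum>j = 1..n - 1. G j) = 0"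
    proof (rule unary_eqI)
      show "(\<Sum>j = 1..n - 1. G j) \<in> ml 1 (1 - 2 * int n)"
        by (rule subspace_sum[OF subspace_ml G])
      show "0 \<in> ml 1 0" by (rule subspace_0[OF subspace_ml])
      fix x assume x: "x \<in> \<H>"
      have "(\<Sum>j = 1..n - 1. G j [x]) = 0"
        unfolding i_exact[OF n x, symmetric] by (rule sum.cong[OF refl G_app[OF _ x]])
      then show "(\<Sum>j = 1..n - 1. G j) [x] = 0 [x]" by (simp add: app)
    qed
    then show ?thesis by (simp add: End_operad_def G_def)
  qed
qed

theorem ecbv_algebra_exists: "\<exists>B. ecbv_algebra m (gcar A) d (gmul A) i B"
proof -
  interpret P: ecbv_presentation Q \<mu> \<iota> by (rule ecbv_presentation_End)
  have "ecbv_algebra m (gcar A) d (gmul A) i \<lparr>cx = gcar A, cdiff = d, act = (\<lambda>n k. P.induced)\<rparr>"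
    unfolding ecbv_algebra_def operad_algebra_def
    by (auto simp only: op_algebra.simps P.induced_class interp.simps intro: complex P.operad_morphism_induced)
  then show ?thesis ..
qed

end

subsection \<open>Morphisms are determined by the generators\<close>

lemma class_mem: "t \<in> exprs n k \<Longrightarrow> ecbv_class t \<in> opc ECBV n k"
  by (simp add: ECBV_def ecbv_class.abs_eq)

lemma ecbv_op_induct [consumes 1, case_names zero add scale gen]:
  assumes "X \<in> opc ECBV n k"
    and "P 0" "\<And>X Y. X \<in> opc ECBV n k \<Longrightarrow> Y \<in> opc ECBV n k \<Longrightarrow> P X \<Longrightarrow> P Y \<Longrightarrow> P (X + Y)"
    and "\<And>c X. X \<in> opc ECBV n k \<Longrightarrow> P X \<Longrightarrow> P (c *\<^sub>R X)"
    and "\<And>t. t \<in> exprs n k \<Longrightarrow> P (ecbv_class t)"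
  shows "P X"
proof -
  obtain x where x: "X = abs_ecbv x" "x \<in> fexprs n k" using assms(1) by (auto simp: ECBV_def)
  have mem: "y \<in> fexprs n k \<Longrightarrow> abs_ecbv y \<in> opc ECBV n k" for y by (simp add: ECBV_def)
  have "x \<in> fexprs n k \<and> P (abs_ecbv x)"
    using x(2)[unfolded fexprs_eq_span]
  proof (induction rule: span_induct_alt)
    case base
    then show ?case using assms(2) subspace_0[OF subspace_fexprs] by (simp add: zero_ecbv_def)
  next
    case (step c x y)
    then obtain t where t: "x = basis_elt t" "t \<in> exprs n k" by auto
    have 1: "c *\<^sub>R x \<in> fexprs n k" using t subspace_scale[OF subspace_fexprs] by auto
    have 2: "P (abs_ecbv (c *\<^sub>R x))"
      using assms(4)[OF class_mem[OF t(2)] assms(5)[OF t(2)], of c] t by (simp add: scaleR_ecbv.abs_eq ecbv_class.abs_eq)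
    show ?case
      using assms(3)[OF mem[OF 1] mem[of y] 2] step subspace_add[OF subspace_fexprs 1, of y]
      by (simp add: plus_ecbv.abs_eq)
  qed
  then show ?thesis by (simp add: x)
qed

lemma
  assumes "operad_morphism P Q \<phi>"
  shows operad_morphism_mem: "x \<in> opc P n k \<Longrightarrow> \<phi> n k x \<in> opc Q n k"
    and operad_morphism_lin: "lin_on (opc P n k) (\<phi> n k)"
    and operad_morphism_id: "\<phi> 1 0 (opid P) = opid Q"
    and operad_morphism_comp: "i < r \<Longrightarrow> x \<in> opc P r k \<Longrightarrow> y \<in> opc P n l \<Longrightarrow>
      \<phi> (r + n - 1) (k + l) (opcomp P r k i n l x y) = opcomp Q r k i n l (\<phi> r k x) (\<phi> n l y)"
    and operad_morphism_act: "\<sigma> permutes {..<n} \<Longrightarrow> x \<in> opc P n k \<Longrightarrow>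
      \<phi> n k (opact P n k \<sigma> x) = opact Q n k \<sigma> (\<phi> n k x)"
    and operad_morphism_diff: "x \<in> opc P n k \<Longrightarrow> \<phi> n (k + 1) (opdiff P n k x) = opdiff Q n k (\<phi> n k x)"
  using assms unfolding operad_morphism_def image_subset_iff by simp_all

locale ecbv_op_algebra =
  fixes m :: int and A :: "('v::real_vector, ecbv) op_algebra"
  assumes op_alg: "operad_algebra m ECBV A" and even_modulus: "even m"
begin

sublocale graded_cx m "cx A" "cdiff A"
  using op_alg even_modulus
  by unfold_locales (simp_all add: operad_algebra_def cochain_complex_def)

abbreviation "E \<equiv> End_operad (cx A) (cdiff A)"

lemma act_morphism: "operad_morphism ECBV E (act A)"
  using op_alg by (simp add: operad_algebra_def)

lemma act_ml: "X \<in> opc ECBV n k \<Longrightarrow> act A n k X \<in> multilinear_maps (cx A) n k"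
  using operad_morphism_mem[OF act_morphism] by (simp add: End_operad_def)

lemma act_lin: "lin_on (opc ECBV n k) (act A n k)"
  by (rule operad_morphism_lin[OF act_morphism])

lemma zero_ECBV: "0 \<in> opc ECBV n k"
  using dg_operad_ECBV[unfolded dg_operad_def, THEN conjunct1] subspace_0 by blast

lemma act_zero: "act A n k 0 = 0"
  by (rule lin_on_zero[OF act_lin zero_ECBV])

definition opn :: "expr \<Rightarrow> 'v list \<Rightarrow> 'v"
  where "opn t = act A (earity t) (edeg t) (ecbv_class t)"

lemma opn_ml: "wf_expr t \<Longrightarrow> opn t \<in> multilinear_maps (cx A) (earity t) (edeg t)"
  unfolding opn_def by (intro act_ml class_mem) (simp add: exprs_def)

lemma opn_Id: "opn EId = unary_op (cx A) (\<lambda>x. x)"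
  using operad_morphism_id[OF act_morphism] by (simp add: opn_def End_operad_def ECBV_def)

lemma opn_Comp:
  assumes "wf_expr (EComp s i t)"
  shows "opn (EComp s i t) = end_comp (cx A) (earity s) i (earity t) (edeg t) (opn s) (opn t)"
proof -
  have st: "s \<in> exprs (earity s) (edeg s)" "t \<in> exprs (earity t) (edeg t)" "i < earity s"
    using assms by (auto simp: exprs_def)
  have "ecbv_class (EComp s i t) = opcomp ECBV (earity s) (edeg s) i (earity t) (edeg t) (ecbv_class s) (ecbv_class t)"
    using assms by (simp add: ECBV_def ecbv_class.abs_eq ecbv_comp.abs_eq expr_comp_basis wf_basis_def)
  moreover have "act A (earity s + earity t - 1) (edeg s + edeg t)
      (opcomp ECBV (earity s) (edeg s) i (earity t) (edeg t) (ecbv_class s) (ecbv_class t))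
    = opcomp E (earity s) (edeg s) i (earity t) (edeg t) (opn s) (opn t)"
    unfolding opn_def by (rule operad_morphism_comp[OF act_morphism st(3) class_mem[OF st(1)] class_mem[OF st(2)]])
  ultimately show ?thesis by (simp add: opn_def End_operad_def)
qed

lemma opn_Act:
  assumes "wf_expr (EAct s \<sigma>)"
  shows "opn (EAct s \<sigma>) = end_act (cx A) (earity s) \<sigma> (opn s)"
proof -
  have s: "s \<in> exprs (earity s) (edeg s)" "\<sigma> permutes {..<earity s}" using assms by (auto simp: exprs_def)
  have "ecbv_class (EAct s \<sigma>) = opact ECBV (earity s) (edeg s) \<sigma> (ecbv_class s)"
    using assms by (simp add: ECBV_def ecbv_class.abs_eq ecbv_perm.abs_eq expr_perm_basis wf_basis_def)
  moreover have "act A (earity s) (edeg s) (opact ECBV (earity s) (edeg s) \<sigma> (ecbv_class s))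
    = opact E (earity s) (edeg s) \<sigma> (opn s)"
    unfolding opn_def by (rule operad_morphism_act[OF act_morphism s(2) class_mem[OF s(1)]])
  ultimately show ?thesis by (simp add: opn_def End_operad_def)
qed

lemma opn_Diff:
  assumes "wf_expr s"
  shows "opn (EDiff s) = end_diff (cx A) (cdiff A) (earity s) (edeg s) (opn s)"
proof -
  have s: "s \<in> exprs (earity s) (edeg s)" using assms by (auto simp: exprs_def)
  have "ecbv_class (EDiff s) = opdiff ECBV (earity s) (edeg s) (ecbv_class s)"
    using assms by (simp add: ECBV_def ecbv_class.abs_eq ecbv_diff.abs_eq expr_diff_basis wf_basis_def)
  moreover have "act A (earity s) (edeg s + 1) (opdiff ECBV (earity s) (edeg s) (ecbv_class s))
    = opdiff E (earity s) (edeg s) (opn s)"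
    unfolding opn_def by (rule operad_morphism_diff[OF act_morphism class_mem[OF s]])
  ultimately show ?thesis by (simp add: opn_def End_operad_def)
qed

end

lemma permuted_map:
  assumes "\<sigma> permutes {..<n}" "length xs = n"
  shows "permuted \<sigma> n (map f xs) = map f (permuted \<sigma> n xs)"
  using permutes_less[OF permutes_inv[OF assms(1)]] assms(2) by (simp add: permuted_def)

text \<open>Every operation is a linear combination of expressions in the generators, the operadic compositions,
  the symmetric group actions and the differential, all of which \<open>f\<close> respects.\<close>

theorem ecbv_algebra_morphism:
  fixes f :: "'v::real_vector \<Rightarrow> 'w::real_vector"
  assumes even: "even m"
    and A: "ecbv_algebra m V d mul i A" and B: "ecbv_algebra m V' d' mul' i' B"
    and f: "\<And>k. f ` V k \<subseteq> V' k" "\<And>k. lin_on (V k) f"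
    and f_d: "\<And>x. x \<in> homog V \<Longrightarrow> f (d x) = d' (f x)"
    and f_mul: "\<And>x y. x \<in> homog V \<Longrightarrow> y \<in> homog V \<Longrightarrow> f (mul x y) = mul' (f x) (f y)"
    and f_i: "\<And>n x. 1 \<le> n \<Longrightarrow> x \<in> homog V \<Longrightarrow> f (i n x) = i' n (f x)"
  shows "algebra_morphism ECBV A B f"
proof -
  have A': "cx A = V" "cdiff A = d" and B': "cx B = V'" "cdiff B = d'"
    using A B by (auto simp: ecbv_algebra_def)
  interpret A: ecbv_op_algebra m A using A even by unfold_locales (auto simp: ecbv_algebra_def)
  interpret B: ecbv_op_algebra m B using B even by unfold_locales (auto simp: ecbv_algebra_def)
  have hf: "B.homs (map f xs) js" if "A.homs xs js" for xs js
    using that[unfolded A.homs_def, unfolded A'] f(1)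
    by (subst B.homs_def, unfold B') (auto simp: list_all2_conv_all_nth image_subset_iff)
  have fh: "f x \<in> homog V'" if "x \<in> homog V" for x
    using that f(1) by (auto simp: homog_def)
  have gens: "A.opn EMu = binary_op V mul" "B.opn EMu = binary_op V' mul'"
    "1 \<le> n \<Longrightarrow> A.opn (EI n) = unary_op V (i n)" "1 \<le> n \<Longrightarrow> B.opn (EI n) = unary_op V' (i' n)" for n
    using A B by (auto simp: ecbv_algebra_def A.opn_def B.opn_def)
  have main: "f (A.opn t xs) = B.opn t (map f xs)"
    if "wf_expr t" "A.homs xs js" "length xs = earity t" for t xs js
    using that
  proof (induction t arbitrary: xs js)
    case EMu
    obtain x y where xy: "xs = [x, y]" using EMu(3) by (auto simp: numeral_2_eq_2 length_Suc_conv)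
    have "x \<in> homog V" "y \<in> homog V" using A.homs_homog[OF EMu(2)] by (auto simp: xy A')
    then show ?case unfolding gens using f_mul fh by (simp add: xy ext_map_def)
  next
    case (EI n)
    then have n: "1 \<le> n" by simp
    obtain x where x: "xs = [x]" using EI(3) by (auto simp: length_Suc_conv)
    have "x \<in> homog V" using A.homs_homog[OF EI(2)] by (auto simp: x A')
    then show ?case unfolding gens(3,4)[OF n] using f_i[OF n] fh by (simp add: x ext_map_def)
  next
    case EId
    obtain x where x: "xs = [x]" using EId(3) by (auto simp: length_Suc_conv)
    have "x \<in> homog V" using A.homs_homog[OF EId(2)] by (auto simp: x A')
    then show ?case unfolding A.opn_Id B.opn_Id A' B' using fh by (simp add: x ext_map_def)
  next
    case (EComp s i t)
    have wf: "wf_expr s" "wf_expr t" "i < earity s" using EComp.prems(1) by auto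
    obtain as bs cs where s: "xs = as @ bs @ cs" "length as = i" "length bs = earity t" "i + 1 + length cs = earity s"
      using A.list_split3[of xs "earity s" "earity t" i] EComp.prems(3) wf(3) by auto
    obtain ja jb jc where j: "js = ja @ jb @ jc" "A.homs as ja" "A.homs bs jb" "A.homs cs jc"
      using A.homs_append3E EComp.prems(2) s(1) by blast
    let ?y = "A.opn t bs"
    have y: "A.homs [?y] [sum_list jb + edeg t]"
      using A.ml_degree[OF A.opn_ml[OF wf(2)] j(3) s(3)] by simp
    have "f (A.opn s (as @ [?y] @ cs)) = B.opn s (map f (as @ [?y] @ cs))"
      by (rule EComp.IH(1)[OF wf(1)]) (use A.homs_append[OF j(2) A.homs_append[OF y j(4)]] s in auto)
    moreover have "f ?y = B.opn t (map f bs)" by (rule EComp.IH(2)[OF wf(2) j(3) s(3)])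
    moreover have "A.opn s (as @ [?y] @ cs) \<in> V (sum_list (ja @ [sum_list jb + edeg t] @ jc) + edeg s)"
      unfolding A'(1)[symmetric]
      by (rule A.ml_degree[OF A.opn_ml[OF wf(1)] A.homs_append[OF j(2) A.homs_append[OF y j(4)]]]) (use s in simp)
    moreover have "B.opn (EComp s i t) (map f as @ map f bs @ map f cs)
      = sgn_pow (edeg t * sum_list ja) *\<^sub>R B.opn s (map f as @ [B.opn t (map f bs)] @ map f cs)"
      unfolding B.opn_Comp[OF EComp.prems(1)]
      by (rule B.end_comp_app[OF B.opn_ml[OF wf(1)] B.opn_ml[OF wf(2)] _ _ _ hf[OF j(2)] hf[OF j(3)] hf[OF j(4)]])
        (use s in auto)
    ultimately show ?case
      unfolding A.opn_Comp[OF EComp.prems(1)] s(1)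
        A.end_comp_app[OF A.opn_ml[OF wf(1)] A.opn_ml[OF wf(2)] s(2-4) j(2-4)]
      using lin_on_scale[OF f(2)] by simp
  next
    case (EAct s \<sigma>)
    have wf: "wf_expr s" "\<sigma> permutes {..<earity s}" using EAct.prems(1) by auto
    have len: "length xs = earity s" using EAct.prems(3) by simp
    note p = A.homs_permute[OF wf(2) EAct.prems(2) len]
    have "f (A.opn s (permuted \<sigma> (earity s) xs)) = B.opn s (map f (permuted \<sigma> (earity s) xs))"
      by (rule EAct.IH[OF wf(1) p]) simp
    moreover have "A.opn s (permuted \<sigma> (earity s) xs) \<in> V (sum_list (permuted \<sigma> (earity s) js) + edeg s)"
      unfolding A'(1)[symmetric] by (rule A.ml_degree[OF A.opn_ml[OF wf(1)] p]) simp
    ultimately show ?case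
      unfolding A.opn_Act[OF EAct.prems(1)] B.opn_Act[OF EAct.prems(1)]
        A.end_act_app[OF A.opn_ml[OF wf(1)] wf(2) EAct.prems(2) len]
      using B.end_act_app[OF B.opn_ml[OF wf(1)] wf(2) hf[OF EAct.prems(2)]] len lin_on_scale[OF f(2)]
      by (simp add: permuted_map[OF wf(2)])
  next
    case (EDiff s)
    have wf: "wf_expr s" using EDiff.prems(1) by simp
    have len: "length xs = earity s" using EDiff.prems(3) by simp
    note s = A.opn_ml[OF wf] and s' = B.opn_ml[OF wf]
    note jl = A.homs_length[OF EDiff.prems(2), unfolded len]
    define x' where "x' p = xs[p := d (xs ! p)]" for p
    have x': "A.homs (x' p) (js[p := js ! p + 1])" "length (x' p) = earity s" if "p < earity s" for p
      using A.homs_d[OF EDiff.prems(2), of p] that len by (simp_all add: x'_def A')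
    have D: "A.opn s xs \<in> V (sum_list js + edeg s)"
      unfolding A'(1)[symmetric] by (rule A.ml_degree[OF s EDiff.prems(2) len])
    have mem: "A.opn s (x' p) \<in> V (sum_list js + edeg s + 1)" if "p < earity s" for p
      using A.ml_degree[OF s x'[OF that]] sum_list_update_add[of p js 1] jl that
      by (simp add: A' algebra_simps)
    have dD: "d (A.opn s xs) \<in> V (sum_list js + edeg s + 1)"
      using A.d_mem[OF D[folded A']] by (simp add: A')
    have sub: "subspace (V k)" for k using A.subspace_V by (simp add: A')
    let ?S = "\<Sum>p<earity s. sgn_pow (sum_list (take p js)) *\<^sub>R A.opn s (x' p)"
    have S: "?S \<in> V (sum_list js + edeg s + 1)"
      by (intro subspace_sum[OF sub] subspace_scale[OF sub] mem) auto
    have fx: "map f (x' p) = (map f xs)[p := d' (map f xs ! p)]" if "p < earity s" for p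
      using that len f_d[of "xs ! p"] A.homog_nth[OF A.homs_homog[OF EDiff.prems(2)], of p]
      by (simp add: x'_def map_update A')
    have "f (A.opn (EDiff s) xs) = f (d (A.opn s xs) - sgn_pow (edeg s) *\<^sub>R ?S)"
      unfolding A.opn_Diff[OF wf] A.end_diff_app[OF s EDiff.prems(2) len] unfolding A' x'_def ..
    also have "\<dots> = f (d (A.opn s xs)) - sgn_pow (edeg s) *\<^sub>R f ?S"
      using lin_on_diff[OF f(2) sub dD subspace_scale[OF sub S]] lin_on_scale[OF f(2) S] by simp
    also have "f (d (A.opn s xs)) = d' (B.opn s (map f xs))"
      using f_d[of "A.opn s xs"] D EDiff.IH[OF wf EDiff.prems(2) len] by (auto simp: homog_def)
    also have "f ?S = (\<Sum>p<earity s. f (sgn_pow (sum_list (take p js)) *\<^sub>R A.opn s (x' p)))"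
      by (rule lin_on_sum[OF f(2) sub]) (auto intro: subspace_scale[OF sub] mem)
    also have "\<dots> = (\<Sum>p<earity s. sgn_pow (sum_list (take p js)) *\<^sub>R B.opn s ((map f xs)[p := d' (map f xs ! p)]))"
    proof (rule sum.cong[OF refl])
      fix p assume "p \<in> {..<earity s}"
      then have p: "p < earity s" by simp
      show "f (sgn_pow (sum_list (take p js)) *\<^sub>R A.opn s (x' p))
        = sgn_pow (sum_list (take p js)) *\<^sub>R B.opn s ((map f xs)[p := d' (map f xs ! p)])"
        using lin_on_scale[OF f(2) mem[OF p]] EDiff.IH[OF wf x'[OF p]] fx[OF p] by simp
    qed
    finally show ?case
      using B.end_diff_app[OF s' hf[OF EDiff.prems(2)]] len
      unfolding B.opn_Diff[OF wf] B' by simp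
  qed
  have "f (act A n k X xs) = act B n k X (map f xs)"
    if xs: "length xs = n" "set xs \<subseteq> homog V" and X: "X \<in> opc ECBV n k" for n k xs X
  proof -
    obtain js where js: "A.homs xs js" using A.homs_ex xs(2) A'(1) by auto
    have mem: "act A n k Y xs \<in> V (sum_list js + k)" if "Y \<in> opc ECBV n k" for Y
      using A.ml_degree[OF A.act_ml[OF that] js xs(1)] by (simp add: A')
    from X show ?thesis
    proof (induction rule: ecbv_op_induct)
      case zero
      show ?case using lin_on_zero[OF f(2)[of 0]] A.V_0[of 0] by (simp add: A.act_zero B.act_zero A')
    next
      case (add X Y)
      then show ?case
        using lin_on_add[OF A.act_lin add(1,2)] lin_on_add[OF B.act_lin add(1,2)]
          lin_on_add[OF f(2) mem[OF add(1)] mem[OF add(2)]] by simp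
    next
      case (scale c X)
      then show ?case
        using lin_on_scale[OF A.act_lin scale(1)] lin_on_scale[OF B.act_lin scale(1)]
          lin_on_scale[OF f(2) mem[OF scale(1)]] by (simp add: scaleR_fun_def)
    next
      case (gen t)
      then show ?case using main[OF _ js, of t] xs by (auto simp: exprs_def A.opn_def B.opn_def)
    qed
  qed
  then show ?thesis
    unfolding algebra_morphism_def A' B' using f f_d by blast
qed

subsection \<open>Restriction of scalars and the trivial structure\<close>

lemma operad_morphism_compose:
  assumes \<phi>: "operad_morphism P Q \<phi>" and \<psi>: "operad_morphism Q R \<psi>"
  shows "operad_morphism P R (\<lambda>n k p. \<psi> n k (\<phi> n k p))"
proof -
  have "lin_on (opc P n k) (\<lambda>p. \<psi> n k (\<phi> n k p))" for n k
    by (rule lin_on_compose[OF operad_morphism_lin[OF \<phi>] _ operad_morphism_lin[OF \<psi>]])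
      (auto intro: operad_morphism_mem[OF \<phi>])
  then show ?thesis
    unfolding operad_morphism_def image_subset_iff
    by (intro conjI allI impI ballI)
      (simp_all only: operad_morphism_id[OF \<phi>] operad_morphism_id[OF \<psi>]
        operad_morphism_comp[OF \<phi>] operad_morphism_comp[OF \<psi>]
        operad_morphism_act[OF \<phi>] operad_morphism_act[OF \<psi>]
        operad_morphism_diff[OF \<phi>] operad_morphism_diff[OF \<psi>]
        operad_morphism_mem[OF \<phi>] operad_morphism_mem[OF \<psi>])
qed

lemma operad_morphism_cong:
  assumes dg: "dg_operad P" and \<phi>: "operad_morphism P Q \<phi>" and eq: "\<And>n k p. p \<in> opc P n k \<Longrightarrow> \<psi> n k p = \<phi> n k p"
  shows "operad_morphism P Q \<psi>"
proof -
  have mem: "subspace (opc P n k)" "opid P \<in> opc P 1 0"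
    "i < r \<Longrightarrow> x \<in> opc P r k \<Longrightarrow> y \<in> opc P n l \<Longrightarrow> opcomp P r k i n l x y \<in> opc P (r + n - 1) (k + l)"
    "\<sigma> permutes {..<n} \<Longrightarrow> x \<in> opc P n k \<Longrightarrow> opact P n k \<sigma> x \<in> opc P n k"
    "x \<in> opc P n k \<Longrightarrow> opdiff P n k x \<in> opc P n (k + 1)" for n k i r l x y \<sigma>
    using dg unfolding dg_operad_def image_subset_iff by simp_all
  have "lin_on (opc P n k) (\<psi> n k)" for n k
    by (rule lin_on_cong[OF operad_morphism_lin[OF \<phi>] mem(1)]) (simp add: eq)
  then show ?thesis
    unfolding operad_morphism_def image_subset_iff
    by (intro conjI allI impI ballI)
      (simp_all only: eq mem operad_morphism_mem[OF \<phi>] operad_morphism_id[OF \<phi>] operad_morphism_comp[OF \<phi>]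
        operad_morphism_act[OF \<phi>] operad_morphism_diff[OF \<phi>])
qed

lemma operad_algebra_restrict:
  assumes "operad_morphism P Q \<phi>" "operad_algebra m Q A"
  shows "operad_algebra m P (restrict_scalars \<phi> A)"
  using assms operad_morphism_compose unfolding operad_algebra_def restrict_scalars_def by auto

lemma quasi_iso_restrict:
  assumes \<phi>: "operad_morphism P Q \<phi>" and f: "quasi_iso m Q A B f"
  shows "quasi_iso m P (restrict_scalars \<phi> A) (restrict_scalars \<phi> B) f"
proof -
  have "operad_algebra m P (restrict_scalars \<phi> A)" "operad_algebra m P (restrict_scalars \<phi> B)"
    using f by (auto simp: quasi_iso_def intro: operad_algebra_restrict[OF \<phi>])
  moreover have "algebra_morphism P (restrict_scalars \<phi> A) (restrict_scalars \<phi> B) f"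
    using f operad_morphism_mem[OF \<phi>]
    by (simp add: quasi_iso_def algebra_morphism_def restrict_scalars_def)
  ultimately show ?thesis
    using f unfolding quasi_iso_def by (simp add: restrict_scalars_def)
qed

lemma quasi_iso_cong:
  assumes dg: "dg_operad P" and f: "quasi_iso m P A B f"
    and B': "cx B' = cx B" "cdiff B' = cdiff B" "\<And>n k p. p \<in> opc P n k \<Longrightarrow> act B' n k p = act B n k p"
  shows "quasi_iso m P A B' f"
proof -
  have "operad_algebra m P B'"
    using f operad_morphism_cong[OF dg _ B'(3)] by (simp add: quasi_iso_def operad_algebra_def B'(1,2))
  then show ?thesis
    using f by (simp add: quasi_iso_def algebra_morphism_def B')
qed

text \<open>The only generators of nonzero degree are the \<open>i\<^sub>n\<close>, of degree at most \<open>- 2\<close>, and only differentials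
  raise the degree. By induction, operations of degree 0 are closed, because they are composed of closed
  ones, and operations of degree \<open>- 1\<close> are closed, because they are composed of operations of degree 0 and
  differentials of others. So a further differential gives zero. Therefore the \<open>i\<^sub>n\<close> do not contribute to
  operations of degree 0, operations of negative degree contain some \<open>i\<^sub>n\<close> and vanish if the \<open>i\<^sub>n\<close> do, and
  operations of positive degree are zero.\<close>

lemma weight_zero_part:
  assumes even: "even m"
    and A: "ecbv_algebra m V d mul i A" and B: "ecbv_algebra m V d mul (\<lambda>_ _. 0) B"
    and X: "X \<in> opc ECBV n k"
  shows "(k = 0 \<longrightarrow> act B n k X = act A n k X) \<and> (k \<noteq> 0 \<longrightarrow> act B n k X = 0)"
proof -
  have A': "cx A = V" "cdiff A = d" and B': "cx B = V" "cdiff B = d"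
    using A B by (auto simp: ecbv_algebra_def)
  interpret A: ecbv_op_algebra m A using A even by unfold_locales (auto simp: ecbv_algebra_def)
  interpret B: ecbv_op_algebra m B using B even by unfold_locales (auto simp: ecbv_algebra_def)
  interpret V: graded_cx m V d using A.graded_cx_axioms by (simp add: A')
  have gens: "A.opn EMu = binary_op V mul" "B.opn EMu = binary_op V mul"
    "1 \<le> n \<Longrightarrow> B.opn (EI n) = unary_op V (\<lambda>_. 0)" for n
    using A B by (auto simp: ecbv_algebra_def A.opn_def B.opn_def)
  define good where "good n k F G \<longleftrightarrow> (k > 0 \<longrightarrow> F = 0 \<and> G = 0) \<and>
    (k = 0 \<longrightarrow> F = G \<and> end_diff V d n k F = 0) \<and>
    (k = - 1 \<longrightarrow> G = 0 \<and> end_diff V d n k F = 0) \<and> (k < - 1 \<longrightarrow> G = 0)"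
    for n :: nat and k :: int and F G :: "'a list \<Rightarrow> 'a"
  have ml: "A.opn t \<in> multilinear_maps V (earity t) (edeg t)" "B.opn t \<in> multilinear_maps V (earity t) (edeg t)"
    if "wf_expr t" for t
    using A.opn_ml[OF that] B.opn_ml[OF that] by (simp_all add: A' B')
  have comp0: "end_comp V r i n l 0 g = 0" for r i n l g
    using lin_on_zero[OF V.end_comp_lin_left[of UNIV]] by simp
  have comp0': "end_comp V r i n l f 0 = 0" if "f \<in> multilinear_maps V r k" "i < r" for r i n l f k
    using lin_on_zero[OF V.end_comp_lin_right[OF that] subspace_0[OF V.subspace_ml]] by simp
  have diff0: "end_diff V d n k 0 = 0" for n k
    using lin_on_zero[OF V.end_diff_lin subspace_0[OF V.subspace_ml]] by simp
  have act0: "end_act V n \<sigma> 0 = 0" for n \<sigma>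
    using lin_on_zero[OF V.end_act_lin[of UNIV]] by simp
  have main: "good (earity t) (edeg t) (A.opn t) (B.opn t)" if "wf_expr t" for t
    using that
  proof (induction t)
    case EMu
    have "A.opn (EDiff EMu) = 0"
    proof -
      have "ecbv_class (EDiff EMu) = 0"
        using null_in_ideal[OF ecbv_null.mu_closed] by (simp add: ecbv_class.abs_eq zero_ecbv_def abs_ecbv_eq_iff)
      then show ?thesis by (simp add: A.opn_def A.act_zero)
    qed
    then have "end_diff V d 2 0 (A.opn EMu) = 0" using A.opn_Diff[of EMu] by (simp add: A')
    then show ?case by (simp add: good_def gens)
  next
    case (EI n)
    then have "1 \<le> n" by simp
    moreover have "unary_op V (\<lambda>_. 0) = 0" by (auto simp: ext_map_def fun_eq_iff)
    ultimately show ?case by (auto simp: good_def gens(3))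
  next
    case EId
    have "ecbv_class (EDiff EId) = ecbv_diff (opid ECBV)"
      by (simp add: ECBV_def ecbv_class.abs_eq ecbv_diff.abs_eq expr_diff_basis wf_basis_def)
    have id: "A.opn EId = unary_op V (\<lambda>x. x)" "B.opn EId = unary_op V (\<lambda>x. x)"
      using A.opn_Id B.opn_Id by (simp_all add: A' B')
    have "end_diff V d 1 0 (unary_op V (\<lambda>x. x)) = 0"
    proof (rule V.ml_eqI[OF V.end_diff_mem[OF V.end_unit_mem] subspace_0[OF V.subspace_ml]])
      fix xs js assume xs: "V.homs xs js" "length xs = 1"
      then obtain x where x: "xs = [x]" by (auto simp: length_Suc_conv)
      then have "x \<in> homog V" using V.homs_homog[OF xs(1)] by simp
      then show "end_diff V d 1 0 (unary_op V (\<lambda>x. x)) xs = 0 xs"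
        using V.end_diff_app[OF V.end_unit_mem xs] V.d_homog by (simp add: x ext_map_def)
    qed
    then show ?case by (simp add: good_def id)
  next
    case (EComp s i t)
    have wf: "wf_expr s" "wf_expr t" "i < earity s" using EComp.prems by auto
    note gs = EComp.IH(1)[OF wf(1)] and gt = EComp.IH(2)[OF wf(2)]
    note fs = ml(1)[OF wf(1)] and ft = ml(1)[OF wf(2)] and fs' = ml(2)[OF wf(1)]
    have F: "A.opn (EComp s i t) = end_comp V (earity s) i (earity t) (edeg t) (A.opn s) (A.opn t)"
      using A.opn_Comp[OF EComp.prems] by (simp add: A')
    have G: "B.opn (EComp s i t) = end_comp V (earity s) i (earity t) (edeg t) (B.opn s) (B.opn t)"
      using B.opn_Comp[OF EComp.prems] by (simp add: B')
    have D: "end_diff V d (earity s + earity t - 1) (edeg s + edeg t) (A.opn (EComp s i t))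
      = end_comp V (earity s) i (earity t) (edeg t) (end_diff V d (earity s) (edeg s) (A.opn s)) (A.opn t)
      + sgn_pow (edeg s) *\<^sub>R end_comp V (earity s) i (earity t) (edeg t + 1) (A.opn s) (end_diff V d (earity t) (edeg t) (A.opn t))"
      unfolding F by (rule V.end_diff_comp[OF fs ft wf(3)])
    consider "edeg s > 0" | "edeg t > 0" | "edeg s \<le> 0" "edeg t \<le> 0" by linarith
    then show ?case
    proof cases
      case 1
      then have "A.opn s = 0" "B.opn s = 0" using gs by (auto simp: good_def)
      then have "A.opn (EComp s i t) = 0" "B.opn (EComp s i t) = 0" by (simp_all add: F G comp0)
      then show ?thesis unfolding good_def by (simp only: earity.simps edeg.simps diff0 simp_thms)
    next
      case 2
      then have "A.opn t = 0" "B.opn t = 0" using gt by (auto simp: good_def)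
      then have "A.opn (EComp s i t) = 0" "B.opn (EComp s i t) = 0"
        by (simp_all add: F G comp0'[OF fs wf(3)] comp0'[OF fs' wf(3)])
      then show ?thesis unfolding good_def by (simp only: earity.simps edeg.simps diff0 simp_thms)
    next
      case 3
      have s0: "end_diff V d (earity s) (edeg s) (A.opn s) = 0" if "edeg s = 0 \<or> edeg s = - 1"
        using gs that unfolding good_def by blast
      have t0: "end_diff V d (earity t) (edeg t) (A.opn t) = 0" if "edeg t = 0 \<or> edeg t = - 1"
        using gt that unfolding good_def by blast
      have closed: "end_diff V d (earity s + earity t - 1) (edeg s + edeg t) (A.opn (EComp s i t)) = 0"
        if "edeg s + edeg t = 0 \<or> edeg s + edeg t = - 1"
      proof -
        have "edeg s = 0 \<or> edeg s = - 1" "edeg t = 0 \<or> edeg t = - 1" using that 3 by linarith+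
        then show ?thesis unfolding D by (simp add: s0 t0 comp0 comp0'[OF fs wf(3)])
      qed
      have "B.opn (EComp s i t) = 0" if "edeg s + edeg t < 0"
      proof -
        have "edeg s < 0 \<or> edeg t < 0" using that 3 by linarith
        then have "B.opn s = 0 \<or> B.opn t = 0" using gs gt by (auto simp: good_def)
        then show ?thesis by (auto simp: G comp0 comp0'[OF fs' wf(3)])
      qed
      moreover have "A.opn (EComp s i t) = B.opn (EComp s i t)" if "edeg s + edeg t = 0"
      proof -
        have "edeg s = 0" "edeg t = 0" using that 3 by linarith+
        then show ?thesis using gs gt by (simp add: F G good_def)
      qed
      ultimately show ?thesis using closed 3 by (auto simp: good_def)
    qed
  next
    case (EAct s \<sigma>)
    have wf: "wf_expr s" "\<sigma> permutes {..<earity s}" using EAct.prems by auto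
    note gs = EAct.IH[OF wf(1)]
    have F: "A.opn (EAct s \<sigma>) = end_act V (earity s) \<sigma> (A.opn s)"
      using A.opn_Act[OF EAct.prems] by (simp add: A')
    have G: "B.opn (EAct s \<sigma>) = end_act V (earity s) \<sigma> (B.opn s)"
      using B.opn_Act[OF EAct.prems] by (simp add: B')
    have "end_diff V d (earity s) (edeg s) (A.opn (EAct s \<sigma>)) = end_act V (earity s) \<sigma> (end_diff V d (earity s) (edeg s) (A.opn s))"
      unfolding F by (rule V.end_diff_act[OF ml(1)[OF wf(1)] wf(2)])
    then show ?case using gs by (auto simp: good_def F G act0)
  next
    case (EDiff s)
    have wf: "wf_expr s" using EDiff.prems by simp
    note gs = EDiff.IH[OF wf]
    have F: "A.opn (EDiff s) = end_diff V d (earity s) (edeg s) (A.opn s)"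
      using A.opn_Diff[OF wf] by (simp add: A')
    have G: "B.opn (EDiff s) = end_diff V d (earity s) (edeg s) (B.opn s)"
      using B.opn_Diff[OF wf] by (simp add: B')
    have dd: "end_diff V d (earity s) (edeg s + 1) (A.opn (EDiff s)) = 0"
      unfolding F by (rule V.end_diff_diff[OF ml(1)[OF wf]])
    consider "edeg s > 0" | "edeg s = 0" | "edeg s = - 1" | "edeg s < - 1" by linarith
    then show ?case
    proof cases
      case 1
      then have "A.opn s = 0" "B.opn s = 0" using gs by (auto simp: good_def)
      then have "A.opn (EDiff s) = 0" "B.opn (EDiff s) = 0" unfolding F G by (simp_all only: diff0)
      then show ?thesis unfolding good_def by (simp only: earity.simps edeg.simps diff0 simp_thms)
    next
      case 2
      then have "A.opn s = B.opn s" "end_diff V d (earity s) (edeg s) (A.opn s) = 0"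
        using gs unfolding good_def by blast+
      then have "A.opn (EDiff s) = 0" "B.opn (EDiff s) = 0" unfolding F G by simp_all
      then show ?thesis unfolding good_def by (simp only: earity.simps edeg.simps diff0 simp_thms)
    next
      case 3
      then have "B.opn s = 0" "end_diff V d (earity s) (edeg s) (A.opn s) = 0"
        using gs unfolding good_def by blast+
      then have "A.opn (EDiff s) = 0" "B.opn (EDiff s) = 0" unfolding F G by (simp_all only: diff0)
      then show ?thesis unfolding good_def by (simp only: earity.simps edeg.simps diff0 simp_thms)
    next
      case 4
      then have "B.opn s = 0" using gs by (auto simp: good_def)
      then have "B.opn (EDiff s) = 0" unfolding G by (simp only: diff0)
      moreover have "\<not> edeg (EDiff s) > 0" "edeg (EDiff s) \<noteq> 0" using 4 by simp_all
      ultimately show ?thesis using dd unfolding good_def by simp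
    qed
  qed
  from X show ?thesis
  proof (induction rule: ecbv_op_induct)
    case zero
    show ?case by (simp only: A.act_zero B.act_zero simp_thms)
  next
    case (add X Y)
    then show ?case
      unfolding lin_on_add[OF A.act_lin add(1,2)] lin_on_add[OF B.act_lin add(1,2)] by (metis add_0_right)
  next
    case (scale c X)
    then show ?case
      unfolding lin_on_scale[OF A.act_lin scale(1)] lin_on_scale[OF B.act_lin scale(1)] by (metis scaleR_zero_right)
  next
    case (gen t)
    then have "good n k (act A n k (ecbv_class t)) (act B n k (ecbv_class t))"
      using main[of t] by (auto simp: exprs_def A.opn_def B.opn_def)
    moreover consider "k > 0" | "k = 0" | "k = - 1" | "k < - 1" by linarith
    ultimately show ?case unfolding good_def by (cases; metis less_irrefl)
  qed
qed

lemma act_trivial_algebra: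
  assumes even: "even m"
    and A: "ecbv_algebra m V d mul i A" and B: "ecbv_algebra m V d mul (\<lambda>_ _. 0) B"
    and \<phi>: "operad_morphism P ECBV \<phi>" and dg: "dg_operad P" and p: "p \<in> opc P n k"
  shows "act (trivial_algebra (restrict_scalars \<phi> A)) n k p = act (restrict_scalars \<phi> B) n k p"
proof -
  interpret A: ecbv_op_algebra m A using A even by unfold_locales (auto simp: ecbv_algebra_def)
  have "subspace (opc P n k)" using dg by (simp add: dg_operad_def)
  then have "\<phi> n k 0 = 0" by (intro lin_on_zero[OF operad_morphism_lin[OF \<phi>]] subspace_0)
  then show ?thesis
    using weight_zero_part[OF even A B operad_morphism_mem[OF \<phi> p]]
    by (auto simp: trivial_algebra_def restrict_scalars_def deg0_retraction_def deg0_inclusion_def A.act_zero)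
qed

section \<open>Cartan calculus\<close>

lemma scaleR_fun_apply [simp]: "(c *\<^sub>R f) x = c *\<^sub>R f x"
  by (simp add: scaleR_fun_def)

lemma (in graded_vs) V_period: "V (k + m) = V k"
  using graded by (simp add: graded_space_def)

lemma (in graded_vs) V_direct:
  assumes "finite I" "inj_on (\<lambda>k. k mod m) I" "\<And>k. k \<in> I \<Longrightarrow> x k \<in> V (j + k)" "(\<Sum>k\<in>I. x k) = 0" "k \<in> I"
  shows "x k = 0"
proof -
  let ?J = "(\<lambda>k. j + k) ` I"
  have "inj_on (\<lambda>k. k mod m) ?J"
  proof (rule inj_onI)
    fix a b assume "a \<in> ?J" "b \<in> ?J" "a mod m = b mod m"
    then obtain a' b' where ab: "a = j + a'" "b = j + b'" "a' \<in> I" "b' \<in> I" by auto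
    have "(a - j) mod m = (b - j) mod m" using \<open>a mod m = b mod m\<close> by (rule mod_diff_cong) simp
    then show "a = b" using assms(2) ab by (auto simp: inj_on_def)
  qed
  moreover have "(\<Sum>k\<in>?J. x (k - j)) = 0" using assms(4) by (simp add: sum.reindex)
  moreover have "\<forall>k\<in>?J. x (k - j) \<in> V k" using assms(3) by auto
  ultimately have "\<forall>k\<in>?J. x (k - j) = 0"
    using graded[unfolded graded_space_def, THEN conjunct2, THEN conjunct2, rule_format, of ?J "\<lambda>k. x (k - j)"] assms(1)
    by blast
  then show ?thesis using assms(5) by auto
qed

context gca begin

abbreviation "VF \<equiv> vector_fields A"
abbreviation "bracket \<equiv> vf_bracket A"

lemma
  assumes X: "X \<in> VF k"
  shows vf_mem: "a \<in> gcar A j \<Longrightarrow> X a \<in> gcar A (j + k)"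
    and vf_lin: "lin_on (gcar A j) X"
    and vf_leibniz: "a \<in> gcar A j \<Longrightarrow> b \<in> \<H> \<Longrightarrow> X (a \<odot> b) = X a \<odot> b + sgn_pow (k * j) *\<^sub>R (a \<odot> X b)"
    and vf_outside: "a \<notin> \<H> \<Longrightarrow> X a = 0"
  using X unfolding vector_fields_def by auto

lemma vfI:
  assumes "\<And>j a. a \<in> gcar A j \<Longrightarrow> X a \<in> gcar A (j + k)" "\<And>j. lin_on (gcar A j) X"
    "\<And>j a b. a \<in> gcar A j \<Longrightarrow> b \<in> \<H> \<Longrightarrow> X (a \<odot> b) = X a \<odot> b + sgn_pow (k * j) *\<^sub>R (a \<odot> X b)"
    "\<And>a. a \<notin> \<H> \<Longrightarrow> X a = 0"
  shows "X \<in> VF k"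
  using assms unfolding vector_fields_def by auto

lemma vf_0: "X \<in> VF k \<Longrightarrow> X 0 = 0"
  by (rule lin_on_zero[OF vf_lin V_0])

lemma subspace_VF: "subspace (VF k)"
proof (rule subspace_combI)
  show "0 \<in> VF k"
    by (rule vfI) (auto simp: lin_on_const_zero mul_0_left mul_0_right homogI zero_fun_def)
next
  fix X Y c assume X: "X \<in> VF k" and Y: "Y \<in> VF k"
  show "c *\<^sub>R X + Y \<in> VF k"
  proof (rule vfI)
    fix j a b assume a: "a \<in> gcar A j" and b: "b \<in> \<H>"
    then obtain l where l: "b \<in> gcar A l" by (auto simp: homog_def)
    show "(c *\<^sub>R X + Y) (a \<odot> b) = (c *\<^sub>R X + Y) a \<odot> b + sgn_pow (k * j) *\<^sub>R (a \<odot> (c *\<^sub>R X + Y) b)"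
      using lin_on_comb[OF mul_lin_left[OF b] subspace_V vf_mem[OF X a] vf_mem[OF Y a]]
        lin_on_comb[OF mul_lin_right[OF homogI[OF a]] subspace_V vf_mem[OF X l] vf_mem[OF Y l]]
      by (simp add: vf_leibniz[OF X a b] vf_leibniz[OF Y a b] scaleR_add_right mult.commute)
  qed (use lin_on_plus[OF lin_on_scaled[OF vf_lin[OF X], of _ c] vf_lin[OF Y]] in \<open>auto simp: plus_fun_def scaleR_fun_def
      vf_outside[OF X] vf_outside[OF Y] intro!: V_add V_scale vf_mem[OF X] vf_mem[OF Y]\<close>)
qed

lemma graded_space_VF: "graded_space m VF"
  unfolding graded_space_def
proof (intro conjI allI impI ballI)
  show "subspace (VF k)" for k by (rule subspace_VF)
  have s: "sgn_pow ((k + m) * j) = sgn_pow (k * j)" for k j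
    by (rule sgn_pow_eqI) (use even_m in auto)
  show "VF (k + m) = VF k" for k
    unfolding vector_fields_def s add.assoc[symmetric] V_period ..
  fix I and X :: "int \<Rightarrow> 'a \<Rightarrow> 'a" and k
  assume I: "finite I \<and> inj_on (\<lambda>k. k mod m) I \<and> (\<forall>k\<in>I. X k \<in> VF k) \<and> (\<Sum>k\<in>I. X k) = 0" and k: "k \<in> I"
  show "X k = 0"
  proof
    fix a
    show "X k a = 0 a"
    proof (cases "a \<in> \<H>")
      case True
      then obtain j where j: "a \<in> gcar A j" by (auto simp: homog_def)
      have "(\<Sum>k\<in>I. X k a) = 0" using I by (simp flip: sum_fun_apply)
      then show ?thesis
        using V_direct[of I "\<lambda>k. X k a" j k] I k vf_mem[OF _ j] by simp
    qed (use I k vf_outside in auto)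
  qed
qed

sublocale VF: graded_vs m VF
  by unfold_locales (simp_all add: graded_space_VF even_m)

lemma vf_scale_mem:
  assumes f: "f \<in> gcar A l" and X: "X \<in> VF x"
  shows "vf_scale A f X \<in> VF (l + x)"
proof (rule vfI)
  note fh = homogI[OF f]
  show "vf_scale A f X a \<in> gcar A (j + (l + x))" if "a \<in> gcar A j" for j a
    using mul_mem[OF f vf_mem[OF X that]] by (simp add: vf_scale_def algebra_simps)
  show "lin_on (gcar A j) (vf_scale A f X)" for j
    unfolding vf_scale_def
    by (rule lin_on_compose[OF vf_lin[OF X] _ mul_lin_right[OF fh], of _ "j + x"]) (use vf_mem[OF X] in auto)
  show "vf_scale A f X a = 0" if "a \<notin> \<H>" for a
    using vf_outside[OF X that] by (simp add: vf_scale_def mul_0_right fh)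
  fix j a b assume a: "a \<in> gcar A j" and b: "b \<in> \<H>"
  then obtain k where k: "b \<in> gcar A k" by (auto simp: homog_def)
  have Xa: "X a \<in> gcar A (j + x)" and Xb: "X b \<in> gcar A (k + x)" using vf_mem[OF X] a k by auto
  have 1: "X a \<odot> b \<in> gcar A (j + x + k)" and 2: "a \<odot> X b \<in> gcar A (j + x + k)"
    using mul_mem[OF Xa k] mul_mem[OF a Xb] by (simp_all add: algebra_simps)
  have "f \<odot> (a \<odot> X b) = sgn_pow (l * j) *\<^sub>R (a \<odot> (f \<odot> X b))"
    using mul_assoc[OF fh homogI[OF a] homogI[OF Xb]] mul_assoc[OF homogI[OF a] fh homogI[OF Xb]]
      mul_comm[OF f a] mul_scale_left[OF homogI[OF mul_mem[OF a f]] homogI[OF Xb]] by simp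
  then show "vf_scale A f X (a \<odot> b) = vf_scale A f X a \<odot> b + sgn_pow ((l + x) * j) *\<^sub>R (a \<odot> vf_scale A f X b)"
    using mul_add_right[OF fh 1 V_scale[OF 2]] mul_assoc[OF fh homogI[OF Xa] b] mul_scale_right[OF fh homogI[OF 2]]
    by (simp add: vf_scale_def vf_leibniz[OF X a b] sgn_pow_add distrib_right)
qed

lemma vf_bracket_eq:
  assumes X: "X \<in> VF x" and Y: "Y \<in> VF y"
  shows "bracket X Y a = X (Y a) - sgn_pow (x * y) *\<^sub>R Y (X a)"
proof (cases "X = 0 \<or> Y = 0")
  case True
  then show ?thesis using vf_0[OF X] vf_0[OF Y] by (auto simp: vf_bracket_def)
next
  case False
  then have "sgn_pow (vdeg A X * vdeg A Y) = sgn_pow (x * y)"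
    using VF.gdeg_parity[OF X] VF.gdeg_parity[OF Y] by (intro sgn_pow_eqI) simp
  then show ?thesis by (simp add: vf_bracket_def)
qed

lemma vf_bracket_mem:
  assumes X: "X \<in> VF x" and Y: "Y \<in> VF y"
  shows "bracket X Y \<in> VF (x + y)"
proof (rule vfI)
  note eq = vf_bracket_eq[OF X Y]
  have XY: "X (Y a) \<in> gcar A (j + (x + y))" "Y (X a) \<in> gcar A (j + (x + y))" if "a \<in> gcar A j" for j a
    using vf_mem[OF X vf_mem[OF Y that]] vf_mem[OF Y vf_mem[OF X that]] by (simp_all add: algebra_simps)
  show "bracket X Y a \<in> gcar A (j + (x + y))" if "a \<in> gcar A j" for j a
    unfolding eq by (intro V_diff V_scale XY that)
  have "lin_on (gcar A j) (\<lambda>a. X (Y a) - sgn_pow (x * y) *\<^sub>R Y (X a))" for j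
    by (intro lin_on_minus lin_on_scaled lin_on_compose[OF vf_lin[OF Y] _ vf_lin[OF X], of _ "j + y"]
        lin_on_compose[OF vf_lin[OF X] _ vf_lin[OF Y], of _ "j + x"]) (use vf_mem[OF X] vf_mem[OF Y] in auto)
  then show "lin_on (gcar A j) (bracket X Y)" for j
    by (rule lin_on_cong[OF _ subspace_V]) (simp add: eq)
  show "bracket X Y a = 0" if "a \<notin> \<H>" for a
    using vf_outside[OF X that] vf_outside[OF Y that] vf_0[OF X] vf_0[OF Y] by (simp add: eq)
  fix j a b assume a: "a \<in> gcar A j" and b: "b \<in> \<H>"
  then obtain k where k: "b \<in> gcar A k" by (auto simp: homog_def)
  note Xa = vf_mem[OF X a] and Ya = vf_mem[OF Y a] and Xb = vf_mem[OF X k] and Yb = vf_mem[OF Y k]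
  have 1: "Y a \<odot> b \<in> gcar A (j + k + y)" "a \<odot> Y b \<in> gcar A (j + k + y)"
    "X a \<odot> b \<in> gcar A (j + k + x)" "a \<odot> X b \<in> gcar A (j + k + x)"
    using mul_mem[OF Ya k] mul_mem[OF a Yb] mul_mem[OF Xa k] mul_mem[OF a Xb] by (simp_all add: algebra_simps)
  have E1: "X (Y (a \<odot> b)) = X (Y a) \<odot> b + sgn_pow (x * (j + y)) *\<^sub>R (Y a \<odot> X b)
      + sgn_pow (y * j) *\<^sub>R (X a \<odot> Y b + sgn_pow (x * j) *\<^sub>R (a \<odot> X (Y b)))"
    using lin_on_add[OF vf_lin[OF X] 1(1) V_scale[OF 1(2)]] lin_on_scale[OF vf_lin[OF X] 1(2)]
    by (simp add: vf_leibniz[OF Y a b] vf_leibniz[OF X Ya b] vf_leibniz[OF X a homogI[OF Yb]])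
  have E2: "Y (X (a \<odot> b)) = Y (X a) \<odot> b + sgn_pow (y * (j + x)) *\<^sub>R (X a \<odot> Y b)
      + sgn_pow (x * j) *\<^sub>R (Y a \<odot> X b + sgn_pow (y * j) *\<^sub>R (a \<odot> Y (X b)))"
    using lin_on_add[OF vf_lin[OF Y] 1(3) V_scale[OF 1(4)]] lin_on_scale[OF vf_lin[OF Y] 1(4)]
    by (simp add: vf_leibniz[OF X a b] vf_leibniz[OF Y Xa b] vf_leibniz[OF Y a homogI[OF Xb]])
  have E3: "bracket X Y a \<odot> b = X (Y a) \<odot> b - sgn_pow (x * y) *\<^sub>R (Y (X a) \<odot> b)"
    unfolding eq using mul_diff_left[OF b XY(1)[OF a] V_scale[OF XY(2)[OF a]]]
      mul_scale_left[OF homogI[OF XY(2)[OF a]] b] by simp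
  have E4: "a \<odot> bracket X Y b = a \<odot> X (Y b) - sgn_pow (x * y) *\<^sub>R (a \<odot> Y (X b))"
    unfolding eq using mul_diff_right[OF homogI[OF a] XY(1)[OF k] V_scale[OF XY(2)[OF k]]]
      mul_scale_right[OF homogI[OF a] homogI[OF XY(2)[OF k]]] by simp
  show "bracket X Y (a \<odot> b) = bracket X Y a \<odot> b + sgn_pow ((x + y) * j) *\<^sub>R (a \<odot> bracket X Y b)"
    unfolding E3 E4 eq[of "a \<odot> b"] E1 E2
    by (cases "even x"; cases "even y"; cases "even j"; simp add: sgn_pow_def algebra_simps)
qed

lemma vf_bracket_lin_right:
  assumes X: "X \<in> VF x"
  shows "lin_on (VF y) (bracket X)"
proof (rule lin_onI[OF subspace_VF], rule ext)
  fix c Y Z a assume Y: "Y \<in> VF y" and Z: "Z \<in> VF y"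
  have s: "c *\<^sub>R Y + Z \<in> VF y" by (intro subspace_add subspace_scale subspace_VF Y Z)
  have "X (c *\<^sub>R Y a + Z a) = c *\<^sub>R X (Y a) + X (Z a)"
  proof (cases "a \<in> \<H>")
    case True
    then obtain j where "a \<in> gcar A j" by (auto simp: homog_def)
    then show ?thesis using lin_on_comb[OF vf_lin[OF X] subspace_V vf_mem[OF Y] vf_mem[OF Z]] by blast
  qed (simp add: vf_outside[OF Y] vf_outside[OF Z] vf_0[OF X])
  then show "bracket X (c *\<^sub>R Y + Z) a = (c *\<^sub>R bracket X Y + bracket X Z) a"
    by (simp add: vf_bracket_eq[OF X s] vf_bracket_eq[OF X Y] vf_bracket_eq[OF X Z] scaleR_add_right
        scaleR_diff_right mult.commute)
qed

lemma vf_bracket_swap: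
  assumes X: "X \<in> VF x" and Y: "Y \<in> VF y"
  shows "bracket Y X = - sgn_pow (x * y) *\<^sub>R bracket X Y"
  by (rule ext) (simp add: vf_bracket_eq[OF X Y] vf_bracket_eq[OF Y X] scaleR_diff_right mult.commute[of y x])

lemma vf_bracket_lin_left:
  assumes Y: "Y \<in> VF y"
  shows "lin_on (VF x) (\<lambda>X. bracket X Y)"
  by (rule lin_on_cong[OF lin_on_scaled[OF vf_bracket_lin_right[OF Y]] subspace_VF])
    (rule vf_bracket_swap[OF Y, symmetric])

lemma vf_bracket_scale:
  assumes X: "X \<in> VF x" and Y: "Y \<in> VF y" and f: "f \<in> gcar A l"
  shows "bracket X (vf_scale A f Y) = vf_scale A (X f) Y + sgn_pow (x * l) *\<^sub>R vf_scale A f (bracket X Y)"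
proof
  fix a
  note fY = vf_scale_mem[OF f Y]
  show "bracket X (vf_scale A f Y) a = (vf_scale A (X f) Y + sgn_pow (x * l) *\<^sub>R vf_scale A f (bracket X Y)) a"
  proof (cases "a \<in> \<H>")
    case True
    then obtain j where a: "a \<in> gcar A j" by (auto simp: homog_def)
    have m: "X (Y a) \<in> gcar A (j + (x + y))" "Y (X a) \<in> gcar A (j + (x + y))"
      using vf_mem[OF X vf_mem[OF Y a]] vf_mem[OF Y vf_mem[OF X a]] by (simp_all add: algebra_simps)
    have E: "f \<odot> bracket X Y a = f \<odot> X (Y a) - sgn_pow (x * y) *\<^sub>R (f \<odot> Y (X a))"
      unfolding vf_bracket_eq[OF X Y] using mul_diff_right[OF homogI[OF f] m(1) V_scale[OF m(2)]]
        mul_scale_right[OF homogI[OF f] homogI[OF m(2)]] by simp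
    show ?thesis
      unfolding vf_bracket_eq[OF X fY] unfolding plus_fun_apply scaleR_fun_apply vf_scale_def E
        vf_leibniz[OF X f homogI[OF vf_mem[OF Y a]]]
      by (cases "even x"; cases "even y"; cases "even l"; simp add: sgn_pow_def algebra_simps)
  next
    case False
    then show ?thesis
      using vf_outside[OF vf_bracket_mem[OF X fY] False] vf_outside[OF vf_bracket_mem[OF X Y] False] vf_outside[OF Y False]
        mul_0_right homogI[OF f] homogI[OF vf_mem[OF X f]] by (simp add: vf_scale_def)
  qed
qed

lemma vf_jacobi:
  assumes X: "X \<in> VF x" and Y: "Y \<in> VF y" and Z: "Z \<in> VF z"
  shows "bracket (bracket X Y) Z = bracket X (bracket Y Z) - sgn_pow (x * y) *\<^sub>R bracket Y (bracket X Z)"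
proof
  fix a
  note XY = vf_bracket_mem[OF X Y] and YZ = vf_bracket_mem[OF Y Z] and XZ = vf_bracket_mem[OF X Z]
  show "bracket (bracket X Y) Z a = (bracket X (bracket Y Z) - sgn_pow (x * y) *\<^sub>R bracket Y (bracket X Z)) a"
  proof (cases "a \<in> \<H>")
    case True
    then obtain j where a: "a \<in> gcar A j" by (auto simp: homog_def)
    have lin: "W (U (T a) - c *\<^sub>R T (U a)) = W (U (T a)) - c *\<^sub>R W (T (U a))"
      if "W \<in> VF w" "U \<in> VF u" "T \<in> VF t" for W U T w u t c
    proof -
      have m: "U (T a) \<in> gcar A (j + (u + t))" "T (U a) \<in> gcar A (j + (u + t))"
        using vf_mem[OF that(2) vf_mem[OF that(3) a]] vf_mem[OF that(3) vf_mem[OF that(2) a]] by (simp_all add: algebra_simps)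
      show ?thesis using lin_on_diff[OF vf_lin[OF that(1)] subspace_V m(1) V_scale[OF m(2)]]
          lin_on_scale[OF vf_lin[OF that(1)] m(2)] by simp
    qed
    have E1: "bracket (bracket X Y) Z a = X (Y (Z a)) - sgn_pow (x * y) *\<^sub>R Y (X (Z a))
      - sgn_pow ((x + y) * z) *\<^sub>R (Z (X (Y a)) - sgn_pow (x * y) *\<^sub>R Z (Y (X a)))"
      by (simp only: vf_bracket_eq[OF XY Z] vf_bracket_eq[OF X Y] lin[OF Z X Y])
    have E2: "bracket X (bracket Y Z) a = X (Y (Z a)) - sgn_pow (y * z) *\<^sub>R X (Z (Y a))
      - sgn_pow (x * (y + z)) *\<^sub>R (Y (Z (X a)) - sgn_pow (y * z) *\<^sub>R Z (Y (X a)))"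
      by (simp only: vf_bracket_eq[OF X YZ] vf_bracket_eq[OF Y Z] lin[OF X Y Z])
    have E3: "bracket Y (bracket X Z) a = Y (X (Z a)) - sgn_pow (x * z) *\<^sub>R Y (Z (X a))
      - sgn_pow (y * (x + z)) *\<^sub>R (X (Z (Y a)) - sgn_pow (x * z) *\<^sub>R Z (X (Y a)))"
      by (simp only: vf_bracket_eq[OF Y XZ] vf_bracket_eq[OF X Z] lin[OF Y X Z])
    show ?thesis unfolding minus_apply scaleR_fun_apply E1 E2 E3
      by (simp add: sgn_pow_def algebra_simps)
  qed (simp add: vf_outside[OF vf_bracket_mem[OF XY Z]] vf_outside[OF vf_bracket_mem[OF X YZ]] vf_outside[OF vf_bracket_mem[OF Y XZ]])
qed

subsection \<open>Forms and contractions\<close>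

definition bounded_form :: "nat \<Rightarrow> 'a form \<Rightarrow> bool"
  where "bounded_form N \<omega> \<longleftrightarrow> (\<forall>Xs. N \<le> length Xs \<longrightarrow> \<omega> Xs = 0)"

lemma bounded_form_0: "bounded_form 0 \<omega> \<longleftrightarrow> \<omega> = 0"
  by (auto simp: bounded_form_def fun_eq_iff)

lemma bounded_contract: "bounded_form N \<omega> \<Longrightarrow> bounded_form (N - 1) (contract X \<omega>)"
  by (auto simp: bounded_form_def contract_def)

lemma contract_apply: "contract X \<omega> Xs = \<omega> (X # Xs)"
  by (simp add: contract_def)

lemma contract_arith [simp]:
  "contract X (\<omega> + \<eta>) = contract X \<omega> + contract X \<eta>"
  "contract X (\<omega> - \<eta>) = contract X \<omega> - contract X \<eta>"
  "contract X (c *\<^sub>R \<omega>) = c *\<^sub>R contract X \<omega>"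
  "contract X 0 = 0"
  by (auto simp: contract_def fun_eq_iff)

lemma
  assumes \<omega>: "\<omega> \<in> forms A k"
  shows form_bounded: "\<exists>N. bounded_form N \<omega>"
    and form_outside: "\<not> set Xs \<subseteq> homog VF \<Longrightarrow> \<omega> Xs = 0"
    and form_degree: "VF.homs Xs js \<Longrightarrow> \<omega> Xs \<in> gcar A (k + (\<Sum>j\<leftarrow>js. j - 1))"
    and form_lin: "set Us \<subseteq> homog VF \<Longrightarrow> set Vs \<subseteq> homog VF \<Longrightarrow> lin_on (VF j) (\<lambda>X. \<omega> (Us @ [X] @ Vs))"
    and form_sym: "set Us \<subseteq> homog VF \<Longrightarrow> set Vs \<subseteq> homog VF \<Longrightarrow> X \<in> VF x \<Longrightarrow> Y \<in> VF y \<Longrightarrow>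
        \<omega> (Us @ [X, Y] @ Vs) = sgn_pow ((x - 1) * (y - 1)) *\<^sub>R \<omega> (Us @ [Y, X] @ Vs)"
    and form_last: "set Us \<subseteq> homog VF \<Longrightarrow> f \<in> \<H> \<Longrightarrow> X \<in> homog VF \<Longrightarrow>
        \<omega> (Us @ [vf_scale A f X]) = f \<odot> \<omega> (Us @ [X])"
proof -
  obtain N where "\<forall>Xs. N < length Xs \<longrightarrow> \<omega> Xs = 0" using \<omega> by (auto simp: forms_def)
  then have "bounded_form (Suc N) \<omega>" by (auto simp: bounded_form_def)
  then show "\<exists>N. bounded_form N \<omega>" ..
qed (use \<omega> in \<open>unfold forms_def VF.homs_def, blast+\<close>)

lemma form_nil: "\<omega> \<in> forms A k \<Longrightarrow> \<omega> [] \<in> gcar A k"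
  using form_degree[of \<omega> k "[]" "[]"] by simp

lemma formI:
  assumes "bounded_form N \<omega>"
    "\<And>Xs. \<not> set Xs \<subseteq> homog VF \<Longrightarrow> \<omega> Xs = 0"
    "\<And>Xs js. VF.homs Xs js \<Longrightarrow> \<omega> Xs \<in> gcar A (k + (\<Sum>j\<leftarrow>js. j - 1))"
    "\<And>Us Vs j. set Us \<subseteq> homog VF \<Longrightarrow> set Vs \<subseteq> homog VF \<Longrightarrow> lin_on (VF j) (\<lambda>X. \<omega> (Us @ [X] @ Vs))"
    "\<And>Us Vs X Y x y. set Us \<subseteq> homog VF \<Longrightarrow> set Vs \<subseteq> homog VF \<Longrightarrow> X \<in> VF x \<Longrightarrow> Y \<in> VF y \<Longrightarrow>
        \<omega> (Us @ [X, Y] @ Vs) = sgn_pow ((x - 1) * (y - 1)) *\<^sub>R \<omega> (Us @ [Y, X] @ Vs)"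
    "\<And>Us f X. set Us \<subseteq> homog VF \<Longrightarrow> f \<in> \<H> \<Longrightarrow> X \<in> homog VF \<Longrightarrow>
        \<omega> (Us @ [vf_scale A f X]) = f \<odot> \<omega> (Us @ [X])"
  shows "\<omega> \<in> forms A k"
  unfolding forms_def mem_Collect_eq
proof (intro conjI allI impI ballI)
  show "\<exists>N. \<forall>Xs. N < length Xs \<longrightarrow> \<omega> Xs = 0"
    using assms(1) by (intro exI[of _ N]) (simp add: bounded_form_def)
qed (((elim conjE)?, rule assms(2-6), assumption+) | (rule assms(3)[unfolded VF.homs_def], assumption))+

lemma subspace_forms: "subspace (forms A k)"
proof (rule subspace_combI)
  show "0 \<in> forms A k"
    by (rule formI[of 0]) (auto simp: bounded_form_0 lin_on_const_zero mul_0_right)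
next
  fix \<omega> \<eta> c assume w: "\<omega> \<in> forms A k" and e: "\<eta> \<in> forms A k"
  obtain N M where NM: "bounded_form N \<omega>" "bounded_form M \<eta>" using form_bounded w e by blast
  define S where "S = c *\<^sub>R \<omega> + \<eta>"
  have S: "S Xs = c *\<^sub>R \<omega> Xs + \<eta> Xs" for Xs by (simp add: S_def)
  have "S \<in> forms A k"
  proof (rule formI)
    show "bounded_form (max N M) S" using NM by (auto simp: bounded_form_def S)
    show "S Xs = 0" if "\<not> set Xs \<subseteq> homog VF" for Xs
      using form_outside[OF w that] form_outside[OF e that] by (simp add: S)
    show "S Xs \<in> gcar A (k + (\<Sum>j\<leftarrow>js. j - 1))" if "VF.homs Xs js" for Xs js
      using form_degree[OF w that] form_degree[OF e that] by (simp add: S V_add V_scale)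
    show "lin_on (VF j) (\<lambda>X. S (Us @ [X] @ Vs))" if "set Us \<subseteq> homog VF" "set Vs \<subseteq> homog VF" for Us Vs j
      unfolding S by (intro lin_on_plus lin_on_scaled form_lin[OF w that] form_lin[OF e that])
    show "S (Us @ [X, Y] @ Vs) = sgn_pow ((x - 1) * (y - 1)) *\<^sub>R S (Us @ [Y, X] @ Vs)"
      if "set Us \<subseteq> homog VF" "set Vs \<subseteq> homog VF" "X \<in> VF x" "Y \<in> VF y" for Us Vs X Y x y
      unfolding S form_sym[OF w that] form_sym[OF e that] by (simp add: scaleR_add_right mult.commute)
    fix Us f X assume h: "set Us \<subseteq> homog VF" "f \<in> \<H>" "X \<in> homog VF"
    then obtain js where "VF.homs (Us @ [X]) js" using VF.homs_ex[of "Us @ [X]"] by auto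
    from lin_on_comb[OF mul_lin_right[OF h(2)] subspace_V form_degree[OF w this] form_degree[OF e this]]
    show "S (Us @ [vf_scale A f X]) = f \<odot> S (Us @ [X])"
      unfolding S form_last[OF w h] form_last[OF e h] by simp
  qed
  then show "c *\<^sub>R \<omega> + \<eta> \<in> forms A k" by (simp only: S_def)
qed

lemma graded_space_forms: "graded_space m (forms A)"
  unfolding graded_space_def
proof (intro conjI allI impI ballI)
  show "subspace (forms A k)" for k by (rule subspace_forms)
  have s: "gcar A (k + m + l) = gcar A (k + l)" for k l
    using V_period[of "k + l"] by (simp add: ac_simps)
  show "forms A (k + m) = forms A k" for k
    unfolding forms_def s ..
  fix I and w :: "int \<Rightarrow> 'a form" and k
  assume I: "finite I \<and> inj_on (\<lambda>k. k mod m) I \<and> (\<forall>k\<in>I. w k \<in> forms A k) \<and> (\<Sum>k\<in>I. w k) = 0" and k: "k \<in> I"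
  show "w k = 0"
  proof
    fix Xs
    show "w k Xs = 0 Xs"
    proof (cases "set Xs \<subseteq> homog VF")
      case True
      then obtain js where js: "VF.homs Xs js" using VF.homs_ex by blast
      have "(\<Sum>k\<in>I. w k Xs) = 0" using I by (simp flip: sum_fun_apply)
      then show ?thesis
        using V_direct[of I "\<lambda>k. w k Xs" "\<Sum>j\<leftarrow>js. j - 1" k] I k form_degree[OF _ js] by (simp add: add.commute)
    qed (use I k form_outside in auto)
  qed
qed

sublocale \<Omega>: graded_vs m "forms A"
  by unfold_locales (simp_all add: graded_space_forms even_m)

lemma contract_mem:
  assumes w: "\<omega> \<in> forms A k" and X: "X \<in> VF x"
  shows "contract X \<omega> \<in> forms A (k + x - 1)"
proof -
  obtain N where N: "bounded_form N \<omega>" using form_bounded w by blast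
  have Xh: "X \<in> homog VF" using X by (rule VF.homogI)
  show ?thesis
  proof (rule formI[OF bounded_contract[OF N]])
    show "contract X \<omega> Xs = 0" if "\<not> set Xs \<subseteq> homog VF" for Xs
      using form_outside[OF w, of "X # Xs"] that by (simp add: contract_apply)
    show "contract X \<omega> Xs \<in> gcar A (k + x - 1 + (\<Sum>j\<leftarrow>js. j - 1))" if "VF.homs Xs js" for Xs js
      using form_degree[OF w, of "X # Xs" "x # js"] that X by (simp add: contract_apply algebra_simps)
    show "lin_on (VF j) (\<lambda>Y. contract X \<omega> (Us @ [Y] @ Vs))" if "set Us \<subseteq> homog VF" "set Vs \<subseteq> homog VF" for Us Vs j
      using form_lin[OF w, of "X # Us" Vs j] that Xh by (simp add: contract_apply)
    show "contract X \<omega> (Us @ [Y, Z] @ Vs) = sgn_pow ((y - 1) * (z - 1)) *\<^sub>R contract X \<omega> (Us @ [Z, Y] @ Vs)"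
      if "set Us \<subseteq> homog VF" "set Vs \<subseteq> homog VF" "Y \<in> VF y" "Z \<in> VF z" for Us Vs Y Z y z
      using form_sym[OF w, of "X # Us" Vs Y y Z z] that Xh by (simp add: contract_apply)
    show "contract X \<omega> (Us @ [vf_scale A f Y]) = f \<odot> contract X \<omega> (Us @ [Y])"
      if "set Us \<subseteq> homog VF" "f \<in> \<H>" "Y \<in> homog VF" for Us f Y
      using form_last[OF w, of "X # Us" f Y] that Xh by (simp add: contract_apply)
  qed
qed

lemma contract_lin:
  assumes w: "\<omega> \<in> forms A k"
  shows "lin_on (VF x) (\<lambda>X. contract X \<omega>)"
proof -
  have "lin_on (VF x) (\<lambda>X. \<omega> (X # Xs))" for Xs
  proof (cases "set Xs \<subseteq> homog VF")
    case True
    then show ?thesis using form_lin[OF w, of "[]" Xs x] by simp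
  next
    case False
    then have "\<omega> (X # Xs) = 0" for X using form_outside[OF w, of "X # Xs"] by simp
    then show ?thesis by (simp add: lin_on_const_zero)
  qed
  then show ?thesis unfolding lin_on_def fun_eq_iff by (simp add: contract_apply)
qed

lemma contract_0: "\<omega> \<in> forms A k \<Longrightarrow> contract 0 \<omega> = 0"
  by (rule lin_on_zero[OF contract_lin VF.V_0])

lemma contract_contract:
  assumes w: "\<omega> \<in> forms A k" and X: "X \<in> VF x" and Y: "Y \<in> VF y"
  shows "contract X (contract Y \<omega>) = sgn_pow ((x - 1) * (y - 1)) *\<^sub>R contract Y (contract X \<omega>)"
proof
  fix Zs
  show "contract X (contract Y \<omega>) Zs = (sgn_pow ((x - 1) * (y - 1)) *\<^sub>R contract Y (contract X \<omega>)) Zs"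
  proof (cases "set Zs \<subseteq> homog VF")
    case True
    then show ?thesis using form_sym[OF w _ True Y X, of "[]"] by (simp add: contract_apply mult.commute)
  next
    case False
    then show ?thesis using form_outside[OF w, of "Y # X # Zs"] form_outside[OF w, of "X # Y # Zs"] by (simp add: contract_apply)
  qed
qed

text \<open>All operations on forms are determined by how they commute with contractions. This criterion allows
  one to prove by induction on the bound for the form degree that they produce forms.\<close>

lemma form_intro:
  assumes bd: "bounded_form N \<omega>" and out: "\<And>Xs. \<not> set Xs \<subseteq> homog VF \<Longrightarrow> \<omega> Xs = 0"
    and nil: "\<omega> [] \<in> gcar A k"
    and con: "\<And>x X. X \<in> VF x \<Longrightarrow> contract X \<omega> \<in> forms A (k + x - 1)"
    and lin: "\<And>x. lin_on (VF x) (\<lambda>X. contract X \<omega>)"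
    and sym: "\<And>x y X Y. X \<in> VF x \<Longrightarrow> Y \<in> VF y \<Longrightarrow>
      contract X (contract Y \<omega>) = sgn_pow ((x - 1) * (y - 1)) *\<^sub>R contract Y (contract X \<omega>)"
    and last: "\<And>l f x X. f \<in> gcar A l \<Longrightarrow> X \<in> VF x \<Longrightarrow> \<omega> [vf_scale A f X] = f \<odot> \<omega> [X]"
  shows "\<omega> \<in> forms A k"
proof (rule formI[OF bd out])
  show "\<omega> Xs \<in> gcar A (k + (\<Sum>j\<leftarrow>js. j - 1))" if "VF.homs Xs js" for Xs js
  proof (cases Xs)
    case Nil
    then show ?thesis using that nil by simp
  next
    case (Cons X Ys)
    with \<open>VF.homs Xs js\<close> obtain j ks where js: "js = j # ks" by (cases js) auto
    then show ?thesis using that Cons form_degree[OF con[of X j], of Ys ks] by (simp add: contract_apply algebra_simps)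
  qed
  show "lin_on (VF j) (\<lambda>X. \<omega> (Us @ [X] @ Vs))" if "set Us \<subseteq> homog VF" "set Vs \<subseteq> homog VF" for Us Vs j
  proof (cases Us)
    case Nil
    show ?thesis using lin[of j] unfolding lin_on_def fun_eq_iff by (simp add: contract_apply Nil)
  next
    case (Cons U Us')
    with \<open>set Us \<subseteq> homog VF\<close> obtain u where "U \<in> VF u" by (auto simp: homog_def)
    from form_lin[OF con[OF this], of Us' Vs j] show ?thesis using that Cons by (simp add: contract_apply)
  qed
  show "\<omega> (Us @ [X, Y] @ Vs) = sgn_pow ((x - 1) * (y - 1)) *\<^sub>R \<omega> (Us @ [Y, X] @ Vs)"
    if "set Us \<subseteq> homog VF" "set Vs \<subseteq> homog VF" "X \<in> VF x" "Y \<in> VF y" for Us Vs X Y x y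
  proof (cases Us)
    case Nil
    show ?thesis using fun_cong[OF sym[OF that(4,3)], of Vs] by (simp add: contract_apply Nil mult.commute)
  next
    case (Cons U Us')
    with \<open>set Us \<subseteq> homog VF\<close> obtain u where "U \<in> VF u" by (auto simp: homog_def)
    from form_sym[OF con[OF this], of Us' Vs X x Y y] show ?thesis using that Cons by (simp add: contract_apply)
  qed
  show "\<omega> (Us @ [vf_scale A f X]) = f \<odot> \<omega> (Us @ [X])"
    if "set Us \<subseteq> homog VF" "f \<in> \<H>" "X \<in> homog VF" for Us f X
  proof (cases Us)
    case Nil
    obtain l x where "f \<in> gcar A l" "X \<in> VF x"
      using \<open>f \<in> \<H>\<close> \<open>X \<in> homog VF\<close> by (auto simp: homog_def)
    from last[OF this] show ?thesis by (simp add: Nil)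
  next
    case (Cons U Us')
    with \<open>set Us \<subseteq> homog VF\<close> obtain u where "U \<in> VF u" by (auto simp: homog_def)
    from form_last[OF con[OF this], of Us' f X] show ?thesis using that Cons by (simp add: contract_apply)
  qed
qed

end

text \<open>Forms are functions. Their sums and multiples are expanded pointwise only on request.\<close>

lemmas fun_arith = plus_fun_apply zero_fun_apply minus_apply uminus_apply scaleR_fun_apply

declare fun_arith [simp del]

context gca begin

subsection \<open>Lie derivatives\<close>

text \<open>The Lie derivative, the exterior derivative and the exterior product are used through their
  commutation rules with contractions (\<open>lie_contract\<close>, \<open>d_contract\<close>, \<open>wedge_contract\<close>). An identity
  between forms is proved by induction on the list of arguments: to evaluate on \<open>Z # Zs\<close> means to
  contract with \<open>Z\<close> and to evaluate on \<open>Zs\<close>, and the rules express the contracted sides by instances of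
  the same identity on \<open>Zs\<close>. What remains is a comparison of signs.\<close>

definition lie_deriv :: "('a \<Rightarrow> 'a) \<Rightarrow> 'a form \<Rightarrow> 'a form"
  where "lie_deriv X \<omega> = on_fields A (\<lambda>Xs. lie_rec A X Xs \<omega>)"

lemma form_eqI:
  assumes "\<And>Xs. \<not> set Xs \<subseteq> homog VF \<Longrightarrow> \<eta> Xs = 0" "\<And>Xs. \<not> set Xs \<subseteq> homog VF \<Longrightarrow> \<theta> Xs = 0"
    "\<And>Xs. set Xs \<subseteq> homog VF \<Longrightarrow> \<eta> Xs = \<theta> Xs"
  shows "\<eta> = \<theta>"
  using assms by (metis ext)

lemma contract_on_fields: "X \<in> VF x \<Longrightarrow> contract X (on_fields A F) = on_fields A (\<lambda>Xs. F (X # Xs))"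
  by (auto simp: contract_def on_fields_def fun_eq_iff VF.homogI)

lemma on_fields_form: "\<omega> \<in> forms A k \<Longrightarrow> on_fields A \<omega> = \<omega>"
  using form_outside by (auto simp: on_fields_def fun_eq_iff fun_arith)

lemma vf_bracket_0_left: "Y \<in> VF y \<Longrightarrow> bracket 0 Y = 0"
  by (rule lin_on_zero[OF vf_bracket_lin_left VF.V_0])

lemma vf_bracket_0_right: "X \<in> VF x \<Longrightarrow> bracket X 0 = 0"
  by (rule lin_on_zero[OF vf_bracket_lin_right VF.V_0])

lemma lie_rec_zero_field:
  "\<omega> \<in> forms A k \<Longrightarrow> set Xs \<subseteq> homog VF \<Longrightarrow> lie_rec A 0 Xs \<omega> = 0"
proof (induction Xs arbitrary: \<omega> k)
  case (Cons Y Ys)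
  then obtain y where y: "Y \<in> VF y" by (auto simp: homog_def)
  have "\<omega> (0 # Ys) = 0" using contract_0[OF Cons.prems(1)] contract_apply[of 0 \<omega> Ys] by (simp add: fun_arith)
  then show ?case
    using Cons.IH[OF contract_mem[OF Cons.prems(1) y]] Cons.prems(2) by (simp add: vf_bracket_0_left[OF y])
qed (simp add: fun_arith)

lemma lie_rec_zero_form: "X \<in> VF x \<Longrightarrow> lie_rec A X Xs 0 = 0"
  by (induction Xs) (simp_all add: fun_arith vf_0)

lemma lie_outside: "\<not> set Xs \<subseteq> homog VF \<Longrightarrow> lie_deriv X \<omega> Xs = 0"
  by (simp add: lie_deriv_def on_fields_def)

lemma lie_nil: "lie_deriv X \<omega> [] = X (\<omega> [])"
  by (simp add: lie_deriv_def on_fields_def)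

lemma lie_zero_form: "X \<in> VF x \<Longrightarrow> lie_deriv X 0 = 0"
  by (auto simp: lie_deriv_def on_fields_def fun_eq_iff fun_arith lie_rec_zero_form)

lemma lie_zero_field: "\<omega> \<in> forms A k \<Longrightarrow> lie_deriv 0 \<omega> = 0"
  by (auto simp: lie_deriv_def on_fields_def fun_eq_iff fun_arith lie_rec_zero_field)

lemma lie_contract:
  assumes X: "X \<in> VF x" and Y: "Y \<in> VF y" and w: "\<omega> \<in> forms A k"
  shows "contract Y (lie_deriv X \<omega>) = sgn_pow (x * (y - 1)) *\<^sub>R (lie_deriv X (contract Y \<omega>) - contract (bracket X Y) \<omega>)"
proof -
  have on: "on_fields A (\<lambda>Ys. \<omega> (bracket X Y # Ys)) = contract (bracket X Y) \<omega>"
    using on_fields_form[OF contract_mem[OF w vf_bracket_mem[OF X Y]]] by (simp add: contract_def)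
  have *: "contract Y (lie_deriv X \<omega>) = sgn_pow (vdeg A X * (vdeg A Y - 1)) *\<^sub>R
    (lie_deriv X (contract Y \<omega>) - contract (bracket X Y) \<omega>)"
    unfolding on[symmetric] lie_deriv_def contract_on_fields[OF Y] by (auto simp: on_fields_def fun_eq_iff fun_arith)
  show ?thesis
  proof (cases "X = 0 \<or> Y = 0")
    case True
    then show ?thesis
      using lie_zero_field[OF w] lie_zero_field[OF contract_mem[OF w Y]] lie_zero_form[OF X] contract_0[OF w]
        vf_bracket_0_left[OF Y] vf_bracket_0_right[OF X] unfolding * by auto
  next
    case False
    then have "sgn_pow (vdeg A X * (vdeg A Y - 1)) = sgn_pow (x * (y - 1))"
      using VF.gdeg_parity[OF X] VF.gdeg_parity[OF Y] by (intro sgn_pow_eqI) simp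
    then show ?thesis by (simp add: *)
  qed
qed

lemma lie_lin:
  assumes X: "X \<in> VF x"
  shows "lin_on (forms A k) (lie_deriv X)"
proof -
  have "lie_rec A X Xs (c *\<^sub>R \<omega> + \<eta>) = c *\<^sub>R lie_rec A X Xs \<omega> + lie_rec A X Xs \<eta>"
    if "set Xs \<subseteq> homog VF" "\<omega> \<in> forms A k" "\<eta> \<in> forms A k" for Xs \<omega> \<eta> k c
    using that
  proof (induction Xs arbitrary: \<omega> \<eta> k)
    case Nil
    note n = form_nil[OF Nil(2)] form_nil[OF Nil(3)]
    show ?case
      using lin_on_add[OF vf_lin[OF X] V_scale[OF n(1)] n(2)] lin_on_scale[OF vf_lin[OF X] n(1)] by (simp add: fun_arith)
  next
    case (Cons Y Ys)
    then obtain y where y: "Y \<in> VF y" by (auto simp: homog_def)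
    let ?Zs = "bracket X Y # Ys"
    have "(c *\<^sub>R \<omega> + \<eta>) ?Zs = c *\<^sub>R \<omega> ?Zs + \<eta> ?Zs" by (simp add: fun_arith)
    then show ?case
      using Cons.IH[OF _ contract_mem[OF Cons.prems(2) y] contract_mem[OF Cons.prems(3) y]] Cons.prems(1)
      by (simp add: scaleR_add_right scaleR_diff_right mult.commute)
  qed
  then show ?thesis
    by (intro lin_onI[OF subspace_forms] ext) (simp add: lie_deriv_def on_fields_def fun_arith)
qed

lemma lie_scale_diff:
  assumes X: "X \<in> VF x" and a: "\<alpha> \<in> forms A k" and b: "\<beta> \<in> forms A k"
  shows "lie_deriv X (c *\<^sub>R (\<alpha> - \<beta>)) = c *\<^sub>R (lie_deriv X \<alpha> - lie_deriv X \<beta>)"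
  using lin_on_scale[OF lie_lin[OF X] \<Omega>.V_diff[OF a b]] lin_on_diff[OF lie_lin[OF X] subspace_forms a b] by simp

lemma lie_bounded:
  assumes X: "X \<in> VF x"
  shows "bounded_form N \<omega> \<Longrightarrow> bounded_form N (lie_deriv X \<omega>)"
proof -
  have "lie_rec A X Xs \<omega> = 0" if "bounded_form N \<omega>" "N \<le> length Xs" for Xs \<omega> N
    using that
  proof (induction Xs arbitrary: \<omega> N)
    case Nil
    then show ?case using vf_0[OF X] by (simp add: bounded_form_def)
  next
    case (Cons Y Ys)
    have "lie_rec A X Ys (contract Y \<omega>) = 0"
      by (rule Cons.IH[OF bounded_contract[OF Cons.prems(1)]]) (use Cons.prems(2) in auto)
    then show ?case using Cons.prems by (simp add: bounded_form_def)
  qed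
  then show "bounded_form N \<omega> \<Longrightarrow> bounded_form N (lie_deriv X \<omega>)"
    by (auto simp: bounded_form_def lie_deriv_def on_fields_def)
qed

lemma lie_mem:
  assumes X: "X \<in> VF x" and w: "\<omega> \<in> forms A k"
  shows "lie_deriv X \<omega> \<in> forms A (k + x)"
proof -
  have "lie_deriv X \<omega> \<in> forms A (k + x)" if "bounded_form N \<omega>" "\<omega> \<in> forms A k" for N \<omega> k
    using that
  proof (induction N arbitrary: \<omega> k)
    case 0
    then show ?case using lie_zero_form[OF X] by (simp add: bounded_form_0)
  next
    case (Suc N)
    note w = Suc.prems(2)
    have IH: "lie_deriv X (contract Y \<omega>) \<in> forms A (k + y - 1 + x)" if "Y \<in> VF y" for Y y
      by (rule Suc.IH[OF _ contract_mem[OF w that]]) (use bounded_contract[OF Suc.prems(1)] in simp)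
    show ?case
    proof (rule form_intro[OF lie_bounded[OF X Suc.prems(1)] lie_outside])
      show "lie_deriv X \<omega> [] \<in> gcar A (k + x)" unfolding lie_nil by (rule vf_mem[OF X form_nil[OF w]])
      show "contract Y (lie_deriv X \<omega>) \<in> forms A (k + x + y - 1)" if Y: "Y \<in> VF y" for y Y
        unfolding lie_contract[OF X Y w]
        using IH[OF Y] contract_mem[OF w vf_bracket_mem[OF X Y]]
        by (intro \<Omega>.V_scale \<Omega>.V_diff) (simp_all add: algebra_simps)
      show "lin_on (VF y) (\<lambda>Y. contract Y (lie_deriv X \<omega>))" for y
      proof (rule lin_on_cong[OF _ subspace_VF])
        show "lin_on (VF y) (\<lambda>Y. sgn_pow (x * (y - 1)) *\<^sub>R (lie_deriv X (contract Y \<omega>) - contract (bracket X Y) \<omega>))"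
          by (intro lin_on_scaled lin_on_minus lin_on_compose[OF contract_lin[OF w] _ lie_lin[OF X], of _ "k + y - 1"]
              lin_on_compose[OF vf_bracket_lin_right[OF X] _ contract_lin[OF w], of _ "x + y"])
            (use contract_mem[OF w] vf_bracket_mem[OF X] in auto)
      qed (rule lie_contract[OF X _ w, symmetric])
      show "contract Y (contract Z (lie_deriv X \<omega>)) = sgn_pow ((y - 1) * (z - 1)) *\<^sub>R contract Z (contract Y (lie_deriv X \<omega>))"
        if Y: "Y \<in> VF y" and Z: "Z \<in> VF z" for y z Y Z
      proof -
        note XY = vf_bracket_mem[OF X Y] and XZ = vf_bracket_mem[OF X Z]
        note wY = contract_mem[OF w Y] and wZ = contract_mem[OF w Z]
        have c: "contract Y (contract Z \<omega>) = sgn_pow ((y - 1) * (z - 1)) *\<^sub>R contract Z (contract Y \<omega>)"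
          by (rule contract_contract[OF w Y Z])
        have 1: "lie_deriv X (contract Y (contract Z \<omega>)) = sgn_pow ((y - 1) * (z - 1)) *\<^sub>R lie_deriv X (contract Z (contract Y \<omega>))"
          unfolding c by (rule lin_on_scale[OF lie_lin[OF X] contract_mem[OF wY Z]])
        have 2: "contract Y (contract (bracket X Z) \<omega>) = sgn_pow ((y - 1) * (x + z - 1)) *\<^sub>R contract (bracket X Z) (contract Y \<omega>)"
          by (rule contract_contract[OF w Y XZ])
        have 3: "contract Z (contract (bracket X Y) \<omega>) = sgn_pow ((z - 1) * (x + y - 1)) *\<^sub>R contract (bracket X Y) (contract Z \<omega>)"
          by (rule contract_contract[OF w Z XY])
        show ?thesis
          unfolding lie_contract[OF X Y w] lie_contract[OF X Z w] contract_arith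
            lie_contract[OF X Y wZ] lie_contract[OF X Z wY] 1 2 3
          by (cases "even x"; cases "even y"; cases "even z"; simp add: sgn_pow_def algebra_simps)
      qed
      show "lie_deriv X \<omega> [vf_scale A f Y] = f \<odot> lie_deriv X \<omega> [Y]" if f: "f \<in> gcar A l" and Y: "Y \<in> VF y" for l f y Y
      proof -
        note fY = vf_scale_mem[OF f Y] and XY = vf_bracket_mem[OF X Y]
        note fh = homogI[OF f]
        have fXY: "vf_scale A f (bracket X Y) \<in> VF (l + (x + y))" by (rule vf_scale_mem[OF f XY])
        have XfY: "vf_scale A (X f) Y \<in> VF (l + (x + y))"
          using vf_scale_mem[OF vf_mem[OF X f] Y] by (simp add: algebra_simps)
        have a: "\<omega> [Y] \<in> gcar A (k + (y - 1))" "\<omega> [bracket X Y] \<in> gcar A (k + (x + y - 1))"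
          using form_degree[OF w, of "[Y]" "[y]"] form_degree[OF w, of "[bracket X Y]" "[x + y]"] Y XY by auto
        have last: "\<omega> [vf_scale A g Z] = g \<odot> \<omega> [Z]" if "g \<in> gcar A j" "Z \<in> VF z" for g Z j z
          using form_last[OF w, of "[]" g Z] that by (simp add: homogI VF.homogI)
        have e: "lie_deriv X \<omega> [Z] = sgn_pow (x * (z - 1)) *\<^sub>R (X (\<omega> [Z]) - \<omega> [bracket X Z])" if "Z \<in> VF z" for Z z
          using fun_cong[OF lie_contract[OF X that w], of "[]"] by (simp add: contract_apply lie_nil fun_arith)
        have L: "lin_on (VF (l + (x + y))) (\<lambda>X. \<omega> [X])"
          using form_lin[OF w, of "[]" "[]" "l + (x + y)"] by simp
        have e1: "\<omega> [bracket X (vf_scale A f Y)] = X f \<odot> \<omega> [Y] + sgn_pow (x * l) *\<^sub>R (f \<odot> \<omega> [bracket X Y])"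
          unfolding vf_bracket_scale[OF X Y f]
          using lin_on_add[OF L XfY VF.V_scale[OF fXY, of "sgn_pow (x * l)"]] lin_on_scale[OF L fXY, of "sgn_pow (x * l)"]
          by (simp add: last[OF f XY] last[OF vf_mem[OF X f] Y])
        have e2: "X (\<omega> [vf_scale A f Y]) = X f \<odot> \<omega> [Y] + sgn_pow (x * l) *\<^sub>R (f \<odot> X (\<omega> [Y]))"
          unfolding last[OF f Y] by (rule vf_leibniz[OF X f homogI[OF a(1)]])
        have m: "X (\<omega> [Y]) \<in> gcar A (k + (x + y - 1))" using vf_mem[OF X a(1)] by (simp add: algebra_simps)
        have e3: "f \<odot> lie_deriv X \<omega> [Y] = sgn_pow (x * (y - 1)) *\<^sub>R (f \<odot> X (\<omega> [Y]) - f \<odot> \<omega> [bracket X Y])"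
          unfolding e[OF Y] using mul_scale_right[OF fh homogI[OF V_diff[OF m a(2)]]] mul_diff_right[OF fh m a(2)] by simp
        show ?thesis unfolding e3 e[OF fY] e1 e2
          by (cases "even x"; cases "even y"; cases "even l"; simp add: sgn_pow_def algebra_simps)
      qed
    qed
  qed
  then show ?thesis using form_bounded[OF w] w by blast
qed

lemma lie_lin_field:
  assumes w: "\<omega> \<in> forms A k"
  shows "lin_on (VF x) (\<lambda>X. lie_deriv X \<omega>)"
proof (rule lin_onI[OF subspace_VF])
  fix c X Y assume X: "X \<in> VF x" and Y: "Y \<in> VF x"
  define W where "W = c *\<^sub>R X + Y"
  have W: "W \<in> VF x" unfolding W_def by (intro VF.V_add VF.V_scale X Y)
  have "lie_deriv W \<omega> Zs = c *\<^sub>R lie_deriv X \<omega> Zs + lie_deriv Y \<omega> Zs"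
    if "set Zs \<subseteq> homog VF" "\<omega> \<in> forms A k" for Zs \<omega> k
    using that
  proof (induction Zs arbitrary: \<omega> k)
    case Nil
    then show ?case by (simp add: lie_nil fun_arith W_def)
  next
    case (Cons Z Zs)
    then obtain z where z: "Z \<in> VF z" by (auto simp: homog_def)
    note w = Cons.prems(2)
    have b: "contract (bracket W Z) \<omega> = c *\<^sub>R contract (bracket X Z) \<omega> + contract (bracket Y Z) \<omega>"
      using lin_on_comb[OF vf_bracket_lin_left[OF z] subspace_VF X Y, of c]
        lin_on_comb[OF contract_lin[OF w] subspace_VF vf_bracket_mem[OF X z] vf_bracket_mem[OF Y z], of c]
      by (simp add: W_def)
    have "lie_deriv W (contract Z \<omega>) Zs = c *\<^sub>R lie_deriv X (contract Z \<omega>) Zs + lie_deriv Y (contract Z \<omega>) Zs"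
      using Cons.IH[OF _ contract_mem[OF w z]] Cons.prems(1) by simp
    then show ?case
      unfolding contract_apply[symmetric] lie_contract[OF W z w] lie_contract[OF X z w] lie_contract[OF Y z w] b
      by (simp add: algebra_simps fun_arith)
  qed
  then show "lie_deriv (c *\<^sub>R X + Y) \<omega> = c *\<^sub>R lie_deriv X \<omega> + lie_deriv Y \<omega>"
    using w by (intro form_eqI) (simp_all add: lie_outside fun_arith flip: W_def)
qed

lemma lie_bracket:
  assumes X: "X \<in> VF x" and Y: "Y \<in> VF y" and w: "\<omega> \<in> forms A k"
  shows "lie_deriv (bracket X Y) \<omega> = lie_deriv X (lie_deriv Y \<omega>) - sgn_pow (x * y) *\<^sub>R lie_deriv Y (lie_deriv X \<omega>)"
proof (rule form_eqI)
  fix Zs assume "set Zs \<subseteq> homog VF"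
  from this w show "lie_deriv (bracket X Y) \<omega> Zs
    = (lie_deriv X (lie_deriv Y \<omega>) - sgn_pow (x * y) *\<^sub>R lie_deriv Y (lie_deriv X \<omega>)) Zs"
  proof (induction Zs arbitrary: \<omega> k)
    case Nil
    then show ?case by (simp add: lie_nil fun_arith vf_bracket_eq[OF X Y])
  next
    case (Cons Z Zs)
    then obtain z where Z: "Z \<in> VF z" by (auto simp: homog_def)
    note w = Cons.prems(2)
    note XY = vf_bracket_mem[OF X Y] and XZ = vf_bracket_mem[OF X Z] and YZ = vf_bracket_mem[OF Y Z]
    note Lx = lie_mem[OF X w] and Ly = lie_mem[OF Y w] and wZ = contract_mem[OF w Z]
    have d1: "lie_deriv Y (contract Z \<omega>) \<in> forms A (k + y + z - 1)" "contract (bracket Y Z) \<omega> \<in> forms A (k + y + z - 1)"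
      "lie_deriv X (contract Z \<omega>) \<in> forms A (k + x + z - 1)" "contract (bracket X Z) \<omega> \<in> forms A (k + x + z - 1)"
      using lie_mem[OF Y wZ] lie_mem[OF X wZ] contract_mem[OF w YZ] contract_mem[OF w XZ] by (simp_all add: algebra_simps)
    have d2: "bracket X (bracket Y Z) \<in> VF (x + y + z)" "bracket Y (bracket X Z) \<in> VF (x + y + z)"
      using vf_bracket_mem[OF X YZ] vf_bracket_mem[OF Y XZ] by (simp_all add: algebra_simps)
    have J: "contract (bracket (bracket X Y) Z) \<omega> = contract (bracket X (bracket Y Z)) \<omega>
        - sgn_pow (x * y) *\<^sub>R contract (bracket Y (bracket X Z)) \<omega>"
      unfolding vf_jacobi[OF X Y Z]
      using lin_on_diff[OF contract_lin[OF w] subspace_VF d2(1) VF.V_scale[OF d2(2)]] lin_on_scale[OF contract_lin[OF w] d2(2)] by simp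
    have IH: "lie_deriv (bracket X Y) (contract Z \<omega>) Zs = lie_deriv X (lie_deriv Y (contract Z \<omega>)) Zs
        - sgn_pow (x * y) *\<^sub>R lie_deriv Y (lie_deriv X (contract Z \<omega>)) Zs"
      using Cons.IH[OF _ wZ] Cons.prems(1) by (simp add: fun_arith)
    have E1: "contract Z (lie_deriv X (lie_deriv Y \<omega>)) = sgn_pow (x * (z - 1)) *\<^sub>R
      (sgn_pow (y * (z - 1)) *\<^sub>R (lie_deriv X (lie_deriv Y (contract Z \<omega>)) - lie_deriv X (contract (bracket Y Z) \<omega>))
      - sgn_pow (y * (x + z - 1)) *\<^sub>R (lie_deriv Y (contract (bracket X Z) \<omega>) - contract (bracket Y (bracket X Z)) \<omega>))"
      unfolding lie_contract[OF X Z Ly] lie_contract[OF Y Z w] lie_contract[OF Y XZ w] lie_scale_diff[OF X d1(1,2)] ..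
    have E2: "contract Z (lie_deriv Y (lie_deriv X \<omega>)) = sgn_pow (y * (z - 1)) *\<^sub>R
      (sgn_pow (x * (z - 1)) *\<^sub>R (lie_deriv Y (lie_deriv X (contract Z \<omega>)) - lie_deriv Y (contract (bracket X Z) \<omega>))
      - sgn_pow (x * (y + z - 1)) *\<^sub>R (lie_deriv X (contract (bracket Y Z) \<omega>) - contract (bracket X (bracket Y Z)) \<omega>))"
      unfolding lie_contract[OF Y Z Lx] lie_contract[OF X Z w] lie_contract[OF X YZ w] lie_scale_diff[OF Y d1(3,4)] ..
    show ?case
      unfolding contract_apply[symmetric]
      unfolding contract_arith
      unfolding lie_contract[OF XY Z w] E1 E2 J
      unfolding fun_arith IH
      by (cases "even x"; cases "even y"; cases "even z"; simp add: sgn_pow_def algebra_simps)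
  qed
qed (simp_all add: lie_outside fun_arith)

subsection \<open>The exterior derivative\<close>

abbreviation "d \<equiv> ext_deriv A"

lemma d_outside: "\<not> set Xs \<subseteq> homog VF \<Longrightarrow> d \<omega> Xs = 0"
  by (simp add: ext_deriv_def on_fields_def)

lemma d_nil: "d \<omega> [] = 0"
  by (simp add: ext_deriv_def on_fields_def)

lemma d_zero: "d 0 = 0"
proof -
  have "ext_deriv_rec A Xs 0 = 0" if "set Xs \<subseteq> homog VF" for Xs
    using that by (induction Xs) (auto simp: lie_rec_zero_form homog_def)
  then have "d 0 Xs = 0" for Xs by (simp add: ext_deriv_def on_fields_def)
  then show ?thesis by (intro ext trans[OF _ zero_fun_apply[symmetric]])
qed

lemma d_contract:
  assumes X: "X \<in> VF x" and w: "\<omega> \<in> forms A k"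
  shows "contract X (d \<omega>) = lie_deriv X \<omega> + sgn_pow (x - 1) *\<^sub>R d (contract X \<omega>)"
proof -
  have *: "contract X (d \<omega>) = lie_deriv X \<omega> + sgn_pow (vdeg A X - 1) *\<^sub>R d (contract X \<omega>)"
    unfolding lie_deriv_def ext_deriv_def contract_on_fields[OF X] by (auto simp: on_fields_def fun_eq_iff fun_arith)
  show ?thesis
  proof (cases "X = 0")
    case True
    then show ?thesis unfolding * by (simp add: contract_0[OF w] d_zero)
  next
    case False
    then have "sgn_pow (vdeg A X - 1) = sgn_pow (x - 1)"
      using VF.gdeg_parity[OF X] by (intro sgn_pow_eqI) simp
    then show ?thesis by (simp add: *)
  qed
qed

lemma d_lin: "lin_on (forms A k) d"
proof -
  have "d (c *\<^sub>R \<omega> + \<eta>) Zs = c *\<^sub>R d \<omega> Zs + d \<eta> Zs"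
    if "set Zs \<subseteq> homog VF" "\<omega> \<in> forms A k" "\<eta> \<in> forms A k" for Zs \<omega> \<eta> k c
    using that
  proof (induction Zs arbitrary: \<omega> \<eta> k)
    case (Cons Z Zs)
    then obtain z where z: "Z \<in> VF z" by (auto simp: homog_def)
    note w = Cons.prems(2) and h = Cons.prems(3)
    define S where "S = c *\<^sub>R \<omega> + \<eta>"
    have S: "S \<in> forms A k" unfolding S_def by (rule \<Omega>.V_add[OF \<Omega>.V_scale[OF w] h])
    define U where "U = contract Z S"
    have U: "d U Zs = c *\<^sub>R d (contract Z \<omega>) Zs + d (contract Z \<eta>) Zs"
      using Cons.IH[OF _ contract_mem[OF w z] contract_mem[OF h z]] Cons.prems(1) by (simp add: U_def S_def)
    have L: "lie_deriv Z S = c *\<^sub>R lie_deriv Z \<omega> + lie_deriv Z \<eta>"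
      unfolding S_def using lin_on_add[OF lie_lin[OF z] \<Omega>.V_scale[OF w] h] lin_on_scale[OF lie_lin[OF z] w] by simp
    show ?case
      unfolding S_def[symmetric] contract_apply[symmetric] d_contract[OF z S] d_contract[OF z w]
        d_contract[OF z h] U_def[symmetric] L
      by (simp add: fun_arith U scaleR_add_right mult.commute)
  qed (simp add: d_nil fun_arith)
  then show ?thesis
    by (intro lin_onI[OF subspace_forms] form_eqI) (simp_all add: d_outside fun_arith)
qed

lemma d_bounded: "bounded_form N \<omega> \<Longrightarrow> \<omega> \<in> forms A k \<Longrightarrow> bounded_form (Suc N) (d \<omega>)"
proof -
  have "d \<omega> Zs = 0" if "set Zs \<subseteq> homog VF" "bounded_form N \<omega>" "Suc N \<le> length Zs" "\<omega> \<in> forms A k" for Zs N \<omega> k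
    using that
  proof (induction Zs arbitrary: N \<omega> k)
    case (Cons Z Zs)
    then obtain z where z: "Z \<in> VF z" by (auto simp: homog_def)
    have L: "lie_deriv Z \<omega> Zs = 0" using lie_bounded[OF z Cons.prems(2)] Cons.prems(3) by (simp add: bounded_form_def)
    have "d (contract Z \<omega>) Zs = 0"
    proof (cases N)
      case 0
      then have "\<omega> = 0" using Cons.prems(2) by (simp add: bounded_form_0)
      then show ?thesis by (simp add: d_zero zero_fun_apply[of Zs])
    next
      case (Suc M)
      then show ?thesis
        using Cons.IH[OF _ _ _ contract_mem[OF Cons.prems(4) z], of M] bounded_contract[OF Cons.prems(2), of Z] Cons.prems by simp
    qed
    with L show ?case unfolding contract_apply[symmetric] d_contract[OF z Cons.prems(4)] by (simp add: fun_arith)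
  qed simp
  then show "bounded_form N \<omega> \<Longrightarrow> \<omega> \<in> forms A k \<Longrightarrow> bounded_form (Suc N) (d \<omega>)"
    unfolding bounded_form_def[of "Suc N"] using d_outside by metis
qed

lemma d_mem:
  assumes w: "\<omega> \<in> forms A k"
  shows "d \<omega> \<in> forms A (k + 1)"
proof -
  have "d \<omega> \<in> forms A (k + 1)" if "bounded_form N \<omega>" "\<omega> \<in> forms A k" for N \<omega> k
    using that
  proof (induction N arbitrary: \<omega> k)
    case 0
    then show ?case by (simp add: bounded_form_0 d_zero)
  next
    case (Suc N)
    note w = Suc.prems(2)
    have IH: "d (contract X \<omega>) \<in> forms A (k + x)" if "X \<in> VF x" for X x
      using Suc.IH[OF _ contract_mem[OF w that]] bounded_contract[OF Suc.prems(1), of X] by simp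
    show ?case
    proof (rule form_intro[OF d_bounded[OF Suc.prems] d_outside])
      show "d \<omega> [] \<in> gcar A (k + 1)" by (simp add: d_nil)
      show "contract X (d \<omega>) \<in> forms A (k + 1 + x - 1)" if X: "X \<in> VF x" for x X
        unfolding d_contract[OF X w] using IH[OF X] lie_mem[OF X w] by (simp add: \<Omega>.V_add \<Omega>.V_scale)
      show "lin_on (VF x) (\<lambda>X. contract X (d \<omega>))" for x
      proof (rule lin_on_cong[OF _ subspace_VF])
        show "lin_on (VF x) (\<lambda>X. lie_deriv X \<omega> + sgn_pow (x - 1) *\<^sub>R d (contract X \<omega>))"
          by (intro lin_on_plus lie_lin_field[OF w] lin_on_scaled lin_on_compose[OF contract_lin[OF w] _ d_lin, of _ "k + x - 1"])
            (use contract_mem[OF w] in auto)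
      qed (rule d_contract[OF _ w, symmetric])
      show "contract X (contract Y (d \<omega>)) = sgn_pow ((x - 1) * (y - 1)) *\<^sub>R contract Y (contract X (d \<omega>))"
        if X: "X \<in> VF x" and Y: "Y \<in> VF y" for x y X Y
      proof -
        note wX = contract_mem[OF w X] and wY = contract_mem[OF w Y]
        have 1: "d (contract X (contract Y \<omega>)) = sgn_pow ((x - 1) * (y - 1)) *\<^sub>R d (contract Y (contract X \<omega>))"
          unfolding contract_contract[OF w X Y] by (rule lin_on_scale[OF d_lin contract_mem[OF wX Y]])
        have 2: "contract (bracket Y X) \<omega> = - sgn_pow (x * y) *\<^sub>R contract (bracket X Y) \<omega>"
          unfolding vf_bracket_swap[OF X Y] by (rule lin_on_scale[OF contract_lin[OF w] vf_bracket_mem[OF X Y]])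
        show ?thesis
          unfolding d_contract[OF X w] d_contract[OF Y w] contract_arith d_contract[OF X wY] d_contract[OF Y wX]
            lie_contract[OF X Y w] lie_contract[OF Y X w] 1 2
          by (cases "even x"; cases "even y"; simp add: sgn_pow_def algebra_simps)
      qed
      show "d \<omega> [vf_scale A f X] = f \<odot> d \<omega> [X]" if f: "f \<in> gcar A l" and X: "X \<in> VF x" for l f x X
      proof -
        have "d \<omega> [Y] = Y (\<omega> [])" if "Y \<in> VF y" for Y y
          using fun_cong[OF d_contract[OF that w], of "[]"] by (simp add: contract_apply d_nil lie_nil fun_arith)
        from this[OF X] this[OF vf_scale_mem[OF f X]] show ?thesis by (simp add: vf_scale_def)
      qed
    qed
  qed
  then show ?thesis using form_bounded[OF w] w by blast
qed

lemma lie_d: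
  assumes X: "X \<in> VF x" and w: "\<omega> \<in> forms A k"
  shows "lie_deriv X (d \<omega>) = sgn_pow x *\<^sub>R d (lie_deriv X \<omega>)"
proof (rule form_eqI)
  fix Zs assume "set Zs \<subseteq> homog VF"
  from this w show "lie_deriv X (d \<omega>) Zs = (sgn_pow x *\<^sub>R d (lie_deriv X \<omega>)) Zs"
  proof (induction Zs arbitrary: \<omega> k)
    case Nil
    then show ?case by (simp add: lie_nil d_nil fun_arith vf_0[OF X])
  next
    case (Cons Z Zs)
    then obtain z where Z: "Z \<in> VF z" by (auto simp: homog_def)
    note w = Cons.prems(2)
    note XZ = vf_bracket_mem[OF X Z] and wZ = contract_mem[OF w Z]
    note dwZ = d_mem[OF wZ] and LZ = lie_mem[OF Z w]
    have m: "lie_deriv X (contract Z \<omega>) \<in> forms A (k + x + z - 1)" "contract (bracket X Z) \<omega> \<in> forms A (k + x + z - 1)"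
      using lie_mem[OF X wZ] contract_mem[OF w XZ] by (simp_all add: algebra_simps)
    have m': "d (contract Z \<omega>) \<in> forms A (k + z)" using dwZ by simp
    have e1: "lie_deriv X (lie_deriv Z \<omega> + sgn_pow (z - 1) *\<^sub>R d (contract Z \<omega>))
        = lie_deriv X (lie_deriv Z \<omega>) + sgn_pow (z - 1) *\<^sub>R lie_deriv X (d (contract Z \<omega>))"
      using lin_on_add[OF lie_lin[OF X] LZ \<Omega>.V_scale[OF m']] lin_on_scale[OF lie_lin[OF X] m'] by simp
    have e2: "d (sgn_pow (x * (z - 1)) *\<^sub>R (lie_deriv X (contract Z \<omega>) - contract (bracket X Z) \<omega>))
        = sgn_pow (x * (z - 1)) *\<^sub>R (d (lie_deriv X (contract Z \<omega>)) - d (contract (bracket X Z) \<omega>))"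
      using lin_on_scale[OF d_lin \<Omega>.V_diff[OF m]] lin_on_diff[OF d_lin subspace_forms m] by simp
    have IH: "lie_deriv X (d (contract Z \<omega>)) Zs = sgn_pow x *\<^sub>R d (lie_deriv X (contract Z \<omega>)) Zs"
      using Cons.IH[OF _ wZ] Cons.prems(1) by (simp add: fun_arith)
    show ?case
      unfolding contract_apply[symmetric]
      unfolding contract_arith
      unfolding lie_contract[OF X Z d_mem[OF w]] d_contract[OF Z w] e1
        d_contract[OF XZ w] lie_bracket[OF X Z w] d_contract[OF Z lie_mem[OF X w]] lie_contract[OF X Z w] e2
      unfolding fun_arith IH
      by (cases "even x"; cases "even z"; simp add: sgn_pow_def algebra_simps)
  qed
qed (simp_all add: lie_outside d_outside fun_arith)

lemma d_d_forms:
  assumes w: "\<omega> \<in> forms A k"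
  shows "d (d \<omega>) = 0"
proof -
  have "d (d \<omega>) Zs = 0" if "set Zs \<subseteq> homog VF" for Zs
    using that w
  proof (induction Zs arbitrary: \<omega> k)
    case (Cons Z Zs)
    then obtain z where Z: "Z \<in> VF z" by (auto simp: homog_def)
    note w = Cons.prems(2)
    note wZ = contract_mem[OF w Z]
    have m': "d (contract Z \<omega>) \<in> forms A (k + z)" using d_mem[OF wZ] by simp
    have e: "d (lie_deriv Z \<omega> + sgn_pow (z - 1) *\<^sub>R d (contract Z \<omega>)) = d (lie_deriv Z \<omega>) + sgn_pow (z - 1) *\<^sub>R d (d (contract Z \<omega>))"
      using lin_on_add[OF d_lin lie_mem[OF Z w] \<Omega>.V_scale[OF m']] lin_on_scale[OF d_lin m'] by simp
    have IH: "d (d (contract Z \<omega>)) Zs = 0" using Cons.IH[OF _ wZ] Cons.prems(1) by simp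
    show ?case
      unfolding contract_apply[symmetric]
      unfolding d_contract[OF Z d_mem[OF w]] d_contract[OF Z w] e lie_d[OF Z w]
      unfolding fun_arith IH
      by (simp add: sgn_pow_def)
  qed (simp add: d_nil)
  then show ?thesis by (intro form_eqI) (simp_all add: d_outside fun_arith)
qed

end

context gca begin

subsection \<open>The exterior product\<close>

lemma wedge_rec_parity:
  "even a \<longleftrightarrow> even a' \<Longrightarrow> wedge_rec A Xs a \<alpha> \<beta> = wedge_rec A Xs a' \<alpha> \<beta>"
proof (induction Xs arbitrary: a a' \<alpha> \<beta>)
  case (Cons X Xs)
  have "sgn_pow ((vdeg A X - 1) * a) = sgn_pow ((vdeg A X - 1) * a')"
    using Cons.prems by (intro sgn_pow_eqI) simp
  moreover have "wedge_rec A Xs (a + vdeg A X - 1) \<gamma> \<beta> = wedge_rec A Xs (a' + vdeg A X - 1) \<gamma> \<beta>" for \<gamma>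
    by (rule Cons.IH) (use Cons.prems in simp)
  ultimately show ?case using Cons.IH[OF Cons.prems] by simp
qed simp

lemma wedge_rec_zero_left:
  "\<beta> \<in> forms A b \<Longrightarrow> set Xs \<subseteq> homog VF \<Longrightarrow> wedge_rec A Xs a 0 \<beta> = 0"
proof (induction Xs arbitrary: a \<beta> b)
  case Nil
  then show ?case using mul_0_left[OF homogI[OF form_nil]] by (simp add: zero_fun_apply)
next
  case (Cons X Xs)
  then obtain x where "X \<in> VF x" by (auto simp: homog_def)
  then show ?case using Cons.IH[OF Cons.prems(1)] Cons.IH[OF contract_mem[OF Cons.prems(1)]] Cons.prems(2) by simp
qed

lemma wedge_rec_zero_right:
  "\<alpha> \<in> forms A k \<Longrightarrow> set Xs \<subseteq> homog VF \<Longrightarrow> wedge_rec A Xs a \<alpha> 0 = 0"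
proof (induction Xs arbitrary: a \<alpha> k)
  case Nil
  then show ?case using mul_0_right[OF homogI[OF form_nil]] by (simp add: zero_fun_apply)
next
  case (Cons X Xs)
  then obtain x where "X \<in> VF x" by (auto simp: homog_def)
  then show ?case using Cons.IH[OF Cons.prems(1)] Cons.IH[OF contract_mem[OF Cons.prems(1)]] Cons.prems(2) by simp
qed

text \<open>The recursion may start from any degree of the left factor: only its parity matters, and it is
  determined unless the factor is zero.\<close>

lemma wedge_eq:
  assumes a: "\<alpha> \<in> forms A a" and b: "\<beta> \<in> forms A b"
  shows "wedge A \<alpha> \<beta> = on_fields A (\<lambda>Xs. wedge_rec A Xs a \<alpha> \<beta>)"
proof (cases "\<alpha> = 0")
  case True
  show ?thesis unfolding True wedge_def on_fields_def using wedge_rec_zero_left[OF b] by (intro ext) simp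
next
  case False
  then have "even (gdeg (forms A) \<alpha>) \<longleftrightarrow> even a" by (rule \<Omega>.gdeg_parity[OF a])
  from wedge_rec_parity[OF this] show ?thesis by (simp add: wedge_def)
qed

lemma wedge_outside: "\<not> set Xs \<subseteq> homog VF \<Longrightarrow> wedge A \<alpha> \<beta> Xs = 0"
  by (simp add: wedge_def on_fields_def)

lemma wedge_nil: "wedge A \<alpha> \<beta> [] = \<alpha> [] \<odot> \<beta> []"
  by (simp add: wedge_def on_fields_def)

lemma wedge_zero_left: "\<beta> \<in> forms A b \<Longrightarrow> wedge A 0 \<beta> = 0"
  using wedge_rec_zero_left by (auto simp: wedge_def on_fields_def fun_eq_iff zero_fun_apply)

lemma wedge_zero_right: "\<alpha> \<in> forms A a \<Longrightarrow> wedge A \<alpha> 0 = 0"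
  using wedge_rec_zero_right by (auto simp: wedge_def on_fields_def fun_eq_iff zero_fun_apply)

lemma wedge_contract:
  assumes X: "X \<in> VF x" and a: "\<alpha> \<in> forms A a" and b: "\<beta> \<in> forms A b"
  shows "contract X (wedge A \<alpha> \<beta>) = wedge A (contract X \<alpha>) \<beta> + sgn_pow ((x - 1) * a) *\<^sub>R wedge A \<alpha> (contract X \<beta>)"
proof (cases "X = 0")
  case True
  have "contract 0 (wedge A \<alpha> \<beta>) = 0"
  proof -
    have "contract 0 (wedge A \<alpha> \<beta>) Xs = 0" for Xs
    proof (cases "set Xs \<subseteq> homog VF")
      case True
      have "wedge_rec A (0 # Xs) a \<alpha> \<beta> = 0"
        using wedge_rec_zero_left[OF b True] wedge_rec_zero_right[OF a True] by (simp add: contract_0[OF a] contract_0[OF b])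
      then show ?thesis by (simp add: wedge_eq[OF a b] on_fields_def contract_apply)
    qed (use wedge_outside[of "0 # Xs"] in \<open>simp add: contract_apply\<close>)
    then show ?thesis by (intro ext trans[OF _ zero_fun_apply[symmetric]])
  qed
  then show ?thesis using True contract_0[OF a] contract_0[OF b] wedge_zero_left[OF b] wedge_zero_right[OF a] by simp
next
  case False
  then have p: "even (vdeg A X) \<longleftrightarrow> even x" by (rule VF.gdeg_parity[OF X])
  have s: "sgn_pow ((vdeg A X - 1) * a) = sgn_pow ((x - 1) * a)"
    using p by (intro sgn_pow_eqI) simp
  have r: "wedge_rec A Xs (a + vdeg A X - 1) (contract X \<alpha>) \<beta> = wedge_rec A Xs (a + x - 1) (contract X \<alpha>) \<beta>" for Xs
    by (rule wedge_rec_parity) (use p in simp)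
  show ?thesis
    unfolding wedge_eq[OF a b] wedge_eq[OF contract_mem[OF a X] b] wedge_eq[OF a contract_mem[OF b X]] contract_on_fields[OF X]
    by (auto simp: on_fields_def fun_eq_iff fun_arith r s)
qed

lemma wedge_commute:
  assumes a: "\<alpha> \<in> forms A a" and b: "\<beta> \<in> forms A b"
  shows "wedge A \<alpha> \<beta> = sgn_pow (a * b) *\<^sub>R wedge A \<beta> \<alpha>"
proof (rule form_eqI)
  fix Zs assume "set Zs \<subseteq> homog VF"
  from this a b show "wedge A \<alpha> \<beta> Zs = (sgn_pow (a * b) *\<^sub>R wedge A \<beta> \<alpha>) Zs"
  proof (induction Zs arbitrary: \<alpha> \<beta> a b)
    case Nil
    then show ?case using mul_comm[OF form_nil form_nil, of \<alpha> a \<beta> b] by (simp add: wedge_nil fun_arith)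
  next
    case (Cons Z Zs)
    then obtain z where Z: "Z \<in> VF z" by (auto simp: homog_def)
    note a = Cons.prems(2) and b = Cons.prems(3)
    have 1: "wedge A (contract Z \<alpha>) \<beta> Zs = sgn_pow ((a + z - 1) * b) *\<^sub>R wedge A \<beta> (contract Z \<alpha>) Zs"
      using Cons.IH[OF _ contract_mem[OF a Z] b] Cons.prems(1) by (simp add: fun_arith)
    have 2: "wedge A \<alpha> (contract Z \<beta>) Zs = sgn_pow (a * (b + z - 1)) *\<^sub>R wedge A (contract Z \<beta>) \<alpha> Zs"
      using Cons.IH[OF _ a contract_mem[OF b Z]] Cons.prems(1) by (simp add: fun_arith)
    show ?case
      unfolding contract_apply[symmetric]
      unfolding contract_arith wedge_contract[OF Z a b] wedge_contract[OF Z b a]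
      unfolding fun_arith 1 2
      by (cases "even a"; cases "even b"; cases "even z"; simp add: sgn_pow_def algebra_simps)
  qed
qed (simp_all add: wedge_outside fun_arith)

lemma wedge_lin_right:
  assumes a: "\<alpha> \<in> forms A a"
  shows "lin_on (forms A b) (wedge A \<alpha>)"
proof -
  have "wedge A \<alpha> (r *\<^sub>R \<beta> + \<gamma>) Zs = r *\<^sub>R wedge A \<alpha> \<beta> Zs + wedge A \<alpha> \<gamma> Zs"
    if "set Zs \<subseteq> homog VF" "\<alpha> \<in> forms A a" "\<beta> \<in> forms A b" "\<gamma> \<in> forms A b" for Zs \<alpha> \<beta> \<gamma> a b r
    using that
  proof (induction Zs arbitrary: \<alpha> \<beta> \<gamma> a b)
    case Nil
    note n = form_nil[OF Nil(2)] form_nil[OF Nil(3)] form_nil[OF Nil(4)]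
    show ?case
      using mul_add_right[OF homogI[OF n(1)] V_scale[OF n(2)] n(3)] mul_scale_right[OF homogI[OF n(1)] homogI[OF n(2)]]
      by (simp add: wedge_nil plus_fun_apply[of _ _ "[]"] scaleR_fun_apply[of _ _ "[]"])
  next
    case (Cons Z Zs)
    then obtain z where Z: "Z \<in> VF z" by (auto simp: homog_def)
    note a = Cons.prems(2) and b = Cons.prems(3) and c = Cons.prems(4)
    define S where "S = r *\<^sub>R \<beta> + \<gamma>"
    have S: "S \<in> forms A b" unfolding S_def by (rule \<Omega>.V_add[OF \<Omega>.V_scale[OF b] c])
    have 1: "wedge A (contract Z \<alpha>) S Zs = r *\<^sub>R wedge A (contract Z \<alpha>) \<beta> Zs + wedge A (contract Z \<alpha>) \<gamma> Zs"
      using Cons.IH[OF _ contract_mem[OF a Z] b c] Cons.prems(1) by (simp add: S_def)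
    have 2: "wedge A \<alpha> (contract Z S) Zs = r *\<^sub>R wedge A \<alpha> (contract Z \<beta>) Zs + wedge A \<alpha> (contract Z \<gamma>) Zs"
      using Cons.IH[OF _ a contract_mem[OF b Z] contract_mem[OF c Z]] Cons.prems(1) by (simp add: S_def)
    show ?case
      unfolding S_def[symmetric] contract_apply[symmetric] wedge_contract[OF Z a b] wedge_contract[OF Z a c] wedge_contract[OF Z a S]
      unfolding fun_arith 1 2 by (simp add: scaleR_add_right mult.commute)
  qed
  from this[OF _ a] show ?thesis
    by (intro lin_onI[OF subspace_forms] form_eqI) (simp_all add: wedge_outside fun_arith)
qed

lemma wedge_lin_left:
  assumes b: "\<beta> \<in> forms A b"
  shows "lin_on (forms A a) (\<lambda>\<alpha>. wedge A \<alpha> \<beta>)"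
  by (rule lin_on_cong[OF lin_on_scaled[OF wedge_lin_right[OF b], of "a" "sgn_pow (a * b)"] subspace_forms])
    (rule wedge_commute[OF _ b, symmetric])

lemma wedge_bounded:
  assumes "bounded_form N \<alpha>" "bounded_form M \<beta>" "\<alpha> \<in> forms A a" "\<beta> \<in> forms A b"
  shows "bounded_form (N + M) (wedge A \<alpha> \<beta>)"
proof -
  have "wedge A \<alpha> \<beta> Zs = 0"
    if "set Zs \<subseteq> homog VF" "N + M \<le> length Zs" "bounded_form N \<alpha>" "bounded_form M \<beta>" "\<alpha> \<in> forms A a" "\<beta> \<in> forms A b" for Zs N M \<alpha> \<beta> a b
    using that
  proof (induction Zs arbitrary: N M \<alpha> \<beta> a b)
    case Nil
    then show ?case using mul_0_left[OF homogI[OF V_0]] by (simp add: bounded_form_0 wedge_nil zero_fun_apply[of "[]"])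
  next
    case (Cons Z Zs)
    then obtain z where Z: "Z \<in> VF z" by (auto simp: homog_def)
    note a = Cons.prems(5) and b = Cons.prems(6)
    show ?case
    proof (cases "N = 0 \<or> M = 0")
      case True
      then have "wedge A \<alpha> \<beta> = 0"
        using Cons.prems(3,4) wedge_zero_left[OF b] wedge_zero_right[OF a] by (auto simp: bounded_form_0)
      then show ?thesis by (simp add: zero_fun_apply[of "Z # Zs"])
    next
      case False
      have "wedge A (contract Z \<alpha>) \<beta> Zs = 0"
        by (rule Cons.IH[OF _ _ bounded_contract[OF Cons.prems(3)] Cons.prems(4) contract_mem[OF a Z] b])
          (use Cons.prems(1,2) False in auto)
      moreover have "wedge A \<alpha> (contract Z \<beta>) Zs = 0"
        by (rule Cons.IH[OF _ _ Cons.prems(3) bounded_contract[OF Cons.prems(4)] a contract_mem[OF b Z]])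
          (use Cons.prems(1,2) False in auto)
      ultimately show ?thesis
        unfolding contract_apply[symmetric] wedge_contract[OF Z a b] by (simp add: fun_arith)
    qed
  qed
  then show ?thesis using assms wedge_outside unfolding bounded_form_def[of "N + M"] by blast
qed

lemma wedge_mem:
  assumes a: "\<alpha> \<in> forms A a" and b: "\<beta> \<in> forms A b"
  shows "wedge A \<alpha> \<beta> \<in> forms A (a + b)"
proof -
  have "wedge A \<alpha> \<beta> \<in> forms A (a + b)"
    if "n = N + M" "bounded_form N \<alpha>" "bounded_form M \<beta>" "\<alpha> \<in> forms A a" "\<beta> \<in> forms A b" for n N M \<alpha> \<beta> a b
    using that
  proof (induction n arbitrary: N M \<alpha> \<beta> a b)
    case 0
    then show ?case using wedge_zero_left by (simp add: bounded_form_0)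
  next
    case (Suc n)
    note a = Suc.prems(4) and b = Suc.prems(5)
    show ?case
    proof (cases "N = 0 \<or> M = 0")
      case True
      then have "wedge A \<alpha> \<beta> = 0"
        using Suc.prems(2,3) wedge_zero_left[OF b] wedge_zero_right[OF a] by (auto simp: bounded_form_0)
      then show ?thesis by simp
    next
      case False
      have c1: "wedge A (contract X \<alpha>) \<beta> \<in> forms A (a + b + x - 1)" if "X \<in> VF x" for X x
      proof -
        have "wedge A (contract X \<alpha>) \<beta> \<in> forms A (a + x - 1 + b)"
          by (rule Suc.IH[OF _ bounded_contract[OF Suc.prems(2)] Suc.prems(3) contract_mem[OF a that] b])
            (use Suc.prems(1) False in auto)
        then show ?thesis by (simp add: algebra_simps)
      qed
      have c2: "wedge A \<alpha> (contract X \<beta>) \<in> forms A (a + b + x - 1)" if "X \<in> VF x" for X x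
      proof -
        have "wedge A \<alpha> (contract X \<beta>) \<in> forms A (a + (b + x - 1))"
          by (rule Suc.IH[OF _ Suc.prems(2) bounded_contract[OF Suc.prems(3)] a contract_mem[OF b that]])
            (use Suc.prems(1) False in auto)
        then show ?thesis by (simp add: algebra_simps)
      qed
      show ?thesis
      proof (rule form_intro[OF wedge_bounded[OF Suc.prems(2-5)] wedge_outside])
        show "wedge A \<alpha> \<beta> [] \<in> gcar A (a + b)" unfolding wedge_nil by (rule mul_mem[OF form_nil[OF a] form_nil[OF b]])
        show "contract X (wedge A \<alpha> \<beta>) \<in> forms A (a + b + x - 1)" if X: "X \<in> VF x" for x X
          unfolding wedge_contract[OF X a b] by (intro \<Omega>.V_add \<Omega>.V_scale c1[OF X] c2[OF X])
        show "lin_on (VF x) (\<lambda>X. contract X (wedge A \<alpha> \<beta>))" for x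
        proof (rule lin_on_cong[OF _ subspace_VF])
          show "lin_on (VF x) (\<lambda>X. wedge A (contract X \<alpha>) \<beta> + sgn_pow ((x - 1) * a) *\<^sub>R wedge A \<alpha> (contract X \<beta>))"
            by (intro lin_on_plus lin_on_scaled lin_on_compose[OF contract_lin[OF a] _ wedge_lin_left[OF b], of _ "a + x - 1"]
                lin_on_compose[OF contract_lin[OF b] _ wedge_lin_right[OF a], of _ "b + x - 1"])
              (use contract_mem[OF a] contract_mem[OF b] in auto)
        qed (rule wedge_contract[OF _ a b, symmetric])
        show "contract X (contract Y (wedge A \<alpha> \<beta>)) = sgn_pow ((x - 1) * (y - 1)) *\<^sub>R contract Y (contract X (wedge A \<alpha> \<beta>))"
          if X: "X \<in> VF x" and Y: "Y \<in> VF y" for x y X Y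
        proof -
          note aX = contract_mem[OF a X] and aY = contract_mem[OF a Y] and bX = contract_mem[OF b X] and bY = contract_mem[OF b Y]
          have 1: "wedge A (contract X (contract Y \<alpha>)) \<beta> = sgn_pow ((x - 1) * (y - 1)) *\<^sub>R wedge A (contract Y (contract X \<alpha>)) \<beta>"
            unfolding contract_contract[OF a X Y] by (rule lin_on_scale[OF wedge_lin_left[OF b] contract_mem[OF aX Y]])
          have 2: "wedge A \<alpha> (contract X (contract Y \<beta>)) = sgn_pow ((x - 1) * (y - 1)) *\<^sub>R wedge A \<alpha> (contract Y (contract X \<beta>))"
            unfolding contract_contract[OF b X Y] by (rule lin_on_scale[OF wedge_lin_right[OF a] contract_mem[OF bX Y]])
          show ?thesis
            unfolding wedge_contract[OF X a b] wedge_contract[OF Y a b] contract_arith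
              wedge_contract[OF X aY b] wedge_contract[OF Y aX b] wedge_contract[OF X a bY] wedge_contract[OF Y a bX] 1 2
            by (cases "even x"; cases "even y"; cases "even a"; simp add: sgn_pow_def algebra_simps)
        qed
        show "wedge A \<alpha> \<beta> [vf_scale A f X] = f \<odot> wedge A \<alpha> \<beta> [X]" if f: "f \<in> gcar A l" and X: "X \<in> VF x" for l f x X
        proof -
          have e: "wedge A \<alpha> \<beta> [Y] = \<alpha> [Y] \<odot> \<beta> [] + sgn_pow ((y - 1) * a) *\<^sub>R (\<alpha> [] \<odot> \<beta> [Y])" if "Y \<in> VF y" for Y y
            using fun_cong[OF wedge_contract[OF that a b], of "[]"] by (simp add: contract_apply wedge_nil fun_arith)
          have m: "\<alpha> [X] \<in> gcar A (a + (x - 1))" "\<beta> [X] \<in> gcar A (b + (x - 1))"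
            using form_degree[OF a, of "[X]" "[x]"] form_degree[OF b, of "[X]" "[x]"] X by auto
          note fh = homogI[OF f] and a0 = form_nil[OF a] and b0 = form_nil[OF b]
          have last: "\<alpha> [vf_scale A f X] = f \<odot> \<alpha> [X]" "\<beta> [vf_scale A f X] = f \<odot> \<beta> [X]"
            using form_last[OF a, of "[]" f X] form_last[OF b, of "[]" f X] fh VF.homogI[OF X] by simp_all
          have m1: "\<alpha> [X] \<odot> \<beta> [] \<in> gcar A (a + b + x - 1)" "\<alpha> [] \<odot> \<beta> [X] \<in> gcar A (a + b + x - 1)"
            using mul_mem[OF m(1) b0] mul_mem[OF a0 m(2)] by (simp_all add: algebra_simps)
          have c: "\<alpha> [] \<odot> (f \<odot> \<beta> [X]) = sgn_pow (a * l) *\<^sub>R (f \<odot> (\<alpha> [] \<odot> \<beta> [X]))"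
            using mul_assoc[OF homogI[OF a0] fh homogI[OF m(2)]] mul_assoc[OF fh homogI[OF a0] homogI[OF m(2)]]
              mul_comm[OF a0 f] mul_scale_left[OF homogI[OF mul_mem[OF f a0]] homogI[OF m(2)]] by simp
          have r: "f \<odot> wedge A \<alpha> \<beta> [X] = f \<odot> (\<alpha> [X] \<odot> \<beta> []) + sgn_pow ((x - 1) * a) *\<^sub>R (f \<odot> (\<alpha> [] \<odot> \<beta> [X]))"
            unfolding e[OF X] using mul_add_right[OF fh m1(1) V_scale[OF m1(2)]] mul_scale_right[OF fh homogI[OF m1(2)]] by simp
          show ?thesis
            unfolding r e[OF vf_scale_mem[OF f X]] last c mul_assoc[OF fh homogI[OF m(1)] homogI[OF b0]]
            by (cases "even x"; cases "even l"; cases "even a"; simp add: sgn_pow_def algebra_simps)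
        qed
      qed
    qed
  qed
  then show ?thesis using form_bounded[OF a] form_bounded[OF b] a b by blast
qed

lemma wedge_assoc:
  assumes a: "\<alpha> \<in> forms A a" and b: "\<beta> \<in> forms A b" and c: "\<gamma> \<in> forms A c"
  shows "wedge A (wedge A \<alpha> \<beta>) \<gamma> = wedge A \<alpha> (wedge A \<beta> \<gamma>)"
proof (rule form_eqI)
  fix Zs assume "set Zs \<subseteq> homog VF"
  from this a b c show "wedge A (wedge A \<alpha> \<beta>) \<gamma> Zs = wedge A \<alpha> (wedge A \<beta> \<gamma>) Zs"
  proof (induction Zs arbitrary: \<alpha> \<beta> \<gamma> a b c)
    case Nil
    show ?case
      using mul_assoc[OF homogI[OF form_nil[OF Nil(2)]] homogI[OF form_nil[OF Nil(3)]] homogI[OF form_nil[OF Nil(4)]]]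
      by (simp add: wedge_nil)
  next
    case (Cons Z Zs)
    then obtain z where Z: "Z \<in> VF z" by (auto simp: homog_def)
    note a = Cons.prems(2) and b = Cons.prems(3) and c = Cons.prems(4)
    note aZ = contract_mem[OF a Z] and bZ = contract_mem[OF b Z] and cZ = contract_mem[OF c Z]
    have Zs: "set Zs \<subseteq> homog VF" using Cons.prems(1) by simp
    have m1: "wedge A (contract Z \<alpha>) \<beta> \<in> forms A (a + b + z - 1)" "wedge A \<alpha> (contract Z \<beta>) \<in> forms A (a + b + z - 1)"
      "wedge A (contract Z \<beta>) \<gamma> \<in> forms A (b + c + z - 1)" "wedge A \<beta> (contract Z \<gamma>) \<in> forms A (b + c + z - 1)"
      using wedge_mem[OF aZ b] wedge_mem[OF a bZ] wedge_mem[OF bZ c] wedge_mem[OF b cZ] by (simp_all add: algebra_simps)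
    have e1: "wedge A (wedge A (contract Z \<alpha>) \<beta> + sgn_pow ((z - 1) * a) *\<^sub>R wedge A \<alpha> (contract Z \<beta>)) \<gamma>
      = wedge A (wedge A (contract Z \<alpha>) \<beta>) \<gamma> + sgn_pow ((z - 1) * a) *\<^sub>R wedge A (wedge A \<alpha> (contract Z \<beta>)) \<gamma>"
      using lin_on_add[OF wedge_lin_left[OF c] m1(1) \<Omega>.V_scale[OF m1(2)]] lin_on_scale[OF wedge_lin_left[OF c] m1(2)] by simp
    have e2: "wedge A \<alpha> (wedge A (contract Z \<beta>) \<gamma> + sgn_pow ((z - 1) * b) *\<^sub>R wedge A \<beta> (contract Z \<gamma>))
      = wedge A \<alpha> (wedge A (contract Z \<beta>) \<gamma>) + sgn_pow ((z - 1) * b) *\<^sub>R wedge A \<alpha> (wedge A \<beta> (contract Z \<gamma>))"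
      using lin_on_add[OF wedge_lin_right[OF a] m1(3) \<Omega>.V_scale[OF m1(4)]] lin_on_scale[OF wedge_lin_right[OF a] m1(4)] by simp
    show ?case
      unfolding contract_apply[symmetric]
      unfolding wedge_contract[OF Z wedge_mem[OF a b] c] wedge_contract[OF Z a wedge_mem[OF b c]] wedge_contract[OF Z a b]
        wedge_contract[OF Z b c] e1 e2
      unfolding fun_arith Cons.IH[OF Zs aZ b c] Cons.IH[OF Zs a bZ c] Cons.IH[OF Zs a b cZ]
      by (cases "even a"; cases "even b"; cases "even z"; simp add: sgn_pow_def algebra_simps)
  qed
qed (simp_all add: wedge_outside)

definition one_form :: "'a form"
  where "one_form = (\<lambda>Xs. if Xs = [] then one else 0)"

lemma contract_one_form: "contract X one_form = 0"
  by (rule ext) (simp add: contract_def one_form_def zero_fun_apply)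

lemma one_form_mem: "one_form \<in> forms A 0"
proof (rule form_intro)
  show "bounded_form 1 one_form" by (auto simp: bounded_form_def one_form_def)
  show "one_form [vf_scale A f X] = f \<odot> one_form [X]" if "f \<in> gcar A l" for l f X
    using mul_0_right[OF homogI[OF that(1)]] by (simp add: one_form_def)
  show "one_form [] \<in> gcar A 0" by (simp add: one_form_def one_mem)
  show "one_form Xs = 0" if "\<not> set Xs \<subseteq> homog VF" for Xs using that by (auto simp: one_form_def)
qed (simp_all add: contract_one_form lin_on_const_zero)

lemma one_form_left:
  assumes b: "\<beta> \<in> forms A b"
  shows "wedge A one_form \<beta> = \<beta>"
proof (rule form_eqI)
  fix Zs assume "set Zs \<subseteq> homog VF"
  from this b show "wedge A one_form \<beta> Zs = \<beta> Zs"
  proof (induction Zs arbitrary: \<beta> b)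
    case Nil
    then show ?case using one_left[OF homogI[OF form_nil]] by (simp add: wedge_nil one_form_def)
  next
    case (Cons Z Zs)
    then obtain z where Z: "Z \<in> VF z" by (auto simp: homog_def)
    note b = Cons.prems(2)
    have "wedge A one_form \<beta> (Z # Zs) = contract Z (wedge A one_form \<beta>) Zs" by (simp add: contract_apply)
    also have "contract Z (wedge A one_form \<beta>) = wedge A one_form (contract Z \<beta>)"
      unfolding wedge_contract[OF Z one_form_mem b] contract_one_form wedge_zero_left[OF b] by simp
    also have "wedge A one_form (contract Z \<beta>) Zs = contract Z \<beta> Zs"
      using Cons.IH[OF _ contract_mem[OF b Z]] Cons.prems(1) by simp
    finally show ?case by (simp add: contract_apply)
  qed
qed (simp_all add: wedge_outside form_outside[OF b])

definition forms_alg :: "'a form graded_alg"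
  where "forms_alg = \<lparr>gcar = forms A, gmul = wedge A, gone = one_form\<rparr>"

lemma forms_alg_simps [simp]:
  "gcar forms_alg = forms A" "gmul forms_alg = wedge A" "gone forms_alg = one_form"
  by (simp_all add: forms_alg_def)

theorem graded_comm_alg_forms: "graded_comm_alg m forms_alg"
  unfolding graded_comm_alg_def forms_alg_simps
proof (intro conjI allI ballI)
  show "graded_space m (forms A)" by (rule graded_space_forms)
  show "one_form \<in> forms A 0" by (rule one_form_mem)
qed (auto simp: homog_def intro: wedge_mem wedge_commute wedge_lin_right wedge_assoc one_form_left)

lemma lie_wedge:
  assumes X: "X \<in> VF x" and a: "\<alpha> \<in> forms A a" and b: "\<beta> \<in> forms A b"
  shows "lie_deriv X (wedge A \<alpha> \<beta>) = wedge A (lie_deriv X \<alpha>) \<beta> + sgn_pow (x * a) *\<^sub>R wedge A \<alpha> (lie_deriv X \<beta>)"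
proof (rule form_eqI)
  fix Zs assume "set Zs \<subseteq> homog VF"
  from this a b show "lie_deriv X (wedge A \<alpha> \<beta>) Zs = (wedge A (lie_deriv X \<alpha>) \<beta> + sgn_pow (x * a) *\<^sub>R wedge A \<alpha> (lie_deriv X \<beta>)) Zs"
  proof (induction Zs arbitrary: \<alpha> \<beta> a b)
    case Nil
    then show ?case using vf_leibniz[OF X form_nil homogI[OF form_nil]] by (simp add: wedge_nil lie_nil fun_arith)
  next
    case (Cons Z Zs)
    then obtain z where Z: "Z \<in> VF z" by (auto simp: homog_def)
    note a = Cons.prems(2) and b = Cons.prems(3)
    note aZ = contract_mem[OF a Z] and bZ = contract_mem[OF b Z] and XZ = vf_bracket_mem[OF X Z]
    note La = lie_mem[OF X a] and Lb = lie_mem[OF X b] and ab = wedge_mem[OF a b]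
    have Zs: "set Zs \<subseteq> homog VF" using Cons.prems(1) by simp
    have m: "wedge A (contract Z \<alpha>) \<beta> \<in> forms A (a + b + z - 1)" "wedge A \<alpha> (contract Z \<beta>) \<in> forms A (a + b + z - 1)"
      using wedge_mem[OF aZ b] wedge_mem[OF a bZ] by (simp_all add: algebra_simps)
    have e1: "lie_deriv X (wedge A (contract Z \<alpha>) \<beta> + sgn_pow ((z - 1) * a) *\<^sub>R wedge A \<alpha> (contract Z \<beta>))
      = lie_deriv X (wedge A (contract Z \<alpha>) \<beta>) + sgn_pow ((z - 1) * a) *\<^sub>R lie_deriv X (wedge A \<alpha> (contract Z \<beta>))"
      using lin_on_add[OF lie_lin[OF X] m(1) \<Omega>.V_scale[OF m(2)]] lin_on_scale[OF lie_lin[OF X] m(2)] by simp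
    have m2: "lie_deriv X (contract Z \<alpha>) \<in> forms A (a + x + z - 1)" "contract (bracket X Z) \<alpha> \<in> forms A (a + x + z - 1)"
      "lie_deriv X (contract Z \<beta>) \<in> forms A (b + x + z - 1)" "contract (bracket X Z) \<beta> \<in> forms A (b + x + z - 1)"
      using lie_mem[OF X aZ] lie_mem[OF X bZ] contract_mem[OF a XZ] contract_mem[OF b XZ] by (simp_all add: algebra_simps)
    have e2: "wedge A (c *\<^sub>R (lie_deriv X (contract Z \<alpha>) - contract (bracket X Z) \<alpha>)) \<beta>
      = c *\<^sub>R (wedge A (lie_deriv X (contract Z \<alpha>)) \<beta> - wedge A (contract (bracket X Z) \<alpha>) \<beta>)" for c
      using lin_on_scale[OF wedge_lin_left[OF b] \<Omega>.V_diff[OF m2(1,2)]] lin_on_diff[OF wedge_lin_left[OF b] subspace_forms m2(1,2)] by simp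
    have e3: "wedge A \<alpha> (c *\<^sub>R (lie_deriv X (contract Z \<beta>) - contract (bracket X Z) \<beta>))
      = c *\<^sub>R (wedge A \<alpha> (lie_deriv X (contract Z \<beta>)) - wedge A \<alpha> (contract (bracket X Z) \<beta>))" for c
      using lin_on_scale[OF wedge_lin_right[OF a] \<Omega>.V_diff[OF m2(3,4)]] lin_on_diff[OF wedge_lin_right[OF a] subspace_forms m2(3,4)] by simp
    have I1: "lie_deriv X (wedge A (contract Z \<alpha>) \<beta>) Zs = wedge A (lie_deriv X (contract Z \<alpha>)) \<beta> Zs
        + sgn_pow (x * (a + z - 1)) *\<^sub>R wedge A (contract Z \<alpha>) (lie_deriv X \<beta>) Zs"
      using Cons.IH[OF Zs aZ b] by (simp add: fun_arith)
    have I2: "lie_deriv X (wedge A \<alpha> (contract Z \<beta>)) Zs = wedge A (lie_deriv X \<alpha>) (contract Z \<beta>) Zs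
        + sgn_pow (x * a) *\<^sub>R wedge A \<alpha> (lie_deriv X (contract Z \<beta>)) Zs"
      using Cons.IH[OF Zs a bZ] by (simp add: fun_arith)
    show ?case
      unfolding contract_apply[symmetric]
      unfolding contract_arith
      unfolding lie_contract[OF X Z ab] wedge_contract[OF Z La b] wedge_contract[OF Z a Lb] wedge_contract[OF Z a b] e1
        wedge_contract[OF XZ a b] lie_contract[OF X Z a] lie_contract[OF X Z b] e2 e3
      unfolding fun_arith I1 I2
      by (cases "even a"; cases "even x"; cases "even z"; simp add: sgn_pow_def algebra_simps)
  qed
qed (simp_all add: lie_outside wedge_outside fun_arith)

lemma d_wedge:
  assumes a: "\<alpha> \<in> forms A a" and b: "\<beta> \<in> forms A b"
  shows "d (wedge A \<alpha> \<beta>) = wedge A (d \<alpha>) \<beta> + sgn_pow a *\<^sub>R wedge A \<alpha> (d \<beta>)"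
proof (rule form_eqI)
  fix Zs assume "set Zs \<subseteq> homog VF"
  from this a b show "d (wedge A \<alpha> \<beta>) Zs = (wedge A (d \<alpha>) \<beta> + sgn_pow a *\<^sub>R wedge A \<alpha> (d \<beta>)) Zs"
  proof (induction Zs arbitrary: \<alpha> \<beta> a b)
    case Nil
    then show ?case using mul_0_left[OF homogI[OF form_nil]] mul_0_right[OF homogI[OF form_nil]]
      by (simp add: wedge_nil d_nil fun_arith)
  next
    case (Cons Z Zs)
    then obtain z where Z: "Z \<in> VF z" by (auto simp: homog_def)
    note a = Cons.prems(2) and b = Cons.prems(3)
    note aZ = contract_mem[OF a Z] and bZ = contract_mem[OF b Z]
    note da = d_mem[OF a] and db = d_mem[OF b] and ab = wedge_mem[OF a b]
    have Zs: "set Zs \<subseteq> homog VF" using Cons.prems(1) by simp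
    have m: "wedge A (contract Z \<alpha>) \<beta> \<in> forms A (a + b + z - 1)" "wedge A \<alpha> (contract Z \<beta>) \<in> forms A (a + b + z - 1)"
      using wedge_mem[OF aZ b] wedge_mem[OF a bZ] by (simp_all add: algebra_simps)
    have e1: "d (wedge A (contract Z \<alpha>) \<beta> + sgn_pow ((z - 1) * a) *\<^sub>R wedge A \<alpha> (contract Z \<beta>))
      = d (wedge A (contract Z \<alpha>) \<beta>) + sgn_pow ((z - 1) * a) *\<^sub>R d (wedge A \<alpha> (contract Z \<beta>))"
      using lin_on_add[OF d_lin m(1) \<Omega>.V_scale[OF m(2)]] lin_on_scale[OF d_lin m(2)] by simp
    have m2: "d (contract Z \<alpha>) \<in> forms A (a + z)" "d (contract Z \<beta>) \<in> forms A (b + z)"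
      using d_mem[OF aZ] d_mem[OF bZ] by simp_all
    have e2: "wedge A (lie_deriv Z \<alpha> + c *\<^sub>R d (contract Z \<alpha>)) \<beta> = wedge A (lie_deriv Z \<alpha>) \<beta> + c *\<^sub>R wedge A (d (contract Z \<alpha>)) \<beta>" for c
      using lin_on_add[OF wedge_lin_left[OF b] lie_mem[OF Z a] \<Omega>.V_scale[OF m2(1)]] lin_on_scale[OF wedge_lin_left[OF b] m2(1)] by simp
    have e3: "wedge A \<alpha> (lie_deriv Z \<beta> + c *\<^sub>R d (contract Z \<beta>)) = wedge A \<alpha> (lie_deriv Z \<beta>) + c *\<^sub>R wedge A \<alpha> (d (contract Z \<beta>))" for c
      using lin_on_add[OF wedge_lin_right[OF a] lie_mem[OF Z b] \<Omega>.V_scale[OF m2(2)]] lin_on_scale[OF wedge_lin_right[OF a] m2(2)] by simp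
    have I1: "d (wedge A (contract Z \<alpha>) \<beta>) Zs = wedge A (d (contract Z \<alpha>)) \<beta> Zs
        + sgn_pow (a + z - 1) *\<^sub>R wedge A (contract Z \<alpha>) (d \<beta>) Zs"
      using Cons.IH[OF Zs aZ b] by (simp add: fun_arith)
    have I2: "d (wedge A \<alpha> (contract Z \<beta>)) Zs = wedge A (d \<alpha>) (contract Z \<beta>) Zs
        + sgn_pow a *\<^sub>R wedge A \<alpha> (d (contract Z \<beta>)) Zs"
      using Cons.IH[OF Zs a bZ] by (simp add: fun_arith)
    show ?case
      unfolding contract_apply[symmetric]
      unfolding contract_arith
      unfolding d_contract[OF Z ab] lie_wedge[OF Z a b] wedge_contract[OF Z da b] wedge_contract[OF Z a db] wedge_contract[OF Z a b] e1
        d_contract[OF Z a] d_contract[OF Z b] e2 e3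
      unfolding fun_arith I1 I2
      by (cases "even a"; cases "even z"; simp add: sgn_pow_def algebra_simps)
  qed
qed (simp_all add: d_outside wedge_outside fun_arith)

end

context gca begin

subsection \<open>Interior products\<close>

abbreviation pdeg :: "int list \<Rightarrow> int"
  where "pdeg js \<equiv> (\<Sum>j\<leftarrow>js. j - 1)"

abbreviation ins :: "('a \<Rightarrow> 'a) list \<Rightarrow> 'a form \<Rightarrow> 'a form"
  where "ins \<equiv> foldr contract"

lemma ins_add: "ins Xs (\<alpha> + \<beta>) = ins Xs \<alpha> + ins Xs \<beta>"
  by (induction Xs) auto

lemma ins_diff: "ins Xs (\<alpha> - \<beta>) = ins Xs \<alpha> - ins Xs \<beta>"
  by (induction Xs) auto

lemma ins_scale: "ins Xs (c *\<^sub>R \<alpha>) = c *\<^sub>R ins Xs \<alpha>"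
  by (induction Xs) auto

lemma ins_zero: "ins Xs 0 = 0"
  using ins_scale[of Xs 0 0] by simp

lemma ins_mem: "VF.homs Xs js \<Longrightarrow> \<omega> \<in> forms A k \<Longrightarrow> ins Xs \<omega> \<in> forms A (k + pdeg js)"
  unfolding VF.homs_def
proof (induction Xs js rule: list_all2_induct)
  case (Cons X Xs j js)
  then show ?case using contract_mem[of "ins Xs \<omega>" "k + pdeg js" X j] by (simp add: algebra_simps)
qed simp

lemma ins_sum: "ins Xs (\<Sum>i\<in>I. F i) = (\<Sum>i\<in>I. ins Xs (F i))"
  by (induction I rule: infinite_finite_induct) (simp_all add: ins_zero ins_add)

lemma ins_lin: "lin_on S (ins Xs)"
  by (simp add: lin_on_def ins_add ins_scale)

lemma ins_hom_op: "VF.homs Xs js \<Longrightarrow> hom_op (forms A) (pdeg js) (ins Xs)"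
  by (auto simp: hom_op_def ins_mem ins_lin)

lemma contract_ins:
  assumes "X \<in> VF x" "VF.homs Ys ys" "\<omega> \<in> forms A k"
  shows "contract X (ins Ys \<omega>) = sgn_pow ((x - 1) * pdeg ys) *\<^sub>R ins Ys (contract X \<omega>)"
  using assms(2) unfolding VF.homs_def
proof (induction Ys ys rule: list_all2_induct)
  case (Cons Y Ys y ys)
  have Ys: "VF.homs Ys ys" using Cons by (simp add: VF.homs_def)
  have "contract X (ins (Y # Ys) \<omega>) = sgn_pow ((x - 1) * (y - 1)) *\<^sub>R contract Y (contract X (ins Ys \<omega>))"
    using contract_contract[OF ins_mem[OF Ys assms(3)] assms(1) Cons(1)] by simp
  also have "\<dots> = (sgn_pow ((x - 1) * (y - 1)) * sgn_pow ((x - 1) * pdeg ys)) *\<^sub>R ins (Y # Ys) (contract X \<omega>)"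
    unfolding Cons.IH by simp
  also have "sgn_pow ((x - 1) * (y - 1)) * sgn_pow ((x - 1) * pdeg ys) = sgn_pow ((x - 1) * pdeg (y # ys))"
    unfolding sgn_pow_add[symmetric] by (simp add: algebra_simps)
  finally show ?case .
qed simp

lemma ins_ins:
  assumes "VF.homs Xs xs" "VF.homs Ys ys" "\<omega> \<in> forms A k"
  shows "ins Xs (ins Ys \<omega>) = sgn_pow (pdeg xs * pdeg ys) *\<^sub>R ins Ys (ins Xs \<omega>)"
  using assms(1) unfolding VF.homs_def
proof (induction Xs xs rule: list_all2_induct)
  case (Cons X Xs x xs)
  have Xs: "VF.homs Xs xs" using Cons by (simp add: VF.homs_def)
  have "ins (X # Xs) (ins Ys \<omega>) = sgn_pow (pdeg xs * pdeg ys) *\<^sub>R contract X (ins Ys (ins Xs \<omega>))"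
    by (simp add: Cons.IH)
  also have "\<dots> = (sgn_pow (pdeg xs * pdeg ys) * sgn_pow ((x - 1) * pdeg ys)) *\<^sub>R ins Ys (ins (X # Xs) \<omega>)"
    unfolding contract_ins[OF Cons(1) assms(2) ins_mem[OF Xs assms(3)]] by simp
  also have "sgn_pow (pdeg xs * pdeg ys) * sgn_pow ((x - 1) * pdeg ys) = sgn_pow (pdeg (x # xs) * pdeg ys)"
    unfolding sgn_pow_add[symmetric] by (simp add: algebra_simps)
  finally show ?case .
qed simp

lemma ins_zero_field: 
  assumes "VF.homs Xs js" "0 \<in> set Xs" "\<omega> \<in> forms A k"
  shows "ins Xs \<omega> = 0"
  using assms(1,2) unfolding VF.homs_def
proof (induction Xs js rule: list_all2_induct)
  case (Cons X Xs j js)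
  show ?case
  proof (cases "X = 0")
    case True
    have "VF.homs Xs js" using Cons by (simp add: VF.homs_def)
    then show ?thesis using contract_0[OF ins_mem[OF _ assms(3)]] True by simp
  qed (use Cons in simp)
qed simp

text \<open>Forms are linear over functions in the last argument by definition. For the first argument, \<open>X\<close> is
  moved past the others by graded symmetry.\<close>

lemma contract_scale:
  assumes f: "f \<in> gcar A l" and X: "X \<in> VF x" and w: "\<omega> \<in> forms A k" and Z: "VF.homs Zs zs"
  shows "contract (vf_scale A f X) \<omega> Zs = sgn_pow (l * pdeg zs) *\<^sub>R (f \<odot> contract X \<omega> Zs)"
  using Z w unfolding VF.homs_def
proof (induction Zs zs arbitrary: \<omega> k rule: list_all2_induct)
  case Nil
  then show ?case
    using form_last[of \<omega> k "[]" f X] homogI[OF f] VF.homogI[OF X] by (simp add: contract_apply)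
next
  case (Cons Z Zs z zs)
  note Z = Cons(1) and w = Cons.prems
  note wZ = contract_mem[OF w Z]
  have Zs: "VF.homs Zs zs" using Cons by (simp add: VF.homs_def)
  have "contract X (contract Z \<omega>) Zs \<in> gcar A (k + z - 1 + x - 1 + pdeg zs)"
    by (rule form_degree[OF contract_mem[OF wZ X]]) (use Zs in \<open>simp add: VF.homs_def\<close>)
  then have h: "contract Z (contract X \<omega>) Zs \<in> \<H>"
    unfolding contract_contract[OF w Z X] by (auto simp: fun_arith intro!: homogI V_scale)
  have "contract (vf_scale A f X) \<omega> (Z # Zs) = contract Z (contract (vf_scale A f X) \<omega>) Zs"
    by (simp add: contract_apply)
  also have "\<dots> = sgn_pow ((z - 1) * (l + x - 1)) *\<^sub>R contract (vf_scale A f X) (contract Z \<omega>) Zs"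
    unfolding contract_contract[OF w Z vf_scale_mem[OF f X]] by (simp add: fun_arith)
  also have "contract (vf_scale A f X) (contract Z \<omega>) Zs = sgn_pow (l * pdeg zs) *\<^sub>R (f \<odot> contract X (contract Z \<omega>) Zs)"
    by (rule Cons.IH[OF wZ])
  also have "f \<odot> contract X (contract Z \<omega>) Zs = sgn_pow ((x - 1) * (z - 1)) *\<^sub>R (f \<odot> contract X \<omega> (Z # Zs))"
    unfolding contract_contract[OF w X Z] scaleR_fun_apply mul_scale_right[OF homogI[OF f] h] by (simp add: contract_apply)
  finally show ?case
    by (cases "even x"; cases "even z"; cases "even l"; cases "even (pdeg zs)"; simp add: sgn_pow_def)
qed

lemma contract_balance:
  assumes f: "f \<in> gcar A l" and X: "X \<in> VF x" and Y: "Y \<in> VF y" and w: "\<omega> \<in> forms A k"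
  shows "contract X (contract (vf_scale A f Y) \<omega>) = sgn_pow ((x - 1) * l) *\<^sub>R contract (vf_scale A f X) (contract Y \<omega>)"
proof (rule form_eqI)
  fix Zs assume "set Zs \<subseteq> homog VF"
  then obtain zs where Zs: "VF.homs Zs zs" using VF.homs_ex by blast
  then have XZs: "VF.homs (X # Zs) (x # zs)" using X by (simp add: VF.homs_def)
  have "contract X (contract (vf_scale A f Y) \<omega>) Zs = contract (vf_scale A f Y) \<omega> (X # Zs)"
    by (simp add: contract_apply)
  also have "\<dots> = sgn_pow (l * pdeg (x # zs)) *\<^sub>R (f \<odot> contract Y \<omega> (X # Zs))"
    by (rule contract_scale[OF f Y w XZs])
  finally show "contract X (contract (vf_scale A f Y) \<omega>) Zs
      = (sgn_pow ((x - 1) * l) *\<^sub>R contract (vf_scale A f X) (contract Y \<omega>)) Zs"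
    unfolding scaleR_fun_apply contract_scale[OF f X contract_mem[OF w Y] Zs]
    by (cases "even l"; cases "even x"; cases "even (pdeg zs)"; simp add: contract_apply sgn_pow_def)
next
  fix Zs assume "\<not> set Zs \<subseteq> homog VF"
  then show "contract X (contract (vf_scale A f Y) \<omega>) Zs = 0"
    "(sgn_pow ((x - 1) * l) *\<^sub>R contract (vf_scale A f X) (contract Y \<omega>)) Zs = 0"
    using form_outside[OF w] by (simp_all add: contract_apply fun_arith)
qed

abbreviation ip :: "'a polyvector \<Rightarrow> 'a form \<Rightarrow> 'a form"
  where "ip \<equiv> interior_product"

lemma linear_interior: "linear (\<lambda>P. ip P \<omega>)"
  unfolding interior_product_def by (rule linear_linext)

lemma interior_basis: "ip (basis_elt Xs) = (ins Xs)"
  by (rule ext) (simp add: interior_product_def)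

lemma interior_add: "ip (P + Q) \<omega> = ip P \<omega> + ip Q \<omega>"
  using linear_add[OF linear_interior] .

lemma interior_diff: "ip (P - Q) \<omega> = ip P \<omega> - ip Q \<omega>"
  using linear_diff[OF linear_interior] .

lemma interior_scale: "ip (c *\<^sub>R P) \<omega> = c *\<^sub>R ip P \<omega>"
  using linear_scale[OF linear_interior] .

lemma interior_zero: "ip 0 \<omega> = 0"
  using linear_0[OF linear_interior] .

lemma polyvector_induct [consumes 1, case_names zero step]:
  assumes "P \<in> polyvectors A r e" and "\<Phi> 0"
    and "\<And>c Xs js Q. VF.homs Xs js \<Longrightarrow> length Xs = r \<Longrightarrow> pdeg js = e \<Longrightarrow> Q \<in> polyvectors A r e \<Longrightarrow> \<Phi> Q \<Longrightarrow>
      \<Phi> (c *\<^sub>R basis_elt Xs + Q)"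
  shows "\<Phi> P"
proof -
  have "P \<in> polyvectors A r e \<and> \<Phi> P"
    using assms(1) unfolding polyvectors_def
  proof (induction rule: span_induct_alt)
    case base
    then show ?case using assms(2) by (simp add: span_zero)
  next
    case (step c x y)
    from step(1) obtain Xs js where x: "x = basis_elt Xs" "VF.homs Xs js" "length Xs = r" "pdeg js = e"
      unfolding VF.homs_def by blast
    have "c *\<^sub>R x + y \<in> polyvectors A r e"
      unfolding polyvectors_def
      by (rule span_add[OF span_scale[OF span_base[OF step(1)]]]) (use step(2) in blast)
    moreover have "\<Phi> (c *\<^sub>R x + y)"
      unfolding x(1) by (rule assms(3)[OF x(2-4)]) (use step(2) in \<open>auto simp: polyvectors_def\<close>)
    ultimately show ?case unfolding polyvectors_def by blast
  qed
  then show ?thesis ..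
qed

lemma interior_step: "ip (c *\<^sub>R basis_elt Xs + Q) = (\<lambda>\<omega>. c *\<^sub>R ins Xs \<omega> + ip Q \<omega>)"
  by (rule ext) (simp add: interior_add interior_scale interior_basis)

lemma interior_lin: "lin_on S (ip P)"
proof -
  have "ip P = (\<lambda>\<omega>. linext (\<lambda>Xs. ins Xs \<omega>) P)" by (rule ext) (simp add: interior_product_def)
  then show ?thesis
    by (simp add: lin_on_def ins_add ins_scale linext_fun_add linext_fun_scale)
qed

lemma interior_mem: "P \<in> polyvectors A r e \<Longrightarrow> \<omega> \<in> forms A k \<Longrightarrow> ip P \<omega> \<in> forms A (k + e)"
proof (induction rule: polyvector_induct)
  case (step c Xs js Q)
  then show ?case using ins_mem[OF step(1,6)] by (simp add: interior_step \<Omega>.V_add \<Omega>.V_scale)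
qed (simp add: interior_zero)

lemma interior_hom_op: "P \<in> polyvectors A r e \<Longrightarrow> hom_op (forms A) e (ip P)"
  by (auto simp: hom_op_def interior_mem interior_lin)

text \<open>Polyvectors that vanish in the graded symmetric algebra over the functions act by zero, since
  contractions are linear, commute in the graded sense and satisfy \<open>contract_balance\<close>.\<close>

lemma interior_null:
  assumes "P \<in> polyvector_null A" "\<omega> \<in> forms A k"
  shows "ip P \<omega> = 0"
proof -
  have "ip R \<omega> = 0" if "R \<in> polyvector_relators A" for R
    using that
  proof cases
    case (add Us Vs X j Y)
    obtain vs where "VF.homs Vs vs" using VF.homs_ex add(3) by blast
    note \<eta> = ins_mem[OF this assms(2)]
    have "contract (X + Y) (ins Vs \<omega>) = contract X (ins Vs \<omega>) + contract Y (ins Vs \<omega>)"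
      by (rule lin_on_add[OF contract_lin[OF \<eta>] add(4,5)])
    then show ?thesis by (simp add: add(1) interior_diff interior_basis ins_add)
  next
    case (scale Us Vs X j c)
    obtain vs where "VF.homs Vs vs" using VF.homs_ex scale(3) by blast
    note \<eta> = ins_mem[OF this assms(2)]
    have "contract (c *\<^sub>R X) (ins Vs \<omega>) = c *\<^sub>R contract X (ins Vs \<omega>)"
      by (rule lin_on_scale[OF contract_lin[OF \<eta>] scale(4)])
    then show ?thesis by (simp add: scale(1) interior_diff interior_scale interior_basis ins_scale)
  next
    case (commute Us Vs X i Y j)
    obtain vs where "VF.homs Vs vs" using VF.homs_ex commute(3) by blast
    from contract_contract[OF ins_mem[OF this assms(2)] commute(4,5)]
    show ?thesis by (simp add: commute(1) interior_diff interior_scale interior_basis ins_scale)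
  next
    case (balance Us Vs X i Y f l)
    obtain vs where "VF.homs Vs vs" using VF.homs_ex balance(3) by blast
    moreover obtain y where "Y \<in> VF y" using balance(5) by (auto simp: homog_def)
    ultimately have "contract X (contract (vf_scale A f Y) (ins Vs \<omega>)) =
        sgn_pow ((i - 1) * l) *\<^sub>R contract (vf_scale A f X) (contract Y (ins Vs \<omega>))"
      using contract_balance[OF balance(6,4)] ins_mem[OF _ assms(2)] by blast
    then show ?thesis by (simp add: balance(1) interior_diff interior_scale interior_basis ins_scale)
  qed
  then have "polyvector_null A \<subseteq> {R. ip R \<omega> = 0}"
    unfolding polyvector_null_def
    by (intro span_minimal) (auto simp: subspace_def interior_zero interior_add interior_scale)
  then show ?thesis using assms(1) by blast
qed

lemma gca_forms: "gca m forms_alg"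
  by unfold_locales (rule graded_comm_alg_forms, rule even_m')

lemma contract_derivation: "X \<in> VF x \<Longrightarrow> gca.derivation forms_alg (x - 1) (contract X)"
proof -
  interpret F: gca m forms_alg by (rule gca_forms)
  assume X: "X \<in> VF x"
  have "contract X \<omega> \<in> forms A (k + (x - 1))" if "\<omega> \<in> forms A k" for \<omega> k
    using contract_mem[OF that X] by (simp add: algebra_simps)
  then show ?thesis
    using wedge_contract[OF X] by (auto simp: F.derivation_def hom_op_def lin_on_def homog_def)
qed

text \<open>A composition of \<open>r\<close> contractions is a composition of \<open>r\<close> derivations, hence of order at most \<open>r\<close>.\<close>

lemma ins_diffop: "VF.homs Xs js \<Longrightarrow> gca.diffop forms_alg (Suc (length Xs)) (pdeg js) (ins Xs)"
  unfolding VF.homs_def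
proof (induction Xs js rule: list_all2_induct)
  interpret F: gca m forms_alg by (rule gca_forms)
  case Nil
  show ?case by (simp add: F.mult_bracket_def sgn_pow_def)
next
  interpret F: gca m forms_alg by (rule gca_forms)
  case (Cons X Xs j js)
  have "VF.homs Xs js" using Cons by (simp add: VF.homs_def)
  from F.diffop_derivation_compose[OF contract_derivation[OF Cons(1)] Cons(3)] ins_hom_op[OF this]
  show ?case by (simp add: comp_def)
qed

lemma interior_diffop:
  "P \<in> polyvectors A r e \<Longrightarrow> gca.diffop forms_alg (Suc r) e (ip P)"
proof (induction rule: polyvector_induct)
  interpret F: gca m forms_alg by (rule gca_forms)
  case zero
  show ?case using F.diffop_zero by (rule F.diffop_cong) (simp add: interior_zero)
next
  interpret F: gca m forms_alg by (rule gca_forms)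
  case (step c Xs js Q)
  have h: "hom_op (gcar forms_alg) e (ins Xs)" "hom_op (gcar forms_alg) e (ip Q)"
    using ins_hom_op[OF step(1)] interior_hom_op[OF step(4)] step(3) by simp_all
  show ?case
    unfolding interior_step using ins_diffop[OF step(1)] step(2,3) h
    by (intro F.diffop_add F.diffop_scale F.hom_op_scale step(5)) auto
qed

lemma interior_one: "P \<in> polyvectors A (Suc r) e \<Longrightarrow> ip P one_form = 0"
proof (induction rule: polyvector_induct)
  case (step c Xs js Q)
  have "ins Xs one_form = 0" if "Xs \<noteq> []" for Xs :: "('a \<Rightarrow> 'a) list"
    using that
  proof (induction Xs)
    case (Cons X Xs)
    then show ?case by (cases "Xs = []") (simp_all add: contract_one_form)
  qed simp
  then have "ins Xs one_form = 0" using step(2) by (metis length_0_conv nat.distinct(1))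
  then show ?case using step by (simp add: interior_step)
qed (simp add: interior_zero)

lemma interior_commute:
  assumes P: "P \<in> polyvectors A r e" and Q: "Q \<in> polyvectors A s f" and e: "even e" and w: "\<omega> \<in> forms A k"
  shows "ip P (ip Q \<omega>) = ip Q (ip P \<omega>)"
  using P
proof (induction rule: polyvector_induct)
  case zero
  then show ?case using lin_on_zero[OF interior_lin] \<Omega>.V_0 by (auto simp: interior_zero)
next
  case (step c Xs js P)
  note Xs = step(1) and js = step(3)
  have 1: "ins Xs (ip Q \<omega>) = ip Q (ins Xs \<omega>)"
    using Q
  proof (induction rule: polyvector_induct)
    case zero
    then show ?case by (simp add: interior_zero ins_zero)
  next
    case (step c' Ys ys Q)
    have "ins Xs (ins Ys \<omega>) = ins Ys (ins Xs \<omega>)"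
      using ins_ins[OF Xs step(1) w] e js by (simp add: sgn_pow_def)
    then show ?case using step by (simp add: interior_step ins_add ins_scale)
  qed
  show ?case
    using step(5) 1 interior_lin[of UNIV Q] by (simp add: interior_step lin_on_def)
qed

subsection \<open>The Schouten bracket as a double commutator\<close>

abbreviation vdegs :: "('a \<Rightarrow> 'a) list \<Rightarrow> int"
  where "vdegs Xs \<equiv> (\<Sum>X\<leftarrow>Xs. vdeg A X - 1)"

lemma vdeg_mem: "X \<in> homog VF \<Longrightarrow> X \<in> VF (vdeg A X)"
  unfolding homog_def gdeg_def by (auto intro: someI)

lemma homs_vdegs: "set Xs \<subseteq> homog VF \<Longrightarrow> VF.homs Xs (map (vdeg A) Xs)"
  by (auto simp: VF.homs_def list_all2_conv_all_nth intro!: vdeg_mem)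

lemma ins_mem_vdegs: "set Xs \<subseteq> homog VF \<Longrightarrow> \<omega> \<in> forms A k \<Longrightarrow> ins Xs \<omega> \<in> forms A (k + vdegs Xs)"
  using ins_mem[OF homs_vdegs] by (simp add: comp_def)

text \<open>The graded derivation rule for \<open>[L X, \<iota> Y] = \<iota> [X, Y]\<close>.\<close>

lemma lie_ins:
  assumes X: "X \<in> homog VF" and w: "\<omega> \<in> forms A k" and "set Ys \<subseteq> homog VF"
  shows "lie_deriv X (ins Ys \<omega>) = sgn_pow (vdeg A X * vdegs Ys) *\<^sub>R ins Ys (lie_deriv X \<omega>) +
    (\<Sum>j<length Ys. sgn_pow (vdeg A X * vdegs (take j Ys)) *\<^sub>R
      ins (take j Ys @ [bracket X (Ys ! j)] @ drop (Suc j) Ys) \<omega>)"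
  using assms(3)
proof (induction Ys)
  case Nil
  then show ?case by (simp add: sgn_pow_def)
next
  case (Cons Y Ys)
  define x y where "x = vdeg A X" and "y = vdeg A Y"
  have X': "X \<in> VF x" and Y: "Y \<in> VF y" using vdeg_mem X Cons.prems by (auto simp: x_def y_def)
  have m: "ins Ys \<omega> \<in> forms A (k + vdegs Ys)" using Cons.prems ins_mem_vdegs[OF _ w] by simp
  have L: "lie_deriv X (ins (Y # Ys) \<omega>) = contract (bracket X Y) (ins Ys \<omega>)
      + sgn_pow (x * (y - 1)) *\<^sub>R contract Y (lie_deriv X (ins Ys \<omega>))"
    unfolding lie_contract[OF X' Y m] by (simp add: sgn_pow_scaleR_twice)
  have sg: "sgn_pow (vdeg A X * vdeg A Y - vdeg A X) * sgn_pow (vdeg A X * s)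
      = sgn_pow (vdeg A X * vdeg A Y + vdeg A X * s - vdeg A X)" for s
    unfolding sgn_pow_add[symmetric] by (simp add: algebra_simps)
  show ?case
    using L Cons unfolding length_Cons sum.lessThan_Suc_shift
    by (simp add: ins_sum[of "[Y]", simplified] scaleR_sum_right x_def y_def algebra_simps comp_def sg)
qed

text \<open>The graded commutator of \<open>\<iota> X\<^sub>1 \<circ> \<cdots> \<circ> \<iota> X\<^sub>r\<close> with \<open>d\<close>.\<close>

definition d_comm :: "('a \<Rightarrow> 'a) list \<Rightarrow> 'a form \<Rightarrow> 'a form"
  where "d_comm Xs \<omega> = ins Xs (d \<omega>) - sgn_pow (vdegs Xs) *\<^sub>R d (ins Xs \<omega>)"

lemma d_comm_Cons:
  assumes X: "X \<in> homog VF" and Xs: "set Xs \<subseteq> homog VF" and w: "\<omega> \<in> forms A k"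
  shows "d_comm (X # Xs) \<omega> = contract X (d_comm Xs \<omega>) + sgn_pow (vdegs Xs) *\<^sub>R lie_deriv X (ins Xs \<omega>)"
proof -
  have "contract X (d (ins Xs \<omega>)) = lie_deriv X (ins Xs \<omega>) + sgn_pow (vdeg A X - 1) *\<^sub>R d (ins (X # Xs) \<omega>)"
    using d_contract[OF vdeg_mem[OF X] ins_mem_vdegs[OF Xs w]] by simp
  then show ?thesis
    by (cases "even (vdeg A X)"; cases "even (vdegs Xs)"; simp add: d_comm_def sgn_pow_def)
qed

text \<open>By \<open>d_comm_Cons\<close> a further field \<open>X\<close> in front adds a Lie derivative along \<open>X\<close> to the commutator with
  \<open>d\<close>. The commutator of that Lie derivative with the contractions along \<open>Ys\<close> gives the row of the
  Schouten bracket that belongs to \<open>X\<close>, and the other rows come from the shorter list.\<close>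

theorem d_comm_schouten:
  assumes "set Xs \<subseteq> homog VF" and Ys: "set Ys \<subseteq> homog VF" and w: "\<omega> \<in> forms A k"
  shows "d_comm Xs (ins Ys \<omega>) - sgn_pow ((vdegs Xs + 1) * vdegs Ys) *\<^sub>R ins Ys (d_comm Xs \<omega>)
    = ip (schouten_basis A Xs Ys) \<omega>"
proof -
  have "d_comm Xs (ins Ys \<omega>) - sgn_pow ((vdegs Xs + 1) * vdegs Ys) *\<^sub>R ins Ys (d_comm Xs \<omega>)
    = (\<Sum>i<length Xs. \<Sum>j<length Ys.
      sgn_pow (vdeg A (Xs ! i) * vdegs (take j Ys) + vdegs (drop (Suc i) Xs) * (vdegs Ys + 1)) *\<^sub>R
      ins (take i Xs @ take j Ys @ [bracket (Xs ! i) (Ys ! j)] @ drop (Suc j) Ys @ drop (Suc i) Xs) \<omega>)"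
    using assms(1)
  proof (induction Xs)
    case Nil
    then show ?case by (simp add: d_comm_def sgn_pow_def ins_diff ins_zero)
  next
    case (Cons X Xs)
    then have X: "X \<in> homog VF" and Xs: "set Xs \<subseteq> homog VF" by auto
    define x p q where "x = vdeg A X" and "p = vdegs Xs" and "q = vdegs Ys"
    note X' = vdeg_mem[OF X, folded x_def]
    have w': "ins Xs \<omega> \<in> forms A (k + p)" unfolding p_def by (rule ins_mem_vdegs[OF Xs w])
    have m: "d_comm Xs \<omega> \<in> forms A (k + p + 1)"
      unfolding d_comm_def using ins_mem_vdegs[OF Xs d_mem[OF w]] d_mem[OF w']
      by (intro \<Omega>.V_diff \<Omega>.V_scale) (simp_all add: p_def algebra_simps)
    have YX: "ins Xs (ins Ys \<omega>) = sgn_pow (p * q) *\<^sub>R ins Ys (ins Xs \<omega>)"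
      using ins_ins[OF homs_vdegs[OF Xs] homs_vdegs[OF Ys] w] by (simp add: p_def q_def comp_def)
    have cY: "ins Ys (contract X (d_comm Xs \<omega>)) = sgn_pow ((x - 1) * q) *\<^sub>R contract X (ins Ys (d_comm Xs \<omega>))"
      using contract_ins[OF X' homs_vdegs[OF Ys] m] by (simp add: q_def comp_def sgn_pow_scaleR_twice)
    have LX: "lie_deriv X (ins Xs (ins Ys \<omega>)) = sgn_pow (p * q) *\<^sub>R lie_deriv X (ins Ys (ins Xs \<omega>))"
      unfolding YX by (rule lin_on_scale[OF lie_lin[OF X'] ins_mem_vdegs[OF Ys w']])
    have S: "lie_deriv X (ins Ys (ins Xs \<omega>)) - sgn_pow (x * q) *\<^sub>R ins Ys (lie_deriv X (ins Xs \<omega>))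
      = (\<Sum>j<length Ys. sgn_pow (x * vdegs (take j Ys)) *\<^sub>R
        ins (take j Ys @ [bracket X (Ys ! j)] @ drop (Suc j) Ys) (ins Xs \<omega>))" (is "_ = ?S")
      using lie_ins[OF X w' Ys] by (simp add: x_def q_def)
    have "d_comm (X # Xs) (ins Ys \<omega>) - sgn_pow ((x - 1 + p + 1) * q) *\<^sub>R ins Ys (d_comm (X # Xs) \<omega>)
      = contract X (d_comm Xs (ins Ys \<omega>) - sgn_pow ((p + 1) * q) *\<^sub>R ins Ys (d_comm Xs \<omega>))
        + sgn_pow (p * (q + 1)) *\<^sub>R ?S"
      unfolding S[symmetric] d_comm_Cons[OF X Xs w] d_comm_Cons[OF X Xs ins_mem_vdegs[OF Ys w]] LX ins_add ins_scale cY
        p_def[symmetric]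
      by (cases "even x"; cases "even p"; cases "even q"; simp add: sgn_pow_def algebra_simps)
    moreover have "vdegs (X # Xs) + 1 = x - 1 + p + 1" by (simp add: x_def p_def)
    ultimately show ?case
      unfolding Cons.IH[OF Xs, folded p_def q_def] length_Cons sum.lessThan_Suc_shift
      by (simp add: q_def[symmetric] x_def[symmetric] p_def[symmetric] sgn_pow_add scaleR_sum_right
        ins_sum[of "[X]", simplified] mult.commute algebra_simps comp_def)
  qed
  also have "\<dots> = ip (schouten_basis A Xs Ys) \<omega>"
    unfolding schouten_basis_def
    by (simp add: linear_sum[OF linear_interior] interior_scale interior_basis)
  finally show ?thesis .
qed

end

context gca begin

lemma vdegs_parity: "VF.homs Xs js \<Longrightarrow> 0 \<notin> set Xs \<Longrightarrow> even (vdegs Xs) \<longleftrightarrow> even (pdeg js)"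
  unfolding VF.homs_def
  by (induction Xs js rule: list_all2_induct) (auto simp: VF.gdeg_parity)

definition even_comm :: "('a form \<Rightarrow> 'a form) \<Rightarrow> 'a form \<Rightarrow> 'a form"
  where "even_comm E \<omega> = E (d \<omega>) - d (E \<omega>)"

text \<open>For lists without zero fields the parities are determined by the fields, and this is
  \<open>d_comm_schouten\<close>. If some field is zero, all terms on the left vanish, and \<open>d_comm_schouten\<close> shows
  that the right-hand side does too.\<close>

lemma schouten_even_basis:
  assumes Xs: "VF.homs Xs xs" "even (pdeg xs)" and Ys: "VF.homs Ys ys" "even (pdeg ys)" and w: "\<omega> \<in> forms A k"
  shows "even_comm (ins Xs) (ins Ys \<omega>) - ins Ys (even_comm (ins Xs) \<omega>) = ip (schouten_basis A Xs Ys) \<omega>"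
proof -
  note hX = VF.homs_homog[OF Xs(1)] and hY = VF.homs_homog[OF Ys(1)]
  note main = d_comm_schouten[OF hX hY w]
  note w' = ins_mem[OF Ys(1) w]
  consider "0 \<in> set Xs" | "0 \<in> set Ys" | "0 \<notin> set Xs" "0 \<notin> set Ys" by blast
  then show ?thesis
  proof cases
    case 1
    note z = ins_zero_field[OF Xs(1) 1]
    show ?thesis using main
      by (simp add: even_comm_def d_comm_def z[OF w] z[OF w'] z[OF d_mem[OF w]] z[OF d_mem[OF w']] d_zero ins_zero)
  next
    case 2
    note z = ins_zero_field[OF Ys(1) 2]
    have "ins Xs (d \<omega>) \<in> forms A (k + 1 + pdeg xs)" "d (ins Xs \<omega>) \<in> forms A (k + pdeg xs + 1)"
      using ins_mem[OF Xs(1)] d_mem w by blast+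
    from this[THEN z] show ?thesis using main
      by (simp add: even_comm_def d_comm_def z[OF w] d_zero ins_zero ins_diff ins_scale)
  next
    case 3
    then show ?thesis
      using main vdegs_parity[OF Xs(1)] vdegs_parity[OF Ys(1)] Xs(2) Ys(2)
      by (simp add: even_comm_def d_comm_def sgn_pow_def)
  qed
qed

text \<open>The bracket of \<open>[i\<^sub>P, d]\<close> with \<open>i\<^sub>Q\<close> is \<open>i\<close> of the Schouten bracket; both sides are bilinear.\<close>

theorem interior_schouten:
  assumes P: "P \<in> polyvectors A r e" "even e" and Q: "Q \<in> polyvectors A s f" "even f" and w: "\<omega> \<in> forms A k"
  shows "even_comm (ip P) (ip Q \<omega>) - ip Q (even_comm (ip P) \<omega>)
    = ip (schouten A P Q) \<omega>"
  using P(1)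
proof (induction rule: polyvector_induct)
  case zero
  show ?case
    by (simp add: even_comm_def schouten_def linext_def interior_zero d_zero lin_on_zero[OF interior_lin \<Omega>.V_0])
next
  case (step c Xs xs P)
  have Xs: "VF.homs Xs xs" "even (pdeg xs)" using step(1,3) P(2) by simp_all
  note Ip = interior_mem[OF step(4)]
  have dlin: "d (c *\<^sub>R \<alpha> + \<beta>) = c *\<^sub>R d \<alpha> + d \<beta>" if "\<alpha> \<in> forms A l" "\<beta> \<in> forms A l" for c \<alpha> \<beta> l
    using lin_on_add[OF d_lin \<Omega>.V_scale[OF that(1)] that(2)] lin_on_scale[OF d_lin that(1)] by simp
  have Qlin: "ip Q (\<alpha> + \<beta>) = ip Q \<alpha> + ip Q \<beta>"
    "ip Q (\<alpha> - \<beta>) = ip Q \<alpha> - ip Q \<beta>"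
    "ip Q (c *\<^sub>R \<alpha>) = c *\<^sub>R ip Q \<alpha>" for \<alpha> \<beta> :: "'a form" and c
    using interior_lin[of UNIV Q] lin_on_diff[OF interior_lin[of UNIV Q] subspace_UNIV] by (auto simp: lin_on_def)
  have step_lin: "even_comm (ip (c *\<^sub>R basis_elt Xs + P)) \<eta>
      = c *\<^sub>R even_comm (ins Xs) \<eta> + even_comm (ip P) \<eta>" if \<eta>: "\<eta> \<in> forms A l" for \<eta> l
  proof -
    have m: "ins Xs \<eta> \<in> forms A (l + e)" "ip P \<eta> \<in> forms A (l + e)"
      using ins_mem[OF step(1) \<eta>] step(3) Ip[OF \<eta>] by simp_all
    show ?thesis unfolding even_comm_def interior_step dlin[OF m] by (simp add: algebra_simps)
  qed
  have B: "even_comm (ins Xs) (ip Q \<omega>) - ip Q (even_comm (ins Xs) \<omega>)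
      = ip (linext (schouten_basis A Xs) Q) \<omega>"
    using Q(1)
  proof (induction rule: polyvector_induct)
    case zero
    show ?case by (simp add: even_comm_def linext_def interior_zero d_zero ins_zero)
  next
    case (step c' Ys ys Q')
    have Ys: "VF.homs Ys ys" "even (pdeg ys)" using step(1,3) Q(2) by simp_all
    have m: "ins Ys \<omega> \<in> forms A (k + f)" "ip Q' \<omega> \<in> forms A (k + f)"
      using ins_mem[OF step(1) w] step(3) interior_mem[OF step(4) w] by simp_all
    have mm: "ins Xs (ins Ys \<omega>) \<in> forms A (k + f + pdeg xs)" "ins Xs (ip Q' \<omega>) \<in> forms A (k + f + pdeg xs)"
      using m[THEN ins_mem[OF Xs(1)]] by auto
    have "even_comm (ins Xs) (c' *\<^sub>R ins Ys \<omega> + ip Q' \<omega>)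
      = c' *\<^sub>R even_comm (ins Xs) (ins Ys \<omega>) + even_comm (ins Xs) (ip Q' \<omega>)"
      unfolding even_comm_def dlin[OF m] ins_add ins_scale dlin[OF mm] by (simp add: algebra_simps)
    moreover have "linext (schouten_basis A Xs) (c' *\<^sub>R basis_elt Ys + Q')
      = c' *\<^sub>R schouten_basis A Xs Ys + linext (schouten_basis A Xs) Q'"
      by (simp add: linear_add[OF linear_linext] linear_scale[OF linear_linext])
    ultimately show ?case
      using schouten_even_basis[OF Xs Ys w] step(5)
      unfolding interior_step by (simp add: interior_add interior_scale algebra_simps)
  qed
  have "schouten A (c *\<^sub>R basis_elt Xs + P) Q = c *\<^sub>R linext (schouten_basis A Xs) Q + schouten A P Q"
    by (simp add: schouten_def linear_add[OF linear_linext] linear_scale[OF linear_linext])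
  then have "ip (schouten A (c *\<^sub>R basis_elt Xs + P) Q) \<omega>
      = c *\<^sub>R ip (linext (schouten_basis A Xs) Q) \<omega> + ip (schouten A P Q) \<omega>"
    by (simp add: interior_add interior_scale)
  then show ?case
    unfolding step_lin[OF w] step_lin[OF interior_mem[OF Q(1) w]] Qlin B[symmetric] step(5)[symmetric]
    by (simp add: algebra_simps)
qed

theorem ecbv_calg_forms:
  assumes P: "generalized_poisson A \<pi>"
  shows "ecbv_calg m forms_alg (ext_deriv A) (\<lambda>n. ip (\<pi> n))"
proof -
  interpret F: gca m forms_alg by (rule gca_forms)
  have pv: "\<pi> n \<in> polyvectors A (Suc n) (- 2 * int n)" if "1 \<le> n" for n
    using P that by (simp add: generalized_poisson_def)
  show ?thesis
  proof
    show "cochain_complex m (gcar forms_alg) d"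
      unfolding cochain_complex_def using graded_space_forms d_lin d_mem d_d_forms by (auto simp: homog_def)
    show "d (gmul forms_alg \<alpha> \<beta>) = gmul forms_alg (d \<alpha>) \<beta> + sgn_pow j *\<^sub>R gmul forms_alg \<alpha> (d \<beta>)"
      if "\<alpha> \<in> gcar forms_alg j" "\<beta> \<in> homog (gcar forms_alg)" for \<alpha> \<beta> j
      using that d_wedge by (auto simp: homog_def)
    fix n k :: nat and \<omega> :: "'a form"
    assume n: "1 \<le> n"
    show "hom_op (gcar forms_alg) (- 2 * int n) (ip (\<pi> n))"
      using interior_hom_op[OF pv[OF n]] by simp
    show "ip (\<pi> n) (gone forms_alg) = 0" using interior_one[OF pv[OF n]] by simp
    show "F.diffop (n + 2) (- 2 * int n) (ip (\<pi> n))" using interior_diffop[OF pv[OF n]] by simp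
    assume k: "1 \<le> k" and "\<omega> \<in> homog (gcar forms_alg)"
    then show "ip (\<pi> n) (ip (\<pi> k) \<omega>) = ip (\<pi> k) (ip (\<pi> n) \<omega>)"
      using interior_commute[OF pv[OF n] pv[OF k]] by (auto simp: homog_def)
  next
    fix n :: nat and \<omega> :: "'a form"
    assume n: "2 \<le> n" and "\<omega> \<in> homog (gcar forms_alg)"
    then obtain k where w: "\<omega> \<in> forms A k" by (auto simp: homog_def)
    let ?i = "\<lambda>n. ip (\<pi> n)"
    have "(\<Sum>j = 1..n - 1. ?i j (d (?i (n - j) \<omega>) - ?i (n - j) (d \<omega>)) - (d (?i (n - j) (?i j \<omega>)) - ?i (n - j) (d (?i j \<omega>))))
      = (\<Sum>j = 1..n - 1. ip (schouten A (\<pi> j) (\<pi> (n - j))) \<omega>)"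
    proof (rule sum.cong[OF refl])
      fix j assume j: "j \<in> {1..n - 1}"
      then have p: "\<pi> j \<in> polyvectors A (Suc j) (- 2 * int j)" and q: "\<pi> (n - j) \<in> polyvectors A (Suc (n - j)) (- 2 * int (n - j))"
        using pv[of j] pv[of "n - j"] by auto
      have diff: "ip R (\<alpha> - \<beta>) = ip R \<alpha> - ip R \<beta>" for R and \<alpha> \<beta> :: "'a form"
        using lin_on_diff[OF interior_lin[of UNIV R] subspace_UNIV] by auto
      show "?i j (d (?i (n - j) \<omega>) - ?i (n - j) (d \<omega>)) - (d (?i (n - j) (?i j \<omega>)) - ?i (n - j) (d (?i j \<omega>)))
        = ip (schouten A (\<pi> j) (\<pi> (n - j))) \<omega>"
        unfolding interior_schouten[OF p _ q _ w, symmetric, simplified] even_comm_def diff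
          interior_commute[OF p q _ d_mem[OF w], simplified] interior_commute[OF p q _ w, simplified]
        by simp
    qed
    also have "\<dots> = ip (\<Sum>j = 1..n - 1. schouten A (\<pi> j) (\<pi> (n - j))) \<omega>"
      by (simp add: linear_sum[OF linear_interior])
    also have "\<dots> = 0"
      using P n by (intro interior_null[OF _ w]) (simp add: generalized_poisson_def)
    finally show "(\<Sum>j = 1..n - 1. ?i j (d (?i (n - j) \<omega>) - ?i (n - j) (d \<omega>)) - (d (?i (n - j) (?i j \<omega>)) - ?i (n - j) (d (?i j \<omega>)))) = 0" .
  qed
qed

end

section \<open>The algebra of polynomial paths\<close>

text \<open>Elements of \<open>A[t, dt]\<close> are encoded as sequences of coefficients: \<open>mon (2 * k) a\<close> is \<open>a t\<^sup>k\<close> and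
  \<open>mon (2 * k + 1) a\<close> is \<open>a t\<^sup>k dt\<close>. With this indexing the product of monomials adds the indices,
  unless it contains \<open>dt\<close> twice. All operations are extended linearly from monomials by \<open>psum\<close>, and identities
  are checked on monomials by \<open>path_ext\<close>.\<close>

definition mon :: "nat \<Rightarrow> 'a::zero \<Rightarrow> nat \<Rightarrow> 'a"
  where "mon i a = (\<lambda>k. if k = i then a else 0)"

definition psum :: "(nat \<Rightarrow> 'a::zero \<Rightarrow> 'w::comm_monoid_add) \<Rightarrow> (nat \<Rightarrow> 'a) \<Rightarrow> 'w"
  where "psum F x = (\<Sum>i | x i \<noteq> 0. F i (x i))"

lemma mon_arith:
  fixes a b :: "'a::real_vector"
  shows "mon i (a + b) = mon i a + mon i b" "mon i (a - b) = mon i a - mon i b"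
    "mon i (c *\<^sub>R a) = c *\<^sub>R mon i a" "mon i (- a) = - mon i a" "mon i (0 :: 'a) = 0"
  by (rule ext, simp add: mon_def fun_arith)+

lemma lin_on_mon:
  fixes f :: "'a::real_vector \<Rightarrow> 'b::real_vector"
  shows "lin_on S f \<Longrightarrow> lin_on S (\<lambda>a. mon i (f a))"
  by (simp add: lin_on_def mon_arith)

lemma psum_superset:
  assumes "finite S" "{i. x i \<noteq> 0} \<subseteq> S" "\<And>i. F i 0 = 0"
  shows "psum F x = (\<Sum>i\<in>S. F i (x i))"
  unfolding psum_def by (rule sum.mono_neutral_left) (use assms in auto)

lemma psum_mon: "F i 0 = 0 \<Longrightarrow> psum F (mon i a) = F i a"
proof (cases "a = 0")
  case False
  then have "{k. mon i a k \<noteq> 0} = {i}" by (auto simp: mon_def)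
  then show ?thesis by (simp add: psum_def mon_def)
qed (simp add: psum_def mon_def)

lemma psum_0 [simp]: "psum F 0 = 0"
  by (simp add: psum_def zero_fun_def)

lemma psum_const_0 [simp]: "psum (\<lambda>i a. 0) x = 0"
  by (simp add: psum_def)

abbreviation odd_part :: "nat \<Rightarrow> int"
  where "odd_part i \<equiv> (if odd i then 1 else 0)"

context gca begin

definition paths :: "int \<Rightarrow> (nat \<Rightarrow> 'a) set"
  where "paths j = {x. finite {i. x i \<noteq> 0} \<and> (\<forall>i. x i \<in> gcar A (j - odd_part i))}"

lemma path_finite: "x \<in> paths j \<Longrightarrow> finite {i. x i \<noteq> 0}"
  by (simp add: paths_def)

lemma path_coeff: "x \<in> paths j \<Longrightarrow> x i \<in> gcar A (j - odd_part i)"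
  by (auto simp: paths_def)

lemma mon_mem: "a \<in> gcar A (j - odd_part i) \<Longrightarrow> mon i a \<in> paths j"
  by (auto simp: paths_def mon_def)

lemma subspace_paths: "subspace (paths j)"
proof (rule subspace_combI)
  fix x y c assume x: "x \<in> paths j" and y: "y \<in> paths j"
  have "{i. (c *\<^sub>R x + y) i \<noteq> 0} \<subseteq> {i. x i \<noteq> 0} \<union> {i. y i \<noteq> 0}" by (auto simp: fun_arith)
  then have "finite {i. (c *\<^sub>R x + y) i \<noteq> 0}" using path_finite[OF x] path_finite[OF y] finite_subset by blast
  then show "c *\<^sub>R x + y \<in> paths j" using path_coeff[OF x] path_coeff[OF y] by (simp add: paths_def V_add V_scale fun_arith)
qed (simp add: paths_def zero_fun_apply)

lemma graded_space_paths: "graded_space m paths"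
  unfolding graded_space_def
proof (intro conjI allI impI ballI)
  show "subspace (paths k)" for k by (rule subspace_paths)
  have "gcar A (k + m - e) = gcar A (k - e)" for k e using V_period[of "k - e"] by (simp add: algebra_simps)
  then show "paths (k + m) = paths k" for k by (simp only: paths_def)
  fix I and x :: "int \<Rightarrow> nat \<Rightarrow> 'a" and k
  assume h: "finite I \<and> inj_on (\<lambda>k. k mod m) I \<and> (\<forall>k\<in>I. x k \<in> paths k) \<and> (\<Sum>k\<in>I. x k) = 0" and k: "k \<in> I"
  have "x k i = 0" for i
  proof (rule V_direct[of I "\<lambda>k. x k i" "- odd_part i" k])
    show "(\<Sum>k\<in>I. x k i) = 0" using h sum_fun_apply[of x I i] by (simp add: zero_fun_apply)
    show "x k i \<in> gcar A (- odd_part i + k)" if "k \<in> I" for k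
      using h that path_coeff[of "x k" k i] by (simp only: add.commute[of _ k] diff_conv_add_uminus)
  qed (use h k in auto)
  then show "x k = 0" by (intro ext) (simp add: zero_fun_apply)
qed

lemma path_expand: "x \<in> paths j \<Longrightarrow> x = (\<Sum>i | x i \<noteq> 0. mon i (x i))"
proof (rule ext)
  fix k assume "x \<in> paths j"
  from path_finite[OF this] show "x k = (\<Sum>i | x i \<noteq> 0. mon i (x i)) k"
    by (simp add: sum_fun_apply mon_def sum.delta')
qed

lemma psum_lin:
  fixes F :: "nat \<Rightarrow> 'a \<Rightarrow> 'w::real_vector"
  assumes "\<And>i. lin_on (gcar A (j - odd_part i)) (F i)"
  shows "lin_on (paths j) (psum F)"
proof -
  have F0: "F i 0 = 0" for i by (rule lin_on_zero[OF assms V_0])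
  show ?thesis
  proof (rule lin_onI[OF subspace_paths])
    fix c x y assume x: "x \<in> paths j" and y: "y \<in> paths j"
    let ?S = "{i. x i \<noteq> 0} \<union> {i. y i \<noteq> 0}"
    have S: "finite ?S" using path_finite[OF x] path_finite[OF y] by simp
    have "psum F (c *\<^sub>R x + y) = (\<Sum>i\<in>?S. F i ((c *\<^sub>R x + y) i))"
      by (rule psum_superset) (use S F0 in \<open>auto simp: fun_arith\<close>)
    also have "\<dots> = c *\<^sub>R (\<Sum>i\<in>?S. F i (x i)) + (\<Sum>i\<in>?S. F i (y i))"
      using lin_on_comb[OF assms subspace_V path_coeff[OF x] path_coeff[OF y]]
      by (simp add: fun_arith sum.distrib scaleR_sum_right)
    also have "\<dots> = c *\<^sub>R psum F x + psum F y"
      using psum_superset[of ?S x F] psum_superset[of ?S y F] S F0 by auto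
    finally show "psum F (c *\<^sub>R x + y) = c *\<^sub>R psum F x + psum F y" .
  qed
qed

lemma psum_mem:
  assumes "x \<in> paths j" "subspace W" "\<And>i a. a \<in> gcar A (j - odd_part i) \<Longrightarrow> F i a \<in> W"
  shows "psum F x \<in> W"
  unfolding psum_def by (rule subspace_sum[OF assms(2)]) (rule assms(3)[OF path_coeff[OF assms(1)]])

lemma path_ext:
  assumes "x \<in> paths j" "lin_on (paths j) F" "lin_on (paths j) G"
    and "\<And>i a. a \<in> gcar A (j - odd_part i) \<Longrightarrow> F (mon i a) = G (mon i a)"
  shows "F x = G x"
proof -
  have m: "mon i (x i) \<in> paths j" for i by (rule mon_mem[OF path_coeff[OF assms(1)]])
  have "F (\<Sum>i | x i \<noteq> 0. mon i (x i)) = G (\<Sum>i | x i \<noteq> 0. mon i (x i))"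
    using lin_on_sum[OF assms(2) subspace_paths, of "{i. x i \<noteq> 0}" "\<lambda>i. mon i (x i)"] m
      lin_on_sum[OF assms(3) subspace_paths, of "{i. x i \<noteq> 0}" "\<lambda>i. mon i (x i)"]
      assms(4)[OF path_coeff[OF assms(1)]] by simp
  then show ?thesis using path_expand[OF assms(1)] by simp
qed

subsection \<open>The product\<close>

text \<open>The sign arises from moving \<open>dt\<close> in the first monomial past the second one, of total degree \<open>b\<close>; if
  the first contains \<open>dt\<close>, the second does not, and \<open>b\<close> is the degree of its coefficient.\<close>

definition mmul :: "int \<Rightarrow> nat \<Rightarrow> 'a \<Rightarrow> nat \<Rightarrow> 'a \<Rightarrow> nat \<Rightarrow> 'a"
  where "mmul b i u j v = (if odd i \<and> odd j then 0 else sgn_pow (int i * b) *\<^sub>R mon (i + j) (u \<odot> v))"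

text \<open>The degree \<open>b\<close> of the second factor is a parameter so that the product is bilinear for fixed \<open>b\<close>.\<close>

definition pmul_deg :: "int \<Rightarrow> (nat \<Rightarrow> 'a) \<Rightarrow> (nat \<Rightarrow> 'a) \<Rightarrow> nat \<Rightarrow> 'a"
  where "pmul_deg b x y = psum (\<lambda>i u. psum (mmul b i u) y) x"

definition pmul :: "(nat \<Rightarrow> 'a) \<Rightarrow> (nat \<Rightarrow> 'a) \<Rightarrow> nat \<Rightarrow> 'a"
  where "pmul x y = pmul_deg (gdeg paths y) x y"

lemma mmul_lin_right:
  assumes u: "u \<in> gcar A k"
  shows "lin_on (gcar A l) (mmul b i u j)"
proof (cases "odd i \<and> odd j")
  case True
  then show ?thesis by (simp add: mmul_def lin_on_def)
next
  case False
  have "lin_on (gcar A l) (\<lambda>v. sgn_pow (int i * b) *\<^sub>R mon (i + j) (u \<odot> v))"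
    by (intro lin_on_scaled lin_on_mon mul_lin_right homogI[OF u])
  moreover have "mmul b i u j = (\<lambda>v. sgn_pow (int i * b) *\<^sub>R mon (i + j) (u \<odot> v))"
    by (rule ext) (use False in \<open>auto simp: mmul_def\<close>)
  ultimately show ?thesis by simp
qed

lemma mmul_lin_left:
  assumes v: "v \<in> gcar A l"
  shows "lin_on (gcar A k) (\<lambda>u. mmul b i u j v)"
proof (cases "odd i \<and> odd j")
  case True
  then show ?thesis by (simp add: mmul_def lin_on_def)
next
  case False
  have "lin_on (gcar A k) (\<lambda>u. sgn_pow (int i * b) *\<^sub>R mon (i + j) (u \<odot> v))"
    by (intro lin_on_scaled lin_on_mon mul_lin_left homogI[OF v])
  moreover have "(\<lambda>u. mmul b i u j v) = (\<lambda>u. sgn_pow (int i * b) *\<^sub>R mon (i + j) (u \<odot> v))"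
    by (rule ext) (use False in \<open>auto simp: mmul_def\<close>)
  ultimately show ?thesis by simp
qed

lemma mmul_mem:
  "u \<in> gcar A (a - odd_part i) \<Longrightarrow> v \<in> gcar A (b - odd_part j) \<Longrightarrow> mmul b i u j v \<in> paths (a + b)"
proof -
  assume "u \<in> gcar A (a - odd_part i)" "v \<in> gcar A (b - odd_part j)"
  from mul_mem[OF this] have "\<not> (odd i \<and> odd j) \<Longrightarrow> u \<odot> v \<in> gcar A (a + b - odd_part (i + j))"
    by (auto simp: algebra_simps)
  then show ?thesis
    by (auto simp: mmul_def intro!: subspace_0 subspace_paths subspace_scale mon_mem simp del: split_paired_All)
qed

lemma pmul_deg_lin_right: "x \<in> paths a \<Longrightarrow> lin_on (paths b) (pmul_deg b x)"
  unfolding pmul_deg_def psum_def[of _ x]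
  by (intro lin_on_setsum psum_lin mmul_lin_right[OF path_coeff])

lemma pmul_deg_lin_left: "y \<in> paths b \<Longrightarrow> lin_on (paths a) (\<lambda>x. pmul_deg b x y)"
  unfolding pmul_deg_def
  by (intro psum_lin) (unfold psum_def[of _ y], intro lin_on_setsum mmul_lin_left[OF path_coeff])

lemma pmul_eq: "y \<in> paths b \<Longrightarrow> pmul x y = pmul_deg b x y"
proof (cases "y = 0")
  case False
  interpret C: graded_vs m paths by unfold_locales (rule graded_space_paths, rule even_m)
  assume "y \<in> paths b"
  from C.gdeg_parity[OF this False] have "sgn_pow (int i * gdeg paths y) = sgn_pow (int i * b)" for i
    by (intro sgn_pow_eqI) simp
  then have "mmul (gdeg paths y) = mmul b" by (intro ext) (simp only: mmul_def)
  then show ?thesis by (simp add: pmul_def pmul_deg_def)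
qed (simp add: pmul_def pmul_deg_def)

lemma pmul_lin_right: "x \<in> paths a \<Longrightarrow> lin_on (paths b) (pmul x)"
  by (rule lin_on_cong[OF pmul_deg_lin_right subspace_paths]) (simp_all add: pmul_eq)

lemma pmul_lin_left: "y \<in> paths b \<Longrightarrow> lin_on (paths a) (\<lambda>x. pmul x y)"
  by (simp add: pmul_eq pmul_deg_lin_left)

lemma pmul_mem: "x \<in> paths a \<Longrightarrow> y \<in> paths b \<Longrightarrow> pmul x y \<in> paths (a + b)"
  unfolding pmul_eq pmul_deg_def
  by (rule psum_mem[OF _ subspace_paths], assumption, rule psum_mem[OF _ subspace_paths], assumption, rule mmul_mem)

lemma pmul_mon:
  assumes u: "u \<in> gcar A k" and v: "v \<in> gcar A (b - odd_part j)"
  shows "pmul (mon i u) (mon j v) = mmul b i u j v"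
proof -
  have 0: "mmul b i 0 l w = 0" "mmul b i u l 0 = 0" if "w \<in> gcar A q" for w l q
    using lin_on_zero[OF mmul_lin_right[OF u] V_0] lin_on_zero[OF mmul_lin_left[OF that] V_0] by blast+
  have "psum (mmul b i 0) (mon j v) = mmul b i 0 j v"
    by (rule psum_mon) (rule 0(1)[OF V_0])
  then have "pmul_deg b (mon i u) (mon j v) = psum (mmul b i u) (mon j v)"
    unfolding pmul_deg_def by (intro psum_mon) (simp add: 0(1)[OF v])
  also have "\<dots> = mmul b i u j v" by (rule psum_mon) (rule 0(2)[OF V_0])
  finally show ?thesis by (simp add: pmul_eq[OF mon_mem[OF v]])
qed

lemma pmul_comm:
  assumes x: "x \<in> paths a" and y: "y \<in> paths b"
  shows "pmul x y = sgn_pow (a * b) *\<^sub>R pmul y x"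
proof (rule path_ext[OF x pmul_lin_left[OF y] lin_on_scaled[OF pmul_lin_right[OF y]]])
  fix i u assume u: "u \<in> gcar A (a - odd_part i)"
  note U = mon_mem[OF u]
  show "pmul (mon i u) y = sgn_pow (a * b) *\<^sub>R pmul y (mon i u)"
  proof (rule path_ext[OF y pmul_lin_right[OF U] lin_on_scaled[OF pmul_lin_left[OF U]]])
    fix j v assume v: "v \<in> gcar A (b - odd_part j)"
    show "pmul (mon i u) (mon j v) = sgn_pow (a * b) *\<^sub>R pmul (mon j v) (mon i u)"
      unfolding pmul_mon[OF u v] pmul_mon[OF v u] mmul_def mul_comm[OF u v]
      by (cases "even i"; cases "even j"; cases "even a"; cases "even b";
          simp add: sgn_pow_def mon_arith add.commute)
  qed
qed

lemma pmul_assoc: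
  assumes x: "x \<in> paths a" and y: "y \<in> paths b" and z: "z \<in> paths c"
  shows "pmul (pmul x y) z = pmul x (pmul y z)"
proof (rule path_ext[OF x])
  show "lin_on (paths a) (\<lambda>x. pmul (pmul x y) z)"
    by (rule lin_on_compose[OF pmul_lin_left[OF y] _ pmul_lin_left[OF z], of _ "a + b"]) (use y pmul_mem in blast)
  show "lin_on (paths a) (\<lambda>x. pmul x (pmul y z))" by (rule pmul_lin_left[OF pmul_mem[OF y z]])
  fix i u assume u: "u \<in> gcar A (a - odd_part i)"
  note U = mon_mem[OF u]
  show "pmul (pmul (mon i u) y) z = pmul (mon i u) (pmul y z)"
  proof (rule path_ext[OF y])
    show "lin_on (paths b) (\<lambda>y. pmul (pmul (mon i u) y) z)"
      by (rule lin_on_compose[OF pmul_lin_right[OF U] _ pmul_lin_left[OF z], of _ "a + b"]) (use U pmul_mem in blast)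
    show "lin_on (paths b) (\<lambda>y. pmul (mon i u) (pmul y z))"
      by (rule lin_on_compose[OF pmul_lin_left[OF z] _ pmul_lin_right[OF U], of _ "b + c"]) (use z pmul_mem in blast)
    fix j v assume v: "v \<in> gcar A (b - odd_part j)"
    note W = mon_mem[OF v]
    show "pmul (pmul (mon i u) (mon j v)) z = pmul (mon i u) (pmul (mon j v) z)"
    proof (rule path_ext[OF z pmul_lin_right[OF pmul_mem[OF U W]]])
      show "lin_on (paths c) (\<lambda>z. pmul (mon i u) (pmul (mon j v) z))"
        by (rule lin_on_compose[OF pmul_lin_right[OF W] _ pmul_lin_right[OF U], of _ "b + c"]) (use W pmul_mem in blast)
      fix k w assume w: "w \<in> gcar A (c - odd_part k)"
      have uv: "u \<odot> v \<in> gcar A (a - odd_part i + (b - odd_part j))" by (rule mul_mem[OF u v])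
      have vw: "v \<odot> w \<in> gcar A (b + c - odd_part (j + k))" if "\<not> (odd j \<and> odd k)"
        using mul_mem[OF v w] that by (auto simp: algebra_simps)
      have e1: "pmul (r *\<^sub>R mon (i + j) (u \<odot> v)) (mon k w) = r *\<^sub>R mmul c (i + j) (u \<odot> v) k w" for r
      proof -
        have "pmul (mon (i + j) (r *\<^sub>R (u \<odot> v))) (mon k w) = mmul c (i + j) (r *\<^sub>R (u \<odot> v)) k w"
          by (rule pmul_mon[OF V_scale[OF uv] w])
        then show ?thesis using lin_on_scale[OF mmul_lin_left[OF w] uv] by (simp add: mon_arith)
      qed
      have e2: "pmul (mon i u) (r *\<^sub>R mon (j + k) (v \<odot> w)) = r *\<^sub>R mmul (b + c) i u (j + k) (v \<odot> w)"
        if "\<not> (odd j \<and> odd k)" for r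
        using pmul_mon[OF u vw[OF that]] lin_on_scale[OF pmul_lin_right[OF U] mon_mem[OF vw[OF that]]] by simp
      have z: "pmul (mon i u) 0 = 0" "pmul 0 (mon k w) = 0"
        by (simp_all add: pmul_def pmul_deg_def)
      show "pmul (pmul (mon i u) (mon j v)) (mon k w) = pmul (mon i u) (pmul (mon j v) (mon k w))"
        unfolding pmul_mon[OF u v] pmul_mon[OF v w] mmul_def[of b i u j v] mmul_def[of c j v k w]
        by (cases "even i"; cases "even j"; cases "even k"; cases "even b"; cases "even c";
            simp add: e1 e2 z mmul_def sgn_pow_def mul_assoc[OF homogI[OF u] homogI[OF v] homogI[OF w]] add.assoc mon_arith(4)
              e1[of 1, simplified] e2[of 1, simplified] e1[of "-1", simplified] e2[of "-1", simplified])
    qed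
  qed
qed

definition paths_alg :: "(nat \<Rightarrow> 'a) graded_alg"
  where "paths_alg = \<lparr>gcar = paths, gmul = pmul, gone = mon 0 one\<rparr>"

lemma paths_alg_simps [simp]: "gcar paths_alg = paths" "gmul paths_alg = pmul" "gone paths_alg = mon 0 one"
  by (simp_all add: paths_alg_def)

lemma pmul_one:
  assumes x: "x \<in> paths j"
  shows "pmul (mon 0 one) x = x"
proof -
  have one: "one \<in> gcar A (0 - odd_part 0)" using one_mem by simp
  show ?thesis
  proof (rule path_ext[OF x pmul_lin_right[OF mon_mem[OF one]]])
    show "lin_on (paths j) (\<lambda>x. x)" by (simp add: lin_on_def)
    show "pmul (mon 0 one) (mon i a) = mon i a" if "a \<in> gcar A (j - odd_part i)" for i a
      unfolding pmul_mon[OF one_mem that] using one_left[OF homogI[OF that]] by (simp add: mmul_def)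
  qed
qed

lemma gca_paths: "gca m paths_alg"
proof
  have one: "mon 0 one \<in> paths 0" using one_mem by (intro mon_mem) simp
  show "graded_comm_alg m paths_alg"
    unfolding graded_comm_alg_def paths_alg_simps
  proof (intro conjI allI ballI graded_space_paths one)
    show "pmul x y = sgn_pow (j * k) *\<^sub>R pmul y x" if "x \<in> paths j" "y \<in> paths k" for x y j k
      by (rule pmul_comm[OF that])
  qed (auto simp: homog_def pmul_mem pmul_lin_right pmul_assoc pmul_one)
qed (rule even_m)

end

context gca begin

lemma diffop_sum:
  assumes "finite I" "\<And>i. i \<in> I \<Longrightarrow> diffop r e (D i)" "\<And>i. i \<in> I \<Longrightarrow> hom_op (gcar A) e (D i)"
  shows "diffop r e (\<lambda>u. \<Sum>i\<in>I. D i u) \<and> hom_op (gcar A) e (\<lambda>u. \<Sum>i\<in>I. D i u)"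
  using assms by (induction I rule: finite_induct) (auto intro: diffop_add diffop_zero hom_op_add hom_op_zero)

lemma psum_hom_op:
  assumes "\<And>j i a. a \<in> gcar A (j - odd_part i) \<Longrightarrow> F i a \<in> paths (j + e)"
    "\<And>j i. lin_on (gcar A j) (F i)"
  shows "hom_op paths e (psum F)"
  using psum_mem[OF _ subspace_paths assms(1)] psum_lin[OF assms(2)] by (auto simp: hom_op_def)

lemma hom_op_0: "hom_op (gcar A) e D \<Longrightarrow> D 0 = 0"
  by (rule lin_on_zero[OF hom_op_lin V_0])

text \<open>The operator \<open>t\<^sup>n D\<close>.\<close>

definition shift_op :: "nat \<Rightarrow> ('a \<Rightarrow> 'a) \<Rightarrow> (nat \<Rightarrow> 'a) \<Rightarrow> nat \<Rightarrow> 'a"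
  where "shift_op n D = psum (\<lambda>k a. mon (2 * n + k) (D a))"

lemma shift_op_hom_op:
  assumes D: "hom_op (gcar A) e D"
  shows "hom_op paths e (shift_op n D)"
  unfolding shift_op_def
proof (rule psum_hom_op)
  show "mon (2 * n + i) (D a) \<in> paths (j + e)" if "a \<in> gcar A (j - odd_part i)" for j i a
    using hom_op_mem[OF D that] by (intro mon_mem) (simp add: algebra_simps split: if_splits)
  show "lin_on (gcar A j) (\<lambda>a. mon (2 * n + i) (D a))" for j i
    by (rule lin_on_mon[OF hom_op_lin[OF D]])
qed

lemma shift_op_mon: "hom_op (gcar A) e D \<Longrightarrow> shift_op n D (mon k a) = mon (2 * n + k) (D a)"
  unfolding shift_op_def by (rule psum_mon) (simp add: hom_op_0 mon_arith)

text \<open>The commutator of \<open>D\<close>, acting on coefficients, with the multiplication by \<open>a t\<^sup>k\<close> or \<open>a t\<^sup>k dt\<close> is the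
  coefficientwise action of \<open>[D, a]\<close> followed, up to sign, by multiplication with \<open>t\<^sup>k\<close> or \<open>t\<^sup>k dt\<close>. Hence extending an
  operator to paths does not change its order.\<close>

lemma pmul_monomial_op:
  assumes x: "mon i a \<in> paths b" "a \<in> gcar A (b - odd_part i)" and D: "hom_op (gcar A) f D" and u: "u \<in> paths c"
  shows "gca.mult_bracket paths_alg f (shift_op 0 D) b (mon i a) u
    = sgn_pow (int i * (f + b - odd_part i)) *\<^sub>R pmul (mon i one) (shift_op 0 (mult_bracket f D (b - odd_part i) a) u)"
proof -
  interpret C: gca m paths_alg by (rule gca_paths)
  define B where "B = mult_bracket f D (b - odd_part i) a"
  have B: "hom_op (gcar A) (f + (b - odd_part i)) B" unfolding B_def by (rule hom_op_bracket[OF D x(2)])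
  have o: "one \<in> gcar A (odd_part i - odd_part i)" using one_mem by simp
  have D': "hom_op (gcar paths_alg) f (shift_op 0 D)" using shift_op_hom_op[OF D] by simp
  have o': "mon i one \<in> gcar paths_alg (odd_part i)" using mon_mem[OF o] by simp
  have B': "hom_op (gcar paths_alg) (f + (b - odd_part i)) (shift_op 0 B)" using shift_op_hom_op[OF B] by simp
  from C.hom_op_compose[OF C.mult_op[OF o'] B']
  have "hom_op paths (odd_part i + (f + (b - odd_part i))) (\<lambda>u. pmul (mon i one) (shift_op 0 B u))"
    by (simp only: paths_alg_simps)
  from C.hom_op_scale[unfolded paths_alg_simps, OF this] have lR: "lin_on (paths c) (\<lambda>u. sgn_pow (int i * (f + b - odd_part i)) *\<^sub>R pmul (mon i one) (shift_op 0 B u))"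
    by (rule hom_op_lin)
  have lL: "lin_on (paths c) (C.mult_bracket f (shift_op 0 D) b (mon i a))"
    using hom_op_lin[OF C.hom_op_bracket[OF D']] x(1) by simp
  show ?thesis
    unfolding B_def[symmetric]
  proof (rule path_ext[OF u lL lR])
    fix k v assume v: "v \<in> gcar A (c - odd_part k)"
    have Dv: "D v \<in> gcar A (c + f - odd_part k)" using hom_op_mem[OF D v] by (simp add: algebra_simps)
    have Bv: "B v \<in> gcar A (c + f + b - odd_part i - odd_part k)" using hom_op_mem[OF B v] by (simp add: algebra_simps)
    have av: "a \<odot> v \<in> gcar A (b - odd_part i + (c - odd_part k))" by (rule mul_mem[OF x(2) v])
    have e1: "shift_op 0 D (pmul (mon i a) (mon k v)) = mmul c i one k (D (a \<odot> v))"
      unfolding pmul_mon[OF x(2) v]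
    proof (cases "odd i \<and> odd k")
      case False
      have "shift_op 0 D (mon (i + k) (sgn_pow (int i * c) *\<^sub>R (a \<odot> v))) = mon (i + k) (D (sgn_pow (int i * c) *\<^sub>R (a \<odot> v)))"
        using shift_op_mon[OF D, of 0] by simp
      then show "shift_op 0 D (mmul c i a k v) = mmul c i one k (D (a \<odot> v))"
        using False lin_on_scale[OF hom_op_lin[OF D] av] one_left[OF homogI[OF hom_op_mem[OF D av]]] by (auto simp: mmul_def mon_arith)
    qed (simp add: mmul_def shift_op_def)
    have e2: "pmul (mon i a) (shift_op 0 D (mon k v)) = mmul (c + f) i a k (D v)"
      using shift_op_mon[OF D, of 0 k v] pmul_mon[OF x(2) Dv] by simp
    have e3: "pmul (mon i one) (shift_op 0 B (mon k v)) = mmul (c + f + b - odd_part i) i one k (B v)"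
      using shift_op_mon[OF B, of 0 k v] pmul_mon[OF one_mem Bv] by simp
    have h: "B v = D (a \<odot> v) - sgn_pow (f * (b - odd_part i)) *\<^sub>R (a \<odot> D v)"
      by (simp add: B_def mult_bracket_def)
    have o1: "one \<odot> B v = B v" "one \<odot> D (a \<odot> v) = D (a \<odot> v)"
      using one_left homogI[OF Bv] homogI[OF hom_op_mem[OF D av]] by blast+
    show "C.mult_bracket f (shift_op 0 D) b (mon i a) (mon k v)
      = sgn_pow (int i * (f + b - odd_part i)) *\<^sub>R pmul (mon i one) (shift_op 0 B (mon k v))"
      unfolding C.mult_bracket_def paths_alg_simps e1 e2 e3 mmul_def o1
      unfolding h
      by (cases "even i"; cases "even k"; cases "even b"; cases "even c"; cases "even f"; simp add: sgn_pow_def mon_arith)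
  qed
qed

lemma diffop_coefficientwise:
  "hom_op (gcar A) f D \<Longrightarrow> diffop r f D \<Longrightarrow> gca.diffop paths_alg r f (shift_op 0 D)"
proof (induction r arbitrary: f D)
  case 0
  interpret C: gca m paths_alg by (rule gca_paths)
  show ?case
  proof (clarsimp simp: homog_def)
    fix u j assume u: "u \<in> paths j"
    show "shift_op 0 D u = 0"
      by (rule path_ext[OF u hom_op_lin[OF shift_op_hom_op[OF 0(1)]] lin_on_const_zero])
        (use 0 in \<open>simp add: shift_op_mon[OF 0(1)] homogI mon_arith\<close>)
  qed
next
  case (Suc r)
  interpret C: gca m paths_alg by (rule gca_paths)
  note D = Suc.prems(1)
  have D': "hom_op (gcar paths_alg) f (shift_op 0 D)" using shift_op_hom_op[OF D] by simp
  have mon: "C.diffop r (f + b) (C.mult_bracket f (shift_op 0 D) b (mon i a))"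
    if a: "a \<in> gcar A (b - odd_part i)" for i a b
  proof -
    define B where "B = mult_bracket f D (b - odd_part i) a"
    have B: "hom_op (gcar A) (f + (b - odd_part i)) B" unfolding B_def by (rule hom_op_bracket[OF D a])
    have "diffop r (f + (b - odd_part i)) B" using Suc.prems(2) a by (simp add: B_def)
    from Suc.IH[OF B this] have IH: "C.diffop r (f + (b - odd_part i)) (shift_op 0 B)" .
    have B': "hom_op (gcar paths_alg) (f + (b - odd_part i)) (shift_op 0 B)" using shift_op_hom_op[OF B] by simp
    have o: "mon i one \<in> gcar paths_alg (odd_part i)" using one_mem by (auto intro!: mon_mem)
    have h: "hom_op (gcar paths_alg) (f + (b - odd_part i) + odd_part i) (\<lambda>u. pmul (mon i one) (shift_op 0 B u))"
      using C.hom_op_compose[OF C.mult_op[OF o] B'] by (simp add: ac_simps)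
    have "C.diffop r (f + (b - odd_part i) + odd_part i)
      (\<lambda>u. sgn_pow (int i * (f + b - odd_part i)) *\<^sub>R pmul (mon i one) (shift_op 0 B u))"
      using C.diffop_scale[OF C.diffop_mult_left[OF IH B' o] _, of "sgn_pow (int i * (f + b - odd_part i))"] h by simp
    then have "C.diffop r (f + b) (\<lambda>u. sgn_pow (int i * (f + b - odd_part i)) *\<^sub>R pmul (mon i one) (shift_op 0 B u))"
      by simp
    then show ?thesis
      by (rule C.diffop_cong) (use pmul_monomial_op[OF mon_mem[OF a] a D] in \<open>auto simp: homog_def B_def\<close>)
  qed
  show ?case unfolding C.diffop.simps
  proof (intro allI ballI)
    fix b x assume "x \<in> gcar paths_alg b"
    then have x: "x \<in> paths b" by simp
    let ?S = "{i. x i \<noteq> 0}"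
    have m: "mon i (x i) \<in> paths b" for i by (rule mon_mem[OF path_coeff[OF x]])
    have "C.diffop r (f + b) (\<lambda>u. \<Sum>i\<in>?S. C.mult_bracket f (shift_op 0 D) b (mon i (x i)) u)"
      using C.diffop_sum[OF path_finite[OF x] mon[OF path_coeff[OF x]] C.hom_op_bracket[OF D']] m by simp
    then show "C.diffop r (f + b) (C.mult_bracket f (shift_op 0 D) b x)"
    proof (rule C.diffop_cong)
      fix u assume "u \<in> homog (gcar paths_alg)"
      then obtain c where u: "u \<in> paths c" by (auto simp: homog_def)
      have Du: "shift_op 0 D u \<in> paths (c + f)" by (rule hom_op_mem[OF shift_op_hom_op[OF D] u])
      have 1: "lin_on (paths b) (\<lambda>x. shift_op 0 D (pmul x u))"
        by (rule lin_on_compose[OF pmul_lin_left[OF u] _ hom_op_lin[OF shift_op_hom_op[OF D]], of _ "b + c"]) (use u pmul_mem in blast)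
      have "lin_on (paths b) (\<lambda>x. C.mult_bracket f (shift_op 0 D) b x u)"
        unfolding C.mult_bracket_def paths_alg_simps by (intro lin_on_minus lin_on_scaled 1 pmul_lin_left[OF Du])
      from lin_on_sum[OF this subspace_paths, of ?S "\<lambda>i. mon i (x i)"]
      show "(\<Sum>i\<in>?S. C.mult_bracket f (shift_op 0 D) b (mon i (x i)) u) = C.mult_bracket f (shift_op 0 D) b x u"
        using m path_expand[OF x] by simp
    qed
  qed
qed

lemma diffop_shift:
  assumes D: "hom_op (gcar A) f D" and r: "diffop r f D"
  shows "gca.diffop paths_alg r f (shift_op n D)"
proof -
  interpret C: gca m paths_alg by (rule gca_paths)
  have o: "mon (2 * n) one \<in> gcar paths_alg 0" using one_mem by (auto intro!: mon_mem)
  have "C.diffop r f (\<lambda>u. pmul (mon (2 * n) one) (shift_op 0 D u))"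
    using C.diffop_mult_left[OF diffop_coefficientwise[OF D r] _ o] shift_op_hom_op[OF D] by simp
  then show ?thesis
  proof (rule C.diffop_cong)
    fix u assume "u \<in> homog (gcar paths_alg)"
    then obtain c where u: "u \<in> paths c" by (auto simp: homog_def)
    have o': "mon (2 * n) one \<in> paths 0" using o by simp
    show "pmul (mon (2 * n) one) (shift_op 0 D u) = shift_op n D u"
    proof (rule path_ext[OF u _ hom_op_lin[OF shift_op_hom_op[OF D]]])
      show "lin_on (paths c) (\<lambda>u. pmul (mon (2 * n) one) (shift_op 0 D u))"
        by (rule lin_on_compose[OF hom_op_lin[OF shift_op_hom_op[OF D]] _ pmul_lin_right[OF o', of "c + f"]])
          (use hom_op_mem[OF shift_op_hom_op[OF D]] in blast)
      fix k v assume v: "v \<in> gcar A (c - odd_part k)"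
      have Dv: "D v \<in> gcar A (c + f - odd_part k)" using hom_op_mem[OF D v] by (simp add: algebra_simps)
      show "pmul (mon (2 * n) one) (shift_op 0 D (mon k v)) = shift_op n D (mon k v)"
        using pmul_mon[OF one_mem Dv] one_left[OF homogI[OF Dv]]
        by (simp add: shift_op_mon[OF D] mmul_def sgn_pow_def)
    qed
  qed
qed

end

subsection \<open>The differential and the operators\<close>

context ecbv_calg begin

text \<open>\<open>d (a t\<^sup>k) = (d a) t\<^sup>k + (- 1)\<^bsup>|a|\<^esup> k a t\<^bsup>k - 1\<^esup> dt\<close> and \<open>d (a t\<^sup>k dt) = (d a) t\<^sup>k dt\<close>. The truncated index
  \<open>k - 1\<close> for \<open>k = 0\<close> is harmless because its coefficient is zero.\<close>

definition mdiff :: "int \<Rightarrow> nat \<Rightarrow> 'a \<Rightarrow> nat \<Rightarrow> 'a"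
  where "mdiff b k a = mon k (d a) + (if even k then (sgn_pow b * real (k div 2)) *\<^sub>R mon (k - 1) a else 0)"

definition pdiff :: "(nat \<Rightarrow> 'a) \<Rightarrow> nat \<Rightarrow> 'a"
  where "pdiff x = psum (mdiff (gdeg paths x)) x"

lemma d_hom: "hom_op (gcar A) 1 d"
  using complex by (auto simp: hom_op_def cochain_complex_def)

lemma mdiff_lin: "lin_on (gcar A j) (mdiff b k)"
proof -
  have "lin_on (gcar A j) (\<lambda>a. mon k a)" for k by (rule lin_on_mon) (simp add: lin_on_def)
  then have "lin_on (gcar A j) (\<lambda>a. if even k then (sgn_pow b * real (k div 2)) *\<^sub>R mon (k - 1) a else 0)"
    by (cases "even k"; simp only: if_True if_False; intro lin_on_scaled lin_on_const_zero; assumption?)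
  then show ?thesis
    unfolding mdiff_def[abs_def] by (intro lin_on_plus lin_on_mon hom_op_lin[OF d_hom])
qed

lemma mdiff_mem:
  assumes a: "a \<in> gcar A (j - odd_part k)"
  shows "mdiff b k a \<in> paths (j + 1)"
proof -
  have "mon k (d a) \<in> paths (j + 1)" using hom_op_mem[OF d_hom a] by (intro mon_mem) (simp add: algebra_simps)
  moreover have "c *\<^sub>R mon (k - 1) a \<in> paths (j + 1)" if "even k" "k \<noteq> 0" for c
    using that a by (intro subspace_scale subspace_paths mon_mem) simp
  ultimately show ?thesis
    unfolding mdiff_def
    by (cases "k = 0") (auto intro!: subspace_add subspace_paths simp: subspace_0)
qed

lemma pdiff_eq: "x \<in> paths b \<Longrightarrow> pdiff x = psum (mdiff b) x"
proof (cases "x = 0")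
  case False
  interpret C: graded_vs m paths by unfold_locales (rule graded_space_paths, rule even_m)
  assume "x \<in> paths b"
  from C.gdeg_parity[OF this False] have "sgn_pow (gdeg paths x) = sgn_pow b" by (rule sgn_pow_eqI)
  then have "mdiff (gdeg paths x) = mdiff b" by (intro ext) (simp only: mdiff_def)
  then show ?thesis by (simp add: pdiff_def)
qed (simp add: pdiff_def)

lemma pdiff_mem: "x \<in> paths b \<Longrightarrow> pdiff x \<in> paths (b + 1)"
  unfolding pdiff_eq by (rule psum_mem[OF _ subspace_paths mdiff_mem])

lemma pdiff_lin: "lin_on (paths b) pdiff"
  by (rule lin_on_cong[OF psum_lin[OF mdiff_lin] subspace_paths]) (simp add: pdiff_eq)

lemma pdiff_hom: "hom_op paths 1 pdiff"
  by (auto simp: hom_op_def pdiff_mem pdiff_lin)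

lemma pdiff_mon: "a \<in> gcar A (b - odd_part k) \<Longrightarrow> pdiff (mon k a) = mdiff b k a"
  unfolding pdiff_eq[OF mon_mem]
  by (rule psum_mon) (rule lin_on_zero[OF mdiff_lin V_0])

lemma pdiff_pdiff:
  assumes x: "x \<in> paths b"
  shows "pdiff (pdiff x) = 0"
proof (rule path_ext[OF x _ lin_on_const_zero])
  show "lin_on (paths b) (\<lambda>x. pdiff (pdiff x))"
    by (rule lin_on_compose[OF pdiff_lin _ pdiff_lin, of _ "b + 1"]) (use pdiff_mem in blast)
  fix k a assume a: "a \<in> gcar A (b - odd_part k)"
  have da: "d a \<in> gcar A (b + 1 - odd_part k)" using hom_op_mem[OF d_hom a] by (simp add: algebra_simps)
  have dd: "d (d a) = 0" using complex homogI[OF a] by (simp add: cochain_complex_def)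
  note M = mon_mem[OF da]
  show "pdiff (pdiff (mon k a)) = 0"
  proof (cases "even k \<and> k \<noteq> 0")
    case False
    then have "mdiff b k a = mon k (d a)" by (auto simp: mdiff_def)
    moreover have "mdiff (b + 1) k (d a) = 0" using False dd by (auto simp: mdiff_def mon_arith)
    ultimately show ?thesis using pdiff_mon[OF a] pdiff_mon[OF da] by simp
  next
    case True
    then obtain l where l: "k = Suc l" "odd l" by (cases k) auto
    with a have a': "a \<in> gcar A (b + 1 - odd_part l)" by simp
    let ?c = "sgn_pow b * real (k div 2)"
    have "pdiff (mon k (d a) + ?c *\<^sub>R mon l a) = pdiff (mon k (d a)) + ?c *\<^sub>R pdiff (mon l a)"
      using lin_on_add[OF pdiff_lin M subspace_scale[OF subspace_paths mon_mem[OF a']]] lin_on_scale[OF pdiff_lin mon_mem[OF a']] by simp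
    moreover have "pdiff (mon k a) = mon k (d a) + ?c *\<^sub>R mon l a" unfolding pdiff_mon[OF a] mdiff_def using l by simp
    moreover have "pdiff (mon l a) = mon l (d a)" unfolding pdiff_mon[OF a'] mdiff_def using l by simp
    moreover have "pdiff (mon k (d a)) = - ?c *\<^sub>R mon l (d a)"
      unfolding pdiff_mon[OF da] mdiff_def using l by (simp add: dd mon_arith sgn_pow_def algebra_simps)
    ultimately show ?thesis by simp
  qed
qed

lemma pdiff_pmul:
  assumes x: "x \<in> paths a" and y: "y \<in> paths b"
  shows "pdiff (pmul x y) = pmul (pdiff x) y + sgn_pow a *\<^sub>R pmul x (pdiff y)"
proof (rule path_ext[OF x])
  note lc = lin_on_compose[OF pmul_lin_left _ pdiff_lin] lin_on_compose[OF pmul_lin_right _ pdiff_lin]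
    lin_on_compose[OF pdiff_lin _ pmul_lin_left] lin_on_compose[OF pdiff_lin _ pmul_lin_right]
  show "lin_on (paths a) (\<lambda>x. pdiff (pmul x y))"
    by (rule lc(1)[OF y, of _ "a + b"]) (use y pmul_mem in blast)
  show "lin_on (paths a) (\<lambda>x. pmul (pdiff x) y + sgn_pow a *\<^sub>R pmul x (pdiff y))"
    by (intro lin_on_plus lin_on_scaled pmul_lin_left[OF pdiff_mem[OF y]] lc(3)[OF _ y, of _ "a + 1"]) (use pdiff_mem in blast)
  fix i u assume u: "u \<in> gcar A (a - odd_part i)"
  note U = mon_mem[OF u]
  show "pdiff (pmul (mon i u) y) = pmul (pdiff (mon i u)) y + sgn_pow a *\<^sub>R pmul (mon i u) (pdiff y)"
  proof (rule path_ext[OF y])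
    show "lin_on (paths b) (\<lambda>y. pdiff (pmul (mon i u) y))"
      by (rule lc(2)[OF U, of _ "a + b"]) (use U pmul_mem in blast)
    show "lin_on (paths b) (\<lambda>y. pmul (pdiff (mon i u)) y + sgn_pow a *\<^sub>R pmul (mon i u) (pdiff y))"
      by (intro lin_on_plus lin_on_scaled pmul_lin_right[OF pdiff_mem[OF U]] lc(4)[OF _ U, of _ "b + 1"]) (use pdiff_mem in blast)
    fix j v assume v: "v \<in> gcar A (b - odd_part j)"
    note W = mon_mem[OF v]
    have du: "d u \<in> gcar A (a + 1 - odd_part i)" and dv: "d v \<in> gcar A (b + 1 - odd_part j)"
      using hom_op_mem[OF d_hom u] hom_op_mem[OF d_hom v] by (simp_all add: algebra_simps)
    have uv: "u \<odot> v \<in> gcar A (a - odd_part i + (b - odd_part j))" by (rule mul_mem[OF u v])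
    have duv: "d (u \<odot> v) = d u \<odot> v + sgn_pow (a - odd_part i) *\<^sub>R (u \<odot> d v)"
      by (rule d_deriv[OF u homogI[OF v]])
    have lft: "pmul (mdiff a i u) (mon j v) = mmul b i (d u) j v
      + (if even i then (sgn_pow a * real (i div 2)) *\<^sub>R mmul b (i - 1) u j v else 0)"
    proof (cases "even i \<and> i \<noteq> 0")
      case True
      then have u': "u \<in> gcar A (a + 1 - odd_part (i - 1))" using u by simp
      show ?thesis
        using True lin_on_add[OF pmul_lin_left[OF W] mon_mem[OF du] subspace_scale[OF subspace_paths mon_mem[OF u']]]
          lin_on_scale[OF pmul_lin_left[OF W] mon_mem[OF u']] pmul_mon[OF du v] pmul_mon[OF u' v]
        by (simp add: mdiff_def)
    qed (use pmul_mon[OF du v] in \<open>auto simp: mdiff_def\<close>)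
    have rgt: "pmul (mon i u) (mdiff b j v) = mmul (b + 1) i u j (d v)
      + (if even j then (sgn_pow b * real (j div 2)) *\<^sub>R mmul (b + 1) i u (j - 1) v else 0)"
    proof (cases "even j \<and> j \<noteq> 0")
      case True
      then have v': "v \<in> gcar A (b + 1 - odd_part (j - 1))" using v by simp
      show ?thesis
        using True lin_on_add[OF pmul_lin_right[OF U] mon_mem[OF dv] subspace_scale[OF subspace_paths mon_mem[OF v']]]
          lin_on_scale[OF pmul_lin_right[OF U] mon_mem[OF v']] pmul_mon[OF u dv] pmul_mon[OF u v']
        by (simp add: mdiff_def)
    qed (use pmul_mon[OF u dv] in \<open>auto simp: mdiff_def\<close>)
    have tot: "pdiff (mmul b i u j v) = (if odd i \<and> odd j then 0 else sgn_pow (int i * b) *\<^sub>R mdiff (a + b) (i + j) (u \<odot> v))"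
    proof (cases "odd i \<and> odd j")
      case False
      then have uv': "u \<odot> v \<in> gcar A (a + b - odd_part (i + j))" using uv by (auto simp: algebra_simps)
      have "pdiff (sgn_pow (int i * b) *\<^sub>R mon (i + j) (u \<odot> v)) = sgn_pow (int i * b) *\<^sub>R mdiff (a + b) (i + j) (u \<odot> v)"
        using lin_on_scale[OF pdiff_lin mon_mem[OF uv']] pdiff_mon[OF uv'] by simp
      then show ?thesis using False by (auto simp: mmul_def)
    qed (simp add: mmul_def pdiff_def)
    note expand = pmul_mon[OF u v] pdiff_mon[OF u] pdiff_mon[OF v] lft rgt tot
    show "pdiff (pmul (mon i u) (mon j v)) = pmul (pdiff (mon i u)) (mon j v) + sgn_pow a *\<^sub>R pmul (mon i u) (pdiff (mon j v))"
    proof (cases "even i")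
      case True
      then obtain p where p: "i = 2 * p" by blast
      show ?thesis
      proof (cases "even j")
        case True
        then obtain q where q: "j = 2 * q" by blast
        show ?thesis unfolding expand unfolding duv mmul_def mdiff_def p q
          by (cases "p = 0"; cases "q = 0"; cases "even a"; cases "even b"; simp add: sgn_pow_def mon_arith algebra_simps)
      next
        case False
        then show ?thesis unfolding expand unfolding duv mmul_def mdiff_def p
          by (cases "p = 0"; cases "even a"; cases "even b"; simp add: sgn_pow_def mon_arith algebra_simps)
      qed
    next
      case False
      then show ?thesis unfolding expand unfolding duv mmul_def mdiff_def
        by (cases "j = 0"; cases "even j"; cases "even a"; cases "even b"; simp add: sgn_pow_def mon_arith algebra_simps)
    qed
  qed
qed

end

context ecbv_calg begin

abbreviation I :: "nat \<Rightarrow> (nat \<Rightarrow> 'a) \<Rightarrow> nat \<Rightarrow> 'a"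
  where "I n \<equiv> shift_op n (i n)"

lemma I_hom: "1 \<le> n \<Longrightarrow> hom_op paths (- 2 * int n) (I n)"
  by (rule shift_op_hom_op[OF i_op])

lemma I_mon: "1 \<le> n \<Longrightarrow> I n (mon k a) = mon (2 * n + k) (i n a)"
  by (rule shift_op_mon[OF i_op])

lemma i_mem: "1 \<le> n \<Longrightarrow> a \<in> gcar A (b - odd_part k) \<Longrightarrow> i n a \<in> gcar A (b - 2 * int n - odd_part k)"
  using hom_op_mem[OF i_op, of n a "b - odd_part k"] by (simp add: algebra_simps)

lemma d_mem': "a \<in> gcar A (b - odd_part k) \<Longrightarrow> d a \<in> gcar A (b + 1 - odd_part k)"
  using hom_op_mem[OF d_hom, of a "b - odd_part k"] by (simp add: algebra_simps)

lemma pred_mem: "a \<in> gcar A (b - odd_part k) \<Longrightarrow> even k \<Longrightarrow> k \<noteq> 0 \<Longrightarrow> a \<in> gcar A (b + 1 - odd_part (k - 1))"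
  by simp

lemma I_mdiff:
  assumes n: "1 \<le> n" and a: "a \<in> gcar A (b - odd_part k)"
  shows "I n (mdiff b k a) = mon (2 * n + k) (i n (d a))
    + (if even k then (sgn_pow b * real (k div 2)) *\<^sub>R mon (2 * n + k - 1) (i n a) else 0)"
proof (cases "even k \<and> k \<noteq> 0")
  case False
  then show ?thesis using I_mon[OF n] by (auto simp: mdiff_def)
next
  case True
  note m = mon_mem[OF d_mem'[OF a]] mon_mem[OF pred_mem[OF a]]
  note lin = hom_op_lin[OF I_hom[OF n], of "b + 1"]
  show ?thesis
    using True lin_on_add[OF lin m(1) subspace_scale[OF subspace_paths m(2)]] lin_on_scale[OF lin m(2)] I_mon[OF n]
    by (simp add: mdiff_def)
qed

definition comm_op :: "nat \<Rightarrow> (nat \<Rightarrow> 'a) \<Rightarrow> nat \<Rightarrow> 'a"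
  where "comm_op n x = pdiff (I n x) - I n (pdiff x)"

lemma comm_op_hom:
  assumes n: "1 \<le> n"
  shows "hom_op paths (1 - 2 * int n) (comm_op n)"
proof -
  interpret C: gca m paths_alg by (rule gca_paths)
  have h: "hom_op (gcar paths_alg) 1 pdiff" "hom_op (gcar paths_alg) (- 2 * int n) (I n)"
    using pdiff_hom I_hom[OF n] by simp_all
  have "hom_op (gcar paths_alg) (1 - 2 * int n) (\<lambda>x. pdiff (I n x))"
    "hom_op (gcar paths_alg) (1 - 2 * int n) (\<lambda>x. I n (pdiff x))"
    using C.hom_op_compose[OF h] C.hom_op_compose[OF h(2,1)] by (simp_all add: algebra_simps)
  from C.hom_op_diff[OF this] show ?thesis by (simp add: comm_op_def[abs_def])
qed

text \<open>\<open>[d, t\<^sup>n i\<^sub>n]\<close> differs from \<open>t\<^sup>n [d, i\<^sub>n]\<close> by a multiple of \<open>i\<^sub>n\<close> by \<open>n t\<^bsup>n - 1\<^esup> dt\<close>, from the derivative of \<open>t\<^sup>n\<close>.\<close>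

lemma comm_op_mon:
  assumes n: "1 \<le> n" and a: "a \<in> gcar A (b - odd_part k)"
  shows "comm_op n (mon k a) = mon (2 * n + k) (d (i n a) - i n (d a))
    + (if even k then (sgn_pow b * real n) *\<^sub>R mon (2 * n + k - 1) (i n a) else 0)"
proof -
  have "i n a \<in> gcar A (b - 2 * int n - odd_part (2 * n + k))" using i_mem[OF n a] by simp
  from pdiff_mon[OF this]
  have "pdiff (I n (mon k a)) = mdiff (b - 2 * int n) (2 * n + k) (i n a)" by (simp add: I_mon[OF n])
  then show ?thesis
    unfolding comm_op_def pdiff_mon[OF a] I_mdiff[OF n a]
    by (simp add: mdiff_def mon_arith sgn_pow_def algebra_simps)
qed

text \<open>The operators \<open>t\<^sup>n i\<^sub>n\<close> satisfy the relations: the extra summands in \<open>comm_op_mon\<close> commute with all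
  \<open>t\<^sup>j i\<^sub>j\<close>, and the remaining part of the \<open>n\<close>-th relation is \<open>t\<^sup>n\<close> times the relation for the \<open>i\<^sub>j\<close>.\<close>

lemma ecbv_calg_paths: "ecbv_calg m paths_alg pdiff I"
proof -
  interpret C: gca m paths_alg by (rule gca_paths)
  show ?thesis
  proof
    show "cochain_complex m (gcar paths_alg) pdiff"
      unfolding cochain_complex_def using graded_space_paths pdiff_lin pdiff_mem pdiff_pdiff by (auto simp: homog_def)
    show "pdiff (gmul paths_alg x y) = gmul paths_alg (pdiff x) y + sgn_pow j *\<^sub>R gmul paths_alg x (pdiff y)"
      if "x \<in> gcar paths_alg j" "y \<in> homog (gcar paths_alg)" for x y j
      using that pdiff_pmul by (auto simp: homog_def)
    fix n k :: nat and x :: "nat \<Rightarrow> 'a"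
    assume n: "1 \<le> n"
    show "hom_op (gcar paths_alg) (- 2 * int n) (I n)" using I_hom[OF n] by simp
    show "I n (gone paths_alg) = 0" using I_mon[OF n] i_one[OF n] by (simp add: mon_arith)
    show "C.diffop (n + 2) (- 2 * int n) (I n)" by (rule diffop_shift[OF i_op[OF n] i_order[OF n]])
    assume k: "1 \<le> k" and "x \<in> homog (gcar paths_alg)"
    then obtain j where x: "x \<in> paths j" by (auto simp: homog_def)
    have lin: "lin_on (paths j) (\<lambda>x. I n (I k x))" if "1 \<le> n" "1 \<le> k" for n k
      by (rule lin_on_compose[OF hom_op_lin[OF I_hom[OF that(2)]] _ hom_op_lin[OF I_hom[OF that(1)], of "j + - 2 * int k"]])
        (use hom_op_mem[OF I_hom[OF that(2)]] in blast)
    show "I n (I k x) = I k (I n x)"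
      by (rule path_ext[OF x lin[OF n k] lin[OF k n]])
        (use i_commute[OF n k] in \<open>simp add: I_mon[OF n] I_mon[OF k] homogI add.left_commute\<close>)
  next
    fix n :: nat and x :: "nat \<Rightarrow> 'a"
    assume n: "2 \<le> n" and "x \<in> homog (gcar paths_alg)"
    then obtain b where x: "x \<in> paths b" by (auto simp: homog_def)
    let ?K = "\<lambda>x. \<Sum>j = 1..n - 1. I j (comm_op (n - j) x) - comm_op (n - j) (I j x)"
    have "?K x = 0"
    proof (rule path_ext[OF x _ lin_on_const_zero])
      show "lin_on (paths b) ?K"
      proof (intro lin_on_setsum lin_on_minus)
        fix j assume "j \<in> {1..n - 1}"
        then have j: "1 \<le> j" "1 \<le> n - j" by auto
        note Ih = I_hom[OF j(1)] and Ch = comm_op_hom[OF j(2)]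
        show "lin_on (paths b) (\<lambda>x. I j (comm_op (n - j) x))"
          by (rule lin_on_compose[OF hom_op_lin[OF Ch] _ hom_op_lin[OF Ih]]) (use hom_op_mem[OF Ch] in blast)
        show "lin_on (paths b) (\<lambda>x. comm_op (n - j) (I j x))"
          by (rule lin_on_compose[OF hom_op_lin[OF Ih] _ hom_op_lin[OF Ch]]) (use hom_op_mem[OF Ih] in blast)
      qed
      fix k a assume a: "a \<in> gcar A (b - odd_part k)"
      have "?K (mon k a) = (\<Sum>j = 1..n - 1. mon (2 * n + k)
        (i j (d (i (n - j) a) - i (n - j) (d a)) - (d (i (n - j) (i j a)) - i (n - j) (d (i j a)))))"
      proof (rule sum.cong[OF refl])
        fix j assume "j \<in> {1..n - 1}"
        then have j: "1 \<le> j" and p: "1 \<le> n - j" by auto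
        obtain q where q: "n = q + j" "1 \<le> q" using j p by (metis le_add_diff_inverse2 nat_le_linear diff_is_0_eq not_one_le_zero)
        have qn: "n - j = q" using q by simp
        have ia: "i j a \<in> gcar A (b - 2 * int j - odd_part (2 * j + k))" using i_mem[OF j a] by simp
        have c: "i q (i j a) = i j (i q a)" by (rule i_commute[OF q(2) j homogI[OF a]])
        have m1: "d (i q a) - i q (d a) \<in> gcar A (b + 1 - 2 * int q - odd_part (2 * q + k))"
          using d_mem'[OF i_mem[OF q(2) a]] i_mem[OF q(2) d_mem'[OF a]] by (simp add: V_diff algebra_simps)
        have m2: "i q a \<in> gcar A (b + 1 - 2 * int q - odd_part (2 * q + k - 1))" if "even k"
          using i_mem[OF q(2) a] that q(2) by (simp add: algebra_simps)
        note lin = hom_op_lin[OF I_hom[OF j]]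
        have "I j (comm_op q (mon k a)) = mon (2 * j + (2 * q + k)) (i j (d (i q a) - i q (d a)))
          + (if even k then (sgn_pow b * real q) *\<^sub>R mon (2 * j + (2 * q + k - 1)) (i j (i q a)) else 0)"
          unfolding comm_op_mon[OF q(2) a]
          using lin_on_add[OF lin mon_mem[OF m1] subspace_scale[OF subspace_paths mon_mem[OF m2]]]
            lin_on_scale[OF lin mon_mem[OF m2]] I_mon[OF j] by simp
        moreover have "comm_op q (I j (mon k a)) = mon (2 * q + (2 * j + k)) (d (i q (i j a)) - i q (d (i j a)))
          + (if even k then (sgn_pow b * real q) *\<^sub>R mon (2 * q + (2 * j + k) - 1) (i q (i j a)) else 0)"
          unfolding I_mon[OF j] comm_op_mon[OF q(2) ia] by (simp add: sgn_pow_def)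
        moreover have "2 * j + (2 * q + k - 1) = 2 * n + k - 1" "2 * q + (2 * j + k) - 1 = 2 * n + k - 1"
          "2 * j + (2 * q + k) = 2 * n + k" "2 * q + (2 * j + k) = 2 * n + k"
          using q by simp_all
        ultimately show "I j (comm_op (n - j) (mon k a)) - comm_op (n - j) (I j (mon k a)) = mon (2 * n + k)
            (i j (d (i (n - j) a) - i (n - j) (d a)) - (d (i (n - j) (i j a)) - i (n - j) (d (i j a))))"
          unfolding qn by (simp only: c mon_arith(2)[symmetric] add_diff_add) (simp add: mon_arith)
      qed
      also have "\<dots> = mon (2 * n + k) (\<Sum>j = 1..n - 1.
        i j (d (i (n - j) a) - i (n - j) (d a)) - (d (i (n - j) (i j a)) - i (n - j) (d (i j a))))"
        by (rule lin_on_sum[of UNIV, symmetric]) (auto intro: lin_on_mon simp: lin_on_def mon_arith)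
      also have "\<dots> = 0" unfolding i_exact[OF n homogI[OF a]] by (rule mon_arith)
      finally show "?K (mon k a) = 0" .
    qed
    then show "(\<Sum>j = 1..n - 1. I j (pdiff (I (n - j) x) - I (n - j) (pdiff x))
        - (pdiff (I (n - j) (I j x)) - I (n - j) (pdiff (I j x)))) = 0"
      by (simp add: comm_op_def)
  qed
qed

lemma ecbv_calg_zero: "ecbv_calg m A d (\<lambda>_ _. 0)"
  using lin_on_zero[OF hom_op_lin[OF d_hom] V_0]
  by unfold_locales (auto simp: complex d_deriv diffop_zero hom_op_zero)

subsection \<open>Evaluation\<close>

text \<open>The evaluation at \<open>t = c\<close>, \<open>dt = 0\<close>.\<close>

definition eval_at :: "real \<Rightarrow> (nat \<Rightarrow> 'a) \<Rightarrow> 'a"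
  where "eval_at c = psum (\<lambda>k a. if even k then c ^ (k div 2) *\<^sub>R a else 0)"

lemma eval_at_mon: "eval_at c (mon k a) = (if even k then c ^ (k div 2) *\<^sub>R a else 0)"
  unfolding eval_at_def by (rule psum_mon) simp

lemma eval_at_lin: "lin_on (paths j) (eval_at c)"
  unfolding eval_at_def by (rule psum_lin) (simp add: lin_on_def scaleR_add_right mult.commute)

lemma eval_at_mem: "x \<in> paths j \<Longrightarrow> eval_at c x \<in> gcar A j"
  unfolding eval_at_def by (rule psum_mem[OF _ subspace_V]) (auto intro: V_scale)

lemma eval_at_pmul:
  assumes x: "x \<in> paths a" and y: "y \<in> paths b"
  shows "eval_at c (pmul x y) = eval_at c x \<odot> eval_at c y"
proof (rule path_ext[OF x])
  show "lin_on (paths a) (\<lambda>x. eval_at c (pmul x y))"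
    by (rule lin_on_compose[OF pmul_lin_left[OF y] _ eval_at_lin, of _ "a + b"]) (use y pmul_mem in blast)
  show "lin_on (paths a) (\<lambda>x. eval_at c x \<odot> eval_at c y)"
    by (rule lin_on_compose[OF eval_at_lin _ mul_lin_left[OF homogI[OF eval_at_mem[OF y]]], of _ "a"]) (use eval_at_mem in blast)
  fix k u assume u: "u \<in> gcar A (a - odd_part k)"
  note U = mon_mem[OF u]
  show "eval_at c (pmul (mon k u) y) = eval_at c (mon k u) \<odot> eval_at c y"
  proof (rule path_ext[OF y])
    show "lin_on (paths b) (\<lambda>y. eval_at c (pmul (mon k u) y))"
      by (rule lin_on_compose[OF pmul_lin_right[OF U] _ eval_at_lin, of _ "a + b"]) (use U pmul_mem in blast)
    show "lin_on (paths b) (\<lambda>y. eval_at c (mon k u) \<odot> eval_at c y)"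
      by (rule lin_on_compose[OF eval_at_lin _ mul_lin_right[OF homogI[OF eval_at_mem[OF U]]], of _ "b"]) (use eval_at_mem in blast)
    fix l v assume v: "v \<in> gcar A (b - odd_part l)"
    note h = homogI[OF u] homogI[OF v]
    have s: "eval_at c (r *\<^sub>R mon l w) = r *\<^sub>R eval_at c (mon l w)" for r l and w :: 'a
      using eval_at_mon[of c l "r *\<^sub>R w"] by (simp add: mon_arith eval_at_mon mult.commute)
    show "eval_at c (pmul (mon k u) (mon l v)) = eval_at c (mon k u) \<odot> eval_at c (mon l v)"
    proof (cases "even k \<and> even l")
      case True
      then have "(k + l) div 2 = k div 2 + l div 2" by (auto elim!: evenE)
      then show ?thesis
        unfolding pmul_mon[OF u v] mmul_def using True
        by (simp add: s eval_at_mon sgn_pow_def mul_scale_left[OF h(1) homog_scale[OF h(2)]] mul_scale_right[OF h] power_add)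
    next
      case False
      have "eval_at c 0 = 0" by (simp add: eval_at_def)
      then show ?thesis
        unfolding pmul_mon[OF u v] mmul_def using False mul_0_left[OF homog_scale[OF h(2)]] mul_0_right[OF homog_scale[OF h(1)]] mul_0_left[of 0]
        by (auto simp: s eval_at_mon)
    qed
  qed
qed

lemma eval_at_pdiff:
  assumes x: "x \<in> paths b"
  shows "eval_at c (pdiff x) = d (eval_at c x)"
proof (rule path_ext[OF x])
  show "lin_on (paths b) (\<lambda>x. eval_at c (pdiff x))"
    by (rule lin_on_compose[OF pdiff_lin _ eval_at_lin, of _ "b + 1"]) (use pdiff_mem in blast)
  show "lin_on (paths b) (\<lambda>x. d (eval_at c x))"
    by (rule lin_on_compose[OF eval_at_lin _ hom_op_lin[OF d_hom], of _ b]) (use eval_at_mem in blast)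
  fix k a assume a: "a \<in> gcar A (b - odd_part k)"
  show "eval_at c (pdiff (mon k a)) = d (eval_at c (mon k a))"
  proof (cases "even k \<and> k \<noteq> 0")
    case False
    then have "mdiff b k a = mon k (d a)" by (auto simp: mdiff_def)
    then show ?thesis using False hom_op_0[OF d_hom] by (auto simp: pdiff_mon[OF a] eval_at_mon)
  next
    case True
    note m = mon_mem[OF d_mem'[OF a]] mon_mem[OF pred_mem[OF a]]
    show ?thesis
      using True lin_on_add[OF eval_at_lin m(1) subspace_scale[OF subspace_paths m(2)]] lin_on_scale[OF eval_at_lin m(2)]
        lin_on_scale[OF hom_op_lin[OF d_hom] a]
      by (simp add: pdiff_mon[OF a] mdiff_def eval_at_mon)
  qed
qed

lemma eval_at_I:
  assumes n: "1 \<le> n" and x: "x \<in> paths b"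
  shows "eval_at c (I n x) = c ^ n *\<^sub>R i n (eval_at c x)"
proof (rule path_ext[OF x])
  show "lin_on (paths b) (\<lambda>x. eval_at c (I n x))"
    by (rule lin_on_compose[OF hom_op_lin[OF I_hom[OF n]] _ eval_at_lin]) (use hom_op_mem[OF I_hom[OF n]] in blast)
  show "lin_on (paths b) (\<lambda>x. c ^ n *\<^sub>R i n (eval_at c x))"
    by (rule lin_on_scaled, rule lin_on_compose[OF eval_at_lin _ hom_op_lin[OF i_op[OF n]], of _ b]) (use eval_at_mem in blast)
  fix k a assume a: "a \<in> gcar A (b - odd_part k)"
  show "eval_at c (I n (mon k a)) = c ^ n *\<^sub>R i n (eval_at c (mon k a))"
    using lin_on_scale[OF hom_op_lin[OF i_op[OF n]] a] hom_op_0[OF i_op[OF n]]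
    by (auto simp: I_mon[OF n] eval_at_mon power_add elim!: evenE)
qed

text \<open>Integration from \<open>c\<close>: \<open>a t\<^sup>k dt\<close> goes to \<open>a (t\<^bsup>k + 1\<^esup> - c\<^bsup>k + 1\<^esup>) / (k + 1)\<close>. The index is \<open>2 * k + 1\<close>.\<close>

definition hpy :: "real \<Rightarrow> (nat \<Rightarrow> 'a) \<Rightarrow> nat \<Rightarrow> 'a"
  where "hpy c = psum (\<lambda>k a. if odd k
    then (1 / real (k div 2 + 1)) *\<^sub>R (mon (k + 1) a - c ^ (k div 2 + 1) *\<^sub>R mon 0 a) else 0)"

lemma hpy_hom: "hom_op paths (- 1) (hpy c)"
  unfolding hpy_def
proof (rule psum_hom_op)
  show "(if odd k then (1 / real (k div 2 + 1)) *\<^sub>R (mon (k + 1) a - c ^ (k div 2 + 1) *\<^sub>R mon 0 a) else 0) \<in> paths (j + - 1)"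
    if "a \<in> gcar A (j - odd_part k)" for j k a
    using that by (auto intro!: subspace_scale subspace_diff subspace_paths mon_mem subspace_0)
  show "lin_on (gcar A j) (\<lambda>a. if odd k then (1 / real (k div 2 + 1)) *\<^sub>R (mon (k + 1) a - c ^ (k div 2 + 1) *\<^sub>R mon 0 a) else 0)" for j k
    by (auto simp: lin_on_def mon_arith algebra_simps)
qed

lemma hpy_mon: "hpy c (mon k a) = (if odd k
    then (1 / real (k div 2 + 1)) *\<^sub>R (mon (k + 1) a - c ^ (k div 2 + 1) *\<^sub>R mon 0 a) else 0)"
  unfolding hpy_def by (rule psum_mon) (simp add: mon_arith)

text \<open>The fundamental theorem of calculus for polynomials.\<close>

lemma hpy_homotopy:
  assumes x: "x \<in> paths b"
  shows "pdiff (hpy c x) - hpy c (pdiff x) = sgn_pow (b - 1) *\<^sub>R (x - mon 0 (eval_at c x))"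
proof (rule path_ext[OF x])
  note hm = hom_op_mem[OF hpy_hom] and hl = hom_op_lin[OF hpy_hom]
  have "lin_on (paths b) (\<lambda>x. x)" by (simp add: lin_on_def)
  then show "lin_on (paths b) (\<lambda>x. sgn_pow (b - 1) *\<^sub>R (x - mon 0 (eval_at c x)))"
    by (intro lin_on_scaled lin_on_minus lin_on_mon eval_at_lin)
  have "lin_on (paths b) (\<lambda>x. pdiff (hpy c x))"
    by (rule lin_on_compose[OF hl _ pdiff_lin]) (use hm in blast)
  moreover have "lin_on (paths b) (\<lambda>x. hpy c (pdiff x))"
    by (rule lin_on_compose[OF pdiff_lin _ hl]) (use pdiff_mem in blast)
  ultimately show "lin_on (paths b) (\<lambda>x. pdiff (hpy c x) - hpy c (pdiff x))" by (rule lin_on_minus)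
  fix k a assume a: "a \<in> gcar A (b - odd_part k)"
  show "pdiff (hpy c (mon k a)) - hpy c (pdiff (mon k a)) = sgn_pow (b - 1) *\<^sub>R (mon k a - mon 0 (eval_at c (mon k a)))"
  proof (cases "even k")
    case True
    have z: "hpy c (mon k a) = 0" "pdiff 0 = 0" using True by (simp_all add: hpy_mon pdiff_def)
    show ?thesis
    proof (cases "k = 0")
      case True
      then show ?thesis using z unfolding pdiff_mon[OF a] mdiff_def by (simp add: hpy_mon eval_at_mon)
    next
      case False
      then obtain l where l: "k = Suc l" "odd l" using True by (cases k) auto
      have a': "a \<in> gcar A (b + 1 - odd_part l)" using a l by simp
      let ?r = "1 + real (l div 2)"
      have k2: "real (k div 2) = ?r" "k div 2 = Suc (l div 2)" using l by simp_all
      have "hpy c (pdiff (mon k a)) = hpy c (mon k (d a)) + (sgn_pow b * ?r) *\<^sub>R hpy c (mon l a)"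
        using l lin_on_add[OF hl mon_mem[OF d_mem'[OF a]] subspace_scale[OF subspace_paths mon_mem[OF a']]]
          lin_on_scale[OF hl mon_mem[OF a']] unfolding pdiff_mon[OF a] mdiff_def k2 by simp
      moreover have "hpy c (mon k (d a)) = 0" using True by (simp add: hpy_mon)
      moreover have "hpy c (mon l a) = (1 / ?r) *\<^sub>R (mon k a - mon 0 (eval_at c (mon k a)))"
        using l True by (simp add: hpy_mon eval_at_mon mon_arith)
      moreover have "?r \<noteq> 0" by simp
      ultimately show ?thesis using z by (simp add: sgn_pow_def)
    qed
  next
    case False
    define p where "p = k div 2"
    have a1: "a \<in> gcar A (b - 1 - odd_part (k + 1))" "a \<in> gcar A (b - 1 - odd_part 0)" using a False by simp_all
    have k2: "(k + 1) div 2 = p + 1" using False by (auto simp: p_def elim!: oddE)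
    let ?X = "mon (k + 1) a - c ^ (p + 1) *\<^sub>R mon 0 a"
    have r: "(s / (1 + real p)) *\<^sub>R z + (real p * s / (1 + real p)) *\<^sub>R z = s *\<^sub>R z" for s and z :: "nat \<Rightarrow> 'a"
    proof -
      have "s / (1 + real p) + real p * s / (1 + real p) = ((1 + real p) * s) / (1 + real p)"
        by (simp add: add_divide_distrib[symmetric] algebra_simps)
      also have "\<dots> = s" by simp
      finally have "s / (1 + real p) + real p * s / (1 + real p) = s" .
      then show ?thesis by (simp flip: scaleR_add_left)
    qed
    have "pdiff ((1 / real (p + 1)) *\<^sub>R ?X) = (1 / real (p + 1)) *\<^sub>R (pdiff (mon (k + 1) a) - c ^ (p + 1) *\<^sub>R pdiff (mon 0 a))"
      using lin_on_scale[OF pdiff_lin subspace_diff[OF subspace_paths mon_mem[OF a1(1)] subspace_scale[OF subspace_paths mon_mem[OF a1(2)]]]]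
        lin_on_diff[OF pdiff_lin subspace_paths mon_mem[OF a1(1)] subspace_scale[OF subspace_paths mon_mem[OF a1(2)]]]
        lin_on_scale[OF pdiff_lin mon_mem[OF a1(2)]] by simp
    moreover have "pdiff (mon (k + 1) a) = mon (k + 1) (d a) + (sgn_pow (b - 1) * real (p + 1)) *\<^sub>R mon k a"
      unfolding pdiff_mon[OF a1(1)] mdiff_def k2 using False by simp
    moreover have "pdiff (mon 0 a) = mon 0 (d a)"
      unfolding pdiff_mon[OF a1(2)] mdiff_def by simp
    moreover have "pdiff (mon k a) = mon k (d a)"
      unfolding pdiff_mon[OF a] mdiff_def using False by simp
    ultimately show ?thesis
      using False by (simp add: hpy_mon eval_at_mon p_def[symmetric] mon_arith algebra_simps r)
  qed
qed

text \<open>Evaluation at \<open>c\<close> is split by the constant paths, and up to the homotopy \<open>hpy\<close> it is inverse to them.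
  It intertwines \<open>t\<^sup>n i\<^sub>n\<close> with \<open>c\<^sup>n i\<^sub>n\<close>, so \<open>c = 1\<close> and \<open>c = 0\<close> give the original and the vanishing operators.\<close>

theorem quasi_iso_eval_at:
  assumes B: "ecbv_algebra m paths pdiff pmul I B" and B': "ecbv_algebra m (gcar A) d (gmul A) i' B'"
    and i': "\<And>n x. 1 \<le> n \<Longrightarrow> x \<in> \<H> \<Longrightarrow> i' n x = c ^ n *\<^sub>R i n x"
  shows "quasi_iso m ECBV B B' (eval_at c)"
proof -
  have [simp]: "cx B = paths" "cdiff B = pdiff" "cx B' = gcar A" "cdiff B' = d"
    using B B' by (auto simp: ecbv_algebra_def)
  have const: "a \<in> gcar A k \<Longrightarrow> mon 0 a \<in> paths k" "a \<in> gcar A k \<Longrightarrow> pdiff (mon 0 a) = mon 0 (d a)" for a k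
    using mon_mem[of a k 0] pdiff_mon[of a k 0] by (auto simp: mdiff_def)
  have "algebra_morphism ECBV B B' (eval_at c)"
  proof (rule ecbv_algebra_morphism[OF even_m B B'])
    show "eval_at c ` paths k \<subseteq> gcar A k" "lin_on (paths k) (eval_at c)" for k
      using eval_at_mem eval_at_lin by auto
    show "eval_at c (pdiff x) = d (eval_at c x)" if "x \<in> homog paths" for x using that eval_at_pdiff by (auto simp: homog_def)
    show "eval_at c (pmul x y) = eval_at c x \<odot> eval_at c y" if "x \<in> homog paths" "y \<in> homog paths" for x y
      using that eval_at_pmul by (auto simp: homog_def)
    show "eval_at c (I n x) = i' n (eval_at c x)" if n: "1 \<le> n" and "x \<in> homog paths" for n x
    proof -
      obtain b where x: "x \<in> paths b" using \<open>x \<in> homog paths\<close> by (auto simp: homog_def)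
      show ?thesis unfolding eval_at_I[OF n x] i'[OF n homogI[OF eval_at_mem[OF x]]] ..
    qed
  qed
  moreover have "x \<in> pdiff ` paths (k - 1)"
    if x: "x \<in> paths k" "pdiff x = 0" and e: "eval_at c x \<in> d ` gcar A (k - 1)" for x k
  proof -
    from e obtain y where y: "eval_at c x = d y" "y \<in> gcar A (k - 1)" by blast
    have hx: "hpy c x \<in> paths (k - 1)" using hom_op_mem[OF hpy_hom x(1)] by simp
    have "hpy c 0 = 0" by (simp add: hpy_def)
    then have "pdiff (hpy c x) = sgn_pow (k - 1) *\<^sub>R (x - mon 0 (d y))"
      using hpy_homotopy[OF x(1), of c] by (simp add: x(2) y(1))
    then have "sgn_pow (k - 1) *\<^sub>R pdiff (hpy c x) = x - mon 0 (d y)" by simp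
    then have "x = pdiff (sgn_pow (k - 1) *\<^sub>R hpy c x + mon 0 y)"
      using lin_on_add[OF pdiff_lin subspace_scale[OF subspace_paths hx] const(1)[OF y(2)]]
        lin_on_scale[OF pdiff_lin hx] const(2)[OF y(2)] by simp
    moreover have "sgn_pow (k - 1) *\<^sub>R hpy c x + mon 0 y \<in> paths (k - 1)"
      by (intro subspace_add subspace_scale subspace_paths hx const(1)[OF y(2)])
    ultimately show ?thesis by blast
  qed
  moreover have "\<exists>x\<in>paths k. pdiff x = 0 \<and> y - eval_at c x \<in> d ` gcar A (k - 1)"
    if y: "y \<in> gcar A k" "d y = 0" for y k
  proof (rule bexI[OF _ const(1)[OF y(1)]], intro conjI)
    show "pdiff (mon 0 y) = 0" by (simp add: const(2)[OF y(1)] y(2) mon_arith)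
    have "d 0 = 0" by (rule hom_op_0[OF d_hom])
    then show "y - eval_at c (mon 0 y) \<in> d ` gcar A (k - 1)" by (auto simp: eval_at_mon intro!: image_eqI[of _ d 0])
  qed
  ultimately show ?thesis
    using B B' by (auto simp: quasi_iso_def ecbv_algebra_def)
qed

end

section \<open>Triviality of the structure on differential forms\<close>

text \<open>Both evaluations of the path algebra are restricted along \<open>\<phi>\<close>. At \<open>t = 0\<close> all operators vanish, and by
  \<open>act_trivial_algebra\<close> the resulting structure is the trivial one.\<close>

theorem (in ecbv_calg) formality:
  assumes A: "ecbv_algebra m (gcar A) d (gmul A) i \<Omega>" and dg: "dg_operad P" and \<phi>: "operad_morphism P ECBV \<phi>"
  shows "quasi_isomorphic TYPE(nat \<Rightarrow> 'a) m P (restrict_scalars \<phi> \<Omega>) (trivial_algebra (restrict_scalars \<phi> \<Omega>))"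
proof -
  interpret Z: ecbv_calg m A d "\<lambda>_ _. 0" by (rule ecbv_calg_zero)
  interpret C: ecbv_calg m paths_alg pdiff I by (rule ecbv_calg_paths)
  obtain \<Omega>\<^sub>0 where Z: "ecbv_algebra m (gcar A) d (gmul A) (\<lambda>_ _. 0) \<Omega>\<^sub>0" using Z.ecbv_algebra_exists by blast
  obtain B where B: "ecbv_algebra m paths pdiff pmul I B" using C.ecbv_algebra_exists by auto
  let ?B = "restrict_scalars \<phi> B" and ?\<Omega> = "restrict_scalars \<phi> \<Omega>"
  have "quasi_iso m P ?B ?\<Omega> (eval_at 1)"
    by (rule quasi_iso_restrict[OF \<phi> quasi_iso_eval_at[OF B A]]) simp
  moreover have "quasi_iso m P ?B (restrict_scalars \<phi> \<Omega>\<^sub>0) (eval_at 0)"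
    by (rule quasi_iso_restrict[OF \<phi> quasi_iso_eval_at[OF B Z]]) simp
  then have "quasi_iso m P ?B (trivial_algebra ?\<Omega>) (eval_at 0)"
  proof (rule quasi_iso_cong[OF dg])
    show "cx (trivial_algebra ?\<Omega>) = cx (restrict_scalars \<phi> \<Omega>\<^sub>0)" "cdiff (trivial_algebra ?\<Omega>) = cdiff (restrict_scalars \<phi> \<Omega>\<^sub>0)"
      using A Z by (simp_all add: trivial_algebra_def restrict_scalars_def ecbv_algebra_def)
    show "act (trivial_algebra ?\<Omega>) n k p = act (restrict_scalars \<phi> \<Omega>\<^sub>0) n k p" if "p \<in> opc P n k" for n k p
      by (rule act_trivial_algebra[OF even_m A Z \<phi> dg that])
  qed
  ultimately show ?thesis
    unfolding quasi_isomorphic_def qi_link_def by blast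
qed

theorem corollary6p11:
  fixes M :: "('x, 'a::real_vector) graded_ringed_space"
    and m :: int
    and \<pi> :: "nat \<Rightarrow> 'a polyvector"
    and P :: "'p::real_vector operad"
    and \<phi> :: "nat \<Rightarrow> int \<Rightarrow> 'p \<Rightarrow> ecbv"
  assumes "graded_manifold M \<and> m = 0 \<or> supermanifold M \<and> m = 2"
    and "generalized_poisson (global_functions M) \<pi>"
    and "graded_operad P"
    and "\<forall>n k. k > 0 \<longrightarrow> opc P n k = {0}"
    and "operad_morphism P ECBV \<phi>"
  shows "(\<exists>\<Omega>. de_rham_ecbv_algebra m M \<pi> \<Omega>) \<and>
    (\<forall>\<Omega>. de_rham_ecbv_algebra m M \<pi> \<Omega> \<longrightarrow>
      quasi_isomorphic TYPE(nat \<Rightarrow> 'a form) m P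
        (restrict_scalars \<phi> \<Omega>) (trivial_algebra (restrict_scalars \<phi> \<Omega>)))"
proof -
  have "sheaf_of_algebras m M" and even: "even m"
    using assms(1) by (auto simp: graded_manifold_def supermanifold_def)
  then have "graded_comm_alg m (global_functions M)"
    by (simp add: sheaf_of_algebras_def global_functions_def)
  then interpret A: gca m "global_functions M" using even by unfold_locales
  interpret \<Omega>: ecbv_calg m A.forms_alg "ext_deriv (global_functions M)" "\<lambda>n. interior_product (\<pi> n)"
    by (rule A.ecbv_calg_forms[OF assms(2)])
  have "dg_operad P" using assms(3) by (simp add: graded_operad_def)
  then show ?thesis
    using \<Omega>.ecbv_algebra_exists \<Omega>.formality[OF _ _ assms(5)] by (simp add: de_rham_ecbv_algebra_def)
qed

end
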